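(* Let $n\ge 1$, let $\delta:\{0,1\}\times\{0,\dots,n-1\}\to\{0,1\}\times\{0,\dots,n-1\}\times\{\text{left},\text{right}\}$ be a transition function (with left $=0$, right $=1$), let $A$ be a formula, and let ${}_\delta\underline{\mathrm{left}}_A,{}_\delta\underline{\mathrm{right}}_A,{}_\delta\underline{\mathrm{state}}_A$ be the proofs constructed in the context. Let $S_1,\dots,S_s,T_1,\dots,T_t\in\{0,1\}^*$, $\sigma_1,\dots,\sigma_s,\tau_1,\dots,\tau_t\in\{0,1\}$, $q_1,\dots,q_r\in\{0,\dots,n-1\}$, let $a_i,b_i,c_i\in k$, and put $$\alpha=\sum_{i=1}^s a_i[\![\underline{S_i\sigma_i}_{A^3}]\!],\quad \beta=\sum_{i=1}^t b_i[\![\underline{T_i\tau_i}_{A^3}]\!],\quad \gamma=\sum_{i=1}^r c_i[\![\underline{q_i}_{A^3}]\!],$$ and $(\hat\sigma_i^j,\hat q_i^j,\hat d_i^j)=\delta(\sigma_i,q_j)$. Write $\delta_{P}$ for $1$ if the condition $P$ holds and $0$ otherwise. Then: (1) $[\![{}_\delta\underline{\mathrm{left}}_A]\!](\alpha^{\otimes3}\otimes\beta\otimes\gamma^{\otimes2})\in[\![\mathbf{bint}_A]\!]$ equals $$\Big(\sum_{i=1}^s\sum_{j=1}^r a_ic_j\delta_{\hat d_i^j=0}\Big)\Big(\sum_{i=1}^s a_i\Big)\Big(\sum_{i=1}^t b_i\Big)\Big(\sum_{i=1}^r c_i\Big)\Big(\sum_{i=1}^s a_i[\![\underline{S_i}_A]\!]\Big)+\Big(\sum_{i=1}^s\sum_{j=1}^r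 a_ic_j\delta_{\hat d_i^j=1}\Big)\Big(\sum_{i=1}^s\sum_{j=1}^s\sum_{k=1}^t\sum_{l=1}^r a_ia_jb_kc_l[\![\underline{S_i\hat\sigma_j^l\tau_k}_A]\!]\Big).$$ (2) $[\![{}_\delta\underline{\mathrm{right}}_A]\!](\alpha^{\otimes2}\otimes\beta^{\otimes2}\otimes\gamma^{\otimes2})\in[\![\mathbf{bint}_A]\!]$ equals $$\Big(\sum_{i=1}^s\sum_{j=1}^r a_ic_j\delta_{\hat d_i^j=1}\Big)\Big(\sum_{i=1}^s a_i\Big)\Big(\sum_{i=1}^t b_i\Big)\Big(\sum_{i=1}^r c_i\Big)\Big(\sum_{i=1}^t b_i[\![\underline{T_i}_A]\!]\Big)+\Big(\sum_{i=1}^s\sum_{j=1}^r a_ic_j\delta_{\hat d_i^j=0}\Big)\Big(\sum_{i=1}^t\sum_{j=1}^s\sum_{k=1}^t\sum_{l=1}^r b_ia_jb_kc_l[\![\underline{T_i\tau_k\hat\sigma_j^l}_A]\!]\Big).$$ (3) $[\![{}_\delta\underline{\mathrm{state}}_A]\!](\alpha\otimes\gamma)\in[\![{}_n\mathbf{bool}_A]\!]$ equals $\sum_{i=1}^s\sum_{j=1}^r a_ic_j[\![\underline{\hat q_i^j}_A]\!]$.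
   Context: **Logic and semantics.** Linear logic means propositional intuitionistic linear logic with connectives $\otimes,\&,\multimap,!$ (sequent calculus with one formula on the right; rules for $!$: dereliction, weakening, contraction, promotion). $k$ is an algebraically closed field. The *Sweedler semantics* $[\![-]\!]$ assigns vector spaces to formulas: chosen spaces for atoms, $[\![A\otimes B]\!]=[\![A]\!]\otimes[\![B]\!]$, $[\![A\&B]\!]=[\![A]\!]\oplus[\![B]\!]$, $[\![A\multimap B]\!]=\mathrm{Hom}_k([\![A]\!],[\![B]\!])$, $[\![!A]\!]={!}[\![A]\!]$, where $!V$ is the universal (cofree) cocommutative coassociative counital coalgebra with its universal linear map $d:{!}V\to V$. A proof of $A_1,\dots,A_r\vdash B$ denotes a linear map $[\![A_1]\!]\otimes\cdots\otimes[\![A_r]\!]\to[\![B]\!]$ in the standard way: dereliction is $d$, contraction is the comultiplication, weakening is the counit, promotion is the unique lift to a coalgebra morphism, cut is composition. A proof of $\vdash B$ denotes an element of $[\![B]\!]$. $A^m=A\&\cdots\&A$ ($m$ copies); "$m\,B$" in a list of hypotheses means $m$ copies of $B$. **Types and data.** With $E=A\multimap A$: ${}_n\mathbf{bool}_A=A^n\multimap A$, $\mathbf{bool}_A={}_2\mathbf{bool}_A$, $\mathbf{bint}_A={!}E\multimap({!}E\multimap E)$. $\underline{i}_A$ is the proof of ${}_n\mathbf{bool}_A$ given by projection onto the $i$-th coordinate ($0\le i\le n-1$). For $S=s_1\cdots s_l\in\{0,1\}^*$, $\underline{S}_A$ is the proof of $\mathbf{bint}_A$ given by the term $\lambda !u_0.\lambda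 !u_1.\lambda a.\,u_{s_l}(\cdots u_{s_1}(a)\cdots)$. **Construction.** Proofs are described by linear $\lambda$-terms: $\lambda$/application for $\multimap$, $\langle\dots\rangle$ for $\&R$ (the components share the same hypotheses), $x_i$ for the $i$-th projection (counted from $0$), $!t$ for promotion of a proof $t$, and $\lambda!u$ for $\multimap R$ on a hypothesis $!E$, whose variable $u:E$ may be used any number of times (via dereliction, contraction, weakening). $\delta_0,\delta_1,\delta_2$ are the components (symbol, state, direction) of $\delta$. - $\underline{\mathrm{head}}_A:\mathbf{bint}_{A^3}\vdash\mathbf{bool}_A$ is $b\vdash\lambda x.\,\big(b\,(!\pi_0)\,(!\pi_1)\,\langle x_0,x_1,x_0\rangle\big)_2$ with $\pi_i=\lambda t.\langle t_0,t_1,t_i\rangle$. - $\underline{\mathrm{tail}}_A:\mathbf{bint}_{A^3}\vdash\mathbf{bint}_A$ is $b\vdash\lambda!u.\lambda!v.\lambda a.\,\big(b\,(!R_u)\,(!R_v)\,\langle a,a,a\rangle\big)_0$ with $R_u=\lambda t.\langle t_2,t_2,u\,t_2\rangle$. - ${}_n\underline{\mathrm{booltype}}_A:{}_n\mathbf{bool}_{A^3}\vdash{}_n\mathbf{bool}_A$ is $q\vdash\lambda x.\,\big(q\langle\langle x_0,x_0,x_0\rangle,\dots,\langle x_{n-1},x_{n-1},x_{n-1}\rangle\rangle\big)_0$. - ${}^i_\delta\underline{\mathrm{trans}}_A:\mathbf{bool}_A,{}_n\mathbf{bool}_A\vdash{}_m\mathbf{bool}_A$ ($m=n$ if $i=1$,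 $m=2$ if $i=0,2$) is $b,q\vdash\lambda x.\,b\langle q\langle x_{\delta_i(0,0)},\dots,x_{\delta_i(0,n-1)}\rangle,\;q\langle x_{\delta_i(1,0)},\dots,x_{\delta_i(1,n-1)}\rangle\rangle$. - For $w=w_1\cdots w_l\in\{0,1\}^*$ and $S:\mathbf{bint}_A$ put $[S;w]=u_{w_l}(\cdots u_{w_1}(S\,(!u_0)\,(!u_1)\,a)\cdots)$. Then ${}^0\underline{\mathrm{recomb}}_A,{}^1\underline{\mathrm{recomb}}_A:\mathbf{bint}_A,3\,\mathbf{bool}_A\vdash\mathbf{bint}_A$, with hypotheses $S,\tau,\sigma,d$ in this order, are $\lambda!u_0.\lambda!u_1.\lambda a.\,d\langle P,P'\rangle$, where for ${}^0\underline{\mathrm{recomb}}$: $P=\tau\langle\sigma\langle[S;\emptyset],[S;\emptyset]\rangle,\sigma\langle[S;\emptyset],[S;\emptyset]\rangle\rangle$ and $P'=\tau\langle\sigma\langle[S;00],[S;10]\rangle,\sigma\langle[S;01],[S;11]\rangle\rangle$; for ${}^1\underline{\mathrm{recomb}}$: $P=\tau\langle\sigma\langle[S;00],[S;01]\rangle,\sigma\langle[S;10],[S;11]\rangle\rangle$ and $P'=\tau\langle\sigma\langle[S;\emptyset],[S;\emptyset]\rangle,\sigma\langle[S;\emptyset],[S;\emptyset]\rangle\rangle$. - ${}_\delta\underline{\mathrm{left}}_A:3\,\mathbf{bint}_{A^3},\mathbf{bint}_{A^3},2\,{}_n\mathbf{bool}_{A^3}\vdash\mathbf{bint}_A$, on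 hypotheses $X_1,X_2,X_3,Y,q_1,q_2$, is ${}^0\underline{\mathrm{recomb}}\big(\underline{\mathrm{tail}}(X_1),\underline{\mathrm{head}}(Y),{}^0_\delta\underline{\mathrm{trans}}(\underline{\mathrm{head}}(X_2),\underline{\mathrm{booltype}}(q_1)),{}^2_\delta\underline{\mathrm{trans}}(\underline{\mathrm{head}}(X_3),\underline{\mathrm{booltype}}(q_2))\big)$ (composition by cuts). - ${}_\delta\underline{\mathrm{right}}_A:2\,\mathbf{bint}_{A^3},2\,\mathbf{bint}_{A^3},2\,{}_n\mathbf{bool}_{A^3}\vdash\mathbf{bint}_A$, on $X_1,X_2,Y_1,Y_2,q_1,q_2$, is ${}^1\underline{\mathrm{recomb}}\big(\underline{\mathrm{tail}}(Y_2),\underline{\mathrm{head}}(Y_1),{}^0_\delta\underline{\mathrm{trans}}(\underline{\mathrm{head}}(X_1),\underline{\mathrm{booltype}}(q_1)),{}^2_\delta\underline{\mathrm{trans}}(\underline{\mathrm{head}}(X_2),\underline{\mathrm{booltype}}(q_2))\big)$. - ${}_\delta\underline{\mathrm{state}}_A:\mathbf{bint}_{A^3},{}_n\mathbf{bool}_{A^3}\vdash{}_n\mathbf{bool}_A$, on $X,q$, is ${}^1_\delta\underline{\mathrm{trans}}(\underline{\mathrm{head}}(X),\underline{\mathrm{booltype}}(q))$. *)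

theory Defs
  imports "HOL-Computational_Algebra.Polynomial" "HOL-Library.Function_Algebras"
    "HOL-Library.Product_Plus"
begin

section \<open>Linear algebra on subspaces\<close>

text \<open>
  A vector space over \<open>'k\<close> is a subspace of an ambient \<open>vector_space s\<close> on a type. Linear maps
  between subspaces are only constrained on the domain; the elements of the space \<open>Hom\<close> are
  normalised to be \<open>0\<close> outside it, so that they are determined by their values on the domain.
\<close>

definition linear_on ::
  "('k::field \<Rightarrow> 'v::ab_group_add \<Rightarrow> 'v) \<Rightarrow> ('k \<Rightarrow> 'w::ab_group_add \<Rightarrow> 'w) \<Rightarrow>
   'v set \<Rightarrow> 'w set \<Rightarrow> ('v \<Rightarrow> 'w) \<Rightarrow> bool"
  where "linear_on s s' V W f \<longleftrightarrow>
    (\<forall>x\<in>V. f x \<in> W) \<and> (\<forall>x\<in>V. \<forall>y\<in>V. f (x + y) = f x + f y) \<and> (\<forall>c. \<forall>x\<in>V. f (s c x) = s' c (f x))"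

definition Hom ::
  "('k::field \<Rightarrow> 'v::ab_group_add \<Rightarrow> 'v) \<Rightarrow> ('k \<Rightarrow> 'w::ab_group_add \<Rightarrow> 'w) \<Rightarrow>
   'v set \<Rightarrow> 'w set \<Rightarrow> ('v \<Rightarrow> 'w) set"
  where "Hom s s' V W = {f. linear_on s s' V W f \<and> (\<forall>x. x \<notin> V \<longrightarrow> f x = 0)}"

definition linear_iso ::
  "('k::field \<Rightarrow> 'v::ab_group_add \<Rightarrow> 'v) \<Rightarrow> ('k \<Rightarrow> 'w::ab_group_add \<Rightarrow> 'w) \<Rightarrow>
   'v set \<Rightarrow> 'w set \<Rightarrow> ('v \<Rightarrow> 'w) \<Rightarrow> bool"
  where "linear_iso s s' V W f \<longleftrightarrow> linear_on s s' V W f \<and> bij_betw f V W"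

definition fun_scale :: "('k \<Rightarrow> 'w \<Rightarrow> 'w) \<Rightarrow> 'k \<Rightarrow> ('x \<Rightarrow> 'w) \<Rightarrow> 'x \<Rightarrow> 'w"
  where "fun_scale s c f = (\<lambda>x. s c (f x))"

definition prod_scale :: "('k \<Rightarrow> 'v \<Rightarrow> 'v) \<Rightarrow> 'k \<Rightarrow> 'v \<times> 'v \<Rightarrow> 'v \<times> 'v"
  where "prod_scale s c p = (s c (fst p), s c (snd p))"


section \<open>Tensor products\<close>

text \<open>
  \<open>x\<^sub>1 \<otimes> \<dots> \<otimes> x\<^sub>r\<close> is evaluation at \<open>(x\<^sub>1, \<dots>, x\<^sub>r)\<close> on \<open>r\<close>-linear forms, and \<open>V\<^sub>1 \<otimes> \<dots> \<otimes> V\<^sub>r\<close> is the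
  span of these functionals for \<open>x\<^sub>i \<in> V\<^sub>i\<close>. Over a field this is the usual tensor product: forms on
  the ambient space suffice, since multilinear forms on subspaces extend. For \<open>r = 0\<close> it is a copy
  of \<open>'k\<close>, spanned by the functional of the empty list.
\<close>

type_synonym ('k, 'v) tensor = "('v list \<Rightarrow> 'k) \<Rightarrow> 'k"

definition multilinear_form ::
  "('k::field \<Rightarrow> 'v::ab_group_add \<Rightarrow> 'v) \<Rightarrow> nat \<Rightarrow> ('v list \<Rightarrow> 'k) \<Rightarrow> bool"
  where "multilinear_form s r \<phi> \<longleftrightarrow>
    (\<forall>xs i. length xs = r \<longrightarrow> i < r \<longrightarrow> Vector_Spaces.linear s (*) (\<lambda>x. \<phi> (xs[i := x])))"

definition tpure ::
  "('k::field \<Rightarrow> 'v::ab_group_add \<Rightarrow> 'v) \<Rightarrow> 'v list \<Rightarrow> ('k, 'v) tensor"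
  where "tpure s xs = (\<lambda>\<phi>. if multilinear_form s (length xs) \<phi> then \<phi> xs else 0)"

definition tscale :: "'k::field \<Rightarrow> ('k, 'v) tensor \<Rightarrow> ('k, 'v) tensor"
  where "tscale = fun_scale (*)"

definition tspace ::
  "('k::field \<Rightarrow> 'v::ab_group_add \<Rightarrow> 'v) \<Rightarrow> 'v set list \<Rightarrow> ('k, 'v) tensor set"
  where "tspace s Vs = module.span tscale (tpure s ` listset Vs)"

text \<open>The linear map on \<open>V\<^sub>1 \<otimes> \<dots> \<otimes> V\<^sub>r\<close> induced by a multilinear map \<open>f\<close>.\<close>

definition tlift ::
  "('k::field \<Rightarrow> 'v::ab_group_add \<Rightarrow> 'v) \<Rightarrow> ('k \<Rightarrow> 'w::ab_group_add \<Rightarrow> 'w) \<Rightarrow>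
   'v set list \<Rightarrow> ('v list \<Rightarrow> 'w) \<Rightarrow> ('k, 'v) tensor \<Rightarrow> 'w"
  where "tlift s s' Vs f =
    (THE g. g \<in> Hom tscale s' (tspace s Vs) UNIV \<and> (\<forall>xs \<in> listset Vs. g (tpure s xs) = f xs))"

definition tlift2 ::
  "('k::field \<Rightarrow> 'v::ab_group_add \<Rightarrow> 'v) \<Rightarrow> ('k \<Rightarrow> 'w::ab_group_add \<Rightarrow> 'w) \<Rightarrow>
   'v set \<Rightarrow> ('v \<Rightarrow> 'v \<Rightarrow> 'w) \<Rightarrow> ('k, 'v) tensor \<Rightarrow> 'w"
  where "tlift2 s s' V f = tlift s s' [V, V] (\<lambda>xs. f (xs ! 0) (xs ! 1))"


section \<open>Coalgebras\<close>

definition cocomm_coalgebra ::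
  "('k::field \<Rightarrow> 'c::ab_group_add \<Rightarrow> 'c) \<Rightarrow> 'c set \<Rightarrow> ('c \<Rightarrow> ('k, 'c) tensor) \<Rightarrow> ('c \<Rightarrow> 'k) \<Rightarrow> bool"
  where "cocomm_coalgebra s C \<Delta> \<epsilon> \<longleftrightarrow>
    module.subspace s C \<and>
    linear_on s tscale C (tspace s [C, C]) \<Delta> \<and>
    linear_on s (*) C UNIV \<epsilon> \<and>
    (\<forall>c\<in>C. tlift2 s tscale C (\<lambda>x y. tlift2 s tscale C (\<lambda>u v. tpure s [u, v, y]) (\<Delta> x)) (\<Delta> c) =
           tlift2 s tscale C (\<lambda>x y. tlift2 s tscale C (\<lambda>u v. tpure s [x, u, v]) (\<Delta> y)) (\<Delta> c)) \<and>
    (\<forall>c\<in>C. tlift2 s s C (\<lambda>x y. s (\<epsilon> x) y) (\<Delta> c) = c) \<and>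
    (\<forall>c\<in>C. tlift2 s s C (\<lambda>x y. s (\<epsilon> y) x) (\<Delta> c) = c) \<and>
    (\<forall>c\<in>C. tlift2 s tscale C (\<lambda>x y. tpure s [y, x]) (\<Delta> c) = \<Delta> c)"

definition coalgebra_mor ::
  "('k::field \<Rightarrow> 'c::ab_group_add \<Rightarrow> 'c) \<Rightarrow> 'c set \<Rightarrow> ('c \<Rightarrow> ('k, 'c) tensor) \<Rightarrow> ('c \<Rightarrow> 'k) \<Rightarrow>
   ('k \<Rightarrow> 'b::ab_group_add \<Rightarrow> 'b) \<Rightarrow> 'b set \<Rightarrow> ('b \<Rightarrow> ('k, 'b) tensor) \<Rightarrow> ('b \<Rightarrow> 'k) \<Rightarrow> ('c \<Rightarrow> 'b) \<Rightarrow> bool"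
  where "coalgebra_mor s C \<Delta> \<epsilon> s' C' \<Delta>' \<epsilon>' g \<longleftrightarrow>
    g \<in> Hom s s' C C' \<and>
    (\<forall>c\<in>C. \<Delta>' (g c) = tlift2 s tscale C (\<lambda>x y. tpure s' [g x, g y]) (\<Delta> c)) \<and>
    (\<forall>c\<in>C. \<epsilon>' (g c) = \<epsilon> c)"

text \<open>
  The tensor product coalgebra \<open>C\<^sub>1 \<otimes> \<dots> \<otimes> C\<^sub>r\<close>: on pure tensors, \<open>x\<^sub>1 \<otimes> \<dots> \<otimes> x\<^sub>r\<close> is mapped to the sum
  of all \<open>(x\<^sub>1' \<otimes> \<dots> \<otimes> x\<^sub>r') \<otimes> (x\<^sub>1'' \<otimes> \<dots> \<otimes> x\<^sub>r'')\<close>, where \<open>\<Delta>\<^sub>i x\<^sub>i\<close> is the sum of the \<open>x\<^sub>i' \<otimes> x\<^sub>i''\<close>.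
\<close>

definition tcons ::
  "('k::field \<Rightarrow> 'v::ab_group_add \<Rightarrow> 'v) \<Rightarrow> 'v set list \<Rightarrow> 'v \<Rightarrow> ('k, 'v) tensor \<Rightarrow> ('k, 'v) tensor"
  where "tcons s Vs x = tlift s tscale Vs (\<lambda>xs. tpure s (x # xs))"

fun comult_pure ::
  "('k::field \<Rightarrow> 'v::ab_group_add \<Rightarrow> 'v) \<Rightarrow> ('v set \<times> ('v \<Rightarrow> ('k, 'v) tensor)) list \<Rightarrow> 'v list \<Rightarrow>
   ('k, ('k, 'v) tensor) tensor"
  where
    "comult_pure s [] [] = tpure tscale [tpure s [], tpure s []]"
  | "comult_pure s ((C, \<Delta>) # Cs) (x # xs) =
      (let Vs = map fst Cs in
       tlift2 s tscale C (\<lambda>y z.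
         tlift2 tscale tscale (tspace s Vs) (\<lambda>p q. tpure tscale [tcons s Vs y p, tcons s Vs z q])
           (comult_pure s Cs xs)) (\<Delta> x))"

definition tensor_comult ::
  "('k::field \<Rightarrow> 'v::ab_group_add \<Rightarrow> 'v) \<Rightarrow> ('v set \<times> ('v \<Rightarrow> ('k, 'v) tensor)) list \<Rightarrow>
   ('k, 'v) tensor \<Rightarrow> ('k, ('k, 'v) tensor) tensor"
  where "tensor_comult s Cs = tlift s tscale (map fst Cs) (comult_pure s Cs)"

definition tensor_counit ::
  "('k::field \<Rightarrow> 'v::ab_group_add \<Rightarrow> 'v) \<Rightarrow> ('v set \<times> ('v \<Rightarrow> 'k)) list \<Rightarrow> ('k, 'v) tensor \<Rightarrow> 'k"
  where "tensor_counit s Cs =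
    tlift s (*) (map fst Cs) (\<lambda>xs. prod_list (map2 (\<lambda>C x. snd C x) Cs xs))"


section \<open>Intuitionistic linear logic\<close>

datatype 'a formula =
    Atom 'a
  | Tensor "'a formula" "'a formula"
  | With "'a formula" "'a formula"
  | Lolli "'a formula" "'a formula" (infixr "\<multimap>" 60)
  | is_OfCourse: OfCourse (unbang: "'a formula")

primrec subformulas :: "'a formula \<Rightarrow> 'a formula set"
  where
    "subformulas (Atom a) = {Atom a}"
  | "subformulas (Tensor A B) = insert (Tensor A B) (subformulas A \<union> subformulas B)"
  | "subformulas (With A B) = insert (With A B) (subformulas A \<union> subformulas B)"
  | "subformulas (A \<multimap> B) = insert (A \<multimap> B) (subformulas A \<union> subformulas B)"
  | "subformulas (OfCourse A) = insert (OfCourse A) (subformulas A)"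

text \<open>
  Sequent calculus proof trees; \<open>hyps \<pi>\<close> and \<open>concl \<pi>\<close> are the two sides of the last sequent, and
  \<open>valid \<pi>\<close> says that all rules are applied correctly. Left rules act on the first hypothesis,
  except that \<open>Cut i \<pi> \<rho>\<close> cuts \<open>\<pi>\<close> into hypothesis number \<open>i\<close> of \<open>\<rho>\<close>, and \<open>Contr i \<pi>\<close> contracts the
  hypotheses number \<open>i\<close> and \<open>i + 1\<close>. Exchange is taken for arbitrary permutations: \<open>Exch \<Gamma> js \<pi>\<close> has
  the hypotheses \<open>\<Gamma>\<close>, and hypothesis number \<open>i\<close> of \<open>\<pi>\<close> is number \<open>js ! i\<close> of \<open>\<Gamma>\<close>.
\<close>

datatype 'a deriv =
    Ax "'a formula"
  | Exch "'a formula list" "nat list" "'a deriv"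
  | Cut nat "'a deriv" "'a deriv"
  | TensorR "'a deriv" "'a deriv"
  | TensorL "'a deriv"
  | WithR "'a deriv" "'a deriv"
  | WithL0 "'a formula" "'a deriv"
  | WithL1 "'a formula" "'a deriv"
  | LolliR "'a deriv"
  | LolliL "'a deriv" "'a deriv"
  | Der "'a deriv"
  | Prom "'a deriv"
  | Weak "'a formula" "'a deriv"
  | Contr nat "'a deriv"

fun hyps :: "'a deriv \<Rightarrow> 'a formula list" and concl :: "'a deriv \<Rightarrow> 'a formula"
  where
    "hyps (Ax A) = [A]"
  | "hyps (Exch \<Gamma> js \<pi>) = \<Gamma>"
  | "hyps (Cut i \<pi> \<rho>) = take i (hyps \<rho>) @ hyps \<pi> @ drop (Suc i) (hyps \<rho>)"
  | "hyps (TensorR \<pi> \<rho>) = hyps \<pi> @ hyps \<rho>"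
  | "hyps (TensorL \<pi>) = Tensor (hyps \<pi> ! 0) (hyps \<pi> ! 1) # drop 2 (hyps \<pi>)"
  | "hyps (WithR \<pi> \<rho>) = hyps \<pi>"
  | "hyps (WithL0 B \<pi>) = With (hd (hyps \<pi>)) B # tl (hyps \<pi>)"
  | "hyps (WithL1 A \<pi>) = With A (hd (hyps \<pi>)) # tl (hyps \<pi>)"
  | "hyps (LolliR \<pi>) = tl (hyps \<pi>)"
  | "hyps (LolliL \<pi> \<rho>) = (concl \<pi> \<multimap> hd (hyps \<rho>)) # hyps \<pi> @ tl (hyps \<rho>)"
  | "hyps (Der \<pi>) = OfCourse (hd (hyps \<pi>)) # tl (hyps \<pi>)"
  | "hyps (Prom \<pi>) = hyps \<pi>"
  | "hyps (Weak A \<pi>) = OfCourse A # hyps \<pi>"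
  | "hyps (Contr i \<pi>) = take (Suc i) (hyps \<pi>) @ drop (Suc (Suc i)) (hyps \<pi>)"
  | "concl (Ax A) = A"
  | "concl (Exch \<Gamma> js \<pi>) = concl \<pi>"
  | "concl (Cut i \<pi> \<rho>) = concl \<rho>"
  | "concl (TensorR \<pi> \<rho>) = Tensor (concl \<pi>) (concl \<rho>)"
  | "concl (TensorL \<pi>) = concl \<pi>"
  | "concl (WithR \<pi> \<rho>) = With (concl \<pi>) (concl \<rho>)"
  | "concl (WithL0 B \<pi>) = concl \<pi>"
  | "concl (WithL1 A \<pi>) = concl \<pi>"
  | "concl (LolliR \<pi>) = (hd (hyps \<pi>) \<multimap> concl \<pi>)"
  | "concl (LolliL \<pi> \<rho>) = concl \<rho>"
  | "concl (Der \<pi>) = concl \<pi>"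
  | "concl (Prom \<pi>) = OfCourse (concl \<pi>)"
  | "concl (Weak A \<pi>) = concl \<pi>"
  | "concl (Contr i \<pi>) = concl \<pi>"

primrec valid :: "'a deriv \<Rightarrow> bool"
  where
    "valid (Ax A) = True"
  | "valid (Exch \<Gamma> js \<pi>) = (valid \<pi> \<and> distinct js \<and> set js = {..<length \<Gamma>} \<and> hyps \<pi> = map ((!) \<Gamma>) js)"
  | "valid (Cut i \<pi> \<rho>) = (valid \<pi> \<and> valid \<rho> \<and> i < length (hyps \<rho>) \<and> hyps \<rho> ! i = concl \<pi>)"
  | "valid (TensorR \<pi> \<rho>) = (valid \<pi> \<and> valid \<rho>)"
  | "valid (TensorL \<pi>) = (valid \<pi> \<and> length (hyps \<pi>) \<ge> 2)"
  | "valid (WithR \<pi> \<rho>) = (valid \<pi> \<and> valid \<rho> \<and> hyps \<pi> = hyps \<rho>)"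
  | "valid (WithL0 B \<pi>) = (valid \<pi> \<and> hyps \<pi> \<noteq> [])"
  | "valid (WithL1 A \<pi>) = (valid \<pi> \<and> hyps \<pi> \<noteq> [])"
  | "valid (LolliR \<pi>) = (valid \<pi> \<and> hyps \<pi> \<noteq> [])"
  | "valid (LolliL \<pi> \<rho>) = (valid \<pi> \<and> valid \<rho> \<and> hyps \<rho> \<noteq> [])"
  | "valid (Der \<pi>) = (valid \<pi> \<and> hyps \<pi> \<noteq> [])"
  | "valid (Prom \<pi>) = (valid \<pi> \<and> (\<forall>B \<in> set (hyps \<pi>). is_OfCourse B))"
  | "valid (Weak A \<pi>) = valid \<pi>"
  | "valid (Contr i \<pi>) = (valid \<pi> \<and> Suc i < length (hyps \<pi>) \<and>
      hyps \<pi> ! i = hyps \<pi> ! Suc i \<and> is_OfCourse (hyps \<pi> ! i))"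

definition proves :: "'a deriv \<Rightarrow> 'a formula list \<Rightarrow> 'a formula \<Rightarrow> bool"
  where "proves \<pi> \<Gamma> A \<longleftrightarrow> valid \<pi> \<and> hyps \<pi> = \<Gamma> \<and> concl \<pi> = A"


section \<open>Sweedler semantics\<close>

text \<open>
  The spaces \<open>\<lbrakk>A\<rbrakk>\<close> are subspaces of one ambient space \<open>'v\<close>, and \<open>\<lbrakk>A \<otimes> B\<rbrakk>\<close>, \<open>\<lbrakk>A & B\<rbrakk>\<close>, \<open>\<lbrakk>A \<multimap> B\<rbrakk>\<close> are
  identified with \<open>\<lbrakk>A\<rbrakk> \<otimes> \<lbrakk>B\<rbrakk>\<close>, \<open>\<lbrakk>A\<rbrakk> \<oplus> \<lbrakk>B\<rbrakk>\<close>, \<open>Hom(\<lbrakk>A\<rbrakk>, \<lbrakk>B\<rbrakk>)\<close> by chosen isomorphisms. As cardinalities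
  grow with the nesting of \<open>\<multimap>\<close> and \<open>!\<close>, no single HOL type accommodates all formulas; hence a
  semantics is given on a set \<open>formulas\<close> of formulas that is closed under subformulas. The fields
  \<open>comult\<close>, \<open>counit\<close> and \<open>derel\<close> at the index \<open>A\<close> are the structure maps of \<open>\<lbrakk>!A\<rbrakk>\<close>.
\<close>

record ('a, 'k, 'v) semantics =
  formulas :: "'a formula set"
  scale :: "'k \<Rightarrow> 'v \<Rightarrow> 'v"
  space :: "'a formula \<Rightarrow> 'v set"
  tensor_in :: "'a formula \<Rightarrow> 'a formula \<Rightarrow> ('k, 'v) tensor \<Rightarrow> 'v"
  with_in :: "'a formula \<Rightarrow> 'a formula \<Rightarrow> 'v \<times> 'v \<Rightarrow> 'v"
  lolli_in :: "'a formula \<Rightarrow> 'a formula \<Rightarrow> ('v \<Rightarrow> 'v) \<Rightarrow> 'v"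
  comult :: "'a formula \<Rightarrow> 'v \<Rightarrow> ('k, 'v) tensor"
  counit :: "'a formula \<Rightarrow> 'v \<Rightarrow> 'k"
  derel :: "'a formula \<Rightarrow> 'v \<Rightarrow> 'v"

text \<open>
  In the universal property of \<open>!V\<close> the test coalgebras are carried by subspaces of the type
  \<open>('k, 'v) tensor\<close>, which contains isomorphic copies of \<open>'k\<close>, of all subspaces of \<open>'v\<close> and of
  their finite tensor products. Asking for the property only on these coalgebras is weaker than
  asking for it on all coalgebras.
\<close>

locale sweedler_semantics =
  fixes M :: "('a, 'k::alg_closed_field, 'v::ab_group_add) semantics"
  assumes vector_space: "vector_space (scale M)"
    and formulas: "A \<in> formulas M \<Longrightarrow> subformulas A \<subseteq> formulas M"
    and space: "A \<in> formulas M \<Longrightarrow> module.subspace (scale M) (space M A)"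
    and tensor: "Tensor A B \<in> formulas M \<Longrightarrow>
      linear_iso tscale (scale M) (tspace (scale M) [space M A, space M B]) (space M (Tensor A B))
        (tensor_in M A B)"
    and "with": "With A B \<in> formulas M \<Longrightarrow>
      linear_iso (prod_scale (scale M)) (scale M) (space M A \<times> space M B) (space M (With A B))
        (with_in M A B)"
    and lolli: "(A \<multimap> B) \<in> formulas M \<Longrightarrow>
      linear_iso (fun_scale (scale M)) (scale M) (Hom (scale M) (scale M) (space M A) (space M B))
        (space M (A \<multimap> B)) (lolli_in M A B)"
    and coalgebra: "OfCourse A \<in> formulas M \<Longrightarrow>
      cocomm_coalgebra (scale M) (space M (OfCourse A)) (comult M A) (counit M A)"
    and derel: "OfCourse A \<in> formulas M \<Longrightarrow>
      linear_on (scale M) (scale M) (space M (OfCourse A)) (space M A) (derel M A)"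
    and universal: "OfCourse A \<in> formulas M \<Longrightarrow>
      cocomm_coalgebra tscale (C :: ('k, 'v) tensor set) \<Delta> \<epsilon> \<Longrightarrow>
      linear_on tscale (scale M) C (space M A) f \<Longrightarrow>
      \<exists>!g. coalgebra_mor tscale C \<Delta> \<epsilon>
              (scale M) (space M (OfCourse A)) (comult M A) (counit M A) g \<and>
           (\<forall>c\<in>C. derel M A (g c) = f c)"

definition promote ::
  "('a, 'k::alg_closed_field, 'v::ab_group_add) semantics \<Rightarrow> 'a formula list \<Rightarrow> 'a formula \<Rightarrow>
   (('k, 'v) tensor \<Rightarrow> 'v) \<Rightarrow> ('k, 'v) tensor \<Rightarrow> 'v"
  where "promote M As B f =
    (let Vs = map (\<lambda>A. space M (OfCourse A)) As in
     THE g. coalgebra_mor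
        tscale (tspace (scale M) Vs)
        (tensor_comult (scale M) (zip Vs (map (comult M) As)))
        (tensor_counit (scale M) (zip Vs (map (counit M) As)))
        (scale M) (space M (OfCourse B)) (comult M B) (counit M B) g \<and>
      (\<forall>t \<in> tspace (scale M) Vs. derel M B (g t) = f t))"

definition ext ::
  "('a, 'k::alg_closed_field, 'v::ab_group_add) semantics \<Rightarrow> 'a formula list \<Rightarrow> ('v list \<Rightarrow> 'v) \<Rightarrow>
   ('k, 'v) tensor \<Rightarrow> 'v"
  where "ext M \<Gamma> f = tlift (scale M) (scale M) (map (space M) \<Gamma>) f"

text \<open>
  \<open>den M \<pi>\<close> is the linear map \<open>\<lbrakk>A\<^sub>1\<rbrakk> \<otimes> \<dots> \<otimes> \<lbrakk>A\<^sub>r\<rbrakk> \<rightarrow> \<lbrakk>B\<rbrakk>\<close> denoted by a proof \<open>\<pi>\<close> of \<open>A\<^sub>1, \<dots>, A\<^sub>r \<turnstile> B\<close>.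
\<close>

fun den ::
  "('a, 'k::alg_closed_field, 'v::ab_group_add) semantics \<Rightarrow> 'a deriv \<Rightarrow> ('k, 'v) tensor \<Rightarrow> 'v"
  where
    "den M (Ax A) = ext M [A] (\<lambda>xs. hd xs)"
  | "den M (Exch \<Gamma> js \<pi>) = ext M \<Gamma> (\<lambda>xs. den M \<pi> (tpure (scale M) (map ((!) xs) js)))"
  | "den M (Cut i \<pi> \<rho>) = ext M (hyps (Cut i \<pi> \<rho>)) (\<lambda>xs.
      let m = length (hyps \<pi>) in
      den M \<rho> (tpure (scale M)
        (take i xs @ den M \<pi> (tpure (scale M) (take m (drop i xs))) # drop (i + m) xs)))"
  | "den M (TensorR \<pi> \<rho>) = ext M (hyps \<pi> @ hyps \<rho>) (\<lambda>xs.
      let m = length (hyps \<pi>) in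
      tensor_in M (concl \<pi>) (concl \<rho>) (tpure (scale M)
        [den M \<pi> (tpure (scale M) (take m xs)), den M \<rho> (tpure (scale M) (drop m xs))]))"
  | "den M (TensorL \<pi>) = ext M (hyps (TensorL \<pi>)) (\<lambda>xs.
      let A = hyps \<pi> ! 0; B = hyps \<pi> ! 1 in
      ext M [A, B] (\<lambda>ys. den M \<pi> (tpure (scale M) (ys @ tl xs)))
        (inv_into (tspace (scale M) [space M A, space M B]) (tensor_in M A B) (hd xs)))"
  | "den M (WithR \<pi> \<rho>) = ext M (hyps \<pi>) (\<lambda>xs.
      with_in M (concl \<pi>) (concl \<rho>) (den M \<pi> (tpure (scale M) xs), den M \<rho> (tpure (scale M) xs)))"
  | "den M (WithL0 B \<pi>) = ext M (hyps (WithL0 B \<pi>)) (\<lambda>xs.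
      let A = hd (hyps \<pi>) in
      den M \<pi> (tpure (scale M)
        (fst (inv_into (space M A \<times> space M B) (with_in M A B) (hd xs)) # tl xs)))"
  | "den M (WithL1 A \<pi>) = ext M (hyps (WithL1 A \<pi>)) (\<lambda>xs.
      let B = hd (hyps \<pi>) in
      den M \<pi> (tpure (scale M)
        (snd (inv_into (space M A \<times> space M B) (with_in M A B) (hd xs)) # tl xs)))"
  | "den M (LolliR \<pi>) = ext M (tl (hyps \<pi>)) (\<lambda>xs.
      let A = hd (hyps \<pi>) in
      lolli_in M A (concl \<pi>) (\<lambda>a. if a \<in> space M A then den M \<pi> (tpure (scale M) (a # xs)) else 0))"
  | "den M (LolliL \<pi> \<rho>) = ext M (hyps (LolliL \<pi> \<rho>)) (\<lambda>xs.
      let A = concl \<pi>; B = hd (hyps \<rho>); m = length (hyps \<pi>);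
          f = inv_into (Hom (scale M) (scale M) (space M A) (space M B)) (lolli_in M A B) (hd xs) in
      den M \<rho> (tpure (scale M)
        (f (den M \<pi> (tpure (scale M) (take m (tl xs)))) # drop m (tl xs))))"
  | "den M (Der \<pi>) = ext M (hyps (Der \<pi>)) (\<lambda>xs.
      den M \<pi> (tpure (scale M) (derel M (hd (hyps \<pi>)) (hd xs) # tl xs)))"
  | "den M (Prom \<pi>) = promote M (map unbang (hyps \<pi>)) (concl \<pi>) (den M \<pi>)"
  | "den M (Weak A \<pi>) = ext M (hyps (Weak A \<pi>)) (\<lambda>xs.
      scale M (counit M A (hd xs)) (den M \<pi> (tpure (scale M) (tl xs))))"
  | "den M (Contr i \<pi>) = ext M (hyps (Contr i \<pi>)) (\<lambda>xs.
      let B = hyps \<pi> ! i in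
      ext M [B, B] (\<lambda>ys. den M \<pi> (tpure (scale M) (take i xs @ ys @ drop (Suc i) xs)))
        (comult M (unbang B) (xs ! i)))"

text \<open>The element of \<open>\<lbrakk>B\<rbrakk>\<close> denoted by a proof of \<open>\<turnstile> B\<close>: the value at \<open>1\<close> in the empty tensor product.\<close>

definition den_closed ::
  "('a, 'k::alg_closed_field, 'v::ab_group_add) semantics \<Rightarrow> 'a deriv \<Rightarrow> 'v"
  where "den_closed M \<pi> = den M \<pi> (tpure (scale M) [])"


section \<open>Linear lambda terms\<close>

text \<open>
  \<open>Lam\<close>/\<open>Var\<close> bind and use linear hypotheses; \<open>LamB\<close> (written \<open>\<lambda>!u\<close>) binds a hypothesis \<open>!A\<close> whose
  variable is used by \<open>UVar\<close> any number of times.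
\<close>

datatype 'a tm =
    Var string
  | UVar string
  | Lam string "'a formula" "'a tm"
  | LamB string "'a formula" "'a tm"
  | App "'a tm" "'a tm"
  | Tup "'a tm" "'a tm"
  | Fst "'a tm"
  | Snd "'a tm"
  | Bang "'a tm"

primrec linear_vars :: "'a tm \<Rightarrow> string set"
  where
    "linear_vars (Var x) = {x}"
  | "linear_vars (UVar u) = {}"
  | "linear_vars (Lam x A t) = linear_vars t - {x}"
  | "linear_vars (LamB u A t) = linear_vars t"
  | "linear_vars (App t t') = linear_vars t \<union> linear_vars t'"
  | "linear_vars (Tup t t') = linear_vars t \<union> linear_vars t'"
  | "linear_vars (Fst t) = linear_vars t"
  | "linear_vars (Snd t) = linear_vars t"
  | "linear_vars (Bang t) = linear_vars t"

text \<open>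
  \<open>elab \<Theta> \<Gamma> t\<close> is the proof of \<open>!\<Theta>, \<Gamma> \<turnstile> B\<close> described by a term \<open>t\<close> with unrestricted variables \<open>\<Theta>\<close>
  and linear variables \<open>\<Gamma>\<close>. Eliminations are left rules followed by a cut. In an application, the
  linear hypotheses are distributed according to their occurrences, while all of \<open>!\<Theta>\<close> is passed to
  both parts and contracted; hypotheses in \<open>!\<Theta>\<close> that are not needed are weakened at the variables.
  Only well-typed terms yield valid proofs.
\<close>

fun elab :: "(string \<times> 'a formula) list \<Rightarrow> (string \<times> 'a formula) list \<Rightarrow> 'a tm \<Rightarrow> 'a deriv"
  where
    "elab \<Theta> \<Gamma> (Var x) = foldr Weak (map snd \<Theta>) (Ax (the (map_of \<Gamma> x)))"
  | "elab \<Theta> \<Gamma> (UVar u) =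
      (let m = length \<Theta>;
           i = length (takeWhile (\<lambda>p. fst p \<noteq> u) \<Theta>);
           js = filter (\<lambda>j. j \<noteq> i) [0..<m] in
       Exch (map (OfCourse \<circ> snd) \<Theta>) (js @ [i])
         (foldr Weak (map (\<lambda>j. snd (\<Theta> ! j)) js) (Der (Ax (snd (\<Theta> ! i))))))"
  | "elab \<Theta> \<Gamma> (Lam x A t) =
      (let m = length \<Theta> in
       LolliR (Exch (A # map (OfCourse \<circ> snd) \<Theta> @ map snd \<Gamma>)
         ([1..<Suc m] @ [0] @ [Suc m..<Suc (m + length \<Gamma>)]) (elab \<Theta> ((x, A) # \<Gamma>) t)))"
  | "elab \<Theta> \<Gamma> (LamB u A t) = LolliR (elab ((u, A) # \<Theta>) \<Gamma> t)"
  | "elab \<Theta> \<Gamma> (App t t') =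
      (let m = length \<Theta>;
           js = filter (\<lambda>j. fst (\<Gamma> ! j) \<in> linear_vars t) [0..<length \<Gamma>];
           js' = filter (\<lambda>j. fst (\<Gamma> ! j) \<notin> linear_vars t) [0..<length \<Gamma>];
           \<pi> = elab \<Theta> (map ((!) \<Gamma>) js) t;
           \<rho> = elab \<Theta> (map ((!) \<Gamma>) js') t';
           B = (case concl \<pi> of _ \<multimap> B \<Rightarrow> B) in
       fold Contr [0..<m]
         (Exch (concat (map (\<lambda>p. [OfCourse (snd p), OfCourse (snd p)]) \<Theta>) @ map snd \<Gamma>)
           (map (\<lambda>i. 2 * i) [0..<m] @ map ((+) (2 * m)) js @
            map (\<lambda>i. 2 * i + 1) [0..<m] @ map ((+) (2 * m)) js')
           (Cut 0 \<pi> (LolliL \<rho> (Ax B)))))"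
  | "elab \<Theta> \<Gamma> (Tup t t') = WithR (elab \<Theta> \<Gamma> t) (elab \<Theta> \<Gamma> t')"
  | "elab \<Theta> \<Gamma> (Fst t) =
      (let \<pi> = elab \<Theta> \<Gamma> t in case concl \<pi> of With A B \<Rightarrow> Cut 0 \<pi> (WithL0 B (Ax A)))"
  | "elab \<Theta> \<Gamma> (Snd t) =
      (let \<pi> = elab \<Theta> \<Gamma> t in case concl \<pi> of With A B \<Rightarrow> Cut 0 \<pi> (WithL1 A (Ax B)))"
  | "elab \<Theta> \<Gamma> (Bang t) = Prom (elab \<Theta> \<Gamma> t)"


section \<open>Types and data\<close>

text \<open>\<open>A\<^sup>m\<close>, bracketed to the right; the value at \<open>m = 0\<close> is a dummy.\<close>

fun pow :: "'a formula \<Rightarrow> nat \<Rightarrow> 'a formula"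
  where
    "pow A 0 = A"
  | "pow A (Suc 0) = A"
  | "pow A (Suc (Suc m)) = With A (pow A (Suc m))"

fun tuple :: "'a tm list \<Rightarrow> 'a tm"
  where
    "tuple [t] = t"
  | "tuple (t # t' # ts) = Tup t (tuple (t' # ts))"

text \<open>\<open>proj m i t\<close> is the component number \<open>i < m\<close>, counted from \<open>0\<close>, of \<open>t : A\<^sup>m\<close>.\<close>

fun proj :: "nat \<Rightarrow> nat \<Rightarrow> 'a tm \<Rightarrow> 'a tm"
  where
    "proj m 0 t = (if m \<le> 1 then t else Fst t)"
  | "proj m (Suc i) t = proj (m - 1) i (Snd t)"

definition nbool :: "nat \<Rightarrow> 'a formula \<Rightarrow> 'a formula"
  where "nbool n A = (pow A n \<multimap> A)"

definition bint :: "'a formula \<Rightarrow> 'a formula"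
  where "bint A = (OfCourse (A \<multimap> A) \<multimap> OfCourse (A \<multimap> A) \<multimap> A \<multimap> A)"

definition nbool_val :: "nat \<Rightarrow> 'a formula \<Rightarrow> nat \<Rightarrow> 'a deriv"
  where "nbool_val n A i = elab [] [] (Lam ''x'' (pow A n) (proj n i (Var ''x'')))"

text \<open>\<open>apply_word w t\<close> is \<open>u\<^bsub>w\<^sub>l\<^esub> (\<dots> (u\<^bsub>w\<^sub>1\<^esub> t) \<dots>)\<close>; the symbols are the numbers \<open>0\<close> and \<open>1\<close>.\<close>

definition word_var :: "nat \<Rightarrow> 'a tm"
  where "word_var s = UVar (if s = 0 then ''u0'' else ''u1'')"

definition apply_word :: "nat list \<Rightarrow> 'a tm \<Rightarrow> 'a tm"
  where "apply_word w t = fold (\<lambda>s. App (word_var s)) w t"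

definition bint_val :: "'a formula \<Rightarrow> nat list \<Rightarrow> 'a deriv"
  where "bint_val A w =
    elab [] [] (LamB ''u0'' (A \<multimap> A) (LamB ''u1'' (A \<multimap> A) (Lam ''a'' A (apply_word w (Var ''a'')))))"


section \<open>The transition proofs\<close>

definition head :: "'a formula \<Rightarrow> 'a deriv"
  where "head A =
    (let p = (\<lambda>i. Lam ''t'' (pow A 3)
                (tuple [proj 3 0 (Var ''t''), proj 3 1 (Var ''t''), proj 3 i (Var ''t'')]));
         x = (\<lambda>i. proj 2 i (Var ''x'')) in
     elab [] [(''b'', bint (pow A 3))]
       (Lam ''x'' (pow A 2)
         (proj 3 2 (App (App (App (Var ''b'') (Bang (p 0))) (Bang (p 1))) (tuple [x 0, x 1, x 0])))))"

definition tail :: "'a formula \<Rightarrow> 'a deriv"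
  where "tail A =
    (let R = (\<lambda>v. Lam ''t'' (pow A 3)
                (tuple [proj 3 2 (Var ''t''), proj 3 2 (Var ''t''),
                        App (UVar v) (proj 3 2 (Var ''t''))])) in
     elab [] [(''b'', bint (pow A 3))]
       (LamB ''u'' (A \<multimap> A) (LamB ''v'' (A \<multimap> A) (Lam ''a'' A
         (proj 3 0 (App (App (App (Var ''b'') (Bang (R ''u''))) (Bang (R ''v'')))
           (tuple [Var ''a'', Var ''a'', Var ''a''])))))))"

definition booltype :: "nat \<Rightarrow> 'a formula \<Rightarrow> 'a deriv"
  where "booltype n A =
    (let x = (\<lambda>i. proj n i (Var ''x'')) in
     elab [] [(''q'', nbool n (pow A 3))]
       (Lam ''x'' (pow A n)
         (proj 3 0 (App (Var ''q'') (tuple (map (\<lambda>i. tuple [x i, x i, x i]) [0..<n]))))))"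

text \<open>
  A transition function maps a symbol and a state to a symbol, a state and a direction;
  \<open>delta_comp \<delta> i\<close> is its component \<open>\<delta>\<^sub>i\<close>.
\<close>

type_synonym transition = "nat \<times> nat \<Rightarrow> nat \<times> nat \<times> nat"

definition is_transition :: "nat \<Rightarrow> transition \<Rightarrow> bool"
  where "is_transition n \<delta> \<longleftrightarrow> (\<forall>p \<in> {0, 1} \<times> {..<n}. \<delta> p \<in> {0, 1} \<times> {..<n} \<times> {0, 1})"

definition delta_comp :: "transition \<Rightarrow> nat \<Rightarrow> nat \<times> nat \<Rightarrow> nat"
  where "delta_comp \<delta> i p = (case \<delta> p of (s, q, d) \<Rightarrow> if i = 0 then s else if i = 1 then q else d)"

definition trans_proof :: "nat \<Rightarrow> nat \<Rightarrow> transition \<Rightarrow> 'a formula \<Rightarrow> 'a deriv"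
  where "trans_proof i n \<delta> A =
    (let m = (if i = 1 then n else 2);
         x = (\<lambda>j. proj m j (Var ''x''));
         row = (\<lambda>s. App (Var ''q'') (tuple (map (\<lambda>j. x (delta_comp \<delta> i (s, j))) [0..<n]))) in
     elab [] [(''b'', nbool 2 A), (''q'', nbool n A)]
       (Lam ''x'' (pow A m) (App (Var ''b'') (tuple [row 0, row 1]))))"

text \<open>\<open>after w\<close> is the term \<open>[S; w]\<close>.\<close>

definition after :: "nat list \<Rightarrow> 'a tm"
  where "after w =
    apply_word w (App (App (App (Var ''S'') (Bang (word_var 0))) (Bang (word_var 1))) (Var ''a''))"

definition recomb_frame :: "'a formula \<Rightarrow> 'a tm \<Rightarrow> 'a tm \<Rightarrow> 'a deriv"
  where "recomb_frame A P P' =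
    elab [] [(''S'', bint A), (''tau'', nbool 2 A), (''sigma'', nbool 2 A), (''d'', nbool 2 A)]
      (LamB ''u0'' (A \<multimap> A) (LamB ''u1'' (A \<multimap> A) (Lam ''a'' A (App (Var ''d'') (Tup P P')))))"

definition choice :: "nat list \<Rightarrow> nat list \<Rightarrow> nat list \<Rightarrow> nat list \<Rightarrow> 'a tm"
  where "choice w w' v v' =
    App (Var ''tau'') (Tup (App (Var ''sigma'') (Tup (after w) (after w')))
                           (App (Var ''sigma'') (Tup (after v) (after v'))))"

definition recomb0 :: "'a formula \<Rightarrow> 'a deriv"
  where "recomb0 A = recomb_frame A (choice [] [] [] []) (choice [0,0] [1,0] [0,1] [1,1])"

definition recomb1 :: "'a formula \<Rightarrow> 'a deriv"
  where "recomb1 A = recomb_frame A (choice [0,0] [0,1] [1,0] [1,1]) (choice [] [] [] [])"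

text \<open>\<open>step_proof i\<close> proves \<open>X, q \<turnstile> \<^sub>mbool\<^sub>A\<close> by cutting \<open>head(X)\<close> and \<open>booltype(q)\<close> into \<open>trans_proof i\<close>.\<close>

definition step_proof :: "nat \<Rightarrow> nat \<Rightarrow> transition \<Rightarrow> 'a formula \<Rightarrow> 'a deriv"
  where "step_proof i n \<delta> A = Cut 0 (head A) (Cut 1 (booltype n A) (trans_proof i n \<delta> A))"

text \<open>
  The iterated cuts prove \<open>X\<^sub>1, Y, X\<^sub>2, q\<^sub>1, X\<^sub>3, q\<^sub>2 \<turnstile> bint\<^sub>A\<close> and \<open>Y\<^sub>2, Y\<^sub>1, X\<^sub>1, q\<^sub>1, X\<^sub>2, q\<^sub>2 \<turnstile> bint\<^sub>A\<close>,
  respectively; the hypotheses are then reordered.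
\<close>

definition left_proof :: "nat \<Rightarrow> transition \<Rightarrow> 'a formula \<Rightarrow> 'a deriv"
  where "left_proof n \<delta> A =
    (let B = bint (pow A 3); Q = nbool n (pow A 3) in
     Exch [B, B, B, B, Q, Q] [0, 3, 1, 4, 2, 5]
       (Cut 0 (tail A) (Cut 1 (head A) (Cut 2 (step_proof 0 n \<delta> A) (Cut 3 (step_proof 2 n \<delta> A)
         (recomb0 A))))))"

definition right_proof :: "nat \<Rightarrow> transition \<Rightarrow> 'a formula \<Rightarrow> 'a deriv"
  where "right_proof n \<delta> A =
    (let B = bint (pow A 3); Q = nbool n (pow A 3) in
     Exch [B, B, B, B, Q, Q] [3, 2, 0, 4, 1, 5]
       (Cut 0 (tail A) (Cut 1 (head A) (Cut 2 (step_proof 0 n \<delta> A) (Cut 3 (step_proof 2 n \<delta> A)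
         (recomb1 A))))))"

definition state_proof :: "nat \<Rightarrow> transition \<Rightarrow> 'a formula \<Rightarrow> 'a deriv"
  where "state_proof n \<delta> A = step_proof 1 n \<delta> A"


section \<open>The induced map \<open>tlift\<close> is well defined\<close>

definition pair_scale where "pair_scale s1 s2 c p = (s1 c (fst p), s2 c (snd p))"

lemma vector_space_tscale: "vector_space (tscale :: 'k::field \<Rightarrow> ('k,'v) tensor \<Rightarrow> _)"
  by standard (auto simp: tscale_def fun_scale_def algebra_simps)

lemma vector_space_pair_scale: assumes "vector_space s1" "vector_space s2" shows "vector_space (pair_scale s1 s2)"
proof -
  interpret a: vector_space s1 by fact
  interpret b: vector_space s2 by fact
  show ?thesis by standard (auto simp: pair_scale_def algebra_simps a.scale_right_distrib a.scale_left_distrib b.scale_right_distrib b.scale_left_distrib)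
qed

lemma lin_id: assumes "vector_space s" shows "Vector_Spaces.linear s s id"
  using assms by (metis vector_space.linear_id)

lemma listset_length: "xs \<in> listset Vs \<Longrightarrow> length xs = length Vs"
  by (induction Vs arbitrary: xs) (auto simp: set_Cons_def)
lemma listset_nth: "xs \<in> listset Vs \<longleftrightarrow> length xs = length Vs \<and> (\<forall>i<length Vs. xs ! i \<in> Vs ! i)"
proof (induction Vs arbitrary: xs)
  case (Cons V Vs) show ?case
    by (cases xs) (auto simp: set_Cons_def Cons less_Suc_eq_0_disj)
qed auto

lemma tlift_unique_existence:
  fixes s :: "'k::field \<Rightarrow> 'v::ab_group_add \<Rightarrow> 'v" and s' :: "'k \<Rightarrow> 'w::ab_group_add \<Rightarrow> 'w"
  assumes s: "vector_space s" and s': "vector_space s'"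
    and sub: "\<forall>V\<in>set Vs. module.subspace s V"
    and ml: "\<And>xs i. xs \<in> listset Vs \<Longrightarrow> i < length Vs \<Longrightarrow> linear_on s s' (Vs ! i) UNIV (\<lambda>x. f (xs[i := x]))"
  shows "\<exists>!g. g \<in> Hom tscale s' (tspace s Vs) UNIV \<and> (\<forall>xs \<in> listset Vs. g (tpure s xs) = f xs)"
proof -
  interpret a: vector_space s by fact
  interpret b: vector_space s' by fact
  interpret t: vector_space "tscale :: 'k \<Rightarrow> ('k,'v) tensor \<Rightarrow> _" by (rule vector_space_tscale)
  interpret P: vector_space "pair_scale (tscale :: 'k \<Rightarrow> ('k,'v) tensor \<Rightarrow> _) s'" by (intro vector_space_pair_scale t.vector_space_axioms s' vector_space_tscale)
  interpret aa: vector_space_pair s s ..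
  interpret kk: vector_space "(*) :: 'k \<Rightarrow> _" by standard (auto simp: algebra_simps)
  interpret bk: vector_space_pair s' "(*)" ..
  have "\<exists>p. range p \<subseteq> V \<and> Vector_Spaces.linear s s p \<and> (\<forall>v\<in>V. p v = v)" if "V \<in> set Vs" for V
    using aa.linear_exists_left_inverse_on[OF lin_id[OF s], of V] that sub by auto
  then obtain p where p: "\<And>V. V \<in> set Vs \<Longrightarrow> range (p V) \<subseteq> V \<and> Vector_Spaces.linear s s (p V) \<and> (\<forall>v\<in>V. p V v = v)"
    by metis
  define R where "R = P.span ((\<lambda>xs. (tpure s xs, f xs)) ` listset Vs)"
  define pr where "pr xs = map2 p Vs xs" for xs
  have prm: "pr xs \<in> listset Vs" if "length xs = length Vs" for xs
    using that p by (auto simp: listset_nth pr_def) (metis nth_mem range_subsetD)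
  have pri: "pr xs = xs" if "xs \<in> listset Vs" for xs
    using that p by (auto simp: listset_nth pr_def intro!: nth_equalityI)
  have pru: "pr (xs[i := x]) = (pr xs)[i := p (Vs!i) x]" if "length xs = length Vs" "i < length Vs" for xs i x
    using that by (auto simp: pr_def intro!: nth_equalityI simp: nth_list_update)
  have mlf: "multilinear_form s (length Vs) (\<lambda>xs. \<psi> (f (pr xs)))" if psi: "Vector_Spaces.linear s' (*) \<psi>" for \<psi>
    unfolding multilinear_form_def
  proof (intro allI impI)
    fix xs :: "'v list" and i assume l: "length xs = length Vs" and i: "i < length Vs"
    interpret psi: Vector_Spaces.linear s' "(*)" \<psi> by fact
    interpret pi: Vector_Spaces.linear s s "p (Vs ! i)" using p i by auto
    have pin: "p (Vs ! i) x \<in> Vs ! i" for x using p i by (metis nth_mem range_subsetD)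
    note L = ml[OF prm[OF l] i, unfolded linear_on_def]
    show "Vector_Spaces.linear s (*) (\<lambda>x. \<psi> (f (pr (xs[i := x]))))"
      by (intro Vector_Spaces.linear.intro module_hom.intro module_hom_axioms.intro a.vector_space_axioms kk.vector_space_axioms a.module_axioms kk.module_axioms) (simp_all add: pru l i pi.add pi.scale L pin psi.add psi.scale)
  qed
  have key: "fst z (\<lambda>xs. \<psi> (f (pr xs))) = \<psi> (snd z)" if psi: "Vector_Spaces.linear s' (*) \<psi>" and z: "z \<in> R" for \<psi> z
    using z[unfolded R_def]
  proof (induction rule: P.span_induct_alt)
    case base
    interpret psi: Vector_Spaces.linear s' "(*)" \<psi> by fact
    show ?case by simp
  next
    case (step c x y)
    interpret psi: Vector_Spaces.linear s' "(*)" \<psi> by fact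
    from step show ?case using mlf[OF psi]
      by (auto simp: pair_scale_def psi.add psi.scale tscale_def fun_scale_def tpure_def listset_length pri)
  qed
  have z0: "w = 0" if "(0, w) \<in> R" for w
  proof (rule ccontr)
    assume w: "w \<noteq> 0"
    then have "b.independent {w}" by simp
    from bk.linear_independent_extend[OF this, of "\<lambda>_. 1"] obtain \<psi> where "Vector_Spaces.linear s' (*) \<psi>" "\<psi> w = 1" by auto
    with key[OF this(1) that] show False by simp
  qed
  have fn: "w = w'" if "(t, w) \<in> R" "(t, w') \<in> R" for t w w'
    using z0[of "w - w'"] P.span_diff[OF that[unfolded R_def]] by (simp add: R_def)
  have ex: "\<exists>w. (t, w) \<in> R" if "t \<in> tspace s Vs" for t
    using that unfolding tspace_def
  proof (induction rule: t.span_induct_alt)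
    case base show ?case using P.span_zero unfolding R_def zero_prod_def by blast
  next
    case (step c x y)
    then obtain w xs where "(y, w) \<in> R" "x = tpure s xs" "xs \<in> listset Vs" by auto
    then have "pair_scale tscale s' c (x, f xs) + (y, w) \<in> R" unfolding R_def
      by (auto intro!: P.span_add[OF P.span_scale[OF P.span_base]])
    then show ?case unfolding pair_scale_def fst_conv snd_conv add_Pair by blast
  qed
  define g where "g t = (if t \<in> tspace s Vs then THE w. (t, w) \<in> R else 0)" for t
  have g: "(t, g t) \<in> R" if t: "t \<in> tspace s Vs" for t
  proof -
    obtain w where w: "(t,w) \<in> R" using ex[OF t] ..
    have "(THE w. (t, w) \<in> R) = w" using w fn by (intro the_equality) auto
    then show ?thesis using w t by (simp add: g_def)
  qed
  have gp: "g (tpure s xs) = f xs" if "xs \<in> listset Vs" for xs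
    by (intro fn[OF g]) (auto simp: tspace_def R_def that intro!: t.span_base P.span_base)
  have gl: "linear_on tscale s' (tspace s Vs) UNIV g"
    unfolding linear_on_def
  proof (intro conjI ballI allI)
    fix x y c assume x: "x \<in> tspace s Vs" and y: "y \<in> tspace s Vs"
    show "g (x + y) = g x + g y"
      using P.span_add[OF g[OF x, unfolded R_def] g[OF y, unfolded R_def]] x y
      by (intro fn[OF g]) (auto simp: tspace_def R_def t.span_add)
  next
    fix x c assume x: "x \<in> tspace s Vs" 
    show "g (tscale c x) = s' c (g x)"
      using P.span_scale[OF g[OF x, unfolded R_def], of c] x 
      by (intro fn[OF g]) (auto simp: tspace_def R_def t.span_scale pair_scale_def)
  qed auto
  show ?thesis
  proof (intro ex1I[of _ g] conjI)
    show "g \<in> Hom tscale s' (tspace s Vs) UNIV" using gl by (auto simp: Hom_def g_def)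
    show "\<forall>xs \<in> listset Vs. g (tpure s xs) = f xs" using gp by auto
    fix h assume h: "h \<in> Hom tscale s' (tspace s Vs) UNIV \<and> (\<forall>xs \<in> listset Vs. h (tpure s xs) = f xs)"
    have "h t = g t" if "t \<in> tspace s Vs" for t
    proof -
      have "t \<in> tspace s Vs \<and> h t = g t" using that unfolding tspace_def
      proof (induction rule: t.span_induct_alt)
        case base
        have "h (tscale 0 0) = s' 0 (h 0)" "g (tscale 0 0) = s' 0 (g 0)"
          using h gl t.span_zero by (auto simp: Hom_def linear_on_def tspace_def simp del: t.scale_zero_right t.scale_zero_left)
        then have "h 0 = g 0" by simp
        then show ?case using t.span_zero by blast
      next
        case (step c x y)
        have 1: "x \<in> tspace s Vs" "y \<in> tspace s Vs" "tscale c x \<in> tspace s Vs" using step by (auto simp: tspace_def intro: t.span_base t.span_scale)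
        have "h (tscale c x + y) = g (tscale c x + y)"
          using 1 step h gl gp by (auto simp: Hom_def linear_on_def)
        then show ?case using t.span_add[OF 1(3)[unfolded tspace_def] 1(2)[unfolded tspace_def]] by blast
      qed
      then show ?thesis ..
    qed
    then show "h = g" using h by (auto simp: Hom_def g_def fun_eq_iff)
  qed
qed

section \<open>The transition proofs are valid\<close>

definition well_typed :: "(string \<times> 'a formula) list \<Rightarrow> (string \<times> 'a formula) list \<Rightarrow> 'a tm \<Rightarrow> 'a formula \<Rightarrow> bool"
  where "well_typed \<Theta> \<Gamma> t A \<longleftrightarrow> valid (elab \<Theta> \<Gamma> t) \<and>
  hyps (elab \<Theta> \<Gamma> t) = map (OfCourse \<circ> snd) \<Theta> @ map snd \<Gamma> \<and> concl (elab \<Theta> \<Gamma> t) = A"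

lemma weaks: "hyps (foldr Weak As \<pi>) = map OfCourse As @ hyps \<pi>"
  "concl (foldr Weak As \<pi>) = concl \<pi>" "valid (foldr Weak As \<pi>) = valid \<pi>"
  by (induction As) auto

lemma well_typed_Var: "well_typed \<Theta> [(x, A)] (Var x) A"
  by (simp add: well_typed_def weaks)

lemma well_typed_UVar: assumes "distinct (map fst \<Theta>)" "(u, A) \<in> set \<Theta>" shows "well_typed \<Theta> [] (UVar u) A"
proof -
  define i where "i = length (takeWhile (\<lambda>p. fst p \<noteq> u) \<Theta>)"
  have i: "i < length \<Theta>" unfolding i_def using assms(2)
    by (induction \<Theta>) auto
  then have "fst (\<Theta> ! i) = u" unfolding i_def using nth_length_takeWhile by fastforce
  moreover obtain v where v: "\<Theta> ! i = (fst (\<Theta> ! i), v)" by (metis prod.collapse)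
  ultimately have "(u, v) \<in> set \<Theta>" using i by (metis nth_mem)
  then have "v = A" using assms by (simp add: eq_key_imp_eq_value)
  with v \<open>fst (\<Theta> ! i) = u\<close> have e: "\<Theta> ! i = (u, A)" by simp
  define js where "js = filter (\<lambda>j. j \<noteq> i) [0..<length \<Theta>]"
  have js: "distinct (js @ [i])" "set (js @ [i]) = {..<length \<Theta>}" using i by (auto simp: js_def)
  have el: "elab \<Theta> [] (UVar u) = Exch (map (OfCourse \<circ> snd) \<Theta>) (js @ [i])
         (foldr Weak (map (\<lambda>j. snd (\<Theta> ! j)) js) (Der (Ax A)))"
    by (simp add: Let_def i_def[symmetric] js_def e)
  have "map ((!) (map (OfCourse \<circ> snd) \<Theta>)) (js @ [i]) = map (\<lambda>j. OfCourse (snd (\<Theta> ! j))) js @ [OfCourse A]"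
    using i by (auto simp: js_def e)
  then show ?thesis using js unfolding well_typed_def el by (simp add: weaks o_def)
qed

lemma well_typed_LamB: "well_typed ((u, A) # \<Theta>) \<Gamma> t B \<Longrightarrow> well_typed \<Theta> \<Gamma> (LamB u A t) (OfCourse A \<multimap> B)"
  by (auto simp: well_typed_def)

lemma well_typed_Lam: "well_typed \<Theta> ((x, A) # \<Gamma>) t B \<Longrightarrow> well_typed \<Theta> \<Gamma> (Lam x A t) (A \<multimap> B)"
proof -
  have "map ((!) (A # xs @ ys)) ([1..<Suc (length xs)] @ [0] @ [Suc (length xs)..<Suc (length xs + length ys)]) = xs @ A # ys" for xs ys :: "'a formula list" and A
    by (rule nth_equalityI) (auto simp: nth_append nth_Cons' simp del: upt_Suc)
  from this[of A "map (OfCourse \<circ> snd) \<Theta>" "map snd \<Gamma>"]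
  show "well_typed \<Theta> ((x, A) # \<Gamma>) t B \<Longrightarrow> well_typed \<Theta> \<Gamma> (Lam x A t) (A \<multimap> B)" 
    by (auto simp: well_typed_def Let_def simp del: upt_Suc)
qed

lemma well_typed_Tup: "well_typed \<Theta> \<Gamma> t A \<Longrightarrow> well_typed \<Theta> \<Gamma> t' B \<Longrightarrow> well_typed \<Theta> \<Gamma> (Tup t t') (With A B)"
  by (auto simp: well_typed_def)
lemma well_typed_Fst: "well_typed \<Theta> \<Gamma> t (With A B) \<Longrightarrow> well_typed \<Theta> \<Gamma> (Fst t) A"
  by (auto simp: well_typed_def Let_def)
lemma well_typed_Snd: "well_typed \<Theta> \<Gamma> t (With A B) \<Longrightarrow> well_typed \<Theta> \<Gamma> (Snd t) B"
  by (auto simp: well_typed_def Let_def)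
lemma well_typed_Bang: "well_typed \<Theta> [] t A \<Longrightarrow> well_typed \<Theta> [] (Bang t) (OfCourse A)"
  by (auto simp: well_typed_def)

lemma contrs: assumes "hyps \<pi> = map OfCourse As @ concat (map (\<lambda>B. [OfCourse B, OfCourse B]) Bs) @ \<Gamma>" "valid \<pi>"
  shows "valid (fold Contr [length As..<length As + length Bs] \<pi>) \<and> concl (fold Contr [length As..<length As + length Bs] \<pi>) = concl \<pi> \<and>
   hyps (fold Contr [length As..<length As + length Bs] \<pi>) = map OfCourse (As @ Bs) @ \<Gamma>"
  using assms
proof (induction Bs arbitrary: As \<pi>)
  case (Cons B Bs)
  have "hyps (Contr (length As) \<pi>) = map OfCourse (As @ [B]) @ concat (map (\<lambda>B. [OfCourse B, OfCourse B]) Bs) @ \<Gamma>"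
    "valid (Contr (length As) \<pi>)" using Cons.prems by (auto simp: nth_append)
  from Cons.IH[OF this] show ?case by (simp add: upt_conv_Cons del: upt_Suc)
qed simp

lemma well_typed_App:
  assumes "well_typed \<Theta> (filter (\<lambda>p. fst p \<in> linear_vars t) \<Gamma>) t (A \<multimap> B)"
    "well_typed \<Theta> (filter (\<lambda>p. fst p \<notin> linear_vars t) \<Gamma>) t' A"
  shows "well_typed \<Theta> \<Gamma> (App t t') B"
proof -
  have f: "map ((!) \<Gamma>) (filter (\<lambda>j. P (fst (\<Gamma> ! j))) [0..<length \<Gamma>]) = filter (\<lambda>p. P (fst p)) \<Gamma>" for P
    using filter_map[of "\<lambda>p. P (fst p)" "(!) \<Gamma>" "[0..<length \<Gamma>]"] by (simp add: map_nth o_def)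
  define m where "m = length \<Theta>"
  define js where "js = filter (\<lambda>j. fst (\<Gamma> ! j) \<in> linear_vars t) [0..<length \<Gamma>]"
  define js' where "js' = filter (\<lambda>j. fst (\<Gamma> ! j) \<notin> linear_vars t) [0..<length \<Gamma>]"
  define G where "G = concat (map (\<lambda>p. [OfCourse (snd p), OfCourse (snd p)]) \<Theta>) @ map snd \<Gamma>"
  define k where "k = map (\<lambda>i. 2 * i) [0..<m] @ map ((+) (2 * m)) js @
            map (\<lambda>i. 2 * i + 1) [0..<m] @ map ((+) (2 * m)) js'"
  have js: "map ((!) \<Gamma>) js = filter (\<lambda>p. fst p \<in> linear_vars t) \<Gamma>" "map ((!) \<Gamma>) js' = filter (\<lambda>p. fst p \<notin> linear_vars t) \<Gamma>"
    unfolding js_def js'_def by (rule f)+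
  have jl: "\<forall>j\<in>set js \<union> set js'. j < length \<Gamma>" by (auto simp: js_def js'_def)
  have lc: "length (concat (map (\<lambda>p. [OfCourse (snd p), OfCourse (snd p)]) \<Theta>)) = 2 * m"
    unfolding m_def by (induction \<Theta>) auto
  have nc: "concat (map (\<lambda>p. [OfCourse (snd p), OfCourse (snd p)]) \<Theta>) ! (2 * i) = OfCourse (snd (\<Theta> ! i)) \<and>
     concat (map (\<lambda>p. [OfCourse (snd p), OfCourse (snd p)]) \<Theta>) ! (Suc (2 * i)) = OfCourse (snd (\<Theta> ! i))" if "i < m" for i
    using that unfolding m_def
  proof (induction \<Theta> arbitrary: i)
    case (Cons p \<Theta>) then show ?case by (cases i) auto
  qed simp
  have lG: "length G = 2 * m + length \<Gamma>" by (simp add: G_def lc)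
  have G1: "map (\<lambda>i. G ! (2 * i)) [0..<m] = map (OfCourse \<circ> snd) \<Theta>" "map (\<lambda>i. G ! Suc (2 * i)) [0..<m] = map (OfCourse \<circ> snd) \<Theta>"
    by (intro nth_equalityI; auto simp: G_def nth_append lc nc m_def[symmetric])+
  have G2: "map (\<lambda>j. G ! (2 * m + j)) is = map snd (map ((!) \<Gamma>) is)" if "\<forall>j\<in>set is. j < length \<Gamma>" for "is"
    using that by (auto simp: G_def nth_append lc)
  have mapk: "map ((!) G) k = map (OfCourse \<circ> snd) \<Theta> @ map snd (filter (\<lambda>p. fst p \<in> linear_vars t) \<Gamma>) @
     map (OfCourse \<circ> snd) \<Theta> @ map snd (filter (\<lambda>p. fst p \<notin> linear_vars t) \<Gamma>)"
    using jl by (simp add: k_def o_def G1[unfolded o_def] G2 js[symmetric])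
  have dk: "distinct k"
    by (auto simp: k_def distinct_map inj_on_def js_def js'_def; presburger)
  have sk: "set k = {..<length G}"
  proof
    show "set k \<subseteq> {..<length G}" using jl by (auto simp: k_def lG)
    show "{..<length G} \<subseteq> set k"
    proof
      fix x assume "x \<in> {..<length G}"
      then have x: "x < 2 * m + length \<Gamma>" by (simp add: lG)
      show "x \<in> set k"
      proof (cases "x < 2 * m")
        case True
        then show ?thesis by (cases "even x") (auto simp: k_def elim!: evenE oddE)
      next
        case False
        then have "x = 2 * m + (x - 2 * m)" "x - 2 * m < length \<Gamma>" using x by auto
        then show ?thesis by (force simp: k_def js_def js'_def)
      qed
    qed
  qed
  let ?p = "elab \<Theta> (map ((!) \<Gamma>) js) t" and ?q = "elab \<Theta> (map ((!) \<Gamma>) js') t'"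
  have ok: "valid ?p" "valid ?q" "concl ?p = (A \<multimap> B)" "concl ?q = A"
    "hyps ?p = map (OfCourse \<circ> snd) \<Theta> @ map snd (filter (\<lambda>p. fst p \<in> linear_vars t) \<Gamma>)"
    "hyps ?q = map (OfCourse \<circ> snd) \<Theta> @ map snd (filter (\<lambda>p. fst p \<notin> linear_vars t) \<Gamma>)"
    using assms by (auto simp: well_typed_def js)
  have v: "valid (Exch G k (Cut 0 ?p (LolliL ?q (Ax B))))"
    using dk sk by (simp add: ok mapk)
  have h: "hyps (Exch G k (Cut 0 ?p (LolliL ?q (Ax B)))) = map OfCourse [] @ concat (map (\<lambda>B. [OfCourse B, OfCourse B]) (map snd \<Theta>)) @ map snd \<Gamma>"
    by (simp add: G_def o_def)
  have "elab \<Theta> \<Gamma> (App t t') = fold Contr [0..<m] (Exch G k (Cut 0 ?p (LolliL ?q (Ax B))))"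
    by (simp only: elab.simps Let_def js_def[symmetric] js'_def[symmetric] m_def[symmetric] ok formula.case G_def k_def)
  then show ?thesis using contrs[OF h v] by (simp add: well_typed_def m_def)
qed

lemma well_typed_proj: "well_typed \<Theta> \<Gamma> t (pow A m) \<Longrightarrow> i < m \<Longrightarrow> well_typed \<Theta> \<Gamma> (proj m i t) A"
proof (induction m i t rule: proj.induct)
  case (1 m t)
  then show ?case by (cases m rule: pow.cases[of "(A,m)" for m, simplified]) (auto intro: well_typed_Fst)
next
  case (2 m i t)
  then obtain k where m: "m = Suc (Suc k)" by (metis Suc_less_eq2 less_natE not_less_eq old.nat.exhaust less_Suc_eq_0_disj)
  with 2 show ?case by (auto intro: well_typed_Snd)
qed

lemma well_typed_tuple: "ts \<noteq> [] \<Longrightarrow> \<forall>t\<in>set ts. well_typed \<Theta> \<Gamma> t A \<Longrightarrow> well_typed \<Theta> \<Gamma> (tuple ts) (pow A (length ts))"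
  by (induction ts rule: tuple.induct) (auto intro: well_typed_Tup)

lemma tuple_vars: "ts \<noteq> [] \<Longrightarrow> linear_vars (tuple ts) = (\<Union>t\<in>set ts. linear_vars t)"
  by (induction ts rule: tuple.induct) auto
lemma proj_vars: "linear_vars (proj m i t) = linear_vars t"
  by (induction m i t rule: proj.induct) auto

lemma well_typed_tuple': "length ts = n \<Longrightarrow> n \<ge> 1 \<Longrightarrow> (\<And>t. t\<in>set ts \<Longrightarrow> well_typed \<Theta> \<Gamma> t A) \<Longrightarrow> well_typed \<Theta> \<Gamma> (tuple ts) (pow A n)"
  using well_typed_tuple by (metis One_nat_def list.size(3) not_less_eq_eq zero_le)

lemma booltype_valid: assumes "n \<ge> 1"
  shows "valid (booltype n A) \<and> hyps (booltype n A) = [nbool n (pow A 3)] \<and> concl (booltype n A) = nbool n A"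
proof -
  have "well_typed [] [(''q'', nbool n (pow A 3))] (Lam ''x'' (pow A n)
         (proj 3 0 (App (Var ''q'') (tuple (map (\<lambda>i. tuple [proj n i (Var ''x''), proj n i (Var ''x''), proj n i (Var ''x'')]) [0..<n]))))) (nbool n A)"
    unfolding nbool_def
    apply (rule well_typed_Lam, rule well_typed_proj[where m=3], rule well_typed_App)
      apply (simp, rule well_typed_Var)
     apply simp
     apply (rule well_typed_tuple')
       apply simp
    using assms apply simp
     apply (clarsimp simp: numeral_eq_Suc simp del: proj.simps)
    by (auto intro!: well_typed_proj well_typed_Var well_typed_Tup)
  then show ?thesis unfolding booltype_def well_typed_def Let_def by (simp only: list.map append_Nil snd_conv simp_thms)
qed

lemma trans_valid: assumes "n \<ge> 1" "is_transition n \<delta>" "i \<le> 2"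
  shows "valid (trans_proof i n \<delta> A) \<and> hyps (trans_proof i n \<delta> A) = [nbool 2 A, nbool n A] \<and> concl (trans_proof i n \<delta> A) = nbool (if i = 1 then n else 2) A"
proof -
  define m where "m = (if i = 1 then n else 2)"
  have d: "delta_comp \<delta> i (s, j) < m" if "s \<in> {0,1}" "j < n" for s j
  proof -
    have "\<delta> (s, j) \<in> {0, 1} \<times> {..<n} \<times> {0, 1}" using assms that unfolding is_transition_def by auto
    then show ?thesis by (auto simp: delta_comp_def m_def split: prod.splits)
  qed
  define row :: "nat \<Rightarrow> 'a tm" where "row s = App (Var ''q'') (tuple (map (\<lambda>j. proj m (delta_comp \<delta> i (s, j)) (Var ''x'')) [0..<n]))" for s
  have row: "well_typed [] [(''x'', pow A m), (''q'', nbool n A)] (row s) A" if "s \<in> {0,1}" for s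
    unfolding row_def nbool_def
    apply (rule well_typed_App)
      apply (simp, rule well_typed_Var)
     apply simp
     apply (rule well_typed_tuple')
       apply simp
    using assms apply simp
    using that by (auto intro!: well_typed_proj well_typed_Var d)
  have "well_typed [] [(''b'', nbool 2 A), (''q'', nbool n A)]
       (Lam ''x'' (pow A m) (App (Var ''b'') (tuple [row 0, row 1]))) (nbool m A)"
    unfolding nbool_def[of m]
    apply (rule well_typed_Lam, rule well_typed_App)
      apply (simp add: nbool_def, rule well_typed_Var)
     apply simp
     by (auto intro!: well_typed_Tup row simp: numeral_eq_Suc)
  from this[unfolded well_typed_def list.map append_Nil snd_conv]
  show ?thesis unfolding trans_proof_def Let_def m_def row_def .
qed

lemma head_valid: "valid (head A) \<and> hyps (head A) = [bint (pow A 3)] \<and> concl (head A) = nbool 2 A"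
proof -
  let ?p = "\<lambda>i. Lam ''t'' (pow A 3) (tuple [proj 3 0 (Var ''t''), proj 3 1 (Var ''t''), proj 3 i (Var ''t'')])"
  let ?x = "\<lambda>i. proj 2 i (Var ''x'')"
  have p: "well_typed [] [] (?p i) (pow A 3 \<multimap> pow A 3)" if "i < 3" for i
    using that by (intro well_typed_Lam well_typed_tuple'; clarsimp simp del: elab.simps proj.simps) (elim disjE; simp del: elab.simps proj.simps; intro well_typed_proj[where m=3] well_typed_Var; simp)
  have "well_typed [] [(''b'', bint (pow A 3))]
       (Lam ''x'' (pow A 2)
         (proj 3 2 (App (App (App (Var ''b'') (Bang (?p 0))) (Bang (?p 1))) (tuple [?x 0, ?x 1, ?x 0])))) (nbool 2 A)"
    unfolding nbool_def
    apply (rule well_typed_Lam, rule well_typed_proj[where m=3])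
     apply (rule well_typed_App[where A = "pow A 3"])
      apply (simp add: tuple_vars proj_vars del: elab.simps tuple.simps proj.simps)
      apply (rule well_typed_App[where A = "OfCourse (pow A 3 \<multimap> pow A 3)"])
       apply (simp add: tuple_vars proj_vars del: elab.simps tuple.simps proj.simps)
       apply (rule well_typed_App[where A = "OfCourse (pow A 3 \<multimap> pow A 3)"])
        apply (simp add: tuple_vars proj_vars bint_def del: elab.simps tuple.simps proj.simps)
        apply (rule well_typed_Var)
       apply (simp add: tuple_vars proj_vars del: elab.simps tuple.simps proj.simps)
       apply (rule well_typed_Bang, rule p[of 0, simplified One_nat_def], simp)
      apply (simp add: tuple_vars proj_vars del: elab.simps tuple.simps proj.simps)
      apply (rule well_typed_Bang, rule p[of 1, simplified One_nat_def], simp)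
     apply (simp add: tuple_vars proj_vars del: elab.simps tuple.simps proj.simps)
     apply (rule well_typed_tuple')
       apply simp
    by (auto intro!: well_typed_proj well_typed_Var simp del: elab.simps proj.simps)
  then show ?thesis unfolding head_def well_typed_def Let_def by (simp only: list.map append_Nil snd_conv simp_thms)
qed

lemma tail_valid: "valid (tail A) \<and> hyps (tail A) = [bint (pow A 3)] \<and> concl (tail A) = bint A"
proof -
  let ?T = "[(''v'', A \<multimap> A), (''u'', A \<multimap> A)]"
  let ?R = "\<lambda>v. Lam ''t'' (pow A 3)
                (tuple [proj 3 2 (Var ''t''), proj 3 2 (Var ''t''), App (UVar v) (proj 3 2 (Var ''t''))])"
  have R: "well_typed ?T [] (?R v) (pow A 3 \<multimap> pow A 3)" if "v = ''u'' \<or> v = ''v''" for v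
    apply (rule well_typed_Lam, rule well_typed_tuple')
      apply simp
     apply simp
    using that
    by (auto intro!: well_typed_proj well_typed_Var well_typed_UVar well_typed_App simp del: elab.simps proj.simps)
  have "well_typed [] [(''b'', bint (pow A 3))]
       (LamB ''u'' (A \<multimap> A) (LamB ''v'' (A \<multimap> A) (Lam ''a'' A
         (proj 3 0 (App (App (App (Var ''b'') (Bang (?R ''u''))) (Bang (?R ''v'')))
           (tuple [Var ''a'', Var ''a'', Var ''a''])))))) (bint A)"
    unfolding bint_def[of A]
    apply (rule well_typed_LamB, rule well_typed_LamB, rule well_typed_Lam, rule well_typed_proj[where m=3])
     apply (rule well_typed_App[where A = "pow A 3"])
      apply (simp add: tuple_vars proj_vars del: elab.simps tuple.simps proj.simps)
      apply (rule well_typed_App[where A = "OfCourse (pow A 3 \<multimap> pow A 3)"])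
       apply (simp add: tuple_vars proj_vars del: elab.simps tuple.simps proj.simps)
       apply (rule well_typed_App[where A = "OfCourse (pow A 3 \<multimap> pow A 3)"])
        apply (simp add: tuple_vars proj_vars bint_def del: elab.simps tuple.simps proj.simps)
        apply (rule well_typed_Var)
       apply (simp add: tuple_vars proj_vars del: elab.simps tuple.simps proj.simps)
       apply (rule well_typed_Bang, rule R, simp)
      apply (simp add: tuple_vars proj_vars del: elab.simps tuple.simps proj.simps)
      apply (rule well_typed_Bang, rule R, simp)
     apply (simp add: tuple_vars proj_vars del: elab.simps tuple.simps proj.simps)
     apply (rule well_typed_tuple')
       apply simp
    by (auto intro!: well_typed_proj well_typed_Var simp del: elab.simps proj.simps)
  then show ?thesis unfolding tail_def well_typed_def Let_def by (simp only: list.map append_Nil snd_conv simp_thms)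
qed

lemma well_typed_after: assumes "set w \<subseteq> {0,1}"
  shows "well_typed [(''u1'', A \<multimap> A), (''u0'', A \<multimap> A)] [(''a'', A), (''S'', bint A)] (after w) A"
  unfolding after_def apply_word_def 
proof (induction w rule: rev_induct)
  case Nil
  show ?case
    apply (simp del: elab.simps)
    apply (rule well_typed_App[where A = A])
     apply (simp add: word_var_def del: elab.simps)
     apply (rule well_typed_App[where A = "OfCourse (A \<multimap> A)"])
      apply (simp del: elab.simps)
      apply (rule well_typed_App[where A = "OfCourse (A \<multimap> A)"])
       apply (simp add: bint_def word_var_def del: elab.simps)
       apply (rule well_typed_Var)
    by (auto simp: word_var_def simp del: elab.simps intro!: well_typed_Bang well_typed_UVar well_typed_Var)
next
  case (snoc s w)
  show ?case
    apply (simp del: elab.simps)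
    apply (rule well_typed_App[where A = A])
    using snoc by (auto simp: word_var_def simp del: elab.simps intro!: well_typed_UVar)
qed
lemma after_vars: "linear_vars (after w) = {''S'', ''a''}"
  unfolding after_def apply_word_def 
  by (induction w rule: rev_induct) (auto simp: word_var_def)

lemma well_typed_choice: "\<Union>(set ` {w,w',v,v'}) \<subseteq> {0,1} \<Longrightarrow> 
  well_typed [(''u1'', A \<multimap> A), (''u0'', A \<multimap> A)] [(''a'', A), (''S'', bint A), (''tau'', nbool 2 A), (''sigma'', nbool 2 A)] (choice w w' v v') A"
  unfolding choice_def
  apply (rule well_typed_App[where A = "pow A 2"])
   apply (simp add: nbool_def del: elab.simps)
   apply (rule well_typed_Var)
  apply (simp add: numeral_eq_Suc del: elab.simps)
  apply (rule well_typed_Tup)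
   apply (rule well_typed_App[where A = "pow A 2"])
    apply (simp add: nbool_def numeral_eq_Suc del: elab.simps)
    apply (rule well_typed_Var)
   apply (simp add: numeral_eq_Suc del: elab.simps)
   apply (rule well_typed_Tup; rule well_typed_after; simp)
  apply (rule well_typed_App[where A = "pow A 2"])
   apply (simp add: nbool_def numeral_eq_Suc del: elab.simps)
   apply (rule well_typed_Var)
  apply (simp add: numeral_eq_Suc del: elab.simps)
  apply (rule well_typed_Tup; rule well_typed_after; simp)
  done

lemma recomb_valid: assumes "well_typed [(''u1'', A \<multimap> A), (''u0'', A \<multimap> A)] [(''a'', A), (''S'', bint A), (''tau'', nbool 2 A), (''sigma'', nbool 2 A)] P A" 
   "well_typed [(''u1'', A \<multimap> A), (''u0'', A \<multimap> A)] [(''a'', A), (''S'', bint A), (''tau'', nbool 2 A), (''sigma'', nbool 2 A)] P' A" 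
 shows "valid (recomb_frame A P P') \<and> hyps (recomb_frame A P P') = [bint A, nbool 2 A, nbool 2 A, nbool 2 A] \<and> concl (recomb_frame A P P') = bint A"
proof -
  have "well_typed [] [(''S'', bint A), (''tau'', nbool 2 A), (''sigma'', nbool 2 A), (''d'', nbool 2 A)]
      (LamB ''u0'' (A \<multimap> A) (LamB ''u1'' (A \<multimap> A) (Lam ''a'' A (App (Var ''d'') (Tup P P'))))) (bint A)"
    unfolding bint_def[of A]
    apply (rule well_typed_LamB well_typed_Lam)+
    apply (rule well_typed_App[where A = "pow A 2"])
     apply (simp add: nbool_def del: elab.simps)
     apply (rule well_typed_Var)
    using assms by (auto simp: numeral_eq_Suc bint_def nbool_def simp del: elab.simps intro!: well_typed_Tup)
  then show ?thesis unfolding well_typed_def recomb_frame_def by (simp only: list.map append_Nil snd_conv simp_thms)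
qed

lemma cut_step: "proves \<pi> G A \<Longrightarrow> proves \<rho> (L @ A # R) C \<Longrightarrow> i = length L \<Longrightarrow> proves (Cut i \<pi> \<rho>) (L @ G @ R) C"
  by (auto simp: proves_def)

lemma exch_step: "proves \<pi> G A \<Longrightarrow> distinct js \<Longrightarrow> set js = {..<length G'} \<Longrightarrow> map ((!) G') js = G \<Longrightarrow> proves (Exch G' js \<pi>) G' A"
  by (auto simp: proves_def)

lemma step_valid: assumes "n \<ge> 1" "is_transition n \<delta>" "i \<le> 2"
  shows "proves (step_proof i n \<delta> A) [bint (pow A 3), nbool n (pow A 3)] (nbool (if i = 1 then n else 2) A)"
proof -
  have t: "proves (trans_proof i n \<delta> A) ([nbool 2 A] @ nbool n A # []) (nbool (if i = 1 then n else 2) A)"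
    using trans_valid[OF assms, of A] unfolding proves_def append.simps .
  have b: "proves (booltype n A) [nbool n (pow A 3)] (nbool n A)" using booltype_valid[OF assms(1)] unfolding proves_def .
  have h: "proves (head A) [bint (pow A 3)] (nbool 2 A)" using head_valid unfolding proves_def .
  have 1: "proves (Cut 1 (booltype n A) (trans_proof i n \<delta> A)) ([nbool 2 A] @ [nbool n (pow A 3)] @ []) (nbool (if i = 1 then n else 2) A)"
    by (rule cut_step[OF b t]) (simp only: list.size One_nat_def add_Suc_right add_0_right plus_nat.add_0)
  then have 2: "proves (Cut 1 (booltype n A) (trans_proof i n \<delta> A)) ([] @ nbool 2 A # [nbool n (pow A 3)]) (nbool (if i = 1 then n else 2) A)"
    by (simp only: append.simps)
  have "proves (step_proof i n \<delta> A) ([] @ [bint (pow A 3)] @ [nbool n (pow A 3)]) (nbool (if i = 1 then n else 2) A)"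
    unfolding step_proof_def by (rule cut_step[OF h 2]) (simp only: list.size)
  then show ?thesis by (simp only: append.simps)
qed

lemma chain:
  assumes p: "proves p [B] C1" "proves p' [B] C2" "proves q [B, Q] C3" "proves q' [B, Q] C4" "proves r [C1, C2, C3, C4] C"
   and js: "distinct js" "set js = {..<6}" "map ((!) [B, B, B, B, Q, Q]) js = [B, B, B, Q, B, Q]"
 shows "proves (Exch [B, B, B, B, Q, Q] js (Cut 0 p (Cut 1 p' (Cut 2 q (Cut 3 q' r))))) [B, B, B, B, Q, Q] C"
proof -
  have 1: "proves (Cut 3 q' r) ([C1,C2,C3] @ [B,Q] @ []) C" by (rule cut_step[OF p(4)]) (use p(5) in simp_all)
  have 2: "proves (Cut 2 q (Cut 3 q' r)) ([C1,C2] @ [B,Q] @ [B,Q]) C" by (rule cut_step[OF p(3)]) (use 1 in simp_all)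
  have 3: "proves (Cut 1 p' (Cut 2 q (Cut 3 q' r))) ([C1] @ [B] @ [B,Q,B,Q]) C" by (rule cut_step[OF p(2)]) (use 2 in simp_all)
  have 4: "proves (Cut 0 p (Cut 1 p' (Cut 2 q (Cut 3 q' r)))) ([] @ [B] @ [B,B,Q,B,Q]) C" by (rule cut_step[OF p(1)]) (use 3 in simp_all)
  show ?thesis by (rule exch_step[OF 4 js(1)]) (use js in simp_all)
qed

theorem transition_proofs_valid: assumes "n \<ge> 1" "is_transition n \<delta>"
  shows "proves (left_proof n \<delta> A) (replicate 4 (bint (pow A 3)) @ replicate 2 (nbool n (pow A 3))) (bint A)"
   "proves (right_proof n \<delta> A) (replicate 4 (bint (pow A 3)) @ replicate 2 (nbool n (pow A 3))) (bint A)"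
   "proves (state_proof n \<delta> A) [bint (pow A 3), nbool n (pow A 3)] (nbool n A)"
proof -
  have s: "set [0, 3, 1, 4, 2, 5] = {..<6::nat}" "set [3, 2, 0, 4, 1, 5] = {..<6::nat}" by auto
  have d: "distinct [0, 3, 1, 4, 2, 5::nat]" "distinct [3, 2, 0, 4, 1, 5::nat]" by auto
  have m: "map ((!) [B, B, B, B, Q, Q]) [0, 3, 1, 4, 2, 5] = [B, B, B, Q, B, Q]"
    "map ((!) [B, B, B, B, Q, Q]) [3, 2, 0, 4, 1, 5] = [B, B, B, Q, B, Q]" for B Q :: "'a formula" by (simp_all add: numeral_eq_Suc)
  have st: "proves (step_proof 0 n \<delta> A) [bint (pow A 3), nbool n (pow A 3)] (nbool 2 A)"
    "proves (step_proof 2 n \<delta> A) [bint (pow A 3), nbool n (pow A 3)] (nbool 2 A)"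
    using step_valid[OF assms, of 0 A] step_valid[OF assms, of 2 A] by simp_all
  have ht: "proves (head A) [bint (pow A 3)] (nbool 2 A)" "proves (tail A) [bint (pow A 3)] (bint A)"
    unfolding proves_def by (rule head_valid, rule tail_valid)
  have c: "well_typed [(''u1'', A \<multimap> A), (''u0'', A \<multimap> A)] [(''a'', A), (''S'', bint A), (''tau'', nbool 2 A), (''sigma'', nbool 2 A)] (choice w w' v v') A"
    if "\<Union>(set ` {w,w',v,v'}) \<subseteq> {0,1}" for w w' v v' by (rule well_typed_choice[OF that])
  have r: "proves (recomb0 A) [bint A, nbool 2 A, nbool 2 A, nbool 2 A] (bint A)" "proves (recomb1 A) [bint A, nbool 2 A, nbool 2 A, nbool 2 A] (bint A)"
    unfolding proves_def recomb0_def recomb1_def by (rule recomb_valid; rule c; simp)+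
  have rep: "replicate 4 B @ replicate 2 Q = [B,B,B,B,Q,Q]" for B Q :: "'a formula" by (simp add: numeral_eq_Suc)
  show "proves (left_proof n \<delta> A) (replicate 4 (bint (pow A 3)) @ replicate 2 (nbool n (pow A 3))) (bint A)"
    unfolding left_proof_def Let_def rep by (rule chain[OF ht(2,1) st r(1) d(1) s(1) m(1)])
  show "proves (right_proof n \<delta> A) (replicate 4 (bint (pow A 3)) @ replicate 2 (nbool n (pow A 3))) (bint A)"
    unfolding right_proof_def Let_def rep by (rule chain[OF ht(2,1) st r(2) d(2) s(2) m(2)])
  show "proves (state_proof n \<delta> A) [bint (pow A 3), nbool n (pow A 3)] (nbool n A)"
    using step_valid[OF assms, of 1 A] by (simp add: state_proof_def)
qed

lemma nbool_val_valid: assumes "i < n" shows "proves (nbool_val n A i) [] (nbool n A)"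
proof -
  have "well_typed [] [] (Lam ''x'' (pow A n) (proj n i (Var ''x''))) (nbool n A)"
    unfolding nbool_def by (intro well_typed_Lam well_typed_proj well_typed_Var assms)
  then show ?thesis unfolding proves_def nbool_val_def well_typed_def by (simp only: list.map append_Nil simp_thms)
qed

lemma bint_val_valid: "proves (bint_val A w) [] (bint A)"
proof -
  have "well_typed [(''u1'', A \<multimap> A), (''u0'', A \<multimap> A)] [(''a'', A)] (apply_word w (Var ''a'')) A"
    unfolding apply_word_def
  proof (induction w rule: rev_induct)
    case Nil
    show ?case by (simp only: fold_simps id_apply) (rule well_typed_Var)
  next
    case (snoc s w)
    show ?case
      apply (simp del: elab.simps)
      apply (rule well_typed_App[where A = A])
      using snoc by (auto simp: word_var_def simp del: elab.simps intro!: well_typed_UVar)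
  qed
  then have "well_typed [] [] (LamB ''u0'' (A \<multimap> A) (LamB ''u1'' (A \<multimap> A) (Lam ''a'' A (apply_word w (Var ''a''))))) (bint A)"
    unfolding bint_def by (intro well_typed_LamB well_typed_Lam)
  then show ?thesis unfolding proves_def bint_val_def well_typed_def by (simp only: list.map append_Nil simp_thms)
qed

end

theory Submission
  imports Defs
begin

text \<open>
  A word \<open>s\<^sub>1 \<dots> s\<^sub>l\<close> denotes a convolution product over the coalgebra \<open>!E \<otimes> !E\<close>: its value on
  \<open>x \<in> !E \<otimes> !E\<close> composes the derelictions of the factors of the iterated coproduct of \<open>x\<close>. Arguments of
  the form \<open>!P\<close>, \<open>!Q\<close> are promotions, that is, coalgebra morphisms \<open>C \<rightarrow> !E\<close>; by cocommutativity their
  pairing \<open>C \<rightarrow> !E \<otimes> !E\<close> is one too, and so pulls the convolution product back to the product over \<open>C\<close>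
  of the denotations of \<open>P\<close> and \<open>Q\<close>. This computes \<open>head\<close>, where \<open>C = k\<close> and the third coordinate
  records the last symbol read, \<open>tail\<close>, where the first coordinate lags one symbol behind the third, and
  the words \<open>[S; w]\<close>, where it is concatenation. None of it needs a description of the cofree coalgebra:
  the universal property makes promotions well defined, once tensor products of cocommutative
  coalgebras are known to be cocommutative coalgebras. The formulas then follow by multilinearity.
\<close>

text \<open>Equality in the space of \<open>bint A\<close> has to be tested on arbitrary elements of
  \<open>!E\<close>, not only on group-like ones, and in \<open>tail\<close> and
  \<open>[S; w]\<close> the promotions stand under the binders of the very variables that they
  contain. Such a promotion is a map on all of \<open>!E\<close> \<otimes> \<open>!E\<close>, so its
  effect cannot be computed by substituting an operator for a letter; what can be computed is how
  its coproduct splits. This forces the Sweedler calculus: every application contracts all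
  unrestricted variables, hence denotes a sum over a coproduct, and a part that ignores these
  variables contributes a counit that the sum absorbs. A second obstacle is that
  \<open>tlift\<close> and \<open>promote\<close> are definite descriptions. Each rule has to be
  shown multilinear before its value on pure tensors may be used, and terms carry their linearity
  along with their values. The products of sums in the formulas reflect that each copy of \<alpha>,
  \<beta>, \<gamma> is expanded independently: the direction is computed from other copies than the
  new symbol, so the two expansions are not correlated.\<close>

section \<open>Multilinear maps\<close>

text \<open>As simplification rules, the following eta-expand sums of tensors, which are functions.\<close>

declare plus_fun_apply [simp del] zero_fun_apply [simp del]

lemma subspace_zero: "vector_space s \<Longrightarrow> module.subspace s V \<Longrightarrow> 0 \<in> V"
  and subspace_plus: "vector_space s \<Longrightarrow> module.subspace s V \<Longrightarrow> x \<in> V \<Longrightarrow> y \<in> V \<Longrightarrow> x + y \<in> V"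
  and subspace_smult: "vector_space s \<Longrightarrow> module.subspace s V \<Longrightarrow> x \<in> V \<Longrightarrow> s c x \<in> V"
  and subspace_whole: "vector_space s \<Longrightarrow> module.subspace s UNIV"
proof -
  assume "vector_space s"
  then interpret vector_space s .
  show "subspace V \<Longrightarrow> 0 \<in> V" "subspace V \<Longrightarrow> x \<in> V \<Longrightarrow> y \<in> V \<Longrightarrow> x + y \<in> V"
    "subspace V \<Longrightarrow> x \<in> V \<Longrightarrow> s c x \<in> V" "subspace UNIV"
    by (simp_all add: subspace_0 subspace_add subspace_scale)
qed

lemma subspace_sum_list:
  "vector_space s \<Longrightarrow> module.subspace s V \<Longrightarrow> (\<And>p. p \<in> set ps \<Longrightarrow> f p \<in> V) \<Longrightarrow> (\<Sum>p\<leftarrow>ps. f p) \<in> V"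
  by (induction ps) (auto intro: subspace_zero subspace_plus)

lemma vector_space_add_right: "vector_space s \<Longrightarrow> s c (x + y) = s c x + s c y"
  and vector_space_add_left: "vector_space s \<Longrightarrow> s (c + d) x = s c x + s d x"
  and vector_space_scale: "vector_space s \<Longrightarrow> s c (s d x) = s (c * d) x"
  and vector_space_one: "vector_space s \<Longrightarrow> s 1 x = x"
  by (simp_all add: vector_space_def)

lemma vector_space_zero_right: "vector_space s \<Longrightarrow> s c 0 = 0"
  using vector_space_add_right[of s c 0 0] by simp

lemma vector_space_mult: "vector_space ((*) :: 'k::field \<Rightarrow> 'k \<Rightarrow> 'k)"
  by standard (auto simp: algebra_simps)

lemma linear_on_in: "linear_on s s' V W f \<Longrightarrow> x \<in> V \<Longrightarrow> f x \<in> W"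
  and linear_on_add: "linear_on s s' V W f \<Longrightarrow> x \<in> V \<Longrightarrow> y \<in> V \<Longrightarrow> f (x + y) = f x + f y"
  and linear_on_scale: "linear_on s s' V W f \<Longrightarrow> x \<in> V \<Longrightarrow> f (s c x) = s' c (f x)"
  by (auto simp: linear_on_def)

lemma linear_onI:
  assumes "\<And>x. x \<in> V \<Longrightarrow> f x \<in> W" "\<And>x y. x \<in> V \<Longrightarrow> y \<in> V \<Longrightarrow> f (x + y) = f x + f y"
    "\<And>c x. x \<in> V \<Longrightarrow> f (s c x) = s' c (f x)"
  shows "linear_on s s' V W f"
  using assms by (simp add: linear_on_def)

lemma linear_on_mono: "linear_on s s' V W f \<Longrightarrow> (\<And>x. x \<in> V \<Longrightarrow> f x \<in> W') \<Longrightarrow> linear_on s s' V W' f"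
  by (auto simp: linear_on_def)

lemma linear_on_zero: "linear_on s s' V W f \<Longrightarrow> 0 \<in> V \<Longrightarrow> f 0 = 0"
  using linear_on_add[of s s' V W f 0 0] by simp

lemma linear_on_cong:
  assumes "vector_space s" "module.subspace s V" "\<And>x. x \<in> V \<Longrightarrow> f x = g x" "linear_on s s' V W f"
  shows "linear_on s s' V W g"
  using assms(4) by (auto simp: linear_on_def assms(3)[symmetric] subspace_plus[OF assms(1,2)] subspace_smult[OF assms(1,2)])

lemma linear_on_id: "linear_on s s V V (\<lambda>x. x)"
  by (simp add: linear_on_def)

lemma linear_on_compose:
  "linear_on s s' V W f \<Longrightarrow> linear_on s' s'' W U g \<Longrightarrow> linear_on s s'' V U (\<lambda>x. g (f x))"
  by (simp add: linear_on_def)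

lemma linear_on_apply_sum_list:
  assumes "vector_space s" "module.subspace s V" "linear_on s s' V W f" "\<And>p. p \<in> set ps \<Longrightarrow> h p \<in> V"
  shows "f (\<Sum>p\<leftarrow>ps. h p) = (\<Sum>p\<leftarrow>ps. f (h p))"
  using assms(4)
proof (induction ps)
  case Nil
  then show ?case using linear_on_zero[OF assms(3) subspace_zero[OF assms(1,2)]] by simp
next
  case (Cons p ps)
  then show ?case using linear_on_add[OF assms(3), of "h p" "\<Sum>p\<leftarrow>ps. h p"]
    by (simp add: subspace_sum_list[OF assms(1,2)])
qed

lemma linear_on_sum_list:
  assumes "vector_space s'" "module.subspace s' W" "\<And>p. p \<in> set ps \<Longrightarrow> linear_on s s' V W (h p)"
  shows "linear_on s s' V W (\<lambda>x. \<Sum>p\<leftarrow>ps. h p x)"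
  using assms(3)
proof (induction ps)
  case Nil
  then show ?case
    by (auto intro!: linear_onI simp: subspace_zero[OF assms(1,2)] vector_space_zero_right[OF assms(1)])
next
  case (Cons p ps)
  have "linear_on s s' V W (h p)" "linear_on s s' V W (\<lambda>x. \<Sum>p\<leftarrow>ps. h p x)"
    using Cons by auto
  then show ?case
    by (auto simp: linear_on_def subspace_plus[OF assms(1,2)] vector_space_add_right[OF assms(1)])
qed

lemma linear_on_scale_left:
  assumes "vector_space s'" "module.subspace s' W" "linear_on s (*) V UNIV e" "w \<in> W"
  shows "linear_on s s' V W (\<lambda>x. s' (e x) w)"
  using assms(3,4)
  by (auto simp: linear_on_def subspace_smult[OF assms(1,2)] vector_space_add_left[OF assms(1)]
      vector_space_scale[OF assms(1)])

lemma linear_on_scale_right: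
  assumes "vector_space s'" "module.subspace s' W" "linear_on s s' V W f"
  shows "linear_on s s' V W (\<lambda>x. s' c (f x))"
  using assms(3)
  by (auto simp: linear_on_def subspace_smult[OF assms(1,2)] vector_space_add_right[OF assms(1)]
      vector_space_scale[OF assms(1)] mult.commute)

text \<open>Recursion on the list of spaces makes blocks of arguments easy to split off, which is
  how the sequent rules act on hypotheses. The slotwise form by list update, in which
  \<open>tlift_unique_existence\<close> is stated, is recovered by
  \<open>multilinear_on_update\<close> and \<open>multilinear_onI\<close>.\<close>

primrec multilinear_on ::
  "('k::field \<Rightarrow> 'v::ab_group_add \<Rightarrow> 'v) \<Rightarrow> ('k \<Rightarrow> 'w::ab_group_add \<Rightarrow> 'w) \<Rightarrow>
   'v set list \<Rightarrow> 'w set \<Rightarrow> ('v list \<Rightarrow> 'w) \<Rightarrow> bool"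
  where
    "multilinear_on s s' [] W f \<longleftrightarrow> f [] \<in> W"
  | "multilinear_on s s' (V # Vs) W f \<longleftrightarrow>
      (\<forall>xs\<in>listset Vs. linear_on s s' V W (\<lambda>x. f (x # xs))) \<and>
      (\<forall>x\<in>V. multilinear_on s s' Vs W (\<lambda>xs. f (x # xs)))"

lemma listset_Cons: "x # xs \<in> listset (V # Vs) \<longleftrightarrow> x \<in> V \<and> xs \<in> listset Vs"
  by (auto simp: set_Cons_def)

lemma listset_ConsE:
  assumes "xs \<in> listset (V # Vs)"
  obtains y ys where "xs = y # ys" "y \<in> V" "ys \<in> listset Vs"
  using assms by (auto simp: set_Cons_def)

lemma listset_append: "us \<in> listset Us \<Longrightarrow> vs \<in> listset Vs \<Longrightarrow> us @ vs \<in> listset (Us @ Vs)"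
  by (induction Us arbitrary: us) (auto simp: set_Cons_def)

lemma listset_appendE:
  assumes "xs \<in> listset (Us @ Vs)"
  obtains us vs where "xs = us @ vs" "us \<in> listset Us" "vs \<in> listset Vs"
proof -
  have "\<exists>us vs. xs = us @ vs \<and> us \<in> listset Us \<and> vs \<in> listset Vs"
    using assms
  proof (induction Us arbitrary: xs)
    case (Cons U Us)
    from Cons.prems obtain y ys where "xs = y # ys" "y \<in> U" "ys \<in> listset (Us @ Vs)"
      by (auto simp: set_Cons_def)
    with Cons.IH[of ys] show ?case by (metis append_Cons listset_Cons)
  qed simp
  then show ?thesis using that by blast
qed

lemma multilinear_on_in:
  "multilinear_on s s' Vs W f \<Longrightarrow> xs \<in> listset Vs \<Longrightarrow> f xs \<in> W"
proof (induction Vs arbitrary: f xs)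
  case (Cons V Vs)
  from Cons.prems(2) obtain y ys where "xs = y # ys" "y \<in> V" "ys \<in> listset Vs" by (rule listset_ConsE)
  with Cons.prems(1) Cons.IH[of "\<lambda>xs. f (y # xs)" ys] show ?case by simp
qed simp

lemma multilinear_on_update:
  "multilinear_on s s' Vs W f \<Longrightarrow> xs \<in> listset Vs \<Longrightarrow> i < length Vs \<Longrightarrow>
    linear_on s s' (Vs ! i) W (\<lambda>x. f (xs[i := x]))"
proof (induction Vs arbitrary: f xs i)
  case (Cons V Vs)
  from Cons.prems(2) obtain y ys where "xs = y # ys" "y \<in> V" "ys \<in> listset Vs" by (rule listset_ConsE)
  with Cons.prems(1,3) Cons.IH[of "\<lambda>xs. f (y # xs)" ys] show ?case by (cases i) auto
qed simp

lemma multilinear_onI: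
  assumes "vector_space s" "\<forall>V\<in>set Vs. module.subspace s V"
    and "\<And>xs. xs \<in> listset Vs \<Longrightarrow> f xs \<in> W"
    and "\<And>xs i. xs \<in> listset Vs \<Longrightarrow> i < length Vs \<Longrightarrow> linear_on s s' (Vs ! i) W (\<lambda>x. f (xs[i := x]))"
  shows "multilinear_on s s' Vs W f"
  using assms(2-)
proof (induction Vs arbitrary: f)
  case (Cons V Vs)
  \<comment> \<open>The entry 0 only completes the list; the update at position 0 overwrites
    it.\<close>
  have "0 \<in> V" using Cons.prems(1) by (auto intro: subspace_zero[OF assms(1)])
  then have "linear_on s s' V W (\<lambda>x. f (x # xs))" if "xs \<in> listset Vs" for xs
    using Cons.prems(3)[of "0 # xs" 0] that by (auto simp: set_Cons_def)
  moreover have "multilinear_on s s' Vs W (\<lambda>xs. f (x # xs))" if "x \<in> V" for x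
    using Cons.prems(1) Cons.prems(2)[of "x # xs" for xs] Cons.prems(3)[of "x # xs" "Suc i" for xs i] that
    by (intro Cons.IH) (auto simp: set_Cons_def)
  ultimately show ?case by simp
qed simp

lemma multilinear_on_cong:
  assumes "vector_space s" "\<forall>V\<in>set Vs. module.subspace s V"
    and "\<And>xs. xs \<in> listset Vs \<Longrightarrow> f xs = g xs" "multilinear_on s s' Vs W f"
  shows "multilinear_on s s' Vs W g"
  using assms(2-)
proof (induction Vs arbitrary: f g)
  case (Cons V Vs)
  have "multilinear_on s s' Vs W (\<lambda>xs. g (x # xs))" if "x \<in> V" for x
  proof (rule Cons.IH[of "\<lambda>xs. f (x # xs)"])
    show "f (x # xs) = g (x # xs)" if "xs \<in> listset Vs" for xs
      using Cons.prems(2)[of "x # xs"] that \<open>x \<in> V\<close> by (simp only: listset_Cons)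
  qed (use Cons.prems that in auto)
  moreover have "linear_on s s' V W (\<lambda>x. g (x # xs))" if "xs \<in> listset Vs" for xs
  proof (rule linear_on_cong[OF assms(1)])
    show "f (x # xs) = g (x # xs)" if "x \<in> V" for x
      using Cons.prems(2)[of "x # xs"] that \<open>xs \<in> listset Vs\<close> by (simp only: listset_Cons)
  qed (use Cons.prems that in auto)
  ultimately show ?case by simp
qed simp

lemma multilinear_on_compose:
  "multilinear_on s s' Vs W f \<Longrightarrow> linear_on s' s'' W U g \<Longrightarrow> multilinear_on s s'' Vs U (\<lambda>xs. g (f xs))"
  by (induction Vs arbitrary: f) (auto intro: linear_on_compose linear_on_in)

lemma multilinear_on_sum_list:
  assumes "vector_space s'" "module.subspace s' W"
  shows "(\<And>p. p \<in> set ps \<Longrightarrow> multilinear_on s s' Vs W (h p)) \<Longrightarrow>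
    multilinear_on s s' Vs W (\<lambda>xs. \<Sum>p\<leftarrow>ps. h p xs)"
proof (induction Vs arbitrary: h)
  case Nil
  then show ?case by (auto intro!: subspace_sum_list[OF assms])
next
  case (Cons V Vs)
  then show ?case by (auto intro!: linear_on_sum_list[OF assms])
qed

lemma ball_listset_Cons:
  "(\<forall>xs\<in>listset (V # Vs). P xs) \<longleftrightarrow> (\<forall>x\<in>V. \<forall>xs\<in>listset Vs. P (x # xs))"
  by (auto simp: set_Cons_def)

lemma ball_listset_append:
  "(\<forall>xs\<in>listset (Us @ Vs). P xs) \<longleftrightarrow> (\<forall>us\<in>listset Us. \<forall>vs\<in>listset Vs. P (us @ vs))"
  by (metis listset_append listset_appendE)

text \<open>Linearity in a slot fixes all other slots, so freezing one whole block loses nothing as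
  long as both blocks are treated in turn.\<close>

lemma multilinear_on_append:
  "multilinear_on s s' (Us @ Vs) W f \<longleftrightarrow>
    (\<forall>vs\<in>listset Vs. multilinear_on s s' Us W (\<lambda>us. f (us @ vs))) \<and>
    (\<forall>us\<in>listset Us. multilinear_on s s' Vs W (\<lambda>vs. f (us @ vs)))"
proof (induction Us arbitrary: f)
  case Nil
  then show ?case by (auto intro: multilinear_on_in)
next
  case (Cons U Us)
  show ?case
    by (simp only: append_Cons multilinear_on.simps Cons.IH ball_listset_Cons ball_listset_append) blast
qed

text \<open>This is the multilinear form of a cut. On the outer blocks \<open>L\<close> and
  \<open>R\<close> the inserted value \<open>f vs\<close> is a constant; on the block
  \<open>G\<close> it runs through a single slot of \<open>g\<close>, and a linear map composed with
  a multilinear one is multilinear.\<close>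

lemma multilinear_on_subst:
  assumes s: "vector_space s" and sub: "\<forall>V\<in>set (L @ G @ R). module.subspace s V"
    and g: "multilinear_on s s' (L @ W # R) U g" and f: "multilinear_on s s G W f"
  shows "multilinear_on s s' (L @ G @ R) U
    (\<lambda>xs. g (take (length L) xs @ f (take (length G) (drop (length L) xs)) # drop (length L + length G) xs))"
proof -
  note g = g[unfolded multilinear_on_append multilinear_on.simps]
  note len = listset_length
  show ?thesis
    unfolding multilinear_on_append
  proof (intro conjI ballI)
    fix xs assume "xs \<in> listset (G @ R)"
    then obtain vs ws where xs: "xs = vs @ ws" "vs \<in> listset G" "ws \<in> listset R" by (rule listset_appendE)
    have "multilinear_on s s' L U (\<lambda>us. g (us @ f vs # ws))"
      using g multilinear_on_in[OF f xs(2)] xs(3) by (auto simp: set_Cons_def)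
    then show "multilinear_on s s' L U (\<lambda>us. g (take (length L) (us @ xs) @
        f (take (length G) (drop (length L) (us @ xs))) # drop (length L + length G) (us @ xs)))"
      by (rule multilinear_on_cong[OF s, rotated 2]) (use sub in \<open>auto simp: xs len[OF xs(2)] dest: len\<close>)
  next
    fix us ws assume us: "us \<in> listset L" and ws: "ws \<in> listset R"
    have "multilinear_on s s' G U (\<lambda>vs. g (us @ f vs # ws))"
      using g us ws by (intro multilinear_on_compose[OF f]) auto
    then show "multilinear_on s s' G U (\<lambda>vs. g (take (length L) (us @ vs @ ws) @
        f (take (length G) (drop (length L) (us @ vs @ ws))) # drop (length L + length G) (us @ vs @ ws)))"
      by (rule multilinear_on_cong[OF s, rotated 2]) (use sub in \<open>auto simp: len[OF us] dest: len\<close>)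
  next
    fix us vs assume us: "us \<in> listset L" and vs: "vs \<in> listset G"
    have "multilinear_on s s' R U (\<lambda>ws. g (us @ f vs # ws))"
      using g multilinear_on_in[OF f vs] us by auto
    then show "multilinear_on s s' R U (\<lambda>ws. g (take (length L) (us @ vs @ ws) @
        f (take (length G) (drop (length L) (us @ vs @ ws))) # drop (length L + length G) (us @ vs @ ws)))"
      by (simp add: len[OF us] len[OF vs])
  qed
qed

lemma multilinear_on_permute:
  assumes s: "vector_space s" and sub: "\<forall>V\<in>set Vs. module.subspace s V"
    and js: "distinct js" "set js = {..<length Vs}"
    and f: "multilinear_on s s' (map ((!) Vs) js) W f"
  shows "multilinear_on s s' Vs W (\<lambda>xs. f (map ((!) xs) js))"
proof (rule multilinear_onI[OF s sub])
  have mem: "map ((!) xs) js \<in> listset (map ((!) Vs) js)" if "xs \<in> listset Vs" for xs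
    using that js(2) by (auto simp: listset_nth)
  show "f (map ((!) xs) js) \<in> W" if "xs \<in> listset Vs" for xs
    by (rule multilinear_on_in[OF f mem[OF that]])
  fix xs i assume xs: "xs \<in> listset Vs" and i: "i < length Vs"
  \<comment> \<open>Position \<open>k\<close> is where entry \<open>i\<close> ends up. As
    \<open>js\<close> is a permutation, it occurs there and nowhere else, so changing entry
    \<open>i\<close> changes exactly one slot of \<open>f\<close>.\<close>
  then obtain k where k: "k < length js" "js ! k = i" using js(2) by (metis in_set_conv_nth lessThan_iff)
  have "map ((!) (xs[i := x])) js = (map ((!) xs) js)[k := x]" for x
  proof (rule nth_equalityI)
    fix j assume "j < length (map ((!) (xs[i := x])) js)"
    then have j: "j < length js" by simp
    then have "js ! j = i \<longleftrightarrow> j = k" using js(1) k by (auto simp: nth_eq_iff_index_eq)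
    moreover have "i < length xs" using i listset_length[OF xs] by simp
    ultimately show "map ((!) (xs[i := x])) js ! j = (map ((!) xs) js)[k := x] ! j"
      using j k by (auto simp: nth_list_update)
  qed simp
  then show "linear_on s s' (Vs ! i) W (\<lambda>x. f (map ((!) (xs[i := x])) js))"
    using multilinear_on_update[OF f mem[OF xs], of k] k by simp
qed

section \<open>Pure tensors and the maps induced on tensor products\<close>

lemma tpure_update_linear:
  assumes "vector_space s" "i < length xs"
  shows "tpure s (xs[i := x + y]) = tpure s (xs[i := x]) + tpure s (xs[i := y])"
    and "tpure s (xs[i := s c x]) = tscale c (tpure s (xs[i := x]))"
proof -
  have "\<phi> (xs[i := x + y]) = \<phi> (xs[i := x]) + \<phi> (xs[i := y]) \<and> \<phi> (xs[i := s c x]) = c * \<phi> (xs[i := x])"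
    if "multilinear_form s (length xs) \<phi>" for \<phi> x y c
  proof -
    have "Vector_Spaces.linear s (*) (\<lambda>x. \<phi> (xs[i := x]))"
      using that assms(2) by (auto simp: multilinear_form_def)
    then interpret Vector_Spaces.linear s "(*)" "\<lambda>x. \<phi> (xs[i := x])" .
    show ?thesis by (simp add: add scale)
  qed
  then show "tpure s (xs[i := x + y]) = tpure s (xs[i := x]) + tpure s (xs[i := y])"
    "tpure s (xs[i := s c x]) = tscale c (tpure s (xs[i := x]))"
    by (auto simp: tpure_def tscale_def fun_scale_def fun_eq_iff plus_fun_apply)
qed

lemma
  fixes s :: "'k::field \<Rightarrow> 'v::ab_group_add \<Rightarrow> 'v"
  shows tpure_in_tspace: "xs \<in> listset Vs \<Longrightarrow> tpure s xs \<in> tspace s Vs"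
    and subspace_tspace: "module.subspace tscale (tspace s Vs)"
proof -
  interpret t: vector_space "tscale :: 'k \<Rightarrow> ('k, 'v) tensor \<Rightarrow> _" by (rule vector_space_tscale)
  show "xs \<in> listset Vs \<Longrightarrow> tpure s xs \<in> tspace s Vs" "t.subspace (tspace s Vs)"
    by (auto simp: tspace_def intro: t.span_base)
qed

lemma multilinear_on_tpure:
  assumes "vector_space s" "\<forall>V\<in>set Vs. module.subspace s V"
  shows "multilinear_on s tscale Vs (tspace s Vs) (tpure s)"
proof (rule multilinear_onI[OF assms])
  fix xs i assume xs: "xs \<in> listset Vs" and i: "i < length Vs"
  show "linear_on s tscale (Vs ! i) (tspace s Vs) (\<lambda>x. tpure s (xs[i := x]))"
    using xs i listset_length[OF xs]
    by (intro linear_onI) (auto simp: tpure_update_linear[OF assms(1)] listset_nth nth_list_update intro!: tpure_in_tspace)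
qed (rule tpure_in_tspace)

text \<open>The scalar stays outside the pure tensor so that the rule covers the empty product as
  well, where no entry could absorb it.\<close>

lemma tspace_induct [consumes 1, case_names zero step]:
  assumes "t \<in> tspace s Vs" "P 0"
    "\<And>c xs t. xs \<in> listset Vs \<Longrightarrow> t \<in> tspace s Vs \<Longrightarrow> P t \<Longrightarrow> P (tscale c (tpure s xs) + t)"
  shows "P t"
proof -
  interpret t: vector_space "tscale :: 'b \<Rightarrow> ('b::field, 'a) tensor \<Rightarrow> _" by (rule vector_space_tscale)
  have "t \<in> tspace s Vs \<and> P t"
    using assms(1) unfolding tspace_def
  proof (induction rule: t.span_induct_alt)
    case base
    show ?case by (intro conjI t.span_zero assms(2))
  next
    case (step c x y)
    then show ?case using assms(3)[of _ y c] unfolding tspace_def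
      by (auto intro: t.span_add t.span_scale t.span_base)
  qed
  then show ?thesis ..
qed

lemma linear_on_tspace_eqI:
  assumes "linear_on tscale s' (tspace s Vs) W f" "linear_on tscale s' (tspace s Vs) W g"
    "\<And>xs. xs \<in> listset Vs \<Longrightarrow> f (tpure s xs) = g (tpure s xs)" "t \<in> tspace s Vs"
  shows "f t = g t"
  using assms(4)
proof (induction rule: tspace_induct)
  case zero
  have "0 \<in> tspace s Vs" by (rule subspace_zero[OF vector_space_tscale subspace_tspace])
  then show ?case using linear_on_zero assms(1,2) by metis
next
  case (step c xs t)
  then have "tpure s xs \<in> tspace s Vs" "tscale c (tpure s xs) \<in> tspace s Vs"
    by (auto intro: tpure_in_tspace subspace_smult[OF vector_space_tscale subspace_tspace])
  with step show ?case
    by (simp add: linear_on_add[OF assms(1)] linear_on_add[OF assms(2)] linear_on_scale[OF assms(1)]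
        linear_on_scale[OF assms(2)] assms(3))
qed

lemma linear_on_tspace_in:
  assumes "vector_space s'" "module.subspace s' W" "linear_on tscale s' (tspace s Vs) U f"
    "\<And>xs. xs \<in> listset Vs \<Longrightarrow> f (tpure s xs) \<in> W" "t \<in> tspace s Vs"
  shows "f t \<in> W"
  using assms(5)
proof (induction rule: tspace_induct)
  case zero
  have "0 \<in> tspace s Vs" by (rule subspace_zero[OF vector_space_tscale subspace_tspace])
  then show ?case using linear_on_zero[OF assms(3)] subspace_zero[OF assms(1,2)] by metis
next
  case (step c xs t)
  then have "tpure s xs \<in> tspace s Vs" "tscale c (tpure s xs) \<in> tspace s Vs"
    by (auto intro: tpure_in_tspace subspace_smult[OF vector_space_tscale subspace_tspace])
  with step show ?case
    by (simp add: linear_on_add[OF assms(3)] linear_on_scale[OF assms(3)] assms(4) subspace_plus[OF assms(1,2)] subspace_smult[OF assms(1,2)])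
qed

text \<open>\<open>tlift\<close> is described as a map into the whole ambient space. That it lands
  in \<open>W\<close> follows because the values on pure tensors lie in \<open>W\<close> and pure
  tensors span.\<close>

lemma tlift:
  assumes s: "vector_space s" and s': "vector_space s'" "module.subspace s' W"
    and sub: "\<forall>V\<in>set Vs. module.subspace s V" and f: "multilinear_on s s' Vs W f"
  shows "tlift s s' Vs f \<in> Hom tscale s' (tspace s Vs) W"
    and "xs \<in> listset Vs \<Longrightarrow> tlift s s' Vs f (tpure s xs) = f xs"
proof -
  have "\<exists>!g. g \<in> Hom tscale s' (tspace s Vs) UNIV \<and> (\<forall>xs \<in> listset Vs. g (tpure s xs) = f xs)"
    using multilinear_on_update[OF f]
    by (intro tlift_unique_existence[OF s s'(1) sub]) (auto intro: linear_on_mono)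
  from theI'[OF this] have *: "tlift s s' Vs f \<in> Hom tscale s' (tspace s Vs) UNIV"
    "\<And>xs. xs \<in> listset Vs \<Longrightarrow> tlift s s' Vs f (tpure s xs) = f xs"
    unfolding tlift_def by blast+
  have "tlift s s' Vs f t \<in> W" if "t \<in> tspace s Vs" for t
  proof (rule linear_on_tspace_in[OF s' _ _ that])
    show "linear_on tscale s' (tspace s Vs) UNIV (tlift s s' Vs f)" using *(1) by (simp add: Hom_def)
  qed (simp add: *(2) multilinear_on_in[OF f])
  with * show "tlift s s' Vs f \<in> Hom tscale s' (tspace s Vs) W"
    by (auto simp: Hom_def intro: linear_on_mono)
  show "xs \<in> listset Vs \<Longrightarrow> tlift s s' Vs f (tpure s xs) = f xs" by (rule *)
qed

lemma tlift_cong: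
  assumes "\<And>xs. xs \<in> listset Vs \<Longrightarrow> f xs = g xs"
  shows "tlift s s' Vs f = tlift s s' Vs g"
  by (simp add: tlift_def assms cong: ball_cong)

section \<open>Sweedler sums\<close>

text \<open>A concrete Sweedler sum: the pairs are the legs x' and x'' of a coproduct, and
  \<open>h\<close> is what is done with them. Lists are used since terms may repeat.\<close>

definition psum :: "('x \<Rightarrow> 'y \<Rightarrow> 'w::ab_group_add) \<Rightarrow> ('x \<times> 'y) list \<Rightarrow> 'w"
  where "psum h ps = (\<Sum>p\<leftarrow>ps. h (fst p) (snd p))"

lemma psum_Nil [simp]: "psum h [] = 0"
  and psum_Cons [simp]: "psum h (p # ps) = h (fst p) (snd p) + psum h ps"
  by (simp_all add: psum_def)

lemma psum_append: "psum h (ps @ qs) = psum h ps + psum h qs"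
  by (simp add: psum_def)

lemma psum_map: "psum h (map g ps) = psum (\<lambda>x y. h (fst (g (x, y))) (snd (g (x, y)))) ps"
  by (simp add: psum_def o_def)

lemma psum_concat_map: "psum h (concat (map g ps)) = psum (\<lambda>x y. psum h (g (x, y))) ps"
  by (induction ps) (auto simp: psum_append)

lemma psum_cong:
  "set ps \<subseteq> X \<times> Y \<Longrightarrow> (\<And>x y. x \<in> X \<Longrightarrow> y \<in> Y \<Longrightarrow> h x y = h' x y) \<Longrightarrow> psum h ps = psum h' ps"
  by (induction ps) auto

lemma psum_add: "psum (\<lambda>x y. h x y + h' x y) ps = psum h ps + psum h' ps"
  by (induction ps) (auto simp: algebra_simps)

text \<open>Two coproducts taken independently of each other may be summed in either order; this
  lets the factors of a tensor product be treated one at a time.\<close>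

lemma psum_swap: "psum (\<lambda>x y. psum (h x y) qs) ps = psum (\<lambda>u v. psum (\<lambda>x y. h x y u v) ps) qs"
proof (induction ps)
  case Nil
  show ?case by (simp add: psum_def)
qed (simp add: psum_add)

lemma psum_in:
  assumes "vector_space s" "module.subspace s W"
  shows "set ps \<subseteq> X \<times> Y \<Longrightarrow> (\<And>x y. x \<in> X \<Longrightarrow> y \<in> Y \<Longrightarrow> h x y \<in> W) \<Longrightarrow> psum h ps \<in> W"
  unfolding psum_def by (intro subspace_sum_list[OF assms]) auto

lemma linear_on_apply_psum:
  assumes "vector_space s" "module.subspace s V" "linear_on s s' V W f"
    "set ps \<subseteq> X \<times> Y" "\<And>x y. x \<in> X \<Longrightarrow> y \<in> Y \<Longrightarrow> h x y \<in> V"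
  shows "f (psum h ps) = psum (\<lambda>x y. f (h x y)) ps"
  unfolding psum_def using assms(4,5) by (intro linear_on_apply_sum_list[OF assms(1-3)]) auto

lemma linear_on_psum:
  assumes "vector_space s'" "module.subspace s' W"
    "set ps \<subseteq> X \<times> Y" "\<And>x y. x \<in> X \<Longrightarrow> y \<in> Y \<Longrightarrow> linear_on s s' V W (\<lambda>u. h u x y)"
  shows "linear_on s s' V W (\<lambda>u. psum (h u) ps)"
  unfolding psum_def using assms(3,4) by (intro linear_on_sum_list[OF assms(1,2)]) auto

lemma multilinear_on_psum:
  assumes "vector_space s'" "module.subspace s' W"
    "set ps \<subseteq> X \<times> Y" "\<And>x y. x \<in> X \<Longrightarrow> y \<in> Y \<Longrightarrow> multilinear_on s s' Vs W (\<lambda>us. h us x y)"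
  shows "multilinear_on s s' Vs W (\<lambda>us. psum (h us) ps)"
  unfolding psum_def using assms(3,4) by (intro multilinear_on_sum_list[OF assms(1,2)]) auto

section \<open>Bilinear and trilinear maps, and decompositions into pure tensors\<close>

definition bilinear_on ::
  "('k::field \<Rightarrow> 'v::ab_group_add \<Rightarrow> 'v) \<Rightarrow> ('k \<Rightarrow> 'w::ab_group_add \<Rightarrow> 'w) \<Rightarrow>
   'v set \<Rightarrow> 'w set \<Rightarrow> ('v \<Rightarrow> 'v \<Rightarrow> 'w) \<Rightarrow> bool"
  where "bilinear_on s s' V W h \<longleftrightarrow>
    (\<forall>x\<in>V. linear_on s s' V W (h x)) \<and> (\<forall>y\<in>V. linear_on s s' V W (\<lambda>x. h x y))"

definition trilinear_on ::
  "('k::field \<Rightarrow> 'v::ab_group_add \<Rightarrow> 'v) \<Rightarrow> ('k \<Rightarrow> 'w::ab_group_add \<Rightarrow> 'w) \<Rightarrow>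
   'v set \<Rightarrow> 'w set \<Rightarrow> ('v \<Rightarrow> 'v \<Rightarrow> 'v \<Rightarrow> 'w) \<Rightarrow> bool"
  where "trilinear_on s s' V W h \<longleftrightarrow>
    (\<forall>x\<in>V. bilinear_on s s' V W (h x)) \<and> (\<forall>y\<in>V. \<forall>z\<in>V. linear_on s s' V W (\<lambda>x. h x y z))"

lemma bilinear_on_in: "bilinear_on s s' V W h \<Longrightarrow> x \<in> V \<Longrightarrow> y \<in> V \<Longrightarrow> h x y \<in> W"
  by (auto simp: bilinear_on_def intro: linear_on_in)

lemma bilinear_on_compose:
  "bilinear_on s s' V W h \<Longrightarrow> linear_on s' s'' W U g \<Longrightarrow> bilinear_on s s'' V U (\<lambda>x y. g (h x y))"
  by (auto simp: bilinear_on_def intro: linear_on_compose)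

lemma multilinear_on_pair:
  "multilinear_on s s' [V, V] W (\<lambda>xs. h (xs ! 0) (xs ! 1)) \<longleftrightarrow> bilinear_on s s' V W h \<and> (\<forall>x\<in>V. \<forall>y\<in>V. h x y \<in> W)"
  by (auto simp: bilinear_on_def set_Cons_def)

lemma multilinear_on_triple:
  fixes s :: "'k::field \<Rightarrow> 'v::ab_group_add \<Rightarrow> 'v"
  shows "multilinear_on s s' [V, V, V] W (\<lambda>xs. h (xs ! 0) (xs ! 1) (xs ! 2)) \<longleftrightarrow>
    trilinear_on s s' V W h \<and> (\<forall>x\<in>V. \<forall>y\<in>V. \<forall>z\<in>V. h x y z \<in> W)"
proof -
  have nil: "(\<forall>xs\<in>listset []. P xs) \<longleftrightarrow> P []" for P :: "'v list \<Rightarrow> bool" by simp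
  show ?thesis
    by (simp only: nil bilinear_on_def trilinear_on_def ball_listset_Cons multilinear_on.simps nth_Cons_0
        nth_Cons_Suc numeral_2_eq_2 One_nat_def) blast
qed

lemma trilinear_on_in: "trilinear_on s s' V W h \<Longrightarrow> x \<in> V \<Longrightarrow> y \<in> V \<Longrightarrow> z \<in> V \<Longrightarrow> h x y z \<in> W"
  by (auto simp: trilinear_on_def intro: bilinear_on_in)

lemma bilinear_on_tpure:
  assumes "vector_space s" "module.subspace s V"
  shows "bilinear_on s tscale V (tspace s [V, V]) (\<lambda>x y. tpure s [x, y])"
  using multilinear_on_tpure[OF assms(1), of "[V, V]"] assms(2) by (auto simp: bilinear_on_def set_Cons_def)

lemma trilinear_on_tpure:
  assumes "vector_space s" "module.subspace s V"
  shows "trilinear_on s tscale V (tspace s [V, V, V]) (\<lambda>x y z. tpure s [x, y, z])"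
  using multilinear_on_tpure[OF assms(1), of "[V, V, V]"] assms(2)
  by (auto simp: trilinear_on_def bilinear_on_def set_Cons_def)

text \<open>A fixed way of writing an element of V \<otimes> V as a sum of pure tensors. It carries
  no coefficients, because a scalar can be moved into the first leg.\<close>

definition tdecomp ::
  "('k::field \<Rightarrow> 'v::ab_group_add \<Rightarrow> 'v) \<Rightarrow> 'v set \<Rightarrow> ('k, 'v) tensor \<Rightarrow> ('v \<times> 'v) list"
  where "tdecomp s V t = (SOME ps. set ps \<subseteq> V \<times> V \<and> t = psum (\<lambda>x y. tpure s [x, y]) ps)"

lemma tdecomp:
  assumes "vector_space s" "module.subspace s V" "t \<in> tspace s [V, V]"
  shows "set (tdecomp s V t) \<subseteq> V \<times> V" "psum (\<lambda>x y. tpure s [x, y]) (tdecomp s V t) = t"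
proof -
  have "\<exists>ps. set ps \<subseteq> V \<times> V \<and> t = psum (\<lambda>x y. tpure s [x, y]) ps"
    using assms(3)
  proof (induction rule: tspace_induct)
    case zero
    show ?case by (intro exI[of _ "[]"]) simp
  next
    case (step c xs t)
    then obtain ps where ps: "set ps \<subseteq> V \<times> V" "t = psum (\<lambda>x y. tpure s [x, y]) ps" by blast
    from step(1) obtain x y where xs: "xs = [x, y]" "x \<in> V" "y \<in> V" by (auto simp: set_Cons_def)
    have "tpure s [s c x, y] = tscale c (tpure s [x, y])"
      using tpure_update_linear(2)[OF assms(1), of 0 "[x, y]" c x] by simp
    then show ?case using ps xs
      by (intro exI[of _ "(s c x, y) # ps"]) (auto intro: subspace_smult[OF assms(1,2)])
  qed
  then have "\<exists>ps. set ps \<subseteq> V \<times> V \<and> t = psum (\<lambda>x y. tpure s [x, y]) ps" .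
  from someI_ex[OF this] show "set (tdecomp s V t) \<subseteq> V \<times> V" "psum (\<lambda>x y. tpure s [x, y]) (tdecomp s V t) = t"
    unfolding tdecomp_def by auto
qed

text \<open>
  Choosing a decomposition makes \<open>sw\<close> additive in \<open>h\<close> without any hypothesis on \<open>h\<close>; bilinearity
  of \<open>h\<close> is only needed for the value to be independent of the choice.
\<close>

definition sw ::
  "('k::field \<Rightarrow> 'v::ab_group_add \<Rightarrow> 'v) \<Rightarrow> 'v set \<Rightarrow> ('v \<Rightarrow> 'v \<Rightarrow> 'w::ab_group_add) \<Rightarrow> ('k, 'v) tensor \<Rightarrow> 'w"
  where "sw s V h t = psum h (tdecomp s V t)"

lemma tlift2_pure:
  assumes "vector_space s" "module.subspace s V" "vector_space s'" "module.subspace s' W"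
    and h: "bilinear_on s s' V W h"
  shows "tlift2 s s' V h \<in> Hom tscale s' (tspace s [V, V]) W"
    and "x \<in> V \<Longrightarrow> y \<in> V \<Longrightarrow> tlift2 s s' V h (tpure s [x, y]) = h x y"
proof -
  have m: "multilinear_on s s' [V, V] W (\<lambda>xs. h (xs ! 0) (xs ! 1))"
    using h bilinear_on_in[OF h] by (subst multilinear_on_pair) auto
  note t = tlift[OF assms(1,3,4) _ m]
  show "tlift2 s s' V h \<in> Hom tscale s' (tspace s [V, V]) W"
    unfolding tlift2_def using t(1) assms(2) by simp
  show "x \<in> V \<Longrightarrow> y \<in> V \<Longrightarrow> tlift2 s s' V h (tpure s [x, y]) = h x y"
    unfolding tlift2_def using t(2)[of "[x, y]"] assms(2) by (simp add: set_Cons_def)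
qed

text \<open>The induced map is linear, so it may be evaluated term by term on the chosen
  decomposition. This replaces the definite description behind \<open>tlift2\<close> by a finite
  sum.\<close>

lemma tlift2_eq_sw:
  assumes "vector_space s" "module.subspace s V" "vector_space s'" "module.subspace s' W"
    and h: "bilinear_on s s' V W h" and t: "t \<in> tspace s [V, V]"
  shows "tlift2 s s' V h t = sw s V h t"
proof -
  note l = tlift2_pure[OF assms(1-5)]
  note d = tdecomp[OF assms(1,2) t]
  have "tlift2 s s' V h (psum (\<lambda>x y. tpure s [x, y]) (tdecomp s V t)) = psum (\<lambda>x y. tlift2 s s' V h (tpure s [x, y])) (tdecomp s V t)"
    using l(1) by (intro linear_on_apply_psum[OF vector_space_tscale subspace_tspace _ d(1)])
      (auto simp: Hom_def set_Cons_def intro!: tpure_in_tspace)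
  also have "\<dots> = psum h (tdecomp s V t)"
    by (rule psum_cong[OF d(1)]) (simp add: l(2))
  finally show ?thesis by (simp add: d(2) sw_def)
qed

lemma sw_linear:
  assumes "vector_space s" "module.subspace s V" "vector_space s'" "module.subspace s' W"
    and h: "bilinear_on s s' V W h"
  shows "linear_on tscale s' (tspace s [V, V]) W (sw s V h)"
proof (rule linear_on_cong[OF vector_space_tscale subspace_tspace])
  show "linear_on tscale s' (tspace s [V, V]) W (tlift2 s s' V h)"
    using tlift2_pure(1)[OF assms] by (simp add: Hom_def)
qed (rule tlift2_eq_sw[OF assms])

lemma sw_pure:
  assumes "vector_space s" "module.subspace s V" "vector_space s'" "module.subspace s' W"
    and h: "bilinear_on s s' V W h" and "x \<in> V" "y \<in> V"
  shows "sw s V h (tpure s [x, y]) = h x y"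
  using tlift2_eq_sw[OF assms(1-5), of "tpure s [x, y]"] tlift2_pure(2)[OF assms] assms(6,7)
  by (simp add: tpure_in_tspace set_Cons_def)

lemma sw_cong:
  assumes "vector_space s" "module.subspace s V" "t \<in> tspace s [V, V]"
    "\<And>x y. x \<in> V \<Longrightarrow> y \<in> V \<Longrightarrow> h x y = h' x y"
  shows "sw s V h t = sw s V h' t"
  unfolding sw_def using assms(4) by (rule psum_cong[OF tdecomp(1)[OF assms(1-3)]])

lemma sw_in:
  assumes "vector_space s" "module.subspace s V" "t \<in> tspace s [V, V]"
    "vector_space s'" "module.subspace s' W" "\<And>x y. x \<in> V \<Longrightarrow> y \<in> V \<Longrightarrow> h x y \<in> W"
  shows "sw s V h t \<in> W"
  unfolding sw_def using assms(6) by (rule psum_in[OF assms(4,5) tdecomp(1)[OF assms(1-3)]])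

lemma linear_on_apply_sw:
  assumes "vector_space s" "module.subspace s V" "t \<in> tspace s [V, V]"
    "vector_space s'" "module.subspace s' W" "linear_on s' s'' W U f" "\<And>x y. x \<in> V \<Longrightarrow> y \<in> V \<Longrightarrow> h x y \<in> W"
  shows "f (sw s V h t) = sw s V (\<lambda>x y. f (h x y)) t"
  unfolding sw_def using assms(7) by (rule linear_on_apply_psum[OF assms(4-6) tdecomp(1)[OF assms(1-3)]])

text \<open>With \<open>t\<close> fixed the decomposition is fixed too, and linearity in a parameter
  is inherited from the single terms.\<close>

lemma linear_on_sw:
  assumes "vector_space s" "module.subspace s V" "t \<in> tspace s [V, V]"
    "vector_space s'" "module.subspace s' W"
    "\<And>x y. x \<in> V \<Longrightarrow> y \<in> V \<Longrightarrow> linear_on r s' U W (\<lambda>u. h u x y)"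
  shows "linear_on r s' U W (\<lambda>u. sw s V (h u) t)"
  unfolding sw_def using assms(6) by (rule linear_on_psum[OF assms(4,5) tdecomp(1)[OF assms(1-3)]])

section \<open>Cocommutative coalgebras\<close>

text \<open>Structure maps of the right type, before any axiom. Sweedler sums make sense already
  here, which allows the axioms to be restated with them and then verified for a tensor
  product.\<close>

locale precoalgebra =
  fixes s :: "'k::field \<Rightarrow> 'c::ab_group_add \<Rightarrow> 'c" and C \<Delta> \<epsilon>
  assumes vs: "vector_space s" and C: "module.subspace s C"
    and \<Delta>: "linear_on s tscale C (tspace s [C, C]) \<Delta>" and \<epsilon>: "linear_on s (*) C UNIV \<epsilon>"
begin

abbreviation cs :: "('c \<Rightarrow> 'c \<Rightarrow> 'w::ab_group_add) \<Rightarrow> 'c \<Rightarrow> 'w"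
  where "cs h c \<equiv> sw s C h (\<Delta> c)"

lemma cs_linear:
  assumes "vector_space s'" "module.subspace s' W" "bilinear_on s s' C W h"
  shows "linear_on s s' C W (cs h)"
  by (rule linear_on_compose[OF \<Delta> sw_linear[OF vs C assms]])

lemmas cs_cong = sw_cong[OF vs C linear_on_in[OF \<Delta>]]
lemmas cs_in = sw_in[OF vs C linear_on_in[OF \<Delta>]]
lemmas linear_on_apply_cs = linear_on_apply_sw[OF vs C linear_on_in[OF \<Delta>]]
lemmas linear_on_cs = linear_on_sw[OF vs C linear_on_in[OF \<Delta>]]
lemmas tlift2_eq_cs = tlift2_eq_sw[OF vs C _ _ _ linear_on_in[OF \<Delta>]]

lemma trilinear_cs_left:
  assumes "vector_space s'" "module.subspace s' W" "trilinear_on s s' C W h"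
  shows "bilinear_on s s' C W (\<lambda>x y. cs (\<lambda>u v. h u v y) x)"
proof -
  have "bilinear_on s s' C W (\<lambda>u v. h u v y)" if "y \<in> C" for y
    using assms(3) that by (auto simp: trilinear_on_def bilinear_on_def)
  then show ?thesis
    using assms(3) unfolding bilinear_on_def[of s s' C W "\<lambda>x y. cs (\<lambda>u v. h u v y) x"]
    by (auto intro!: cs_linear[OF assms(1,2)] linear_on_cs[OF _ assms(1,2)] simp: trilinear_on_def bilinear_on_def)
qed

lemma trilinear_cs_right:
  assumes "vector_space s'" "module.subspace s' W" "trilinear_on s s' C W h"
  shows "bilinear_on s s' C W (\<lambda>x y. cs (\<lambda>u v. h x u v) y)"
  using assms(3) unfolding bilinear_on_def[of s s' C W "\<lambda>x y. cs (\<lambda>u v. h x u v) y"]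
  by (auto intro!: cs_linear[OF assms(1,2)] linear_on_cs[OF _ assms(1,2)] simp: trilinear_on_def bilinear_on_def)

lemma bilinear_counit:
  shows "bilinear_on s s C C (\<lambda>x y. s (\<epsilon> x) y)" "bilinear_on s s C C (\<lambda>x y. s (\<epsilon> y) x)"
  unfolding bilinear_on_def
  by (auto intro!: linear_on_scale_left[OF vs C \<epsilon>] linear_on_scale_right[OF vs C linear_on_id])

lemma bilinear_tpure_flip: "bilinear_on s tscale C (tspace s [C, C]) (\<lambda>x y. tpure s [y, x])"
  using bilinear_on_tpure[OF vs C] by (auto simp: bilinear_on_def)

text \<open>The definition nests \<open>tlift2\<close>, and the outer one can be evaluated only if
  the inner one is bilinear in the outer legs. That bilinearity is imported from the Sweedler form,
  with which the inner \<open>tlift2\<close> agrees on \<open>C\<close>.\<close>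

lemma cocomm_coalgebra_iff:
  "cocomm_coalgebra s C \<Delta> \<epsilon> \<longleftrightarrow> (\<forall>c\<in>C.
    cs (\<lambda>x y. cs (\<lambda>u v. tpure s [u, v, y]) x) c = cs (\<lambda>x y. cs (\<lambda>u v. tpure s [x, u, v]) y) c \<and>
    cs (\<lambda>x y. s (\<epsilon> x) y) c = c \<and> cs (\<lambda>x y. s (\<epsilon> y) x) c = c \<and> cs (\<lambda>x y. tpure s [y, x]) c = \<Delta> c)"
proof -
  note T = vector_space_tscale subspace_tspace
  note tri = trilinear_on_tpure[OF vs C]
  have bi: "bilinear_on s tscale C (tspace s [C, C, C]) (\<lambda>u v. tpure s [u, v, y])"
    "bilinear_on s tscale C (tspace s [C, C, C]) (\<lambda>u v. tpure s [y, u, v])" if "y \<in> C" for y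
    using tri that by (auto simp: trilinear_on_def bilinear_on_def)
  have 1: "tlift2 s tscale C (\<lambda>x y. tlift2 s tscale C (\<lambda>u v. tpure s [u, v, y]) (\<Delta> x)) (\<Delta> c) =
    cs (\<lambda>x y. cs (\<lambda>u v. tpure s [u, v, y]) x) c" if "c \<in> C" for c
  proof -
    have e: "tlift2 s tscale C (\<lambda>u v. tpure s [u, v, y]) (\<Delta> x) = cs (\<lambda>u v. tpure s [u, v, y]) x" if "x \<in> C" "y \<in> C" for x y
      by (rule tlift2_eq_cs[OF T bi(1)]) (use that in auto)
    have "bilinear_on s tscale C (tspace s [C, C, C]) (\<lambda>x y. tlift2 s tscale C (\<lambda>u v. tpure s [u, v, y]) (\<Delta> x))"
      using trilinear_cs_left[OF T tri] unfolding bilinear_on_def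
      by (auto intro: linear_on_cong[OF vs C e[symmetric]])
    from tlift2_eq_cs[OF T this that] show ?thesis
      by (simp only:) (rule cs_cong[OF that], rule e)
  qed
  have 2: "tlift2 s tscale C (\<lambda>x y. tlift2 s tscale C (\<lambda>u v. tpure s [x, u, v]) (\<Delta> y)) (\<Delta> c) =
    cs (\<lambda>x y. cs (\<lambda>u v. tpure s [x, u, v]) y) c" if "c \<in> C" for c
  proof -
    have e: "tlift2 s tscale C (\<lambda>u v. tpure s [x, u, v]) (\<Delta> y) = cs (\<lambda>u v. tpure s [x, u, v]) y" if "x \<in> C" "y \<in> C" for x y
      by (rule tlift2_eq_cs[OF T bi(2)]) (use that in auto)
    have "bilinear_on s tscale C (tspace s [C, C, C]) (\<lambda>x y. tlift2 s tscale C (\<lambda>u v. tpure s [x, u, v]) (\<Delta> y))"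
      using trilinear_cs_right[OF T tri] unfolding bilinear_on_def
      by (auto intro: linear_on_cong[OF vs C e[symmetric]])
    from tlift2_eq_cs[OF T this that] show ?thesis
      by (simp only:) (rule cs_cong[OF that], rule e)
  qed
  have 3: "tlift2 s s C (\<lambda>x y. s (\<epsilon> x) y) (\<Delta> c) = cs (\<lambda>x y. s (\<epsilon> x) y) c"
    "tlift2 s s C (\<lambda>x y. s (\<epsilon> y) x) (\<Delta> c) = cs (\<lambda>x y. s (\<epsilon> y) x) c"
    "tlift2 s tscale C (\<lambda>x y. tpure s [y, x]) (\<Delta> c) = cs (\<lambda>x y. tpure s [y, x]) c" if "c \<in> C" for c
    by (rule tlift2_eq_cs[OF vs C bilinear_counit(1) that] tlift2_eq_cs[OF vs C bilinear_counit(2) that]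
        tlift2_eq_cs[OF T bilinear_tpure_flip that])+
  show ?thesis
    unfolding cocomm_coalgebra_def using C \<Delta> \<epsilon> by (auto simp: 1 2 3)
qed

end

locale coalgebra = precoalgebra +
  assumes coalgebra: "cocomm_coalgebra s C \<Delta> \<epsilon>"
begin

lemmas coalgebra_sw = coalgebra[unfolded cocomm_coalgebra_iff]

text \<open>The axiom is the instance where \<open>h\<close> is \<open>tpure\<close> with three
  entries. Every trilinear \<open>h\<close> factors through the triple tensor product, and applying
  the induced linear map \<open>H\<close> to both sides of the axiom gives the general case.\<close>

lemma coassoc:
  assumes W: "vector_space s'" "module.subspace s' W" and h: "trilinear_on s s' C W h" and c: "c \<in> C"
  shows "cs (\<lambda>x y. cs (\<lambda>u v. h u v y) x) c = cs (\<lambda>x y. cs (\<lambda>u v. h x u v) y) c"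
proof -
  define H where "H = tlift s s' [C, C, C] (\<lambda>xs. h (xs ! 0) (xs ! 1) (xs ! 2))"
  have m: "multilinear_on s s' [C, C, C] W (\<lambda>xs. h (xs ! 0) (xs ! 1) (xs ! 2))"
    using h trilinear_on_in[OF h] by (subst multilinear_on_triple) auto
  have Hl: "linear_on tscale s' (tspace s [C, C, C]) W H"
    and Hp: "\<And>x y z. x \<in> C \<Longrightarrow> y \<in> C \<Longrightarrow> z \<in> C \<Longrightarrow> H (tpure s [x, y, z]) = h x y z"
    using tlift[OF vs W _ m] C by (auto simp: H_def Hom_def set_Cons_def)
  have mem: "tpure s [x, y, z] \<in> tspace s [C, C, C]" if "x \<in> C" "y \<in> C" "z \<in> C" for x y z
    using that by (intro tpure_in_tspace) (auto simp: set_Cons_def)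
  note T = vector_space_tscale subspace_tspace
  have e: "H (cs (\<lambda>u v. tpure s [u, v, y]) x) = cs (\<lambda>u v. h u v y) x"
    "H (cs (\<lambda>u v. tpure s [y, u, v]) x) = cs (\<lambda>u v. h y u v) x" if "x \<in> C" "y \<in> C" for x y
    using that by (subst linear_on_apply_cs[OF _ T Hl]; auto intro!: cs_cong simp: mem Hp)+
  have "H (cs (\<lambda>x y. cs (\<lambda>u v. tpure s [u, v, y]) x) c) = H (cs (\<lambda>x y. cs (\<lambda>u v. tpure s [x, u, v]) y) c)"
    using coalgebra_sw c by simp
  moreover have "H (cs (\<lambda>x y. cs (\<lambda>u v. tpure s [u, v, y]) x) c) = cs (\<lambda>x y. cs (\<lambda>u v. h u v y) x) c"
    by (subst linear_on_apply_cs[OF c T Hl]) (auto intro!: cs_cong c cs_in T mem simp: e)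
  moreover have "H (cs (\<lambda>x y. cs (\<lambda>u v. tpure s [x, u, v]) y) c) = cs (\<lambda>x y. cs (\<lambda>u v. h x u v) y) c"
    by (subst linear_on_apply_cs[OF c T Hl]) (auto intro!: cs_cong c cs_in T mem simp: e)
  ultimately show ?thesis by simp
qed

text \<open>Here the linear map applied to the axiom is \<open>sw s C h\<close>, that is,
  \<open>h\<close> extended to C \<otimes> C.\<close>

lemma cocomm:
  assumes W: "vector_space s'" "module.subspace s' W" and h: "bilinear_on s s' C W h" and c: "c \<in> C"
  shows "cs (\<lambda>x y. h y x) c = cs h c"
proof -
  note T = vector_space_tscale subspace_tspace
  have "cs h c = sw s C h (cs (\<lambda>x y. tpure s [y, x]) c)" using coalgebra_sw c by simp
  also have "\<dots> = cs (\<lambda>x y. sw s C h (tpure s [y, x])) c"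
    by (rule linear_on_apply_cs[OF c T sw_linear[OF vs C W h]])
      (auto intro!: tpure_in_tspace simp: set_Cons_def)
  also have "\<dots> = cs (\<lambda>x y. h y x) c"
    by (rule cs_cong[OF c]) (simp add: sw_pure[OF vs C W h])
  finally show ?thesis ..
qed

lemma counit:
  assumes g: "linear_on s s' C W g" and c: "c \<in> C"
  shows "cs (\<lambda>x y. s' (\<epsilon> x) (g y)) c = g c" "cs (\<lambda>x y. s' (\<epsilon> y) (g x)) c = g c"
proof -
  have "g c = g (cs (\<lambda>x y. s (\<epsilon> x) y) c)" "g c = g (cs (\<lambda>x y. s (\<epsilon> y) x) c)" using coalgebra_sw c by auto
  moreover have "g (cs (\<lambda>x y. s (\<epsilon> x) y) c) = cs (\<lambda>x y. g (s (\<epsilon> x) y)) c"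
    "g (cs (\<lambda>x y. s (\<epsilon> y) x) c) = cs (\<lambda>x y. g (s (\<epsilon> y) x)) c"
    by (rule linear_on_apply_cs[OF c vs C g], simp add: subspace_smult[OF vs C])+
  ultimately show "cs (\<lambda>x y. s' (\<epsilon> x) (g y)) c = g c" "cs (\<lambda>x y. s' (\<epsilon> y) (g x)) c = g c"
    using linear_on_scale[OF g] by (auto cong: cs_cong[OF c])
qed

end

lemma coalgebraI:
  assumes "vector_space s" "cocomm_coalgebra s C \<Delta> \<epsilon>"
  shows "coalgebra s C \<Delta> \<epsilon>"
  using assms
  by (intro coalgebra.intro precoalgebra.intro coalgebra_axioms.intro) (auto simp: cocomm_coalgebra_def)

section \<open>Tensor products of coalgebras\<close>

lemma tlift2_cong:
  "(\<And>x y. x \<in> V \<Longrightarrow> y \<in> V \<Longrightarrow> h x y = h' x y) \<Longrightarrow> tlift2 s s' V h = tlift2 s s' V h'"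
  unfolding tlift2_def by (rule tlift_cong) (auto simp: set_Cons_def)

lemma linear_on_smult:
  assumes "vector_space s" "module.subspace s V"
  shows "linear_on s s V V (s c)"
  using linear_on_scale_right[OF assms linear_on_id] .

lemma bilinear_on_precompose:
  assumes h: "bilinear_on s' s'' V' W h" and f: "linear_on s s' V V' f" and g: "linear_on s s' V V' g"
  shows "bilinear_on s s'' V W (\<lambda>x y. h (f x) (g y))"
  unfolding bilinear_on_def
proof (intro conjI ballI)
  fix x assume x: "x \<in> V"
  show "linear_on s s'' V W (\<lambda>y. h (f x) (g y))"
    using h linear_on_in[OF f x] by (intro linear_on_compose[OF g]) (auto simp: bilinear_on_def)
  show "linear_on s s'' V W (\<lambda>y. h (f y) (g x))"
    using h linear_on_in[OF g x] by (intro linear_on_compose[OF f, of s'' W "\<lambda>a. h a (g x)"]) (auto simp: bilinear_on_def)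
qed

text \<open>The factors of a tensor product are selected by a list of indices, with repetition
  allowed. In a semantics the indices are the formulas \<open>A\<close> for which
  \<open>OfCourse A\<close> is interpreted, so that a context of unrestricted variables is such a
  list.\<close>

locale coalgebra_family =
  fixes s :: "'k::field \<Rightarrow> 'v::ab_group_add \<Rightarrow> 'v" and I :: "'i set" and C :: "'i \<Rightarrow> 'v set"
    and \<Delta> :: "'i \<Rightarrow> 'v \<Rightarrow> ('k, 'v) tensor" and \<epsilon> :: "'i \<Rightarrow> 'v \<Rightarrow> 'k"
  assumes vs: "vector_space s" and family: "i \<in> I \<Longrightarrow> cocomm_coalgebra s (C i) (\<Delta> i) (\<epsilon> i)"
begin

lemma component: "i \<in> I \<Longrightarrow> coalgebra s (C i) (\<Delta> i) (\<epsilon> i)"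
  by (intro coalgebraI vs family)

lemma subspace_component: "i \<in> I \<Longrightarrow> module.subspace s (C i)"
  using family by (simp add: cocomm_coalgebra_def)

lemma subspace_components: "set is \<subseteq> I \<Longrightarrow> \<forall>V\<in>set (map C is). module.subspace s V"
  using subspace_component by auto

abbreviation L :: "'i list \<Rightarrow> 'v list set"
  where "L is \<equiv> listset (map C is)"

abbreviation T :: "'i list \<Rightarrow> ('k, 'v) tensor set"
  where "T is \<equiv> tspace s (map C is)"

definition tcomult :: "'i list \<Rightarrow> ('k, 'v) tensor \<Rightarrow> ('k, ('k, 'v) tensor) tensor"
  where "tcomult is = tensor_comult s (map (\<lambda>i. (C i, \<Delta> i)) is)"

definition tcounit :: "'i list \<Rightarrow> ('k, 'v) tensor \<Rightarrow> 'k"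
  where "tcounit is = tensor_counit s (map (\<lambda>i. (C i, \<epsilon> i)) is)"

text \<open>The legs of the coproduct of a pure tensor: each entry is split by the decomposition
  chosen for its own factor, and first and second legs are collected into two lists. On the empty
  tensor this is 1 \<otimes> 1, the comultiplication of the ground field.\<close>

primrec cops :: "'i list \<Rightarrow> 'v list \<Rightarrow> ('v list \<times> 'v list) list"
  where
    "cops [] xs = [([], [])]"
  | "cops (i # is) xs = concat (map (\<lambda>(y, z). map (\<lambda>(ys, zs). (y # ys, z # zs)) (cops is (tl xs)))
      (tdecomp s (C i) (\<Delta> i (hd xs))))"

primrec pcounit :: "'i list \<Rightarrow> 'v list \<Rightarrow> 'k"
  where
    "pcounit [] xs = 1"
  | "pcounit (i # is) xs = \<epsilon> i (hd xs) * pcounit is (tl xs)"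

lemma psum_cops_Nil: "psum H (cops [] xs) = H [] []"
  by simp

lemma psum_cops_Cons:
  "psum H (cops (i # is) (x # xs)) =
    sw s (C i) (\<lambda>y z. psum (\<lambda>ys zs. H (y # ys) (z # zs)) (cops is xs)) (\<Delta> i x)"
  by (simp add: sw_def psum_concat_map psum_map case_prod_beta)

lemma cops_in:
  "set is \<subseteq> I \<Longrightarrow> xs \<in> L is \<Longrightarrow> set (cops is xs) \<subseteq> L is \<times> L is"
proof (induction "is" arbitrary: xs)
  case (Cons i "is")
  then obtain y ys where xs: "xs = y # ys" "y \<in> C i" "ys \<in> L is" by (auto simp: set_Cons_def)
  interpret c: coalgebra s "C i" "\<Delta> i" "\<epsilon> i" using Cons.prems by (intro component) auto
  have "set (tdecomp s (C i) (\<Delta> i y)) \<subseteq> C i \<times> C i"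
    by (rule tdecomp(1)[OF vs c.C linear_on_in[OF c.\<Delta> xs(2)]])
  moreover have "set (cops is ys) \<subseteq> L is \<times> L is" using Cons xs by auto
  ultimately show ?case by (fastforce simp: xs(1) set_Cons_def)
qed simp

lemmas psum_cops_cong = psum_cong[OF cops_in]
lemmas linear_on_apply_psum_cops = linear_on_apply_psum[OF _ _ _ cops_in]

text \<open>The counterpart of \<open>bilinear_on\<close> for pure tensors given by their entries;
  \<open>bimultilinear_on_pure\<close> produces it from a bilinear map on the tensor
  product.\<close>

definition bimultilinear_on ::
  "('k \<Rightarrow> 'w::ab_group_add \<Rightarrow> 'w) \<Rightarrow> 'i list \<Rightarrow> 'w set \<Rightarrow> ('v list \<Rightarrow> 'v list \<Rightarrow> 'w) \<Rightarrow> bool"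
  where "bimultilinear_on s' is W H \<longleftrightarrow>
    (\<forall>ys\<in>L is. multilinear_on s s' (map C is) W (H ys)) \<and>
    (\<forall>zs\<in>L is. multilinear_on s s' (map C is) W (\<lambda>ys. H ys zs))"

definition trimultilinear_on ::
  "('k \<Rightarrow> 'w::ab_group_add \<Rightarrow> 'w) \<Rightarrow> 'i list \<Rightarrow> 'w set \<Rightarrow> ('v list \<Rightarrow> 'v list \<Rightarrow> 'v list \<Rightarrow> 'w) \<Rightarrow> bool"
  where "trimultilinear_on s' is W H \<longleftrightarrow>
    (\<forall>xs\<in>L is. bimultilinear_on s' is W (H xs)) \<and>
    (\<forall>ys\<in>L is. \<forall>zs\<in>L is. multilinear_on s s' (map C is) W (\<lambda>xs. H xs ys zs))"

lemma bimultilinear_on_Cons: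
  assumes "bimultilinear_on s' (i # is) W H"
  shows "y \<in> C i \<Longrightarrow> z \<in> C i \<Longrightarrow> bimultilinear_on s' is W (\<lambda>ys zs. H (y # ys) (z # zs))"
    and "ys \<in> L is \<Longrightarrow> zs \<in> L is \<Longrightarrow> bilinear_on s s' (C i) W (\<lambda>y z. H (y # ys) (z # zs))"
  using assms by (auto simp: bimultilinear_on_def bilinear_on_def ball_listset_Cons simp del: listset.simps)

lemma trimultilinear_on_Cons:
  assumes "trimultilinear_on s' (i # is) W H"
  shows "x \<in> C i \<Longrightarrow> y \<in> C i \<Longrightarrow> z \<in> C i \<Longrightarrow> trimultilinear_on s' is W (\<lambda>xs ys zs. H (x # xs) (y # ys) (z # zs))"
    and "xs \<in> L is \<Longrightarrow> ys \<in> L is \<Longrightarrow> zs \<in> L is \<Longrightarrow>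
      trilinear_on s s' (C i) W (\<lambda>x y z. H (x # xs) (y # ys) (z # zs))"
  using assms
  by (auto simp: trimultilinear_on_def bimultilinear_on_def trilinear_on_def bilinear_on_def
      ball_listset_Cons simp del: listset.simps)

lemma bilinear_on_psum:
  assumes W: "vector_space s'" "module.subspace s' W" and ps: "set ps \<subseteq> X \<times> Y"
    and h: "\<And>x y. x \<in> X \<Longrightarrow> y \<in> Y \<Longrightarrow> bilinear_on s s' V W (\<lambda>u v. h u v x y)"
  shows "bilinear_on s s' V W (\<lambda>u v. psum (h u v) ps)"
  using h unfolding bilinear_on_def by (auto intro!: linear_on_psum[OF W ps])

lemma trilinear_on_psum:
  assumes W: "vector_space s'" "module.subspace s' W" and ps: "set ps \<subseteq> X \<times> Y"
    and h: "\<And>x y. x \<in> X \<Longrightarrow> y \<in> Y \<Longrightarrow> trilinear_on s s' V W (\<lambda>u v w. h u v w x y)"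
  shows "trilinear_on s s' V W (\<lambda>u v w. psum (h u v w) ps)"
  using h unfolding trilinear_on_def by (auto intro!: linear_on_psum[OF W ps] bilinear_on_psum[OF W ps])

lemma psum_cops_multilinear:
  assumes W: "vector_space s'" "module.subspace s' W"
  shows "set is \<subseteq> I \<Longrightarrow> bimultilinear_on s' is W H \<Longrightarrow>
    multilinear_on s s' (map C is) W (\<lambda>xs. psum H (cops is xs))"
proof (induction "is" arbitrary: H)
  case Nil
  then show ?case by (simp add: bimultilinear_on_def)
next
  case (Cons i "is")
  interpret c: coalgebra s "C i" "\<Delta> i" "\<epsilon> i" using Cons.prems by (intro component) auto
  have I: "set is \<subseteq> I" using Cons.prems by simp
  note H = bimultilinear_on_Cons[OF Cons.prems(2)]
  have "linear_on s s' (C i) W (\<lambda>x. psum H (cops (i # is) (x # xs)))" if "xs \<in> L is" for xs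
    unfolding psum_cops_Cons by (intro c.cs_linear[OF W] bilinear_on_psum[OF W cops_in[OF I that]] H)
  moreover have "multilinear_on s s' (map C is) W (\<lambda>xs. psum H (cops (i # is) (x # xs)))" if "x \<in> C i" for x
    unfolding psum_cops_Cons sw_def
    by (intro multilinear_on_psum[OF W tdecomp(1)[OF vs c.C linear_on_in[OF c.\<Delta> that]]] Cons.IH I H)
  ultimately show ?case by simp
qed

text \<open>The sums over head and tail are interchanged until both tail sums are innermost; there
  the induction hypothesis applies with the head legs fixed. What remains is coassociativity of the
  single factor \<open>C i\<close> for the trilinear map \<open>K\<close>, whose tail part is
  already in its final bracketing.\<close>

lemma psum_cops_coassoc:
  assumes W: "vector_space s'" "module.subspace s' W"
  shows "set is \<subseteq> I \<Longrightarrow> trimultilinear_on s' is W H \<Longrightarrow> xs \<in> L is \<Longrightarrow>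
    psum (\<lambda>ys zs. psum (\<lambda>us vs. H us vs zs) (cops is ys)) (cops is xs) =
    psum (\<lambda>ys zs. psum (\<lambda>us vs. H ys us vs) (cops is zs)) (cops is xs)"
proof (induction "is" arbitrary: H xs)
  case Nil
  then show ?case by simp
next
  case (Cons i "is")
  then obtain x xs' where xs: "xs = x # xs'" "x \<in> C i" "xs' \<in> L is" by (auto simp: set_Cons_def)
  interpret c: coalgebra s "C i" "\<Delta> i" "\<epsilon> i" using Cons.prems by (intro component) auto
  have I: "set is \<subseteq> I" using Cons.prems by simp
  note H = trimultilinear_on_Cons[OF Cons.prems(2)]
  define K where "K u v z = psum (\<lambda>ys zs. psum (\<lambda>us vs. H (u # ys) (v # us) (z # vs)) (cops is zs)) (cops is xs')" for u v z
  have K: "trilinear_on s s' (C i) W K"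
    unfolding K_def
    by (intro trilinear_on_psum[OF W cops_in[OF I xs(3)]] trilinear_on_psum[OF W cops_in[OF I]] H)
  have "psum (\<lambda>ys zs. psum (\<lambda>us vs. H us vs zs) (cops (i # is) ys)) (cops (i # is) xs) =
    c.cs (\<lambda>y z. psum (\<lambda>ys zs. c.cs (\<lambda>u v. psum (\<lambda>us vs. H (u # us) (v # vs) (z # zs)) (cops is ys)) y) (cops is xs')) x"
    by (simp only: psum_cops_Cons xs(1))
  also have "\<dots> = c.cs (\<lambda>y z. c.cs (\<lambda>u v. psum (\<lambda>ys zs. psum (\<lambda>us vs. H (u # us) (v # vs) (z # zs)) (cops is ys)) (cops is xs')) y) x"
    unfolding sw_def by (subst psum_swap) (rule refl)
  also have "\<dots> = c.cs (\<lambda>y z. c.cs (\<lambda>u v. K u v z) y) x"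
    unfolding K_def by (intro c.cs_cong[OF xs(2)] c.cs_cong Cons.IH[OF I _ xs(3)] H)
  also have "\<dots> = c.cs (\<lambda>y z. c.cs (\<lambda>u v. K y u v) z) x"
    by (rule c.coassoc[OF W K xs(2)])
  also have "\<dots> = c.cs (\<lambda>y z. psum (\<lambda>ys zs. c.cs (\<lambda>u v. psum (\<lambda>us vs. H (y # ys) (u # us) (v # vs)) (cops is zs)) z) (cops is xs')) x"
    unfolding sw_def K_def by (subst (2) psum_swap) (rule refl)
  also have "\<dots> = psum (\<lambda>ys zs. psum (\<lambda>us vs. H ys us vs) (cops (i # is) zs)) (cops (i # is) xs)"
    by (simp only: psum_cops_Cons xs(1))
  finally show ?case .
qed

lemma psum_cops_cocomm:
  assumes W: "vector_space s'" "module.subspace s' W"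
  shows "set is \<subseteq> I \<Longrightarrow> bimultilinear_on s' is W H \<Longrightarrow> xs \<in> L is \<Longrightarrow>
    psum (\<lambda>ys zs. H zs ys) (cops is xs) = psum H (cops is xs)"
proof (induction "is" arbitrary: H xs)
  case Nil
  then show ?case by simp
next
  case (Cons i "is")
  then obtain x xs' where xs: "xs = x # xs'" "x \<in> C i" "xs' \<in> L is" by (auto simp: set_Cons_def)
  interpret c: coalgebra s "C i" "\<Delta> i" "\<epsilon> i" using Cons.prems by (intro component) auto
  have I: "set is \<subseteq> I" using Cons.prems by simp
  note H = bimultilinear_on_Cons[OF Cons.prems(2)]
  have "psum (\<lambda>ys zs. H zs ys) (cops (i # is) xs) = c.cs (\<lambda>y z. psum (\<lambda>ys zs. H (z # zs) (y # ys)) (cops is xs')) x"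
    by (simp only: psum_cops_Cons xs(1))
  also have "\<dots> = c.cs (\<lambda>y z. psum (\<lambda>ys zs. H (z # ys) (y # zs)) (cops is xs')) x"
    by (intro c.cs_cong[OF xs(2)] Cons.IH[OF I _ xs(3)] H)
  also have "\<dots> = c.cs (\<lambda>y z. psum (\<lambda>ys zs. H (y # ys) (z # zs)) (cops is xs')) x"
    by (intro c.cocomm[OF W _ xs(2)] bilinear_on_psum[OF W cops_in[OF I xs(3)]] H)
  also have "\<dots> = psum H (cops (i # is) xs)"
    by (simp only: psum_cops_Cons xs(1))
  finally show ?case .
qed

lemma psum_cops_counit:
  assumes W: "vector_space s'" "module.subspace s' W"
  shows "set is \<subseteq> I \<Longrightarrow> multilinear_on s s' (map C is) W g \<Longrightarrow> xs \<in> L is \<Longrightarrow>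
    psum (\<lambda>ys zs. s' (pcounit is ys) (g zs)) (cops is xs) = g xs"
proof (induction "is" arbitrary: g xs)
  case Nil
  then show ?case by (simp add: vector_space_one[OF W(1)])
next
  case (Cons i "is")
  then obtain x xs' where xs: "xs = x # xs'" "x \<in> C i" "xs' \<in> L is" by (auto simp: set_Cons_def)
  interpret c: coalgebra s "C i" "\<Delta> i" "\<epsilon> i" using Cons.prems by (intro component) auto
  have I: "set is \<subseteq> I" using Cons.prems by simp
  have g: "multilinear_on s s' (map C is) W (\<lambda>zs. g (z # zs))" if "z \<in> C i" for z
    using Cons.prems(2) that by simp
  have "psum (\<lambda>ys zs. s' (pcounit (i # is) ys) (g zs)) (cops (i # is) xs) =
    c.cs (\<lambda>y z. psum (\<lambda>ys zs. s' (\<epsilon> i y) (s' (pcounit is ys) (g (z # zs)))) (cops is xs')) x"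
    by (simp only: psum_cops_Cons xs(1) pcounit.simps list.sel vector_space_scale[OF W(1)])
  \<comment> \<open>The counit of the head leg does not depend on the tail and leaves the tail sum
    by linearity, which brings that sum into the form of the induction hypothesis.\<close>
  also have "\<dots> = c.cs (\<lambda>y z. s' (\<epsilon> i y) (psum (\<lambda>ys zs. s' (pcounit is ys) (g (z # zs))) (cops is xs'))) x"
    by (intro c.cs_cong[OF xs(2)] linear_on_apply_psum_cops[symmetric, OF W linear_on_smult[OF W] I xs(3)]
        subspace_smult[OF W] multilinear_on_in[OF g])
  also have "\<dots> = c.cs (\<lambda>y z. s' (\<epsilon> i y) (g (z # xs'))) x"
    by (intro c.cs_cong[OF xs(2)] arg_cong[of _ _ "s' _"] Cons.IH[OF I _ xs(3)] g)
  also have "\<dots> = g xs"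
    using Cons.prems(2) xs c.counit(1)[OF _ xs(2), of s' W "\<lambda>z. g (z # xs')"] by simp
  finally show ?case .
qed

lemma tcons:
  assumes "set is \<subseteq> I" "i \<in> I" "y \<in> C i"
  shows "tcons s (map C is) y \<in> Hom tscale tscale (T is) (T (i # is))"
    and "ys \<in> L is \<Longrightarrow> tcons s (map C is) y (tpure s ys) = tpure s (y # ys)"
proof -
  have "multilinear_on s tscale (map C (i # is)) (T (i # is)) (tpure s)"
    using assms by (intro multilinear_on_tpure[OF vs] subspace_components) auto
  then have "multilinear_on s tscale (map C is) (T (i # is)) (\<lambda>ys. tpure s (y # ys))"
    using assms(3) by simp
  note * = tlift[OF vs vector_space_tscale subspace_tspace subspace_components[OF assms(1)] this]
  show "tcons s (map C is) y \<in> Hom tscale tscale (T is) (T (i # is))"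
    unfolding tcons_def by (rule *(1))
  show "ys \<in> L is \<Longrightarrow> tcons s (map C is) y (tpure s ys) = tpure s (y # ys)"
    unfolding tcons_def by (rule *(2))
qed

abbreviation tt :: "'v list \<Rightarrow> 'v list \<Rightarrow> ('k, ('k, 'v) tensor) tensor"
  where "tt ys zs \<equiv> tpure tscale [tpure s ys, tpure s zs]"

lemma bilinear_on_tensor_pure:
  "bilinear_on tscale tscale (T is) (tspace tscale [T is, T is]) (\<lambda>p q. tpure tscale [p, q])"
  by (rule bilinear_on_tpure[OF vector_space_tscale subspace_tspace])

lemma bimultilinear_on_pure:
  assumes "set is \<subseteq> I" "bilinear_on tscale s' (T is) W h"
  shows "bimultilinear_on s' is W (\<lambda>ys zs. h (tpure s ys) (tpure s zs))"
  using assms(2) unfolding bimultilinear_on_def bilinear_on_def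
  by (auto intro!: multilinear_on_compose[OF multilinear_on_tpure[OF vs subspace_components[OF assms(1)]]] tpure_in_tspace)

lemma trimultilinear_on_pure:
  assumes "set is \<subseteq> I" "trilinear_on tscale s' (T is) W h"
  shows "trimultilinear_on s' is W (\<lambda>xs ys zs. h (tpure s xs) (tpure s ys) (tpure s zs))"
  using assms(2) unfolding trimultilinear_on_def trilinear_on_def
  by (auto intro!: multilinear_on_compose[OF multilinear_on_tpure[OF vs subspace_components[OF assms(1)]]]
      bimultilinear_on_pure[OF assms(1)] tpure_in_tspace)

lemma tt_in: "ys \<in> L is \<Longrightarrow> zs \<in> L is \<Longrightarrow> tt ys zs \<in> tspace tscale [T is, T is]"
  by (intro tpure_in_tspace) (auto simp: set_Cons_def intro: tpure_in_tspace)

text \<open>The defining recursion is a nest of induced maps. By induction the coproduct of the tail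
  is a sum of pure pairs, and on these the effect of prepending the head legs is known.\<close>

lemma comult_pure:
  "set is \<subseteq> I \<Longrightarrow> xs \<in> L is \<Longrightarrow> comult_pure s (map (\<lambda>i. (C i, \<Delta> i)) is) xs = psum tt (cops is xs)"
proof (induction "is" arbitrary: xs)
  case Nil
  then show ?case by simp
next
  case (Cons i "is")
  then obtain x xs' where xs: "xs = x # xs'" "x \<in> C i" "xs' \<in> L is" by (auto simp: set_Cons_def)
  have i: "i \<in> I" and I: "set is \<subseteq> I" using Cons.prems by auto
  interpret c: coalgebra s "C i" "\<Delta> i" "\<epsilon> i" by (rule component[OF i])
  note V = vector_space_tscale subspace_tspace
  let ?T = "tspace tscale [T (i # is), T (i # is)]"
  have inner: "tlift2 tscale tscale (T is) (\<lambda>p q. tpure tscale [tcons s (map C is) y p, tcons s (map C is) z q])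
      (psum tt (cops is xs')) = psum (\<lambda>ys zs. tt (y # ys) (z # zs)) (cops is xs')"
    if y: "y \<in> C i" and z: "z \<in> C i" for y z
  proof -
    let ?h = "\<lambda>p q. tpure tscale [tcons s (map C is) y p, tcons s (map C is) z q]"
    note ty = tcons[OF I i y] and tz = tcons[OF I i z]
    have h: "bilinear_on tscale tscale (T is) ?T ?h"
      using ty(1) tz(1) bilinear_on_precompose[OF bilinear_on_tensor_pure[of "i # is"]]
      unfolding Hom_def mem_Collect_eq by blast
    have m: "\<And>ys. ys \<in> L is \<Longrightarrow> tpure s ys \<in> T is" by (rule tpure_in_tspace)
    note l = tlift2_pure[OF V V h]
    have "tlift2 tscale tscale (T is) ?h (psum tt (cops is xs')) =
        psum (\<lambda>ys zs. tlift2 tscale tscale (T is) ?h (tt ys zs)) (cops is xs')"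
    proof (rule linear_on_apply_psum_cops[OF V _ I xs(3)])
      show "linear_on tscale tscale (tspace tscale [T is, T is]) ?T (tlift2 tscale tscale (T is) ?h)"
        using l(1) unfolding Hom_def by blast
    qed (rule tt_in)
    also have "\<dots> = psum (\<lambda>ys zs. tt (y # ys) (z # zs)) (cops is xs')"
      by (rule psum_cops_cong[OF I xs(3)]) (simp add: l(2) m ty tz)
    finally show ?thesis .
  qed
  have bi: "bilinear_on s tscale (C i) ?T (\<lambda>y z. psum (\<lambda>ys zs. tt (y # ys) (z # zs)) (cops is xs'))"
    using bimultilinear_on_pure[OF Cons.prems(1) bilinear_on_tensor_pure]
    by (intro bilinear_on_psum[OF V cops_in[OF I xs(3)]] bimultilinear_on_Cons(2)[of tscale i "is" _ tt])
  have "comult_pure s (map (\<lambda>i. (C i, \<Delta> i)) (i # is)) xs =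
    tlift2 s tscale (C i) (\<lambda>y z. psum (\<lambda>ys zs. tt (y # ys) (z # zs)) (cops is xs')) (\<Delta> i x)"
    unfolding xs(1) by (simp add: Let_def Cons.IH[OF I xs(3)] o_def inner cong: tlift2_cong)
  also have "\<dots> = c.cs (\<lambda>y z. psum (\<lambda>ys zs. tt (y # ys) (z # zs)) (cops is xs')) x"
    by (rule c.tlift2_eq_cs[OF V bi xs(2)])
  also have "\<dots> = psum tt (cops (i # is) xs)" by (simp only: psum_cops_Cons xs(1))
  finally show ?case .
qed

lemma tcomult:
  assumes I: "set is \<subseteq> I"
  shows "tcomult is \<in> Hom tscale tscale (T is) (tspace tscale [T is, T is])"
    and "xs \<in> L is \<Longrightarrow> tcomult is (tpure s xs) = psum tt (cops is xs)"
proof -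
  note V = vector_space_tscale subspace_tspace
  have m: "map fst (map (\<lambda>i. (C i, \<Delta> i)) is) = map C is" by (simp add: o_def)
  have "multilinear_on s tscale (map C is) (tspace tscale [T is, T is]) (comult_pure s (map (\<lambda>i. (C i, \<Delta> i)) is))"
    by (rule multilinear_on_cong[OF vs subspace_components[OF I] comult_pure[OF I, symmetric]
        psum_cops_multilinear[OF V I bimultilinear_on_pure[OF I bilinear_on_tensor_pure]]])
  note * = tlift[OF vs V subspace_components[OF I] this]
  show "tcomult is \<in> Hom tscale tscale (T is) (tspace tscale [T is, T is])"
    unfolding tcomult_def tensor_comult_def m by (rule *(1))
  show "xs \<in> L is \<Longrightarrow> tcomult is (tpure s xs) = psum tt (cops is xs)"
    unfolding tcomult_def tensor_comult_def m by (simp add: *(2) comult_pure[OF I])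
qed

lemma pcounit_eq: "xs \<in> L is \<Longrightarrow> prod_list (map2 (\<lambda>C x. snd C x) (map (\<lambda>i. (C i, \<epsilon> i)) is) xs) = pcounit is xs"
  by (induction "is" arbitrary: xs) (auto simp: set_Cons_def)

lemma multilinear_on_pcounit: "set is \<subseteq> I \<Longrightarrow> multilinear_on s (*) (map C is) UNIV (pcounit is)"
proof (induction "is")
  case (Cons i "is")
  interpret c: coalgebra s "C i" "\<Delta> i" "\<epsilon> i" using Cons.prems by (intro component) auto
  have "multilinear_on s (*) (map C is) UNIV (\<lambda>xs. \<epsilon> i x * pcounit is xs)" for x
  proof (rule multilinear_on_compose[where g = "(*) (\<epsilon> i x)"])
    show "multilinear_on s (*) (map C is) UNIV (pcounit is)" using Cons by simp
    show "linear_on (*) (*) UNIV UNIV ((*) (\<epsilon> i x))"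
      by (intro linear_on_smult vector_space_mult subspace_whole)
  qed
  moreover have "linear_on s (*) (C i) UNIV (\<lambda>x. \<epsilon> i x * pcounit is xs)" for xs
    by (rule linear_on_scale_left[OF vector_space_mult subspace_whole[OF vector_space_mult] c.\<epsilon>]) simp
  ultimately show ?case by simp
qed simp

lemma tcounit:
  assumes I: "set is \<subseteq> I"
  shows "tcounit is \<in> Hom tscale (*) (T is) UNIV"
    and "xs \<in> L is \<Longrightarrow> tcounit is (tpure s xs) = pcounit is xs"
proof -
  have m: "map fst (map (\<lambda>i. (C i, \<epsilon> i)) is) = map C is" by (simp add: o_def)
  let ?f = "\<lambda>xs. prod_list (map2 (\<lambda>C x. snd C x) (map (\<lambda>i. (C i, \<epsilon> i)) is) xs)"
  have "multilinear_on s (*) (map C is) UNIV ?f"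
    by (rule multilinear_on_cong[OF vs subspace_components[OF I] pcounit_eq[symmetric] multilinear_on_pcounit[OF I]])
  note * = tlift[OF vs vector_space_mult subspace_whole[OF vector_space_mult] subspace_components[OF I] this]
  show "tcounit is \<in> Hom tscale (*) (T is) UNIV"
    unfolding tcounit_def tensor_counit_def m by (rule *(1))
  show "xs \<in> L is \<Longrightarrow> tcounit is (tpure s xs) = pcounit is xs"
    unfolding tcounit_def tensor_counit_def m by (simp only: *(2) pcounit_eq)
qed

lemma precoalgebra_tensor:
  assumes I: "set is \<subseteq> I"
  shows "precoalgebra tscale (T is) (tcomult is) (tcounit is)"
  using tcomult(1)[OF I] tcounit(1)[OF I] unfolding Hom_def
  by (intro precoalgebra.intro vector_space_tscale subspace_tspace) blast+

text \<open>\<open>sw\<close> uses the decomposition chosen for the coproduct of the tensor as a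
  whole, \<open>cops\<close> those chosen factor by factor. Bilinearity of \<open>h\<close> makes
  the two sums agree.\<close>

lemma sw_tcomult:
  assumes I: "set is \<subseteq> I" and W: "vector_space s'" "module.subspace s' W"
    and h: "bilinear_on tscale s' (T is) W h" and xs: "xs \<in> L is"
  shows "sw tscale (T is) h (tcomult is (tpure s xs)) = psum (\<lambda>ys zs. h (tpure s ys) (tpure s zs)) (cops is xs)"
proof -
  note V = vector_space_tscale subspace_tspace
  have "sw tscale (T is) h (psum tt (cops is xs)) = psum (\<lambda>ys zs. sw tscale (T is) h (tt ys zs)) (cops is xs)"
    by (rule linear_on_apply_psum_cops[OF V sw_linear[OF V W h] I xs tt_in])
  also have "\<dots> = psum (\<lambda>ys zs. h (tpure s ys) (tpure s zs)) (cops is xs)"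
    by (intro psum_cops_cong[OF I xs] sw_pure[OF V W h] tpure_in_tspace)
  finally show ?thesis by (simp add: tcomult(2)[OF I xs])
qed

text \<open>Both sides of every axiom are linear, hence determined by pure tensors, where they are
  the identities proved for \<open>cops\<close>.\<close>

theorem coalgebra_tensor:
  assumes I: "set is \<subseteq> I"
  shows "coalgebra tscale (T is) (tcomult is) (tcounit is)"
proof -
  interpret p: precoalgebra tscale "T is" "tcomult is" "tcounit is" by (rule precoalgebra_tensor[OF I])
  note V = vector_space_tscale subspace_tspace
  note pure = sw_tcomult[OF I V]
  note tri = trilinear_on_tpure[OF V]
  have mem: "\<And>xs. xs \<in> L is \<Longrightarrow> tpure s xs \<in> T is" by (rule tpure_in_tspace)
  have bi: "bilinear_on tscale tscale (T is) (tspace tscale [T is, T is, T is]) (\<lambda>u v. tpure tscale [u, v, y])"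
    "bilinear_on tscale tscale (T is) (tspace tscale [T is, T is, T is]) (\<lambda>u v. tpure tscale [y, u, v])" if "y \<in> T is" for y
    using tri[of s "map C is"] that by (auto simp: trilinear_on_def bilinear_on_def)
  have "p.cs (\<lambda>x y. p.cs (\<lambda>u v. tpure tscale [u, v, y]) x) c = p.cs (\<lambda>x y. p.cs (\<lambda>u v. tpure tscale [x, u, v]) y) c"
    if "c \<in> T is" for c
  proof (rule linear_on_tspace_eqI[OF p.cs_linear[OF V p.trilinear_cs_left[OF V tri]] p.cs_linear[OF V p.trilinear_cs_right[OF V tri]] _ that])
    fix xs assume xs: "xs \<in> L is"
    have "p.cs (\<lambda>x y. p.cs (\<lambda>u v. tpure tscale [u, v, y]) x) (tpure s xs) =
      psum (\<lambda>ys zs. p.cs (\<lambda>u v. tpure tscale [u, v, tpure s zs]) (tpure s ys)) (cops is xs)"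
      by (rule pure[OF p.trilinear_cs_left[OF V tri] xs])
    also have "\<dots> = psum (\<lambda>ys zs. psum (\<lambda>us vs. tpure tscale [tpure s us, tpure s vs, tpure s zs]) (cops is ys)) (cops is xs)"
      by (intro psum_cops_cong[OF I xs] pure[OF bi(1)] mem)
    also have "\<dots> = psum (\<lambda>ys zs. psum (\<lambda>us vs. tpure tscale [tpure s ys, tpure s us, tpure s vs]) (cops is zs)) (cops is xs)"
      by (rule psum_cops_coassoc[OF V I trimultilinear_on_pure[OF I tri] xs])
    also have "\<dots> = psum (\<lambda>ys zs. p.cs (\<lambda>u v. tpure tscale [tpure s ys, u, v]) (tpure s zs)) (cops is xs)"
      by (intro psum_cops_cong[OF I xs] pure[symmetric, OF bi(2)] mem)
    also have "\<dots> = p.cs (\<lambda>x y. p.cs (\<lambda>u v. tpure tscale [x, u, v]) y) (tpure s xs)"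
      by (rule pure[OF p.trilinear_cs_right[OF V tri] xs, symmetric])
    finally show "p.cs (\<lambda>x y. p.cs (\<lambda>u v. tpure tscale [u, v, y]) x) (tpure s xs) =
      p.cs (\<lambda>x y. p.cs (\<lambda>u v. tpure tscale [x, u, v]) y) (tpure s xs)" .
  qed
  moreover have cu: "p.cs (\<lambda>x y. tscale (tcounit is x) y) c = c" if "c \<in> T is" for c
  proof (rule linear_on_tspace_eqI[OF p.cs_linear[OF V p.bilinear_counit(1)] linear_on_id _ that])
    fix xs assume xs: "xs \<in> L is"
    have "p.cs (\<lambda>x y. tscale (tcounit is x) y) (tpure s xs) =
      psum (\<lambda>ys zs. tscale (tcounit is (tpure s ys)) (tpure s zs)) (cops is xs)"
      by (rule pure[OF p.bilinear_counit(1) xs])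
    also have "\<dots> = psum (\<lambda>ys zs. tscale (pcounit is ys) (tpure s zs)) (cops is xs)"
      by (rule psum_cops_cong[OF I xs]) (simp add: tcounit(2)[OF I])
    also have "\<dots> = tpure s xs"
      by (rule psum_cops_counit[OF V I multilinear_on_tpure[OF vs subspace_components[OF I]] xs])
    finally show "p.cs (\<lambda>x y. tscale (tcounit is x) y) (tpure s xs) = tpure s xs" .
  qed
  \<comment> \<open>Stated for general \<open>h\<close> with values in tensors over any type because
    it serves twice: it turns one counit law into the other, and for \<open>tpure\<close> it is
    cocommutativity.\<close>
  moreover have flip: "p.cs (\<lambda>x y. h y x) c = p.cs h c"
    if h: "bilinear_on tscale tscale (T is) W h" and W: "module.subspace tscale W" and c: "c \<in> T is"
    for c W and h :: "('k, 'v) tensor \<Rightarrow> ('k, 'v) tensor \<Rightarrow> ('k, 'x) tensor"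
  proof (rule linear_on_tspace_eqI[OF p.cs_linear[OF V(1) W] p.cs_linear[OF V(1) W h] _ c])
    show h': "bilinear_on tscale tscale (T is) W (\<lambda>x y. h y x)" using h by (auto simp: bilinear_on_def)
    fix xs assume xs: "xs \<in> L is"
    show "p.cs (\<lambda>x y. h y x) (tpure s xs) = p.cs h (tpure s xs)"
      using psum_cops_cocomm[OF V(1) W I bimultilinear_on_pure[OF I h] xs]
      by (simp add: sw_tcomult[OF I V(1) W h xs] sw_tcomult[OF I V(1) W h' xs])
  qed
  moreover have "p.cs (\<lambda>x y. tscale (tcounit is y) x) c = c" if "c \<in> T is" for c
    using flip[OF p.bilinear_counit(1) subspace_tspace that] cu[OF that] by simp
  moreover have "p.cs (\<lambda>x y. tpure tscale [y, x]) c = tcomult is c" if "c \<in> T is" for c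
    using flip[OF bilinear_on_tensor_pure subspace_tspace that]
      tdecomp(2)[OF V linear_on_in[OF p.\<Delta> that]] by (simp add: sw_def)
  ultimately show ?thesis
    by (intro coalgebraI V) (simp add: p.cocomm_coalgebra_iff)
qed

end

text \<open>The third part is the form in which a morphism is used: a coproduct taken after
  \<open>g\<close> is taken before it instead, with \<open>g\<close> applied to both legs.\<close>

lemma coalgebra_mor_sw:
  assumes "coalgebra s C \<Delta> \<epsilon>" "coalgebra s' C' \<Delta>' \<epsilon>'" and g: "coalgebra_mor s C \<Delta> \<epsilon> s' C' \<Delta>' \<epsilon>' g"
  shows "linear_on s s' C C' g" and "c \<in> C \<Longrightarrow> \<epsilon>' (g c) = \<epsilon> c"
    and "vector_space r \<Longrightarrow> module.subspace r W \<Longrightarrow> bilinear_on s' r C' W h \<Longrightarrow> c \<in> C \<Longrightarrow>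
      sw s' C' h (\<Delta>' (g c)) = sw s C (\<lambda>x y. h (g x) (g y)) (\<Delta> c)"
proof -
  interpret a: coalgebra s C \<Delta> \<epsilon> by fact
  interpret b: coalgebra s' C' \<Delta>' \<epsilon>' by fact
  note V = vector_space_tscale subspace_tspace
  show lin: "linear_on s s' C C' g" using g unfolding coalgebra_mor_def Hom_def by blast
  show "c \<in> C \<Longrightarrow> \<epsilon>' (g c) = \<epsilon> c" using g unfolding coalgebra_mor_def by blast
  assume W: "vector_space r" "module.subspace r W" and h: "bilinear_on s' r C' W h" and c: "c \<in> C"
  have bi: "bilinear_on s tscale C (tspace s' [C', C']) (\<lambda>x y. tpure s' [g x, g y])"
    by (rule bilinear_on_precompose[OF bilinear_on_tpure[OF b.vs b.C] lin lin])
  have "\<Delta>' (g c) = tlift2 s tscale C (\<lambda>x y. tpure s' [g x, g y]) (\<Delta> c)"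
    using g c unfolding coalgebra_mor_def by blast
  also have "\<dots> = a.cs (\<lambda>x y. tpure s' [g x, g y]) c" by (rule a.tlift2_eq_cs[OF V bi c])
  finally have "sw s' C' h (\<Delta>' (g c)) = sw s' C' h (a.cs (\<lambda>x y. tpure s' [g x, g y]) c)" by simp
  also have "\<dots> = a.cs (\<lambda>x y. sw s' C' h (tpure s' [g x, g y])) c"
    by (rule a.linear_on_apply_cs[OF c V sw_linear[OF b.vs b.C W h]]) (rule bilinear_on_in[OF bi])
  also have "\<dots> = a.cs (\<lambda>x y. h (g x) (g y)) c"
    by (intro a.cs_cong[OF c] sw_pure[OF b.vs b.C W h] linear_on_in[OF lin])
  finally show "sw s' C' h (\<Delta>' (g c)) = a.cs (\<lambda>x y. h (g x) (g y)) c" .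
qed

section \<open>Pairing of coalgebra morphisms\<close>

context coalgebra
begin

text \<open>The four legs of an iterated coproduct are regrouped so that the inner two come from one
  coproduct, swapped there by cocommutativity, and grouped back. This is where cocommutativity makes
  the pairing of two morphisms a morphism.\<close>

lemma interchange:
  assumes W: "vector_space s'" "module.subspace s' W" and c: "c \<in> C"
    and k: "\<And>a. a \<in> C \<Longrightarrow> trilinear_on s s' C W (k a)"
      "\<And>x y z. x \<in> C \<Longrightarrow> y \<in> C \<Longrightarrow> z \<in> C \<Longrightarrow> linear_on s s' C W (\<lambda>a. k a x y z)"
  shows "cs (\<lambda>x y. cs (\<lambda>a b. cs (\<lambda>c d. k a b c d) y) x) c = cs (\<lambda>x y. cs (\<lambda>a b. cs (\<lambda>c d. k a c b d) y) x) c"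
proof -
  \<comment> \<open>From (a b)(c d) to a(b(c d)): coassociativity for the map in \<open>a\<close>,
    \<open>b\<close> and the still unsplit \<open>y\<close>. It is kept general in \<open>k\<close>
    because it is used again, backwards, after the swap.\<close>
  have assoc: "cs (\<lambda>x y. cs (\<lambda>a b. cs (\<lambda>c d. k a b c d) y) x) c = cs (\<lambda>a r. cs (\<lambda>b y. cs (\<lambda>c d. k a b c d) y) r) c"
    if "\<And>a. a \<in> C \<Longrightarrow> trilinear_on s s' C W (k a)"
      "\<And>x y z. x \<in> C \<Longrightarrow> y \<in> C \<Longrightarrow> z \<in> C \<Longrightarrow> linear_on s s' C W (\<lambda>a. k a x y z)" for k
  proof (rule coassoc[OF W _ c])
    show "trilinear_on s s' C W (\<lambda>a b y. cs (\<lambda>c d. k a b c d) y)"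
      unfolding trilinear_on_def
    proof (intro conjI ballI)
      show "bilinear_on s s' C W (\<lambda>b y. cs (\<lambda>c d. k a b c d) y)" if "a \<in> C" for a
        by (rule trilinear_cs_right[OF W \<open>\<And>a. a \<in> C \<Longrightarrow> trilinear_on s s' C W (k a)\<close>[OF that]])
      show "linear_on s s' C W (\<lambda>a. cs (\<lambda>c d. k a b c d) y)" if "b \<in> C" "y \<in> C" for b y
        using that by (intro linear_on_cs[OF _ W] \<open>\<And>x y z. _ \<Longrightarrow> _ \<Longrightarrow> _ \<Longrightarrow> linear_on s s' C W (\<lambda>a. k a x y z)\<close>)
    qed
  qed
  have k': "trilinear_on s s' C W (\<lambda>b c d. k a c b d)" if "a \<in> C" for a
    using k(1)[OF that] by (auto simp: trilinear_on_def bilinear_on_def)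
  have k'': "bilinear_on s s' C W (\<lambda>b c. k a b c d)" if "a \<in> C" "d \<in> C" for a d
    using k(1)[OF that(1)] that(2) by (auto simp: trilinear_on_def bilinear_on_def)
  have "cs (\<lambda>x y. cs (\<lambda>a b. cs (\<lambda>c d. k a b c d) y) x) c = cs (\<lambda>a r. cs (\<lambda>b y. cs (\<lambda>c d. k a b c d) y) r) c"
    by (rule assoc[OF k])
  also have "\<dots> = cs (\<lambda>a r. cs (\<lambda>x d. cs (\<lambda>b c. k a b c d) x) r) c"
    by (intro cs_cong[OF c] coassoc[symmetric, OF W k(1)])
  also have "\<dots> = cs (\<lambda>a r. cs (\<lambda>x d. cs (\<lambda>b c. k a c b d) x) r) c"
    by (intro cs_cong[OF c] cs_cong cocomm[symmetric, OF W k''])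
  also have "\<dots> = cs (\<lambda>a r. cs (\<lambda>b y. cs (\<lambda>c d. k a c b d) y) r) c"
    by (intro cs_cong[OF c] coassoc[OF W k'])
  also have "\<dots> = cs (\<lambda>x y. cs (\<lambda>a b. cs (\<lambda>c d. k a c b d) y) x) c"
    by (rule assoc[symmetric, OF k' k(2)])
  finally show ?thesis .
qed

end

locale coalgebra_pairing = coalgebra_family s I C \<Delta> \<epsilon> + D: coalgebra r D \<Delta>\<^sub>D \<epsilon>\<^sub>D
  for s :: "'k::field \<Rightarrow> 'v::ab_group_add \<Rightarrow> 'v" and I :: "'i set" and C \<Delta> \<epsilon>
    and r :: "'k \<Rightarrow> 'd::ab_group_add \<Rightarrow> 'd" and D \<Delta>\<^sub>D \<epsilon>\<^sub>D +
  fixes i j :: 'i and f g :: "'d \<Rightarrow> 'v"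
  assumes i: "i \<in> I" and j: "j \<in> I"
    and f: "coalgebra_mor r D \<Delta>\<^sub>D \<epsilon>\<^sub>D s (C i) (\<Delta> i) (\<epsilon> i) f"
    and g: "coalgebra_mor r D \<Delta>\<^sub>D \<epsilon>\<^sub>D s (C j) (\<Delta> j) (\<epsilon> j) g"
begin

lemmas f_mor = coalgebra_mor_sw[OF D.coalgebra_axioms component[OF i] f]
lemmas g_mor = coalgebra_mor_sw[OF D.coalgebra_axioms component[OF j] g]

text \<open>The composite of \<Delta> with f \<otimes> g. The tensor product is the categorical
  product of cocommutative coalgebras, and this is the map into it with components \<open>f\<close>
  and \<open>g\<close>.\<close>

definition pairing :: "'d \<Rightarrow> ('k, 'v) tensor"
  where "pairing = D.cs (\<lambda>x y. tpure s [f x, g y])"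

lemma ij: "set [i, j] \<subseteq> I" using i j by simp

sublocale P: coalgebra tscale "T [i, j]" "tcomult [i, j]" "tcounit [i, j]"
  by (rule coalgebra_tensor[OF ij])

lemma bilinear_on_tpure_ij:
  shows "a \<in> C i \<Longrightarrow> linear_on s tscale (C j) (T [i, j]) (\<lambda>b. tpure s [a, b])"
    and "b \<in> C j \<Longrightarrow> linear_on s tscale (C i) (T [i, j]) (\<lambda>a. tpure s [a, b])"
  using multilinear_on_tpure[OF vs subspace_components[OF ij]] by (auto simp: set_Cons_def)

lemma tpure_ij: "a \<in> C i \<Longrightarrow> b \<in> C j \<Longrightarrow> tpure s [a, b] \<in> T [i, j]"
  by (rule linear_on_in[OF bilinear_on_tpure_ij(1)])

lemma bilinear_on_fg: "bilinear_on r tscale D (T [i, j]) (\<lambda>x y. tpure s [f x, g y])"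
  unfolding bilinear_on_def
  by (intro conjI ballI linear_on_compose[OF g_mor(1) bilinear_on_tpure_ij(1)] linear_on_in[OF f_mor(1)]
      linear_on_compose[OF f_mor(1) bilinear_on_tpure_ij(2)] linear_on_in[OF g_mor(1)])

lemma fg_in_L: "x \<in> D \<Longrightarrow> y \<in> D \<Longrightarrow> [f x, g y] \<in> L [i, j]"
  by (auto simp: set_Cons_def linear_on_in[OF f_mor(1)] linear_on_in[OF g_mor(1)])

lemma pairing_linear: "linear_on r tscale D (T [i, j]) pairing"
  unfolding pairing_def by (rule D.cs_linear[OF vector_space_tscale subspace_tspace bilinear_on_fg])

lemma tcounit_pairing:
  assumes c: "c \<in> D"
  shows "tcounit [i, j] (pairing c) = \<epsilon>\<^sub>D c"
proof -
  have "tcounit [i, j] (pairing c) = D.cs (\<lambda>x y. tcounit [i, j] (tpure s [f x, g y])) c"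
    unfolding pairing_def
    by (rule D.linear_on_apply_cs[OF c vector_space_tscale subspace_tspace P.\<epsilon> bilinear_on_in[OF bilinear_on_fg]])
  also have "\<dots> = D.cs (\<lambda>x y. \<epsilon>\<^sub>D x * \<epsilon>\<^sub>D y) c"
  proof (rule D.cs_cong[OF c])
    fix x y assume "x \<in> D" "y \<in> D"
    then show "tcounit [i, j] (tpure s [f x, g y]) = \<epsilon>\<^sub>D x * \<epsilon>\<^sub>D y"
      using tcounit(2)[OF ij fg_in_L] by (simp add: f_mor(2) g_mor(2))
  qed
  also have "\<dots> = \<epsilon>\<^sub>D c" by (rule D.counit(1)[OF D.\<epsilon> c])
  finally show ?thesis .
qed

text \<open>The first two arguments of \<open>k\<close> are fed to \<open>f\<close>, the last two to
  \<open>g\<close>. Splitting the image of a term distributes four legs as \<open>k a b c d\<close>,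
  with \<open>a\<close>, \<open>b\<close> from the argument of \<open>f\<close> and
  \<open>c\<close>, \<open>d\<close> from that of \<open>g\<close>; applying \<open>pairing\<close>
  to two legs distributes them as \<open>k a c b d\<close>. The two differ by
  \<open>interchange\<close>.\<close>

theorem tcomult_pairing:
  assumes W: "vector_space s'" "module.subspace s' W" and h: "bilinear_on tscale s' (T [i, j]) W h" and c: "c \<in> D"
  shows "sw tscale (T [i, j]) h (tcomult [i, j] (pairing c)) = D.cs (\<lambda>x y. h (pairing x) (pairing y)) c"
proof -
  note V = vector_space_tscale subspace_tspace
  define k where "k a a' b b' = h (tpure s [f a, g b]) (tpure s [f a', g b'])" for a a' b b'
  have h1: "linear_on tscale s' (T [i, j]) W (h p)" "linear_on tscale s' (T [i, j]) W (\<lambda>q. h q p)" if "p \<in> T [i, j]" for p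
    using h that by (auto simp: bilinear_on_def)
  have fg: "linear_on r tscale D (T [i, j]) (\<lambda>y. tpure s [f x, g y])" "linear_on r tscale D (T [i, j]) (\<lambda>y. tpure s [f y, g x])" if "x \<in> D" for x
    using bilinear_on_fg that by (auto simp: bilinear_on_def)
  note m = bilinear_on_in[OF bilinear_on_fg] 
  have k: "linear_on r s' D W (\<lambda>b. k a b c d)" "linear_on r s' D W (\<lambda>b. k b a c d)" "linear_on r s' D W (\<lambda>b. k a c b d)"
    "linear_on r s' D W (\<lambda>b. k a c d b)" if "a \<in> D" "c \<in> D" "d \<in> D" for a c d
    unfolding k_def using that
    by (auto intro: linear_on_compose[OF fg(1) h1(1)] linear_on_compose[OF fg(2) h1(1)]
        linear_on_compose[OF fg(1) h1(2)] linear_on_compose[OF fg(2) h1(2)] m)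
  have tri: "trilinear_on r s' D W (k a)" if "a \<in> D" for a
    using that by (simp add: trilinear_on_def bilinear_on_def k)
  have "sw tscale (T [i, j]) h (tcomult [i, j] (pairing c)) =
      D.cs (\<lambda>x y. P.cs h (tpure s [f x, g y])) c"
    unfolding pairing_def by (rule D.linear_on_apply_cs[OF c V P.cs_linear[OF W h] m])
  also have "\<dots> = D.cs (\<lambda>x y. D.cs (\<lambda>a b. D.cs (\<lambda>c d. k a b c d) y) x) c"
  proof (rule D.cs_cong[OF c])
    fix x y assume x: "x \<in> D" and y: "y \<in> D"
    have L: "[f x, g y] \<in> L [i, j]"
      by (rule fg_in_L[OF x y])
    have inner: "sw s (C j) (\<lambda>b b'. h (tpure s [a, b]) (tpure s [a', b'])) (\<Delta> j (g y)) =
        D.cs (\<lambda>b b'. h (tpure s [a, g b]) (tpure s [a', g b'])) y" if "a \<in> C i" "a' \<in> C i" for a a'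
      using that by (intro g_mor(3)[OF W _ y] bilinear_on_precompose[OF h] bilinear_on_tpure_ij)
    have bi: "bilinear_on s s' (C i) W (\<lambda>a a'. D.cs (\<lambda>b b'. h (tpure s [a, g b]) (tpure s [a', g b'])) y)"
      unfolding bilinear_on_def
      by (auto intro!: D.linear_on_cs[OF y W] intro: linear_on_compose[OF bilinear_on_tpure_ij(2) h1(1)]
          linear_on_compose[OF bilinear_on_tpure_ij(2) h1(2)] tpure_ij linear_on_in[OF g_mor(1)])
    have "P.cs h (tpure s [f x, g y]) = psum (\<lambda>ys zs. h (tpure s ys) (tpure s zs)) (cops [i, j] [f x, g y])"
      by (rule sw_tcomult[OF ij W h L])
    also have "\<dots> = sw s (C i) (\<lambda>a a'. sw s (C j) (\<lambda>b b'. h (tpure s [a, b]) (tpure s [a', b'])) (\<Delta> j (g y))) (\<Delta> i (f x))"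
      by (simp only: psum_cops_Cons psum_cops_Nil)
    also have "\<dots> = sw s (C i) (\<lambda>a a'. D.cs (\<lambda>b b'. h (tpure s [a, g b]) (tpure s [a', g b'])) y) (\<Delta> i (f x))"
      using component[OF i] x unfolding coalgebra_def precoalgebra_def
      by (intro sw_cong[OF vs subspace_component[OF i]] inner) (auto intro: linear_on_in[OF f_mor(1)] linear_on_in)
    also have "\<dots> = D.cs (\<lambda>a b. D.cs (\<lambda>c d. k a b c d) y) x"
      unfolding k_def by (rule f_mor(3)[OF W bi x])
    finally show "P.cs h (tpure s [f x, g y]) = D.cs (\<lambda>a b. D.cs (\<lambda>c d. k a b c d) y) x" .
  qed
  also have "\<dots> = D.cs (\<lambda>x y. D.cs (\<lambda>a b. D.cs (\<lambda>c d. k a c b d) y) x) c"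
    by (rule D.interchange[OF W c tri k(2)])
  also have "\<dots> = D.cs (\<lambda>x y. h (pairing x) (pairing y)) c"
  proof (rule D.cs_cong[OF c, symmetric])
    fix x y assume x: "x \<in> D" and y: "y \<in> D"
    have "h (pairing x) (pairing y) = D.cs (\<lambda>a b. h (tpure s [f a, g b]) (pairing y)) x"
      unfolding pairing_def[THEN fun_cong, of x]
      by (rule D.linear_on_apply_cs[OF x V h1(2)[OF linear_on_in[OF pairing_linear y]] m])
    also have "\<dots> = D.cs (\<lambda>a b. D.cs (\<lambda>c d. k a c b d) y) x"
      unfolding pairing_def k_def
      by (intro D.cs_cong[OF x] D.linear_on_apply_cs[OF y V h1(1)] m)
    finally show "h (pairing x) (pairing y) = D.cs (\<lambda>a b. D.cs (\<lambda>c d. k a c b d) y) x" .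
  qed
  finally show ?thesis .
qed

end

section \<open>Denotations of the rules\<close>

text \<open>Closure of \<open>V\<close> is assumed directly so that the lemma fits both domains for
  which it is meant, spaces of maps and products, with their own scalings.\<close>

lemma inv_into_linear:
  assumes f: "linear_on s s' V W f" and bij: "bij_betw f V W"
    and plus: "\<And>x y. x \<in> V \<Longrightarrow> y \<in> V \<Longrightarrow> x + y \<in> V" and smult: "\<And>c x. x \<in> V \<Longrightarrow> s c x \<in> V"
  shows "linear_on s' s W V (inv_into V f)"
proof (rule linear_onI)
  note inj = bij_betw_imp_inj_on[OF bij] and surj = bij_betw_imp_surj_on[OF bij]
  have in_V: "inv_into V f y \<in> V" if "y \<in> W" for y
    using that surj by (metis inv_into_into)
  then show "y \<in> W \<Longrightarrow> inv_into V f y \<in> V" for y .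
  have f_inv: "f (inv_into V f y) = y" if "y \<in> W" for y
    using that surj by (metis f_inv_into_f)
  show "inv_into V f (x + y) = inv_into V f x + inv_into V f y" if "x \<in> W" "y \<in> W" for x y
    using that in_V f_inv
    by (intro inv_into_f_eq[OF inj]) (auto simp: linear_on_add[OF f] intro!: plus)
  show "inv_into V f (s' c x) = s c (inv_into V f x)" if "x \<in> W" for c x
    using that in_V f_inv
    by (intro inv_into_f_eq[OF inj]) (auto simp: linear_on_scale[OF f] intro!: smult)
qed

lemma multilinear_on_prod:
  assumes "vector_space s" "\<forall>V\<in>set Vs. module.subspace s V"
    and f: "multilinear_on s s' Vs A f" and g: "multilinear_on s s' Vs B g"
  shows "multilinear_on s (prod_scale s') Vs (A \<times> B) (\<lambda>xs. (f xs, g xs))"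
proof (rule multilinear_onI[OF assms(1,2)])
  show "xs \<in> listset Vs \<Longrightarrow> (f xs, g xs) \<in> A \<times> B" for xs
    using multilinear_on_in[OF f] multilinear_on_in[OF g] by simp
  fix xs i assume xs: "xs \<in> listset Vs" and i: "i < length Vs"
  then show "linear_on s (prod_scale s') (Vs ! i) (A \<times> B) (\<lambda>x. (f (xs[i := x]), g (xs[i := x])))"
    using multilinear_on_update[OF f xs i] multilinear_on_update[OF g xs i]
    by (auto simp: linear_on_def prod_scale_def)
qed

text \<open>The map behind right introduction of \<multimap>. The value 0 outside \<open>A\<close>
  is the normalisation that elements of \<open>Hom\<close> must satisfy.\<close>

lemma multilinear_on_curry:
  assumes s: "vector_space s" and s': "vector_space s'" and sub: "\<forall>V\<in>set (A # Vs). module.subspace s V"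
    and f: "multilinear_on s s' (A # Vs) W f"
  shows "multilinear_on s (fun_scale s') Vs (Hom s s' A W) (\<lambda>xs a. if a \<in> A then f (a # xs) else 0)"
proof (rule multilinear_onI[OF s])
  show "\<forall>V\<in>set Vs. module.subspace s V" using sub by simp
  have A: "module.subspace s A" using sub by simp
  show mem: "(\<lambda>a. if a \<in> A then f (a # xs) else 0) \<in> Hom s s' A W" if "xs \<in> listset Vs" for xs
    using f that by (auto simp: Hom_def linear_on_def subspace_plus[OF s A] subspace_smult[OF s A])
  fix xs i assume xs: "xs \<in> listset Vs" and i: "i < length Vs"
  have lin: "linear_on s s' (Vs ! i) W (\<lambda>x. f (a # xs[i := x]))" if "a \<in> A" for a
    using multilinear_on_update[OF f, of "a # xs" "Suc i"] xs i that by (auto simp: set_Cons_def)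
  have upd: "xs[i := x] \<in> listset Vs" if "x \<in> Vs ! i" for x
    using xs i that by (auto simp: listset_nth nth_list_update)
  show "linear_on s (fun_scale s') (Vs ! i) (Hom s s' A W) (\<lambda>x a. if a \<in> A then f (a # xs[i := x]) else 0)"
  proof (rule linear_onI)
    fix x y c assume x: "x \<in> Vs ! i"
    show "(\<lambda>a. if a \<in> A then f (a # xs[i := x]) else 0) \<in> Hom s s' A W" by (rule mem[OF upd[OF x]])
    show "(\<lambda>a. if a \<in> A then f (a # xs[i := x + y]) else 0) =
      (\<lambda>a. if a \<in> A then f (a # xs[i := x]) else 0) + (\<lambda>a. if a \<in> A then f (a # xs[i := y]) else 0)"
      if "y \<in> Vs ! i"
      by (rule ext) (auto simp: plus_fun_apply linear_on_add[OF lin x that])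
    show "(\<lambda>a. if a \<in> A then f (a # xs[i := s c x]) else 0) =
      fun_scale s' c (\<lambda>a. if a \<in> A then f (a # xs[i := x]) else 0)"
    proof (rule ext)
      fix a
      show "(if a \<in> A then f (a # xs[i := s c x]) else 0) =
        fun_scale s' c (\<lambda>a. if a \<in> A then f (a # xs[i := x]) else 0) a"
        by (auto simp: fun_scale_def linear_on_scale[OF lin x] vector_space_zero_right[OF s'])
    qed
  qed
qed

lemma multilinear_on_bilinear:
  assumes "multilinear_on s s' (Us @ [C, C] @ Vs) W f" "us \<in> listset Us" "vs \<in> listset Vs"
  shows "bilinear_on s s' C W (\<lambda>y z. f (us @ y # z # vs))"
  using assms(1)[unfolded multilinear_on_append multilinear_on.simps append_Cons append_Nil] assms(2,3)
  unfolding bilinear_on_def by (auto simp: set_Cons_def)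

text \<open>In the contracted slot linearity comes from that of \<Delta> and of Sweedler sums; in
  any other slot the element being split is fixed, and the value is a finite sum of multilinear
  terms.\<close>

lemma multilinear_on_contract:
  assumes coalg: "coalgebra s C \<Delta> \<epsilon>" and sub: "\<forall>V\<in>set (Us @ Vs). module.subspace s V"
    and W: "vector_space s'" "module.subspace s' W"
    and f: "multilinear_on s s' (Us @ [C, C] @ Vs) W f"
  shows "multilinear_on s s' (Us @ C # Vs) W (\<lambda>xs. sw s C
    (\<lambda>y z. f (take (length Us) xs @ [y, z] @ drop (Suc (length Us)) xs)) (\<Delta> (xs ! length Us)))"
proof -
  interpret c: coalgebra s C \<Delta> \<epsilon> by fact
  note bi = multilinear_on_bilinear[OF f]
  note f = f[unfolded multilinear_on_append multilinear_on.simps append_Cons append_Nil]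
  have m: "y # z # vs \<in> listset (C # C # Vs)" if "y \<in> C" "z \<in> C" "vs \<in> listset Vs" for y z vs
    using that by (auto simp: set_Cons_def)
  note len = listset_length
  note dec = tdecomp(1)[OF c.vs c.C linear_on_in[OF c.\<Delta>]]
  show ?thesis
    unfolding multilinear_on_append multilinear_on.simps
  proof (intro conjI ballI)
    fix xs assume "xs \<in> listset (C # Vs)"
    then obtain x vs where xs: "xs = x # vs" "x \<in> C" "vs \<in> listset Vs" by (rule listset_ConsE)
    have "multilinear_on s s' Us W (\<lambda>us. c.cs (\<lambda>y z. f (us @ y # z # vs)) x)"
      unfolding sw_def using f m[OF _ _ xs(3)] by (intro multilinear_on_psum[OF W dec[OF xs(2)]]) auto
    then show "multilinear_on s s' Us W (\<lambda>us. sw s C (\<lambda>y z. f (take (length Us) (us @ xs) @ [y, z] @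
        drop (Suc (length Us)) (us @ xs))) (\<Delta> ((us @ xs) ! length Us)))"
      by (rule multilinear_on_cong[OF c.vs, rotated 2]) (use sub in \<open>auto simp: xs nth_append dest: len\<close>)
  next
    fix us vs assume us: "us \<in> listset Us" and vs: "vs \<in> listset Vs"
    show "linear_on s s' C W (\<lambda>x. sw s C (\<lambda>y z. f (take (length Us) (us @ x # vs) @ [y, z] @
        drop (Suc (length Us)) (us @ x # vs))) (\<Delta> ((us @ x # vs) ! length Us)))"
      using c.cs_linear[OF W bi[OF us vs]] by (simp add: len[OF us] nth_append)
  next
    fix us x assume us: "us \<in> listset Us" and x: "x \<in> C"
    have "multilinear_on s s' Vs W (\<lambda>vs. c.cs (\<lambda>y z. f (us @ y # z # vs)) x)"
      unfolding sw_def using f us by (intro multilinear_on_psum[OF W dec[OF x]]) auto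
    then show "multilinear_on s s' Vs W (\<lambda>vs. sw s C (\<lambda>y z. f (take (length Us) (us @ x # vs) @ [y, z] @
        drop (Suc (length Us)) (us @ x # vs))) (\<Delta> ((us @ x # vs) ! length Us)))"
      by (simp add: len[OF us] nth_append)
  qed
qed

lemma subformulas_refl [simp]: "A \<in> subformulas A"
  by (cases A) auto

section \<open>Elements of function spaces and products\<close>

context sweedler_semantics
begin

abbreviation "sc \<equiv> scale M"
abbreviation "sp \<equiv> space M"
abbreviation "F \<equiv> formulas M"

lemma formulas_sub:
  shows "With A B \<in> F \<Longrightarrow> A \<in> F" "With A B \<in> F \<Longrightarrow> B \<in> F"
    "(A \<multimap> B) \<in> F \<Longrightarrow> A \<in> F" "(A \<multimap> B) \<in> F \<Longrightarrow> B \<in> F" "OfCourse A \<in> F \<Longrightarrow> A \<in> F"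
  using formulas by fastforce+

sublocale fam: coalgebra_family sc "{A. OfCourse A \<in> F}" "\<lambda>A. sp (OfCourse A)" "comult M" "counit M"
  by (rule coalgebra_family.intro) (auto intro: vector_space coalgebra)

abbreviation pure :: "'v list \<Rightarrow> ('k, 'v) tensor"
  where "pure \<equiv> tpure sc"

abbreviation env :: "'a formula list \<Rightarrow> 'v list set"
  where "env \<Gamma> \<equiv> listset (map sp \<Gamma>)"

lemma subspaces: "set \<Gamma> \<subseteq> F \<Longrightarrow> \<forall>V\<in>set (map sp \<Gamma>). module.subspace sc V"
  using space by auto

definition lam :: "'a formula \<Rightarrow> 'a formula \<Rightarrow> ('v \<Rightarrow> 'v) \<Rightarrow> 'v"
  where "lam A B h = lolli_in M A B (\<lambda>a. if a \<in> sp A then h a else 0)"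

definition lapp :: "'a formula \<Rightarrow> 'a formula \<Rightarrow> 'v \<Rightarrow> 'v \<Rightarrow> 'v"
  where "lapp A B f = inv_into (Hom sc sc (sp A) (sp B)) (lolli_in M A B) f"

definition wpair :: "'a formula \<Rightarrow> 'a formula \<Rightarrow> 'v \<Rightarrow> 'v \<Rightarrow> 'v"
  where "wpair A B a b = with_in M A B (a, b)"

definition wfst :: "'a formula \<Rightarrow> 'a formula \<Rightarrow> 'v \<Rightarrow> 'v"
  where "wfst A B v = fst (inv_into (sp A \<times> sp B) (with_in M A B) v)"

definition wsnd :: "'a formula \<Rightarrow> 'a formula \<Rightarrow> 'v \<Rightarrow> 'v"
  where "wsnd A B v = snd (inv_into (sp A \<times> sp B) (with_in M A B) v)"

lemma Hom_plus: "A \<in> F \<Longrightarrow> B \<in> F \<Longrightarrow> f \<in> Hom sc sc (sp A) (sp B) \<Longrightarrow> g \<in> Hom sc sc (sp A) (sp B) \<Longrightarrow> f + g \<in> Hom sc sc (sp A) (sp B)"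
  by (auto simp: Hom_def linear_on_def plus_fun_apply subspace_plus[OF vector_space space] vector_space_add_right[OF vector_space] algebra_simps)

lemma Hom_smult: "A \<in> F \<Longrightarrow> B \<in> F \<Longrightarrow> f \<in> Hom sc sc (sp A) (sp B) \<Longrightarrow> fun_scale sc c f \<in> Hom sc sc (sp A) (sp B)"
  by (auto simp: Hom_def linear_on_def fun_scale_def subspace_smult[OF vector_space space] vector_space_add_right[OF vector_space]
      vector_space_scale[OF vector_space] vector_space_zero_right[OF vector_space] mult.commute)

lemma lapp_linear_iso:
  assumes "(A \<multimap> B) \<in> F"
  shows "linear_on sc (fun_scale sc) (sp (A \<multimap> B)) (Hom sc sc (sp A) (sp B)) (lapp A B)"
  using lolli[OF assms] formulas_sub(3,4)[OF assms] unfolding linear_iso_def lapp_def[abs_def]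
  by (intro inv_into_linear) (auto intro: Hom_plus Hom_smult)

lemma lapp_linear:
  assumes "(A \<multimap> B) \<in> F"
  shows "f \<in> sp (A \<multimap> B) \<Longrightarrow> linear_on sc sc (sp A) (sp B) (lapp A B f)"
    and "x \<in> sp A \<Longrightarrow> linear_on sc sc (sp (A \<multimap> B)) (sp B) (\<lambda>f. lapp A B f x)"
    and "f \<in> sp (A \<multimap> B) \<Longrightarrow> x \<in> sp A \<Longrightarrow> lapp A B f x \<in> sp B"
proof -
  note l = lapp_linear_iso[OF assms]
  show 1: "f \<in> sp (A \<multimap> B) \<Longrightarrow> linear_on sc sc (sp A) (sp B) (lapp A B f)" for f
    using linear_on_in[OF l, of f] unfolding Hom_def by blast
  then show "f \<in> sp (A \<multimap> B) \<Longrightarrow> x \<in> sp A \<Longrightarrow> lapp A B f x \<in> sp B" for f x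
    by (rule linear_on_in)
  then show "x \<in> sp A \<Longrightarrow> linear_on sc sc (sp (A \<multimap> B)) (sp B) (\<lambda>f. lapp A B f x)"
    using linear_on_add[OF l] linear_on_scale[OF l] by (intro linear_onI) (auto simp: plus_fun_apply fun_scale_def)
qed

lemma lam_Hom:
  assumes "A \<in> F" and "linear_on sc sc (sp A) (sp B) h"
  shows "(\<lambda>a. if a \<in> sp A then h a else 0) \<in> Hom sc sc (sp A) (sp B)"
  using assms(2) by (auto simp: Hom_def linear_on_def subspace_plus[OF vector_space space[OF assms(1)]]
      subspace_smult[OF vector_space space[OF assms(1)]])

lemma lam_in:
  assumes "(A \<multimap> B) \<in> F" and "linear_on sc sc (sp A) (sp B) h"
  shows "lam A B h \<in> sp (A \<multimap> B)"
  unfolding lam_def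
  by (rule linear_on_in[OF conjunct1[OF lolli[OF assms(1), unfolded linear_iso_def]]
        lam_Hom[OF formulas_sub(3)[OF assms(1)] assms(2)]])

lemma lapp_lam:
  assumes "(A \<multimap> B) \<in> F" and "linear_on sc sc (sp A) (sp B) h" and "a \<in> sp A"
  shows "lapp A B (lam A B h) a = h a"
proof -
  have "lapp A B (lam A B h) = (\<lambda>a. if a \<in> sp A then h a else 0)"
    unfolding lapp_def lam_def
    using lolli[OF assms(1)] lam_Hom[OF formulas_sub(3)[OF assms(1)] assms(2)]
    unfolding linear_iso_def by (blast intro: inv_into_f_f bij_betw_imp_inj_on)
  then show ?thesis using assms(3) by simp
qed

lemma lam_cong: "(\<And>a. a \<in> sp A \<Longrightarrow> h a = h' a) \<Longrightarrow> lam A B h = lam A B h'"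
  unfolding lam_def by (rule arg_cong[of _ _ "lolli_in M A B"]) auto

lemma with_props:
  assumes "With A B \<in> F"
  shows "a \<in> sp A \<Longrightarrow> b \<in> sp B \<Longrightarrow> wpair A B a b \<in> sp (With A B)"
    and "a \<in> sp A \<Longrightarrow> b \<in> sp B \<Longrightarrow> wfst A B (wpair A B a b) = a"
    and "a \<in> sp A \<Longrightarrow> b \<in> sp B \<Longrightarrow> wsnd A B (wpair A B a b) = b"
    and "linear_on sc sc (sp (With A B)) (sp A) (wfst A B)"
    and "linear_on sc sc (sp (With A B)) (sp B) (wsnd A B)"
    and "linear_on (prod_scale sc) sc (sp A \<times> sp B) (sp (With A B)) (with_in M A B)"
proof -
  have w: "linear_on (prod_scale sc) sc (sp A \<times> sp B) (sp (With A B)) (with_in M A B)"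
    "bij_betw (with_in M A B) (sp A \<times> sp B) (sp (With A B))"
    using "with"[OF assms] by (auto simp: linear_iso_def)
  show "linear_on (prod_scale sc) sc (sp A \<times> sp B) (sp (With A B)) (with_in M A B)" by (rule w)
  show "a \<in> sp A \<Longrightarrow> b \<in> sp B \<Longrightarrow> wpair A B a b \<in> sp (With A B)"
    unfolding wpair_def by (rule linear_on_in[OF w(1)]) simp
  show "a \<in> sp A \<Longrightarrow> b \<in> sp B \<Longrightarrow> wfst A B (wpair A B a b) = a" "a \<in> sp A \<Longrightarrow> b \<in> sp B \<Longrightarrow> wsnd A B (wpair A B a b) = b"
    unfolding wfst_def wsnd_def wpair_def by (simp_all add: inv_into_f_f[OF bij_betw_imp_inj_on[OF w(2)]])
  note A = formulas_sub(1)[OF assms] and B = formulas_sub(2)[OF assms]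
  have i: "linear_on sc (prod_scale sc) (sp (With A B)) (sp A \<times> sp B) (inv_into (sp A \<times> sp B) (with_in M A B))"
    by (rule inv_into_linear[OF w])
      (auto simp: prod_scale_def subspace_plus[OF vector_space space] subspace_smult[OF vector_space space] A B)
  show "linear_on sc sc (sp (With A B)) (sp A) (wfst A B)" "linear_on sc sc (sp (With A B)) (sp B) (wsnd A B)"
    unfolding wfst_def[abs_def] wsnd_def[abs_def]
    by (rule linear_on_compose[OF i]; auto simp: linear_on_def prod_scale_def)+
qed

text \<open>Says that \<open>den\<close> is a genuine linear map between the intended spaces, which
  a definite description does not guarantee by itself. The formulas of the sequent are recorded as
  well, since only those in \<open>formulas M\<close> have a specified interpretation.\<close>

definition sound :: "'a deriv \<Rightarrow> bool"
  where "sound \<pi> \<longleftrightarrow> den M \<pi> \<in> Hom tscale sc (tspace sc (map sp (hyps \<pi>))) (sp (concl \<pi>)) \<and>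
    set (hyps \<pi>) \<subseteq> F \<and> concl \<pi> \<in> F"

lemma soundD:
  assumes "sound \<pi>"
  shows "set (hyps \<pi>) \<subseteq> F" "concl \<pi> \<in> F"
    and "linear_on tscale sc (tspace sc (map sp (hyps \<pi>))) (sp (concl \<pi>)) (den M \<pi>)"
    and "multilinear_on sc sc (map sp (hyps \<pi>)) (sp (concl \<pi>)) (\<lambda>xs. den M \<pi> (pure xs))"
proof -
  show 1: "set (hyps \<pi>) \<subseteq> F" "concl \<pi> \<in> F" and
    2: "linear_on tscale sc (tspace sc (map sp (hyps \<pi>))) (sp (concl \<pi>)) (den M \<pi>)"
    using assms unfolding sound_def Hom_def by blast+
  show "multilinear_on sc sc (map sp (hyps \<pi>)) (sp (concl \<pi>)) (\<lambda>xs. den M \<pi> (pure xs))"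
    by (rule multilinear_on_compose[OF multilinear_on_tpure[OF vector_space subspaces[OF 1(1)]] 2])
qed

text \<open>Every rule except promotion denotes \<open>ext\<close> of some body. The body may be
  exchanged for any \<open>f\<close> that agrees with it on the environment; multilinearity of
  \<open>f\<close> then yields both soundness and the value on pure tensors.\<close>

lemma sound_ext:
  assumes "den M \<pi> = ext M \<Gamma> body" and h: "hyps \<pi> = \<Gamma>" and \<Gamma>: "set \<Gamma> \<subseteq> F" and B: "concl \<pi> \<in> F"
    and f: "multilinear_on sc sc (map sp \<Gamma>) (sp (concl \<pi>)) f"
    and "\<And>xs. xs \<in> env \<Gamma> \<Longrightarrow> body xs = f xs"
  shows "sound \<pi>" and "xs \<in> env \<Gamma> \<Longrightarrow> den M \<pi> (pure xs) = f xs"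
proof -
  have "den M \<pi> = tlift sc sc (map sp \<Gamma>) f"
    unfolding assms(1) ext_def by (rule tlift_cong) (rule assms(6))
  then show "sound \<pi>" "xs \<in> env \<Gamma> \<Longrightarrow> den M \<pi> (pure xs) = f xs"
    using tlift[OF vector_space vector_space space[OF B] subspaces[OF \<Gamma>] f] \<Gamma> B
    by (simp_all add: sound_def h)
qed

section \<open>Soundness and value of each rule\<close>

lemma env_append: "us \<in> env \<Gamma> \<Longrightarrow> vs \<in> env \<Gamma>' \<Longrightarrow> us @ vs \<in> env (\<Gamma> @ \<Gamma>')"
  by (simp add: listset_append)

lemma sound_Ax:
  assumes "A \<in> F"
  shows "sound (Ax A)" and "x \<in> sp A \<Longrightarrow> den M (Ax A) (pure [x]) = x"
proof -
  have m: "multilinear_on sc sc (map sp (hyps (Ax A))) (sp (concl (Ax A))) hd"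
    by (simp add: linear_on_id)
  note * = sound_ext[of "Ax A", OF _ refl _ _ m]
  show "sound (Ax A)" using assms by (intro *) auto
  show "x \<in> sp A \<Longrightarrow> den M (Ax A) (pure [x]) = x" using assms by (subst *) (auto simp: set_Cons_def)
qed

lemma sound_Exch:
  assumes \<pi>: "sound \<pi>" and js: "distinct js" "set js = {..<length \<Gamma>}" "hyps \<pi> = map ((!) \<Gamma>) js"
  shows "sound (Exch \<Gamma> js \<pi>)"
    and "xs \<in> env \<Gamma> \<Longrightarrow> den M (Exch \<Gamma> js \<pi>) (pure xs) = den M \<pi> (pure (map ((!) xs) js))"
proof -
  have "set \<Gamma> = (!) \<Gamma> ` {..<length \<Gamma>}" by (auto simp: set_conv_nth)
  then have \<Gamma>: "set \<Gamma> \<subseteq> F" using soundD(1)[OF \<pi>] js by simp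
  have h: "map sp (hyps \<pi>) = map ((!) (map sp \<Gamma>)) js" using js by simp
  have m: "multilinear_on sc sc (map sp \<Gamma>) (sp (concl \<pi>)) (\<lambda>xs. den M \<pi> (pure (map ((!) xs) js)))"
    by (rule multilinear_on_permute[OF vector_space subspaces[OF \<Gamma>] js(1) _ soundD(4)[OF \<pi>, unfolded h]]) (simp add: js)
  note * = sound_ext[of "Exch \<Gamma> js \<pi>", OF den.simps(2) hyps.simps(2)]
  show "sound (Exch \<Gamma> js \<pi>)" using \<Gamma> soundD(2)[OF \<pi>] m by (intro *) auto
  show "xs \<in> env \<Gamma> \<Longrightarrow> den M (Exch \<Gamma> js \<pi>) (pure xs) = den M \<pi> (pure (map ((!) xs) js))"
    using \<Gamma> soundD(2)[OF \<pi>] m by (intro *(2)) auto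
qed

lemma sound_Cut:
  assumes \<pi>: "sound \<pi>" and \<rho>: "sound \<rho>" and L: "hyps \<rho> = L @ concl \<pi> # R" and i: "i = length L"
  shows "sound (Cut i \<pi> \<rho>)"
    and "us \<in> env L \<Longrightarrow> vs \<in> env (hyps \<pi>) \<Longrightarrow> ws \<in> env R \<Longrightarrow>
      den M (Cut i \<pi> \<rho>) (pure (us @ vs @ ws)) = den M \<rho> (pure (us @ den M \<pi> (pure vs) # ws))"
proof -
  have h: "hyps (Cut i \<pi> \<rho>) = L @ hyps \<pi> @ R" using L i by simp
  have sub: "set (L @ hyps \<pi> @ R) \<subseteq> F" using soundD(1)[OF \<pi>] soundD(1)[OF \<rho>] L by auto
  let ?f = "\<lambda>xs. den M \<rho> (pure (take (length (map sp L)) xs @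
    den M \<pi> (pure (take (length (map sp (hyps \<pi>))) (drop (length (map sp L)) xs))) #
    drop (length (map sp L) + length (map sp (hyps \<pi>))) xs))"
  have m: "multilinear_on sc sc (map sp (hyps (Cut i \<pi> \<rho>))) (sp (concl (Cut i \<pi> \<rho>))) ?f"
    unfolding h concl.simps map_append
    using soundD(4)[OF \<pi>] soundD(4)[OF \<rho>] subspaces[OF sub]
    by (intro multilinear_on_subst[OF vector_space]) (auto simp: L)
  note * = sound_ext[of "Cut i \<pi> \<rho>", OF den.simps(3) refl _ _ m]
  show "sound (Cut i \<pi> \<rho>)" using sub soundD(2)[OF \<rho>] i unfolding h by (intro *) (auto simp: L i Let_def)
  assume us: "us \<in> env L" and vs: "vs \<in> env (hyps \<pi>)" and ws: "ws \<in> env R"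
  have "us @ vs @ ws \<in> env (hyps (Cut i \<pi> \<rho>))" unfolding h by (intro env_append us vs ws)
  then have "den M (Cut i \<pi> \<rho>) (pure (us @ vs @ ws)) = ?f (us @ vs @ ws)"
    using sub soundD(2)[OF \<rho>] i unfolding h by (intro *) (auto simp: L i Let_def)
  then show "den M (Cut i \<pi> \<rho>) (pure (us @ vs @ ws)) = den M \<rho> (pure (us @ den M \<pi> (pure vs) # ws))"
    using listset_length[OF us] listset_length[OF vs] by simp
qed

lemma sound_Weak:
  assumes \<pi>: "sound \<pi>" and A: "OfCourse A \<in> F"
  shows "sound (Weak A \<pi>)"
    and "x \<in> sp (OfCourse A) \<Longrightarrow> xs \<in> env (hyps \<pi>) \<Longrightarrow>
      den M (Weak A \<pi>) (pure (x # xs)) = sc (counit M A x) (den M \<pi> (pure xs))"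
proof -
  interpret c: coalgebra sc "sp (OfCourse A)" "comult M A" "counit M A" using A by (intro fam.component) simp
  note W = vector_space space[OF soundD(2)[OF \<pi>]]
  let ?f = "\<lambda>xs. sc (counit M A (hd xs)) (den M \<pi> (pure (tl xs)))"
  have m: "multilinear_on sc sc (map sp (hyps (Weak A \<pi>))) (sp (concl (Weak A \<pi>))) ?f"
    using multilinear_on_in[OF soundD(4)[OF \<pi>]] multilinear_on_compose[OF soundD(4)[OF \<pi>] linear_on_smult[OF W]]
    by (auto intro!: linear_on_scale_left[OF W c.\<epsilon>])
  note * = sound_ext[of "Weak A \<pi>", OF den.simps(13) refl _ _ m]
  show "sound (Weak A \<pi>)" using soundD(1,2)[OF \<pi>] A by (intro *) auto
  show "x \<in> sp (OfCourse A) \<Longrightarrow> xs \<in> env (hyps \<pi>) \<Longrightarrow>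
      den M (Weak A \<pi>) (pure (x # xs)) = sc (counit M A x) (den M \<pi> (pure xs))"
    using soundD(1,2)[OF \<pi>] A by (subst *) (auto simp: listset_Cons simp del: listset.simps)
qed

lemma sound_Der:
  assumes \<pi>: "sound \<pi>" and A: "OfCourse A \<in> F" and h: "hyps \<pi> = A # \<Gamma>"
  shows "sound (Der \<pi>)"
    and "x \<in> sp (OfCourse A) \<Longrightarrow> xs \<in> env \<Gamma> \<Longrightarrow>
      den M (Der \<pi>) (pure (x # xs)) = den M \<pi> (pure (derel M A x # xs))"
proof -
  let ?f = "\<lambda>xs. den M \<pi> (pure (derel M A (hd xs) # tl xs))"
  have "multilinear_on sc sc (sp A # map sp \<Gamma>) (sp (concl \<pi>)) (\<lambda>xs. den M \<pi> (pure xs))"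
    using soundD(4)[OF \<pi>] h by simp
  then have m: "multilinear_on sc sc (map sp (hyps (Der \<pi>))) (sp (concl (Der \<pi>))) ?f"
    using linear_on_in[OF derel[OF A]]
    by (auto simp: h intro!: linear_on_compose[OF derel[OF A], where g = "\<lambda>a. den M \<pi> (pure (a # xs))" for xs])
  note * = sound_ext[of "Der \<pi>", OF den.simps(11) refl _ _ m]
  show "sound (Der \<pi>)" using soundD(1,2)[OF \<pi>] A by (intro *) (auto simp: h)
  show "x \<in> sp (OfCourse A) \<Longrightarrow> xs \<in> env \<Gamma> \<Longrightarrow>
      den M (Der \<pi>) (pure (x # xs)) = den M \<pi> (pure (derel M A x # xs))"
    using soundD(1,2)[OF \<pi>] A by (subst *) (auto simp: h listset_Cons simp del: listset.simps)
qed

lemma sound_WithR: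
  assumes \<pi>: "sound \<pi>" and \<rho>: "sound \<rho>" and h: "hyps \<rho> = hyps \<pi>" and W: "With (concl \<pi>) (concl \<rho>) \<in> F"
  shows "sound (WithR \<pi> \<rho>)"
    and "xs \<in> env (hyps \<pi>) \<Longrightarrow>
      den M (WithR \<pi> \<rho>) (pure xs) = wpair (concl \<pi>) (concl \<rho>) (den M \<pi> (pure xs)) (den M \<rho> (pure xs))"
proof -
  let ?f = "\<lambda>xs. wpair (concl \<pi>) (concl \<rho>) (den M \<pi> (pure xs)) (den M \<rho> (pure xs))"
  have m: "multilinear_on sc sc (map sp (hyps \<pi>)) (sp (concl (WithR \<pi> \<rho>))) ?f"
    unfolding wpair_def hyps.simps concl.simps
    by (rule multilinear_on_compose[OF multilinear_on_prod[OF vector_space subspaces[OF soundD(1)[OF \<pi>]] soundD(4)[OF \<pi>]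
          soundD(4)[OF \<rho>, unfolded h]] with_props(6)[OF W]])
  note * = sound_ext[of "WithR \<pi> \<rho>", OF den.simps(6) hyps.simps(6) _ _ m]
  show "sound (WithR \<pi> \<rho>)" using soundD(1)[OF \<pi>] W by (intro *) (auto simp: wpair_def)
  show "xs \<in> env (hyps \<pi>) \<Longrightarrow> den M (WithR \<pi> \<rho>) (pure xs) = ?f xs"
    using soundD(1)[OF \<pi>] W by (intro *) (auto simp: wpair_def)
qed

lemma sound_WithL:
  assumes W: "With A B \<in> F"
  shows "sound (WithL0 B (Ax A))" "sound (WithL1 A (Ax B))"
    and "x \<in> sp (With A B) \<Longrightarrow> den M (WithL0 B (Ax A)) (pure [x]) = wfst A B x"
    and "x \<in> sp (With A B) \<Longrightarrow> den M (WithL1 A (Ax B)) (pure [x]) = wsnd A B x"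
proof -
  have A: "A \<in> F" and B: "B \<in> F" using formulas_sub(1,2)[OF W] by auto
  note w = with_props[OF W]
  have m0: "multilinear_on sc sc (map sp (hyps (WithL0 B (Ax A)))) (sp (concl (WithL0 B (Ax A)))) (\<lambda>xs. wfst A B (hd xs))"
    using w(4) linear_on_in[OF w(4)] by simp
  have m1: "multilinear_on sc sc (map sp (hyps (WithL1 A (Ax B)))) (sp (concl (WithL1 A (Ax B)))) (\<lambda>xs. wsnd A B (hd xs))"
    using w(5) linear_on_in[OF w(5)] by simp
  have e0: "den M (Ax A) (pure (wfst A B (hd xs) # tl xs)) = wfst A B (hd xs)" if "xs \<in> env [With A B]" for xs
    using that sound_Ax(2)[OF A linear_on_in[OF w(4)]] by (auto simp: set_Cons_def)
  have e1: "den M (Ax B) (pure (wsnd A B (hd xs) # tl xs)) = wsnd A B (hd xs)" if "xs \<in> env [With A B]" for xs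
    using that sound_Ax(2)[OF B linear_on_in[OF w(5)]] by (auto simp: set_Cons_def)
  note w0 = sound_ext[of "WithL0 B (Ax A)", OF den.simps(7) refl _ _ m0]
  note w1 = sound_ext[of "WithL1 A (Ax B)", OF den.simps(8) refl _ _ m1]
  show "sound (WithL0 B (Ax A))" using W A e0 by (intro w0) (auto simp: wfst_def Let_def)
  show "sound (WithL1 A (Ax B))" using W B e1 by (intro w1) (auto simp: wsnd_def Let_def)
  show "x \<in> sp (With A B) \<Longrightarrow> den M (WithL0 B (Ax A)) (pure [x]) = wfst A B x"
    using W A e0 by (subst w0) (auto simp: wfst_def Let_def set_Cons_def)
  show "x \<in> sp (With A B) \<Longrightarrow> den M (WithL1 A (Ax B)) (pure [x]) = wsnd A B x"
    using W B e1 by (subst w1) (auto simp: wsnd_def Let_def set_Cons_def)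
qed

lemma sound_LolliR:
  assumes \<pi>: "sound \<pi>" and h: "hyps \<pi> = A # \<Gamma>" and AB: "(A \<multimap> concl \<pi>) \<in> F"
  shows "sound (LolliR \<pi>)"
    and "xs \<in> env \<Gamma> \<Longrightarrow> den M (LolliR \<pi>) (pure xs) = lam A (concl \<pi>) (\<lambda>a. den M \<pi> (pure (a # xs)))"
proof -
  let ?f = "\<lambda>xs. lam A (concl \<pi>) (\<lambda>a. den M \<pi> (pure (a # xs)))"
  have l: "linear_on (fun_scale sc) sc (Hom sc sc (sp A) (sp (concl \<pi>))) (sp (A \<multimap> concl \<pi>)) (lolli_in M A (concl \<pi>))"
    using lolli[OF AB] by (simp add: linear_iso_def)
  have m: "multilinear_on sc sc (map sp (tl (hyps \<pi>))) (sp (concl (LolliR \<pi>))) ?f"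
    unfolding lam_def hyps.simps concl.simps h list.sel
    using soundD(4)[OF \<pi>] subspaces[OF soundD(1)[OF \<pi>]] unfolding h
    by (intro multilinear_on_compose[OF multilinear_on_curry[OF vector_space vector_space] l]) auto
  note * = sound_ext[of "LolliR \<pi>", OF den.simps(9) hyps.simps(9) _ _ m]
  show "sound (LolliR \<pi>)" using soundD(1)[OF \<pi>] AB by (intro *) (auto simp: lam_def h)
  show "xs \<in> env \<Gamma> \<Longrightarrow> den M (LolliR \<pi>) (pure xs) = ?f xs"
    using soundD(1)[OF \<pi>] AB by (intro *) (auto simp: lam_def h)
qed

lemma sound_LolliL:
  assumes \<pi>: "sound \<pi>" and AB: "(concl \<pi> \<multimap> B) \<in> F"
  shows "sound (LolliL \<pi> (Ax B))"
    and "f \<in> sp (concl \<pi> \<multimap> B) \<Longrightarrow> xs \<in> env (hyps \<pi>) \<Longrightarrow>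
      den M (LolliL \<pi> (Ax B)) (pure (f # xs)) = lapp (concl \<pi>) B f (den M \<pi> (pure xs))"
proof -
  let ?f = "\<lambda>xs. lapp (concl \<pi>) B (hd xs) (den M \<pi> (pure (tl xs)))"
  have B: "B \<in> F" by (rule formulas_sub(4)[OF AB])
  have m: "multilinear_on sc sc (map sp (hyps (LolliL \<pi> (Ax B)))) (sp (concl (LolliL \<pi> (Ax B)))) ?f"
    using multilinear_on_in[OF soundD(4)[OF \<pi>]] multilinear_on_compose[OF soundD(4)[OF \<pi>] lapp_linear(1)[OF AB]] lapp_linear(2)[OF AB]
    by auto
  have e: "den M (Ax B) (pure (inv_into (Hom sc sc (sp (concl \<pi>)) (sp B)) (lolli_in M (concl \<pi>) B) (hd xs)
      (den M \<pi> (pure (take (length (hyps \<pi>)) (tl xs)))) # drop (length (hyps \<pi>)) (tl xs))) = ?f xs"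
    if xs: "xs \<in> env (hyps (LolliL \<pi> (Ax B)))" for xs
  proof -
    from xs obtain f ys where x: "xs = f # ys" "f \<in> sp (concl \<pi> \<multimap> B)" "ys \<in> env (hyps \<pi>)"
      by (auto simp: set_Cons_def)
    have "lapp (concl \<pi>) B f (den M \<pi> (pure ys)) \<in> sp B"
      using x multilinear_on_in[OF soundD(4)[OF \<pi>]] by (intro lapp_linear(3)[OF AB]) auto
    then show ?thesis using sound_Ax(2)[OF B] listset_length[OF x(3)] by (simp add: x(1) lapp_def)
  qed
  note * = sound_ext[of "LolliL \<pi> (Ax B)", OF den.simps(10) refl _ _ m]
  show "sound (LolliL \<pi> (Ax B))" using soundD(1)[OF \<pi>] AB B e by (intro *) (auto simp: Let_def)
  show "f \<in> sp (concl \<pi> \<multimap> B) \<Longrightarrow> xs \<in> env (hyps \<pi>) \<Longrightarrow>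
      den M (LolliL \<pi> (Ax B)) (pure (f # xs)) = lapp (concl \<pi>) B f (den M \<pi> (pure xs))"
    using soundD(1)[OF \<pi>] AB B e by (subst *) (auto simp: Let_def listset_Cons simp del: listset.simps)
qed

lemma sound_Contr:
  assumes \<pi>: "sound \<pi>" and h: "hyps \<pi> = L @ [OfCourse A, OfCourse A] @ R" and i: "i = length L"
  shows "sound (Contr i \<pi>)"
    and "us \<in> env L \<Longrightarrow> x \<in> sp (OfCourse A) \<Longrightarrow> vs \<in> env R \<Longrightarrow>
      den M (Contr i \<pi>) (pure (us @ x # vs)) =
      sw sc (sp (OfCourse A)) (\<lambda>y z. den M \<pi> (pure (us @ [y, z] @ vs))) (comult M A x)"
proof -
  have A: "OfCourse A \<in> F" using soundD(1)[OF \<pi>] h by simp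
  have coalg: "coalgebra sc (sp (OfCourse A)) (comult M A) (counit M A)" using A by (intro fam.component) simp
  interpret c: coalgebra sc "sp (OfCourse A)" "comult M A" "counit M A" by (rule coalg)
  have h': "hyps (Contr i \<pi>) = L @ OfCourse A # R" by (simp add: h i)
  have nth: "hyps \<pi> ! i = OfCourse A" by (simp add: h i nth_append)
  have sub: "set (L @ R) \<subseteq> F" using soundD(1)[OF \<pi>] h by auto
  note W = vector_space space[OF soundD(2)[OF \<pi>]]
  have f: "multilinear_on sc sc (map sp L @ [sp (OfCourse A), sp (OfCourse A)] @ map sp R) (sp (concl \<pi>)) (\<lambda>xs. den M \<pi> (pure xs))"
    using soundD(4)[OF \<pi>] by (simp add: h)
  let ?f = "\<lambda>xs. sw sc (sp (OfCourse A)) (\<lambda>y z. den M \<pi> (pure (take (length (map sp L)) xs @ [y, z] @ drop (Suc (length (map sp L))) xs)))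
      (comult M A (xs ! length (map sp L)))"
  have m: "multilinear_on sc sc (map sp (hyps (Contr i \<pi>))) (sp (concl (Contr i \<pi>))) ?f"
    using multilinear_on_contract[OF coalg _ W f] subspaces[OF sub] unfolding h' by simp
  have e: "ext M [OfCourse A, OfCourse A] (\<lambda>ys. den M \<pi> (pure (take i xs @ ys @ drop (Suc i) xs))) (comult M A (xs ! i)) = ?f xs"
    if xs: "xs \<in> env (hyps (Contr i \<pi>))" for xs
  proof -
    from xs obtain us x vs where x: "xs = us @ x # vs" "us \<in> env L" "x \<in> sp (OfCourse A)" "vs \<in> env R"
      unfolding h' map_append list.map by (auto elim!: listset_appendE listset_ConsE simp del: listset.simps)
    have bi: "bilinear_on sc sc (sp (OfCourse A)) (sp (concl \<pi>)) (\<lambda>y z. den M \<pi> (pure (us @ y # z # vs)))"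
      by (rule multilinear_on_bilinear[OF f x(2,4)])
    \<comment> \<open>For the doubled hypothesis the induced map is \<open>tlift2\<close> of a
      binary map, and so a Sweedler sum over the coproduct of \<open>x\<close>.\<close>
    have "ext M [OfCourse A, OfCourse A] (\<lambda>ys. den M \<pi> (pure (us @ ys @ vs))) (comult M A x) =
      tlift2 sc sc (sp (OfCourse A)) (\<lambda>y z. den M \<pi> (pure (us @ y # z # vs))) (comult M A x)"
      unfolding ext_def tlift2_def list.map
      by (rule arg_cong2[OF tlift_cong refl, of _ _ _ "\<lambda>f x. f x"]) (auto simp: set_Cons_def)
    also have "\<dots> = c.cs (\<lambda>y z. den M \<pi> (pure (us @ y # z # vs))) x" by (rule c.tlift2_eq_cs[OF W bi x(3)])
    finally show ?thesis using listset_length[OF x(2)] by (simp add: x(1) i nth_append)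
  qed
  note * = sound_ext[of "Contr i \<pi>", OF den.simps(14) refl _ _ m]
  have F: "set (hyps (Contr i \<pi>)) \<subseteq> F" "concl (Contr i \<pi>) \<in> F" using sub A soundD(2)[OF \<pi>] unfolding h' by auto
  have e': "(let B = hyps \<pi> ! i in ext M [B, B] (\<lambda>ys. den M \<pi> (pure (take i xs @ ys @ drop (Suc i) xs))) (comult M (unbang B) (xs ! i))) = ?f xs"
    if xs: "xs \<in> env (hyps (Contr i \<pi>))" for xs
    using e[OF xs] by (simp add: nth Let_def)
  show "sound (Contr i \<pi>)" by (rule *(1)[OF F e'])
  assume us: "us \<in> env L" and x: "x \<in> sp (OfCourse A)" and vs: "vs \<in> env R"
  have "us @ x # vs \<in> env (hyps (Contr i \<pi>))" unfolding h' by (intro env_append us) (use x vs in \<open>simp add: listset_Cons del: listset.simps\<close>)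
  from *(2)[OF F e' this] show "den M (Contr i \<pi>) (pure (us @ x # vs)) =
      sw sc (sp (OfCourse A)) (\<lambda>y z. den M \<pi> (pure (us @ [y, z] @ vs))) (comult M A x)"
    using listset_length[OF us] by (simp add: nth_append)
qed

text \<open>The tensor product of the hypotheses is a cocommutative coalgebra, and its carrier is a
  set of tensors, the very type over which \<open>universal\<close> ranges. Hence the lift exists
  uniquely and the description defining \<open>promote\<close> is met.\<close>

lemma promote:
  assumes As: "\<forall>A\<in>set As. OfCourse A \<in> F" and B: "OfCourse B \<in> F"
    and f: "linear_on tscale sc (fam.T As) (sp B) f"
  shows "coalgebra_mor tscale (fam.T As) (fam.tcomult As) (fam.tcounit As)
      sc (sp (OfCourse B)) (comult M B) (counit M B) (promote M As B f)"
    and "t \<in> fam.T As \<Longrightarrow> derel M B (promote M As B f t) = f t"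
proof -
  have As': "set As \<subseteq> {A. OfCourse A \<in> F}" using As by auto
  interpret c: coalgebra tscale "fam.T As" "fam.tcomult As" "fam.tcounit As" by (rule fam.coalgebra_tensor[OF As'])
  have z: "zip (map g As) (map h As) = map (\<lambda>A. (g A, h A)) As" for g :: "'a formula \<Rightarrow> 'x" and h :: "'a formula \<Rightarrow> 'y"
    by (induction As) auto
  have eq: "promote M As B f = (THE g. coalgebra_mor tscale (fam.T As) (fam.tcomult As) (fam.tcounit As)
      sc (sp (OfCourse B)) (comult M B) (counit M B) g \<and> (\<forall>t \<in> fam.T As. derel M B (g t) = f t))"
    unfolding promote_def Let_def fam.tcomult_def fam.tcounit_def z ..
  note ex = theI'[OF universal[OF B c.coalgebra f], folded eq]
  show "coalgebra_mor tscale (fam.T As) (fam.tcomult As) (fam.tcounit As)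
      sc (sp (OfCourse B)) (comult M B) (counit M B) (promote M As B f)"
    "t \<in> fam.T As \<Longrightarrow> derel M B (promote M As B f t) = f t"
    using ex by blast+
qed

lemma sound_Prom:
  assumes \<pi>: "sound \<pi>" and h: "hyps \<pi> = map OfCourse As" and B: "OfCourse (concl \<pi>) \<in> F"
  shows "sound (Prom \<pi>)"
    and "coalgebra_mor tscale (fam.T As) (fam.tcomult As) (fam.tcounit As)
      sc (sp (OfCourse (concl \<pi>))) (comult M (concl \<pi>)) (counit M (concl \<pi>)) (den M (Prom \<pi>))"
    and "t \<in> fam.T As \<Longrightarrow> derel M (concl \<pi>) (den M (Prom \<pi>) t) = den M \<pi> t"
proof -
  have As: "\<forall>A\<in>set As. OfCourse A \<in> F" using soundD(1)[OF \<pi>] h by auto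
  have m: "map sp (hyps \<pi>) = map (\<lambda>A. sp (OfCourse A)) As" by (simp add: h)
  have d: "den M (Prom \<pi>) = promote M As (concl \<pi>) (den M \<pi>)" by (simp add: h o_def)
  note p = promote[OF As B soundD(3)[OF \<pi>, unfolded m]]
  show "coalgebra_mor tscale (fam.T As) (fam.tcomult As) (fam.tcounit As)
      sc (sp (OfCourse (concl \<pi>))) (comult M (concl \<pi>)) (counit M (concl \<pi>)) (den M (Prom \<pi>))"
    unfolding d by (rule p)
  show "t \<in> fam.T As \<Longrightarrow> derel M (concl \<pi>) (den M (Prom \<pi>) t) = den M \<pi> t"
    unfolding d by (rule p)
  have "den M (Prom \<pi>) \<in> Hom tscale sc (fam.T As) (sp (OfCourse (concl \<pi>)))"
    using p(1) unfolding d coalgebra_mor_def by blast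
  then show "sound (Prom \<pi>)" using soundD(1)[OF \<pi>] B unfolding sound_def hyps.simps concl.simps m by blast
qed

end

section \<open>Denotations of terms\<close>

text \<open>Above the contractions each unrestricted hypothesis stands next to its copy, so first
  and second legs alternate.\<close>

definition interleave :: "'x list \<Rightarrow> 'x list \<Rightarrow> 'x list"
  where "interleave ps qs = concat (map2 (\<lambda>p q. [p, q]) ps qs)"

lemma interleave_simps [simp]: "interleave [] [] = []" "interleave (p # ps) (q # qs) = p # q # interleave ps qs"
  by (simp_all add: interleave_def)

lemma interleave_nth:
  assumes "length ps = length qs"
  shows "length (interleave ps qs) = 2 * length ps"
    and "i < length ps \<Longrightarrow> interleave ps qs ! (2 * i) = ps ! i"
    and "i < length ps \<Longrightarrow> interleave ps qs ! Suc (2 * i) = qs ! i"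
proof -
  have "length (interleave ps qs) = 2 * length ps \<and> (\<forall>i < length ps. interleave ps qs ! (2 * i) = ps ! i \<and>
    interleave ps qs ! Suc (2 * i) = qs ! i)"
    using assms
  proof (induction ps qs rule: list_induct2)
    case (Cons p ps q qs)
    show ?case
    proof (intro conjI allI impI)
      fix i assume "i < length (p # ps)"
      then show "interleave (p # ps) (q # qs) ! (2 * i) = (p # ps) ! i"
        "interleave (p # ps) (q # qs) ! Suc (2 * i) = (q # qs) ! i"
        using Cons.IH by (cases i; simp)+
    qed (use Cons.IH in simp)
  qed simp
  then show "length (interleave ps qs) = 2 * length ps" "i < length ps \<Longrightarrow> interleave ps qs ! (2 * i) = ps ! i"
    "i < length ps \<Longrightarrow> interleave ps qs ! Suc (2 * i) = qs ! i" by auto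
qed

text \<open>Recovers, from the typing of a whole application, that the exchange above its
  contractions is a permutation.\<close>

lemma valid_fold_Contr: "valid (fold Contr is \<pi>) \<Longrightarrow> valid \<pi>"
proof (induction "is" arbitrary: \<pi>)
  case (Cons i "is")
  then have "valid (fold Contr is (Contr i \<pi>))" by (simp only: fold_simps)
  from Cons.IH[OF this] show ?case by simp
qed simp

declare den.simps [simp del]

context sweedler_semantics
begin

definition admissible :: "(string \<times> 'a formula) list \<Rightarrow> (string \<Rightarrow> 'v) \<Rightarrow> bool"
  where "admissible \<Gamma> \<rho> \<longleftrightarrow> (\<forall>p\<in>set \<Gamma>. \<rho> (fst p) \<in> sp (snd p))"

abbreviation vals :: "(string \<times> 'a formula) list \<Rightarrow> (string \<Rightarrow> 'v) \<Rightarrow> 'v list"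
  where "vals \<Gamma> \<rho> \<equiv> map (\<lambda>p. \<rho> (fst p)) \<Gamma>"

abbreviation BT :: "(string \<times> 'a formula) list \<Rightarrow> ('k, 'v) tensor set"
  where "BT \<Theta> \<equiv> fam.T (map snd \<Theta>)"

abbreviation BL :: "(string \<times> 'a formula) list \<Rightarrow> 'v list set"
  where "BL \<Theta> \<equiv> fam.L (map snd \<Theta>)"

abbreviation Bcomult :: "(string \<times> 'a formula) list \<Rightarrow> ('k, 'v) tensor \<Rightarrow> ('k, ('k, 'v) tensor) tensor"
  where "Bcomult \<Theta> \<equiv> fam.tcomult (map snd \<Theta>)"
abbreviation Bcounit :: "(string \<times> 'a formula) list \<Rightarrow> ('k, 'v) tensor \<Rightarrow> 'k"
  where "Bcounit \<Theta> \<equiv> fam.tcounit (map snd \<Theta>)"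
abbreviation Bsw :: "(string \<times> 'a formula) list \<Rightarrow> (('k, 'v) tensor \<Rightarrow> ('k, 'v) tensor \<Rightarrow> 'w::ab_group_add) \<Rightarrow> ('k, 'v) tensor \<Rightarrow> 'w"
  where "Bsw \<Theta> h c \<equiv> sw tscale (BT \<Theta>) h (Bcomult \<Theta> c)"

definition bangs :: "(string \<times> 'a formula) list \<Rightarrow> bool"
  where "bangs \<Theta> \<longleftrightarrow> set (map snd \<Theta>) \<subseteq> {A. OfCourse A \<in> F}"

lemma vals_in: "admissible \<Gamma> \<rho> \<Longrightarrow> vals \<Gamma> \<rho> \<in> env (map snd \<Gamma>)"
  unfolding admissible_def by (induction \<Gamma>) (auto simp: set_Cons_def)

text \<open>Typing fixes the last sequent of the elaborated proof, soundness its meaning; the rules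
  for terms rely on both.\<close>

definition sound_typed :: "(string \<times> 'a formula) list \<Rightarrow> (string \<times> 'a formula) list \<Rightarrow> 'a tm \<Rightarrow> 'a formula \<Rightarrow> bool"
  where "sound_typed \<Theta> \<Gamma> t B \<longleftrightarrow> well_typed \<Theta> \<Gamma> t B \<and> sound (elab \<Theta> \<Gamma> t)"

lemma sound_typedD:
  assumes "sound_typed \<Theta> \<Gamma> t B"
  shows "valid (elab \<Theta> \<Gamma> t)" "hyps (elab \<Theta> \<Gamma> t) = map (OfCourse \<circ> snd) \<Theta> @ map snd \<Gamma>" "concl (elab \<Theta> \<Gamma> t) = B"
    "sound (elab \<Theta> \<Gamma> t)" "bangs \<Theta>" "set (map snd \<Gamma>) \<subseteq> F" "B \<in> F"
    "multilinear_on sc sc (map (\<lambda>A. sp (OfCourse A)) (map snd \<Theta>) @ map sp (map snd \<Gamma>)) (sp B) (\<lambda>xs. den M (elab \<Theta> \<Gamma> t) (pure xs))"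
proof -
  show *: "valid (elab \<Theta> \<Gamma> t)" "hyps (elab \<Theta> \<Gamma> t) = map (OfCourse \<circ> snd) \<Theta> @ map snd \<Gamma>" "concl (elab \<Theta> \<Gamma> t) = B"
    "sound (elab \<Theta> \<Gamma> t)" using assms unfolding sound_typed_def well_typed_def by auto
  note s = soundD[OF *(4)]
  show "bangs \<Theta>" "set (map snd \<Gamma>) \<subseteq> F" "B \<in> F" using s(1,2) by (auto simp: bangs_def *)
  show "multilinear_on sc sc (map (\<lambda>A. sp (OfCourse A)) (map snd \<Theta>) @ map sp (map snd \<Gamma>)) (sp B) (\<lambda>xs. den M (elab \<Theta> \<Gamma> t) (pure xs))"
    using s(4) by (simp add: * o_def)
qed

text \<open>
  The unrestricted variables enter \<open>f\<close> through one element of \<open>!A\<^sub>1 \<otimes> \<dots> \<otimes> !A\<^sub>r\<close> rather than through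
  separate values, because an application splits them by the comultiplication of this coalgebra.
\<close>

definition tsem ::
  "(string \<times> 'a formula) list \<Rightarrow> (string \<times> 'a formula) list \<Rightarrow> 'a tm \<Rightarrow> 'a formula \<Rightarrow>
   (('k, 'v) tensor \<Rightarrow> (string \<Rightarrow> 'v) \<Rightarrow> 'v) \<Rightarrow> bool"
  where "tsem \<Theta> \<Gamma> t B f \<longleftrightarrow> sound_typed \<Theta> \<Gamma> t B \<and>
    (\<forall>\<rho>. admissible \<Gamma> \<rho> \<longrightarrow> linear_on tscale sc (BT \<Theta>) (sp B) (\<lambda>c. f c \<rho>) \<and>
      (\<forall>xs\<in>BL \<Theta>. den M (elab \<Theta> \<Gamma> t) (pure (xs @ vals \<Gamma> \<rho>)) = f (pure xs) \<rho>))"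

lemma tsemI:
  assumes "well_typed \<Theta> \<Gamma> t B" "sound (elab \<Theta> \<Gamma> t)"
    and "\<And>\<rho>. admissible \<Gamma> \<rho> \<Longrightarrow> linear_on tscale sc (BT \<Theta>) (sp B) (\<lambda>c. f c \<rho>)"
    and "\<And>\<rho> xs. admissible \<Gamma> \<rho> \<Longrightarrow> xs \<in> BL \<Theta> \<Longrightarrow> den M (elab \<Theta> \<Gamma> t) (pure (xs @ vals \<Gamma> \<rho>)) = f (pure xs) \<rho>"
  shows "tsem \<Theta> \<Gamma> t B f"
  using assms unfolding tsem_def sound_typed_def by blast

lemma tsemD:
  assumes "tsem \<Theta> \<Gamma> t B f"
  shows "sound_typed \<Theta> \<Gamma> t B" "well_typed \<Theta> \<Gamma> t B"
    and "admissible \<Gamma> \<rho> \<Longrightarrow> linear_on tscale sc (BT \<Theta>) (sp B) (\<lambda>c. f c \<rho>)"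
    and "admissible \<Gamma> \<rho> \<Longrightarrow> xs \<in> BL \<Theta> \<Longrightarrow> den M (elab \<Theta> \<Gamma> t) (pure (xs @ vals \<Gamma> \<rho>)) = f (pure xs) \<rho>"
    and "admissible \<Gamma> \<rho> \<Longrightarrow> c \<in> BT \<Theta> \<Longrightarrow> f c \<rho> \<in> sp B"
proof -
  show "sound_typed \<Theta> \<Gamma> t B" "well_typed \<Theta> \<Gamma> t B"
    "admissible \<Gamma> \<rho> \<Longrightarrow> xs \<in> BL \<Theta> \<Longrightarrow> den M (elab \<Theta> \<Gamma> t) (pure (xs @ vals \<Gamma> \<rho>)) = f (pure xs) \<rho>"
    and lin: "admissible \<Gamma> \<rho> \<Longrightarrow> linear_on tscale sc (BT \<Theta>) (sp B) (\<lambda>c. f c \<rho>)"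
    using assms unfolding tsem_def sound_typed_def by blast+
  show "admissible \<Gamma> \<rho> \<Longrightarrow> c \<in> BT \<Theta> \<Longrightarrow> f c \<rho> \<in> sp B" by (rule linear_on_in[OF lin])
qed

lemma coalgebra_BT: "bangs \<Theta> \<Longrightarrow> coalgebra tscale (BT \<Theta>) (Bcomult \<Theta>) (Bcounit \<Theta>)"
  unfolding bangs_def by (rule fam.coalgebra_tensor)

lemma subspace_BT: "module.subspace tscale (BT \<Theta>)"
  by (rule subspace_tspace)

lemma tsem_cong:
  assumes f: "tsem \<Theta> \<Gamma> t B f" and eq: "\<And>c \<rho>. admissible \<Gamma> \<rho> \<Longrightarrow> c \<in> BT \<Theta> \<Longrightarrow> f c \<rho> = g c \<rho>"
  shows "tsem \<Theta> \<Gamma> t B g"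
proof (rule tsemI)
  show "well_typed \<Theta> \<Gamma> t B" "sound (elab \<Theta> \<Gamma> t)" using tsemD(1)[OF f] unfolding sound_typed_def by auto
  fix \<rho> assume \<rho>: "admissible \<Gamma> \<rho>"
  show "linear_on tscale sc (BT \<Theta>) (sp B) (\<lambda>c. g c \<rho>)"
    by (rule linear_on_cong[OF vector_space_tscale subspace_BT eq[OF \<rho>] tsemD(3)[OF f \<rho>]])
  show "den M (elab \<Theta> \<Gamma> t) (pure (xs @ vals \<Gamma> \<rho>)) = g (pure xs) \<rho>" if "xs \<in> BL \<Theta>" for xs
    using tsemD(4)[OF f \<rho> that] eq[OF \<rho> tpure_in_tspace[OF that]] by simp
qed

section \<open>Variables and promoted terms\<close>

lemma sound_Weaks:
  assumes \<pi>: "sound \<pi>"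
  shows "set As \<subseteq> {A. OfCourse A \<in> F} \<Longrightarrow> sound (foldr Weak As \<pi>)"
    and "set As \<subseteq> {A. OfCourse A \<in> F} \<Longrightarrow> xs \<in> fam.L As \<Longrightarrow> ys \<in> env (hyps \<pi>) \<Longrightarrow>
      den M (foldr Weak As \<pi>) (pure (xs @ ys)) = sc (fam.pcounit As xs) (den M \<pi> (pure ys))"
proof -
  show s: "set As \<subseteq> {A. OfCourse A \<in> F} \<Longrightarrow> sound (foldr Weak As \<pi>)" for As
    by (induction As) (auto intro: sound_Weak \<pi>)
  show "set As \<subseteq> {A. OfCourse A \<in> F} \<Longrightarrow> xs \<in> fam.L As \<Longrightarrow> ys \<in> env (hyps \<pi>) \<Longrightarrow>
      den M (foldr Weak As \<pi>) (pure (xs @ ys)) = sc (fam.pcounit As xs) (den M \<pi> (pure ys))"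
  proof (induction As arbitrary: xs)
    case Nil
    then show ?case by (simp add: vector_space_one[OF vector_space])
  next
    case (Cons A As)
    then obtain x xs' where xs: "xs = x # xs'" "x \<in> sp (OfCourse A)" "xs' \<in> fam.L As" by (auto simp: set_Cons_def)
    have "xs' @ ys \<in> env (hyps (foldr Weak As \<pi>))"
      using env_append[of xs' "map OfCourse As" ys] xs(3) Cons.prems(3) by (simp add: weaks o_def)
    then show ?case using Cons xs
      by (simp add: sound_Weak(2)[OF s[of As]] vector_space_scale[OF vector_space])
  qed
qed

text \<open>A linear variable is elaborated with all of \<Theta> weakened, which multiplies its
  value by the counit of the tensor product.\<close>

lemma tsem_Var:
  assumes "bangs \<Theta>" "A \<in> F"
  shows "tsem \<Theta> [(x, A)] (Var x) A (\<lambda>c \<rho>. sc (Bcounit \<Theta> c) (\<rho> x))"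
proof (rule tsemI)
  show "well_typed \<Theta> [(x, A)] (Var x) A" by (rule well_typed_Var)
  have b: "set (map snd \<Theta>) \<subseteq> {A. OfCourse A \<in> F}" using assms(1) by (simp add: bangs_def)
  note w = sound_Weaks[OF sound_Ax(1)[OF assms(2)] b]
  show "sound (elab \<Theta> [(x, A)] (Var x))" using w(1) by simp
  interpret c: coalgebra tscale "BT \<Theta>" "Bcomult \<Theta>" "Bcounit \<Theta>" by (rule coalgebra_BT[OF assms(1)])
  fix \<rho> :: "string \<Rightarrow> 'v" assume "admissible [(x, A)] \<rho>"
  then have \<rho>: "\<rho> x \<in> sp A" by (simp add: admissible_def)
  show "linear_on tscale sc (BT \<Theta>) (sp A) (\<lambda>c. sc (Bcounit \<Theta> c) (\<rho> x))"
    by (rule linear_on_scale_left[OF vector_space space[OF assms(2)] c.\<epsilon> \<rho>])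
  fix xs assume xs: "xs \<in> BL \<Theta>"
  have "[\<rho> x] \<in> env (hyps (Ax A))" using \<rho> by (simp add: set_Cons_def)
  from w(2)[OF xs this] show "den M (elab \<Theta> [(x, A)] (Var x)) (pure (xs @ vals [(x, A)] \<rho>)) = sc (Bcounit \<Theta> (pure xs)) (\<rho> x)"
    by (simp add: sound_Ax(2)[OF assms(2) \<rho>] fam.tcounit(2)[OF b xs])
qed

text \<open>The factor of \<open>u\<close> itself is derelicted and all the others are weakened, so
  their counits appear as a scalar.\<close>

lemma UVar_eval:
  assumes "bangs \<Theta>" "distinct (map fst \<Theta>)" "(u, A) \<in> set \<Theta>"
  defines "i \<equiv> length (takeWhile (\<lambda>p. fst p \<noteq> u) \<Theta>)"
  defines "js \<equiv> filter (\<lambda>j. j \<noteq> i) [0..<length \<Theta>]"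
  shows "sound_typed \<Theta> [] (UVar u) A"
    and "xs \<in> BL \<Theta> \<Longrightarrow> den M (elab \<Theta> [] (UVar u)) (pure xs) =
      sc (fam.pcounit (map (\<lambda>j. snd (\<Theta> ! j)) js) (map ((!) xs) js)) (derel M A (xs ! i))"
proof -
  have wt: "well_typed \<Theta> [] (UVar u) A" by (rule well_typed_UVar[OF assms(2,3)])
  have i: "i < length \<Theta>" unfolding i_def using assms(3) by (induction \<Theta>) auto
  let ?B = "snd (\<Theta> ! i)"
  let ?\<pi> = "foldr Weak (map (\<lambda>j. snd (\<Theta> ! j)) js) (Der (Ax ?B))"
  have el: "elab \<Theta> [] (UVar u) = Exch (map (OfCourse \<circ> snd) \<Theta>) (js @ [i]) ?\<pi>"
    by (simp add: Let_def i_def[symmetric] js_def)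
  \<comment> \<open>The formula at the computed position is read off from the conclusion of the
    elaborated proof, whose typing is known.\<close>
  have B: "?B = A" using wt unfolding well_typed_def el by (simp add: weaks)
  have bang: "OfCourse (snd (\<Theta> ! j)) \<in> F" if "j < length \<Theta>" for j
    using assms(1) nth_mem[OF that] unfolding bangs_def by auto
  have A: "OfCourse A \<in> F" "A \<in> F" using bang[OF i] B formulas_sub(5) by auto
  have js: "set (map (\<lambda>j. snd (\<Theta> ! j)) js) \<subseteq> {A. OfCourse A \<in> F}" using bang by (auto simp: js_def)
  have hA: "hyps (Ax A) = A # []" by simp
  note d = sound_Der[OF sound_Ax(1)[OF A(2)] A(1) hA]
  note w = sound_Weaks[OF d(1) js]
  have v: "valid (Exch (map (OfCourse \<circ> snd) \<Theta>) (js @ [i]) ?\<pi>)" using wt unfolding well_typed_def el by simp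
  have e: "distinct (js @ [i])" "set (js @ [i]) = {..<length (map (OfCourse \<circ> snd) \<Theta>)}"
    "hyps ?\<pi> = map ((!) (map (OfCourse \<circ> snd) \<Theta>)) (js @ [i])"
    using v by auto
  note x = sound_Exch[OF w(1)[folded B] e]
  show "sound_typed \<Theta> [] (UVar u) A" using wt x(1) unfolding sound_typed_def el by simp
  assume xs: "xs \<in> BL \<Theta>"
  then have xs': "xs \<in> env (map (OfCourse \<circ> snd) \<Theta>)" by (simp add: o_def)
  have l: "length xs = length \<Theta>" using listset_length[OF xs] by simp
  have xj: "xs ! j \<in> sp (OfCourse (snd (\<Theta> ! j)))" if "j < length \<Theta>" for j
    using xs that by (auto simp: listset_nth)
  have "js ! k < length \<Theta>" if "k < length js" for k
    using nth_mem[OF that] unfolding js_def by auto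
  then have "map ((!) xs) js \<in> fam.L (map (\<lambda>j. snd (\<Theta> ! j)) js)"
    by (auto simp: listset_nth intro: xj)
  moreover have xi: "xs ! i \<in> sp (OfCourse A)" using xj[OF i] B by simp
  moreover have "[xs ! i] \<in> env (hyps (Der (Ax A)))" using xi by (simp add: set_Cons_def)
  moreover have "derel M A (xs ! i) \<in> sp A" by (rule linear_on_in[OF derel[OF A(1)] xi])
  ultimately show "den M (elab \<Theta> [] (UVar u)) (pure xs) =
      sc (fam.pcounit (map (\<lambda>j. snd (\<Theta> ! j)) js) (map ((!) xs) js)) (derel M A (xs ! i))"
    using w(2) d(2)[of "xs ! i" "[]"] sound_Ax(2)[OF A(2)]
    unfolding el x(2)[OF xs'] by (simp add: B)
qed

text \<open>A term without linear variables may serve as its own meaning. In this way a promoted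
  term is treated as an opaque map on the coalgebra.\<close>

lemma tsem_closed:
  assumes "sound_typed \<Theta> [] t A"
  shows "tsem \<Theta> [] t A (\<lambda>c \<rho>. den M (elab \<Theta> [] t) c)"
proof (rule tsemI)
  show "well_typed \<Theta> [] t A" "sound (elab \<Theta> [] t)" using assms by (auto simp: sound_typed_def)
  show "linear_on tscale sc (BT \<Theta>) (sp A) (den M (elab \<Theta> [] t))"
    using soundD(3)[OF sound_typedD(4)[OF assms]] by (simp add: sound_typedD(2,3)[OF assms] o_def)
qed simp

lemma tsem_closed_den:
  assumes "tsem \<Theta> [] t A f" "c \<in> BT \<Theta>"
  shows "den M (elab \<Theta> [] t) c = f c \<rho>"
proof (rule linear_on_tspace_eqI[OF _ _ _ assms(2)])
  have a: "admissible [] \<rho>" by (simp add: admissible_def)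
  show "linear_on tscale sc (BT \<Theta>) (sp A) (den M (elab \<Theta> [] t))"
    using tsemD(3)[OF tsem_closed[OF tsemD(1)[OF assms(1)]] a] .
  show "linear_on tscale sc (BT \<Theta>) (sp A) (\<lambda>c. f c \<rho>)" by (rule tsemD(3)[OF assms(1) a])
  show "den M (elab \<Theta> [] t) (pure xs) = f (pure xs) \<rho>" if "xs \<in> BL \<Theta>" for xs
    using tsemD(4)[OF assms(1) a that] by simp
qed

text \<open>Unlike the other rules for terms this gives no formula for the value: a promotion is
  known only through being a coalgebra morphism and through its dereliction.\<close>

lemma tsem_Bang:
  assumes t: "tsem \<Theta> [] t A f" and A: "OfCourse A \<in> F"
  shows "sound_typed \<Theta> [] (Bang t) (OfCourse A)"
    and "coalgebra_mor tscale (BT \<Theta>) (Bcomult \<Theta>) (Bcounit \<Theta>)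
      sc (sp (OfCourse A)) (comult M A) (counit M A) (den M (elab \<Theta> [] (Bang t)))"
    and "c \<in> BT \<Theta> \<Longrightarrow> derel M A (den M (elab \<Theta> [] (Bang t)) c) = f c \<rho>"
proof -
  note d = sound_typedD[OF tsemD(1)[OF t]]
  have h: "hyps (elab \<Theta> [] t) = map OfCourse (map snd \<Theta>)" by (simp add: d)
  note p = sound_Prom[OF d(4) h, unfolded d(3), OF A]
  show "sound_typed \<Theta> [] (Bang t) (OfCourse A)"
    using p(1) well_typed_Bang[OF tsemD(2)[OF t]] by (simp add: sound_typed_def)
  show "coalgebra_mor tscale (BT \<Theta>) (Bcomult \<Theta>) (Bcounit \<Theta>)
      sc (sp (OfCourse A)) (comult M A) (counit M A) (den M (elab \<Theta> [] (Bang t)))"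
    using p(2) by simp
  show "c \<in> BT \<Theta> \<Longrightarrow> derel M A (den M (elab \<Theta> [] (Bang t)) c) = f c \<rho>"
    using p(3) tsem_closed_den[OF t] by simp
qed

section \<open>Abstraction over linear and unrestricted variables\<close>

lemma linear_on_sc_plus:
  assumes "B \<in> F" "linear_on r sc V (sp B) f" "linear_on r sc V (sp B) g"
  shows "linear_on r sc V (sp B) (\<lambda>x. sc k (f x) + g x)"
proof -
  have "linear_on r sc V (sp B) (\<lambda>x. \<Sum>h\<leftarrow>[\<lambda>x. sc k (f x), g]. h x)"
    using assms by (intro linear_on_sum_list[OF vector_space space[OF assms(1)]])
      (auto intro: linear_on_scale_right[OF vector_space space[OF assms(1)]])
  then show ?thesis by simp
qed

lemma linear_on_vanishing:
  assumes "A \<in> F" "B \<in> F" "\<And>x. x \<in> sp A \<Longrightarrow> f x = 0"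
  shows "linear_on sc sc (sp A) (sp B) f"
  by (rule linear_onI)
    (simp_all add: assms(3) subspace_zero[OF vector_space space[OF assms(2)]] vector_space_zero_right[OF vector_space]
      subspace_plus[OF vector_space space[OF assms(1)]] subspace_smult[OF vector_space space[OF assms(1)]])

lemma lam_linear:
  assumes AB: "(A \<multimap> B) \<in> F"
    and h1: "\<And>c. c \<in> V \<Longrightarrow> linear_on sc sc (sp A) (sp B) (h c)"
    and h2: "\<And>a. a \<in> sp A \<Longrightarrow> linear_on r sc V (sp B) (\<lambda>c. h c a)"
  shows "linear_on r sc V (sp (A \<multimap> B)) (\<lambda>c. lam A B (h c))"
  unfolding lam_def
proof (rule linear_on_compose[where g = "lolli_in M A B"])
  show "linear_on (fun_scale sc) sc (Hom sc sc (sp A) (sp B)) (sp (A \<multimap> B)) (lolli_in M A B)"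
    using lolli[OF AB] by (simp add: linear_iso_def)
  show "linear_on r (fun_scale sc) V (Hom sc sc (sp A) (sp B)) (\<lambda>c a. if a \<in> sp A then h c a else 0)"
  proof (rule linear_onI)
    show "c \<in> V \<Longrightarrow> (\<lambda>a. if a \<in> sp A then h c a else 0) \<in> Hom sc sc (sp A) (sp B)" for c
      by (rule lam_Hom[OF formulas_sub(3)[OF AB] h1])
    show "(\<lambda>a. if a \<in> sp A then h (c + d) a else 0) = (\<lambda>a. if a \<in> sp A then h c a else 0) + (\<lambda>a. if a \<in> sp A then h d a else 0)"
      if "c \<in> V" "d \<in> V" for c d
      using that by (intro ext) (auto simp: plus_fun_apply linear_on_add[OF h2])
    show "(\<lambda>a. if a \<in> sp A then h (r k c) a else 0) = fun_scale sc k (\<lambda>a. if a \<in> sp A then h c a else 0)"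
      if "c \<in> V" for k c
      using that by (intro ext) (auto simp: fun_scale_def linear_on_scale[OF h2] vector_space_zero_right[OF vector_space])
  qed
qed

lemma vals_upd: "x \<notin> fst ` set \<Gamma> \<Longrightarrow> vals ((x, A) # \<Gamma>) (\<rho>(x := a)) = a # vals \<Gamma> \<rho>"
  by (induction \<Gamma>) auto

lemma admissible_Cons_upd:
  "x \<notin> fst ` set \<Gamma> \<Longrightarrow> admissible \<Gamma> \<rho> \<Longrightarrow> a \<in> sp A \<Longrightarrow> admissible ((x, A) # \<Gamma>) (\<rho>(x := a))"
  unfolding admissible_def by force

text \<open>Multilinearity of \<open>den\<close> gives linearity in the variable when
  \<open>c\<close> is a pure tensor. It passes to arbitrary \<open>c\<close> by induction, since
  \<open>f\<close> is linear in \<open>c\<close> and linear maps are closed under the combinations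
  that occur. Freshness of \<open>x\<close> keeps the other values unchanged under the
  update.\<close>

lemma tsem_linear_var:
  assumes t: "tsem \<Theta> ((x, A) # \<Gamma>) t B f" and x: "x \<notin> fst ` set \<Gamma>" and \<rho>: "admissible \<Gamma> \<rho>" and c: "c \<in> BT \<Theta>"
  shows "linear_on sc sc (sp A) (sp B) (\<lambda>a. f c (\<rho>(x := a)))"
proof -
  note d = sound_typedD[OF tsemD(1)[OF t]]
  have A: "A \<in> F" using d(6) by simp
  note adm = admissible_Cons_upd[OF x \<rho>]
  note lin = tsemD(3)[OF t adm]
  show ?thesis
    using c
  proof (induction rule: tspace_induct)
    case zero
    have "f 0 (\<rho>(x := a)) = 0" if "a \<in> sp A" for a
      by (rule linear_on_zero[OF lin[OF that] subspace_zero[OF vector_space_tscale subspace_BT]])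
    then show ?case
      by (rule linear_on_vanishing[OF A d(7)])
  next
    case (step k xs c)
    have "linear_on sc sc (sp A) (sp B) (\<lambda>a. den M (elab \<Theta> ((x, A) # \<Gamma>) t) (pure (xs @ a # vals \<Gamma> \<rho>)))"
      using d(8)[unfolded multilinear_on_append] step(1) vals_in[OF \<rho>] by simp
    then have p: "linear_on sc sc (sp A) (sp B) (\<lambda>a. f (pure xs) (\<rho>(x := a)))"
      by (rule linear_on_cong[OF vector_space space[OF A], rotated])
        (use tsemD(4)[OF t adm step(1)] in \<open>simp only: vals_upd[OF x]\<close>)
    have px: "pure xs \<in> BT \<Theta>" by (rule tpure_in_tspace[OF step(1)])
    have "f (tscale k (pure xs) + c) (\<rho>(x := a)) = sc k (f (pure xs) (\<rho>(x := a))) + f c (\<rho>(x := a))" if "a \<in> sp A" for a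
      using linear_on_add[OF lin[OF that] subspace_smult[OF vector_space_tscale subspace_BT px] step(2)]
        linear_on_scale[OF lin[OF that] px] by simp
    then show ?case
      by (intro linear_on_cong[OF vector_space space[OF A] _ linear_on_sc_plus[OF d(7) p step(3), of k]]) (simp only:)
  qed
qed

lemma tsem_Lam:
  assumes t: "tsem \<Theta> ((x, A) # \<Gamma>) t B f" and AB: "(A \<multimap> B) \<in> F" and x: "x \<notin> fst ` set \<Gamma>"
  shows "tsem \<Theta> \<Gamma> (Lam x A t) (A \<multimap> B) (\<lambda>c \<rho>. lam A B (\<lambda>a. f c (\<rho>(x := a))))"
proof (rule tsemI)
  note d = sound_typedD[OF tsemD(1)[OF t]]
  show wt: "well_typed \<Theta> \<Gamma> (Lam x A t) (A \<multimap> B)" by (rule well_typed_Lam[OF tsemD(2)[OF t]])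
  define m where "m = length \<Theta>"
  define js where "js = [1..<Suc m] @ [0] @ [Suc m..<Suc (m + length \<Gamma>)]"
  define G where "G = A # map (OfCourse \<circ> snd) \<Theta> @ map snd \<Gamma>"
  have el: "elab \<Theta> \<Gamma> (Lam x A t) = LolliR (Exch G js (elab \<Theta> ((x, A) # \<Gamma>) t))"
    by (simp add: Let_def m_def js_def G_def del: upt_Suc)
  have "valid (Exch G js (elab \<Theta> ((x, A) # \<Gamma>) t))" using wt unfolding well_typed_def el by simp
  then have "distinct js" "set js = {..<length G}" "hyps (elab \<Theta> ((x, A) # \<Gamma>) t) = map ((!) G) js" by simp_all
  note e = sound_Exch[OF d(4) this]
  have h: "hyps (Exch G js (elab \<Theta> ((x, A) # \<Gamma>) t)) = A # (map (OfCourse \<circ> snd) \<Theta> @ map snd \<Gamma>)" by (simp add: G_def)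
  have c: "concl (Exch G js (elab \<Theta> ((x, A) # \<Gamma>) t)) = B" by (simp add: d)
  note l = sound_LolliR[OF e(1) h, unfolded c, OF AB]
  show "sound (elab \<Theta> \<Gamma> (Lam x A t))" using l(1) el by simp
  fix \<rho> assume \<rho>: "admissible \<Gamma> \<rho>"
  note adm = admissible_Cons_upd[OF x \<rho>]
  show "linear_on tscale sc (BT \<Theta>) (sp (A \<multimap> B)) (\<lambda>c. lam A B (\<lambda>a. f c (\<rho>(x := a))))"
    by (rule lam_linear[OF AB tsem_linear_var[OF t x \<rho>] tsemD(3)[OF t adm]])
  fix xs assume xs: "xs \<in> BL \<Theta>"
  have lx: "length xs = m" using listset_length[OF xs] by (simp add: m_def)
  have "xs @ vals \<Gamma> \<rho> \<in> env (map (OfCourse \<circ> snd) \<Theta> @ map snd \<Gamma>)"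
    using xs by (intro env_append vals_in \<rho>) (simp add: o_def)
  note l' = l(2)[OF this]
  \<comment> \<open>The bound variable enters at the front, as the hypothesis that
    \<open>LolliR\<close> discharges, whereas the body expects it behind the unrestricted ones;
    \<open>js\<close> moves it there.\<close>
  have j: "map ((!) (a # xs @ vals \<Gamma> \<rho>)) js = xs @ a # vals \<Gamma> \<rho>" for a
    unfolding js_def using lx by (intro nth_equalityI) (auto simp: nth_append nth_Cons' simp del: upt_Suc)
  have "den M (elab \<Theta> \<Gamma> (Lam x A t)) (pure (xs @ vals \<Gamma> \<rho>)) =
    lam A B (\<lambda>a. den M (Exch G js (elab \<Theta> ((x, A) # \<Gamma>) t)) (pure (a # xs @ vals \<Gamma> \<rho>)))"
    unfolding el by (rule l')
  also have "\<dots> = lam A B (\<lambda>a. f (pure xs) (\<rho>(x := a)))"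
  proof (rule lam_cong)
    fix a assume a: "a \<in> sp A"
    have "a # xs @ vals \<Gamma> \<rho> \<in> env G"
      unfolding G_def list.map listset_Cons using a \<open>xs @ vals \<Gamma> \<rho> \<in> env (map (OfCourse \<circ> snd) \<Theta> @ map snd \<Gamma>)\<close> by simp
    from e(2)[OF this] show "den M (Exch G js (elab \<Theta> ((x, A) # \<Gamma>) t)) (pure (a # xs @ vals \<Gamma> \<rho>)) = f (pure xs) (\<rho>(x := a))"
      using tsemD(4)[OF t adm[OF a] xs] by (simp only: j vals_upd[OF x])
  qed
  finally show "den M (elab \<Theta> \<Gamma> (Lam x A t)) (pure (xs @ vals \<Gamma> \<rho>)) = lam A B (\<lambda>a. f (pure xs) (\<rho>(x := a)))" .
qed

lemma Btcons:
  assumes "bangs ((u, A) # \<Theta>)" "x \<in> sp (OfCourse A)"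
  shows "linear_on tscale tscale (BT \<Theta>) (BT ((u, A) # \<Theta>)) (tcons sc (map (\<lambda>A. sp (OfCourse A)) (map snd \<Theta>)) x)"
    and "xs \<in> BL \<Theta> \<Longrightarrow> tcons sc (map (\<lambda>A. sp (OfCourse A)) (map snd \<Theta>)) x (pure xs) = pure (x # xs)"
proof -
  have b: "set (map snd \<Theta>) \<subseteq> {A. OfCourse A \<in> F}" and A: "A \<in> {A. OfCourse A \<in> F}"
    using assms(1) by (auto simp: bangs_def)
  show "linear_on tscale tscale (BT \<Theta>) (BT ((u, A) # \<Theta>)) (tcons sc (map (\<lambda>A. sp (OfCourse A)) (map snd \<Theta>)) x)"
    using fam.tcons(1)[OF b A assms(2)] unfolding Hom_def by simp
  show "xs \<in> BL \<Theta> \<Longrightarrow> tcons sc (map (\<lambda>A. sp (OfCourse A)) (map snd \<Theta>)) x (pure xs) = pure (x # xs)"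
    by (rule fam.tcons(2)[OF b A assms(2)])
qed

lemma tsem_Cons_pure:
  assumes t: "tsem ((u, A) # \<Theta>) \<Gamma> t B f" and \<rho>: "admissible \<Gamma> \<rho>" and x: "x \<in> sp (OfCourse A)" and xs: "xs \<in> BL \<Theta>"
  shows "den M (elab ((u, A) # \<Theta>) \<Gamma> t) (pure (x # xs @ vals \<Gamma> \<rho>)) =
    f (tcons sc (map (\<lambda>A. sp (OfCourse A)) (map snd \<Theta>)) x (pure xs)) \<rho>"
proof -
  have "x # xs \<in> BL ((u, A) # \<Theta>)" using x xs by (simp add: set_Cons_def)
  from tsemD(4)[OF t \<rho> this] show ?thesis
    using Btcons(2)[OF sound_typedD(5)[OF tsemD(1)[OF t]] x xs] by simp
qed

lemma tsem_linear_bang: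
  assumes t: "tsem ((u, A) # \<Theta>) \<Gamma> t B f" and \<rho>: "admissible \<Gamma> \<rho>" and c: "c \<in> BT \<Theta>"
  shows "linear_on sc sc (sp (OfCourse A)) (sp B)
    (\<lambda>x. f (tcons sc (map (\<lambda>A. sp (OfCourse A)) (map snd \<Theta>)) x c) \<rho>)"
proof -
  note d = sound_typedD[OF tsemD(1)[OF t]]
  have A: "OfCourse A \<in> F" using d(5) by (simp add: bangs_def)
  let ?tc = "tcons sc (map (\<lambda>A. sp (OfCourse A)) (map snd \<Theta>))"
  note lin = linear_on_compose[OF Btcons(1)[OF d(5)] tsemD(3)[OF t \<rho>]]
  show ?thesis
    using c
  proof (induction rule: tspace_induct)
    case zero
    have "f (?tc x 0) \<rho> = 0" if "x \<in> sp (OfCourse A)" for x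
      by (rule linear_on_zero[OF lin[OF that] subspace_zero[OF vector_space_tscale subspace_BT]])
    then show ?case
      by (rule linear_on_vanishing[OF A d(7)])
  next
    case (step k xs c)
    have "xs @ vals \<Gamma> \<rho> \<in> listset (map (\<lambda>A. sp (OfCourse A)) (map snd \<Theta>) @ map sp (map snd \<Gamma>))"
      by (rule listset_append[OF step(1) vals_in[OF \<rho>]])
    then have "linear_on sc sc (sp (OfCourse A)) (sp B) (\<lambda>x. den M (elab ((u, A) # \<Theta>) \<Gamma> t) (pure (x # xs @ vals \<Gamma> \<rho>)))"
      using d(8) by simp
    then have q: "linear_on sc sc (sp (OfCourse A)) (sp B) (\<lambda>x. f (?tc x (pure xs)) \<rho>)"
      by (rule linear_on_cong[OF vector_space space[OF A], rotated]) (rule tsem_Cons_pure[OF t \<rho> _ step(1)])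
    have px: "pure xs \<in> BT \<Theta>" by (rule tpure_in_tspace[OF step(1)])
    have "f (?tc x (tscale k (pure xs) + c)) \<rho> = sc k (f (?tc x (pure xs)) \<rho>) + f (?tc x c) \<rho>" if "x \<in> sp (OfCourse A)" for x
      using linear_on_add[OF lin[OF that] subspace_smult[OF vector_space_tscale subspace_BT px] step(2)]
        linear_on_scale[OF lin[OF that] px] by simp
    then show ?case
      by (intro linear_on_cong[OF vector_space space[OF A] _ linear_on_sc_plus[OF d(7) q step(3), of k]]) (simp only:)
  qed
qed

text \<open>The new unrestricted variable is put in front of \<Theta>, so its value \<open>x\<close>
  becomes the first tensor factor. Since \<open>c\<close> may be a sum of pure tensors, this is
  expressed by \<open>tcons\<close>.\<close>

lemma tsem_LamB:
  assumes t: "tsem ((u, A) # \<Theta>) \<Gamma> t B f" and AB: "(OfCourse A \<multimap> B) \<in> F"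
  shows "tsem \<Theta> \<Gamma> (LamB u A t) (OfCourse A \<multimap> B)
    (\<lambda>c \<rho>. lam (OfCourse A) B (\<lambda>x. f (tcons sc (map (\<lambda>A. sp (OfCourse A)) (map snd \<Theta>)) x c) \<rho>))"
proof (rule tsemI)
  note d = sound_typedD[OF tsemD(1)[OF t]]
  show wt: "well_typed \<Theta> \<Gamma> (LamB u A t) (OfCourse A \<multimap> B)" by (rule well_typed_LamB[OF tsemD(2)[OF t]])
  have h: "hyps (elab ((u, A) # \<Theta>) \<Gamma> t) = OfCourse A # (map (OfCourse \<circ> snd) \<Theta> @ map snd \<Gamma>)" by (simp add: d)
  note l = sound_LolliR[OF d(4) h, unfolded d(3), OF AB]
  show "sound (elab \<Theta> \<Gamma> (LamB u A t))" using l(1) by simp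
  fix \<rho> assume \<rho>: "admissible \<Gamma> \<rho>"
  note lin = linear_on_compose[OF Btcons(1)[OF d(5)] tsemD(3)[OF t \<rho>]]
  let ?tc = "tcons sc (map (\<lambda>A. sp (OfCourse A)) (map snd \<Theta>))"
  show "linear_on tscale sc (BT \<Theta>) (sp (OfCourse A \<multimap> B)) (\<lambda>c. lam (OfCourse A) B (\<lambda>x. f (?tc x c) \<rho>))"
    by (rule lam_linear[OF AB tsem_linear_bang[OF t \<rho>] lin])
  fix xs assume xs: "xs \<in> BL \<Theta>"
  have "xs @ vals \<Gamma> \<rho> \<in> env (map (OfCourse \<circ> snd) \<Theta> @ map snd \<Gamma>)"
    using xs by (intro env_append vals_in \<rho>) (simp add: o_def)
  from l(2)[OF this] show "den M (elab \<Theta> \<Gamma> (LamB u A t)) (pure (xs @ vals \<Gamma> \<rho>)) =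
      lam (OfCourse A) B (\<lambda>x. f (?tc x (pure xs)) \<rho>)"
    using tsem_Cons_pure[OF t \<rho> _ xs] by (simp cong: lam_cong)
qed

lemma tsem_Tup:
  assumes f: "tsem \<Theta> \<Gamma> t A f" and g: "tsem \<Theta> \<Gamma> t' B g" and AB: "With A B \<in> F"
  shows "tsem \<Theta> \<Gamma> (Tup t t') (With A B) (\<lambda>c \<rho>. wpair A B (f c \<rho>) (g c \<rho>))"
proof (rule tsemI)
  show "well_typed \<Theta> \<Gamma> (Tup t t') (With A B)" by (rule well_typed_Tup[OF tsemD(2)[OF f] tsemD(2)[OF g]])
  note df = sound_typedD[OF tsemD(1)[OF f]] and dg = sound_typedD[OF tsemD(1)[OF g]]
  have h: "hyps (elab \<Theta> \<Gamma> t') = hyps (elab \<Theta> \<Gamma> t)" by (simp add: df dg)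
  note s = sound_WithR[OF df(4) dg(4) h, unfolded df(3) dg(3), OF AB]
  show "sound (elab \<Theta> \<Gamma> (Tup t t'))" using s(1) by simp
  fix \<rho> assume \<rho>: "admissible \<Gamma> \<rho>"
  have "linear_on tscale (prod_scale sc) (BT \<Theta>) (sp A \<times> sp B) (\<lambda>c. (f c \<rho>, g c \<rho>))"
    using tsemD(3)[OF f \<rho>] tsemD(3)[OF g \<rho>] by (auto simp: linear_on_def prod_scale_def)
  then show "linear_on tscale sc (BT \<Theta>) (sp (With A B)) (\<lambda>c. wpair A B (f c \<rho>) (g c \<rho>))"
    unfolding wpair_def by (rule linear_on_compose[OF _ with_props(6)[OF AB]])
  fix xs assume xs: "xs \<in> BL \<Theta>"
  have "xs @ vals \<Gamma> \<rho> \<in> env (hyps (elab \<Theta> \<Gamma> t))"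
    unfolding df(2) using xs by (intro env_append vals_in \<rho>) (simp add: o_def)
  from s(2)[OF this] show "den M (elab \<Theta> \<Gamma> (Tup t t')) (pure (xs @ vals \<Gamma> \<rho>)) = wpair A B (f (pure xs) \<rho>) (g (pure xs) \<rho>)"
    using tsemD(4)[OF f \<rho> xs] tsemD(4)[OF g \<rho> xs] by simp
qed

text \<open>Both projections are elaborated as a cut against a proof with one hypothesis; only its
  value \<open>k\<close> differs.\<close>

lemma tsem_Cut1:
  assumes t: "tsem \<Theta> \<Gamma> t A f" and \<pi>: "sound \<pi>" "hyps \<pi> = [A]" and e: "\<And>x. x \<in> sp A \<Longrightarrow> den M \<pi> (pure [x]) = k x"
    and k: "linear_on sc sc (sp A) (sp B) k"
    and t': "well_typed \<Theta> \<Gamma> t' B" "elab \<Theta> \<Gamma> t' = Cut 0 (elab \<Theta> \<Gamma> t) \<pi>"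
  shows "tsem \<Theta> \<Gamma> t' B (\<lambda>c \<rho>. k (f c \<rho>))"
proof (rule tsemI[OF t'(1)])
  note d = sound_typedD[OF tsemD(1)[OF t]]
  have h: "hyps \<pi> = [] @ concl (elab \<Theta> \<Gamma> t) # []" using \<pi>(2) d(3) by simp
  note s = sound_Cut[OF d(4) \<pi>(1) h, of 0]
  show "sound (elab \<Theta> \<Gamma> t')" unfolding t'(2) by (rule s) simp
  fix \<rho> assume \<rho>: "admissible \<Gamma> \<rho>"
  show "linear_on tscale sc (BT \<Theta>) (sp B) (\<lambda>c. k (f c \<rho>))" by (rule linear_on_compose[OF tsemD(3)[OF t \<rho>] k])
  fix xs assume xs: "xs \<in> BL \<Theta>"
  have "xs @ vals \<Gamma> \<rho> \<in> env (hyps (elab \<Theta> \<Gamma> t))"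
    unfolding d(2) using xs by (intro env_append vals_in \<rho>) (simp add: o_def)
  from s(2)[of "[]" _ "[]", OF _ _ this] show "den M (elab \<Theta> \<Gamma> t') (pure (xs @ vals \<Gamma> \<rho>)) = k (f (pure xs) \<rho>)"
    unfolding t'(2) using tsemD(4)[OF t \<rho> xs] e[OF tsemD(5)[OF t \<rho> tpure_in_tspace[OF xs]]] by simp
qed

lemma tsem_Fst:
  assumes t: "tsem \<Theta> \<Gamma> t (With A B) f"
  shows "tsem \<Theta> \<Gamma> (Fst t) A (\<lambda>c \<rho>. wfst A B (f c \<rho>))"
    and "tsem \<Theta> \<Gamma> (Snd t) B (\<lambda>c \<rho>. wsnd A B (f c \<rho>))"
proof -
  note d = sound_typedD[OF tsemD(1)[OF t]]
  note w = sound_WithL[OF d(7)] and p = with_props[OF d(7)]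
  show "tsem \<Theta> \<Gamma> (Fst t) A (\<lambda>c \<rho>. wfst A B (f c \<rho>))"
    by (rule tsem_Cut1[OF t w(1) _ w(3) p(4) well_typed_Fst[OF tsemD(2)[OF t]]]) (simp_all add: d(3))
  show "tsem \<Theta> \<Gamma> (Snd t) B (\<lambda>c \<rho>. wsnd A B (f c \<rho>))"
    by (rule tsem_Cut1[OF t w(2) _ w(4) p(5) well_typed_Snd[OF tsemD(2)[OF t]]]) (simp_all add: d(3))
qed

section \<open>Application as convolution\<close>

lemma interleave_in:
  "ps \<in> fam.L Bs \<Longrightarrow> qs \<in> fam.L Bs \<Longrightarrow> interleave ps qs \<in> env (concat (map (\<lambda>B. [OfCourse B, OfCourse B]) Bs))"
proof (induction Bs arbitrary: ps qs)
  case (Cons B Bs)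
  then show ?case by (auto elim!: listset_ConsE simp: listset_Cons simp del: listset.simps)
qed simp

text \<open>The hypotheses \<open>As\<close> are those already contracted; each step moves one
  formula from \<open>Bs\<close> to \<open>As\<close>, which keeps the position of the next
  contraction equal to \<open>length As\<close>. The nested coproducts that arise are those
  enumerated by \<open>cops\<close>, that is, the comultiplication of the tensor product.\<close>

lemma sound_contrs:
  assumes "sound \<pi>" "hyps \<pi> = map OfCourse As @ concat (map (\<lambda>B. [OfCourse B, OfCourse B]) Bs) @ \<Gamma>"
  shows "sound (fold Contr [length As..<length As + length Bs] \<pi>) \<and>
    (\<forall>us\<in>fam.L As. \<forall>xs\<in>fam.L Bs. \<forall>ys\<in>env \<Gamma>.
      den M (fold Contr [length As..<length As + length Bs] \<pi>) (pure (us @ xs @ ys)) =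
      psum (\<lambda>ps qs. den M \<pi> (pure (us @ interleave ps qs @ ys))) (fam.cops Bs xs))"
  using assms
proof (induction Bs arbitrary: As \<pi>)
  case Nil
  then show ?case by simp
next
  case (Cons B Bs)
  define a where "a = length As"
  define D where "D = concat (map (\<lambda>B. [OfCourse B, OfCourse B]) Bs) @ \<Gamma>"
  have h: "hyps \<pi> = map OfCourse As @ [OfCourse B, OfCourse B] @ D" using Cons.prems(2) by (simp add: D_def)
  have a: "a = length (map OfCourse As)" by (simp add: a_def)
  note c = sound_Contr[OF Cons.prems(1) h a]
  have h2: "hyps (Contr a \<pi>) = map OfCourse (As @ [B]) @ concat (map (\<lambda>B. [OfCourse B, OfCourse B]) Bs) @ \<Gamma>"
    by (simp add: h a_def D_def)
  have fold: "fold Contr [length As..<length As + length (B # Bs)] \<pi> =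
      fold Contr [length (As @ [B])..<length (As @ [B]) + length Bs] (Contr a \<pi>)"
    by (simp add: a_def upt_conv_Cons del: upt_Suc)
  note IH = Cons.IH[OF c(1) h2, folded fold]
  have B: "B \<in> {A. OfCourse A \<in> F}" and Bs: "set Bs \<subseteq> {A. OfCourse A \<in> F}"
    using soundD(1)[OF Cons.prems(1)] by (auto simp: h D_def)
  show ?case
  proof (intro conjI ballI)
    show "sound (fold Contr [length As..<length As + length (B # Bs)] \<pi>)" using IH by blast
    fix us xs ys assume us: "us \<in> fam.L As" and "xs \<in> fam.L (B # Bs)" and ys: "ys \<in> env \<Gamma>"
    then obtain x xs' where xs: "xs = x # xs'" "x \<in> sp (OfCourse B)" "xs' \<in> fam.L Bs" by (auto simp: set_Cons_def)
    have us': "us @ [x] \<in> fam.L (As @ [B])"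
      unfolding map_append using us xs(2) by (intro listset_append) (auto simp: set_Cons_def)
    have "den M (fold Contr [length As..<length As + length (B # Bs)] \<pi>) (pure (us @ xs @ ys)) =
      psum (\<lambda>ps qs. den M (Contr a \<pi>) (pure (us @ x # interleave ps qs @ ys))) (fam.cops Bs xs')"
      using IH[THEN conjunct2, rule_format, OF us' xs(3) ys] by (simp add: xs(1))
    also have "\<dots> = psum (\<lambda>ps qs. sw sc (sp (OfCourse B)) (\<lambda>y z. den M \<pi> (pure (us @ [y, z] @ interleave ps qs @ ys))) (comult M B x)) (fam.cops Bs xs')"
    proof (rule fam.psum_cops_cong[OF Bs xs(3)], rule c(2)[OF _ xs(2)])
      show "us \<in> env (map OfCourse As)" using us by (simp add: o_def)
      show "interleave ps qs @ ys \<in> env D" if "ps \<in> fam.L Bs" "qs \<in> fam.L Bs" for ps qs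
        unfolding D_def by (rule env_append[OF interleave_in[OF that] ys])
    qed
    also have "\<dots> = sw sc (sp (OfCourse B)) (\<lambda>y z. psum (\<lambda>ps qs. den M \<pi> (pure (us @ [y, z] @ interleave ps qs @ ys))) (fam.cops Bs xs')) (comult M B x)"
      unfolding sw_def by (rule psum_swap)
    also have "\<dots> = psum (\<lambda>ps qs. den M \<pi> (pure (us @ interleave ps qs @ ys))) (fam.cops (B # Bs) xs)"
      unfolding xs(1) fam.psum_cops_Cons by simp
    finally show "den M (fold Contr [length As..<length As + length (B # Bs)] \<pi>) (pure (us @ xs @ ys)) =
      psum (\<lambda>ps qs. den M \<pi> (pure (us @ interleave ps qs @ ys))) (fam.cops (B # Bs) xs)" .
  qed
qed

lemma admissible_filter: "admissible \<Gamma> \<rho> \<Longrightarrow> admissible (filter P \<Gamma>) \<rho>"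
  by (simp add: admissible_def)

lemma lapp_bilinear:
  assumes "(A \<multimap> B) \<in> F" "linear_on r sc V (sp (A \<multimap> B)) f" "linear_on r sc V (sp A) g"
  shows "bilinear_on r sc V (sp B) (\<lambda>x y. lapp A B (f x) (g y))"
  unfolding bilinear_on_def
proof (intro conjI ballI)
  fix x assume x: "x \<in> V"
  show "linear_on r sc V (sp B) (\<lambda>y. lapp A B (f x) (g y))"
    by (rule linear_on_compose[OF assms(3) lapp_linear(1)[OF assms(1) linear_on_in[OF assms(2) x]]])
  show "linear_on r sc V (sp B) (\<lambda>y. lapp A B (f y) (g x))"
    by (rule linear_on_compose[OF assms(2) lapp_linear(2)[OF assms(1) linear_on_in[OF assms(3) x]]])
qed

text \<open>All unrestricted hypotheses are passed to both parts and contracted. Hence the value is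
  a sum over the coproduct of \<open>c\<close> in the tensor coalgebra, one leg going to the
  function and the other to the argument: application denotes convolution.\<close>

lemma tsem_App:
  assumes f: "tsem \<Theta> (filter (\<lambda>p. fst p \<in> linear_vars t) \<Gamma>) t (A \<multimap> B) f"
    and g: "tsem \<Theta> (filter (\<lambda>p. fst p \<notin> linear_vars t) \<Gamma>) t' A g"
  shows "tsem \<Theta> \<Gamma> (App t t') B (\<lambda>c \<rho>. Bsw \<Theta> (\<lambda>x y. lapp A B (f x \<rho>) (g y \<rho>)) c)"
proof (rule tsemI)
  show wt: "well_typed \<Theta> \<Gamma> (App t t') B" by (rule well_typed_App[OF tsemD(2)[OF f] tsemD(2)[OF g]])
  have fil: "map ((!) \<Gamma>) (filter (\<lambda>j. P (fst (\<Gamma> ! j))) [0..<length \<Gamma>]) = filter (\<lambda>p. P (fst p)) \<Gamma>" for P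
    using filter_map[of "\<lambda>p. P (fst p)" "(!) \<Gamma>" "[0..<length \<Gamma>]"] by (simp add: map_nth o_def)
  define m where "m = length \<Theta>"
  define js where "js = filter (\<lambda>j. fst (\<Gamma> ! j) \<in> linear_vars t) [0..<length \<Gamma>]"
  define js' where "js' = filter (\<lambda>j. fst (\<Gamma> ! j) \<notin> linear_vars t) [0..<length \<Gamma>]"
  define G where "G = concat (map (\<lambda>p. [OfCourse (snd p), OfCourse (snd p)]) \<Theta>) @ map snd \<Gamma>"
  define k where "k = map (\<lambda>i. 2 * i) [0..<m] @ map ((+) (2 * m)) js @
            map (\<lambda>i. 2 * i + 1) [0..<m] @ map ((+) (2 * m)) js'"
  define \<Gamma>1 where "\<Gamma>1 = filter (\<lambda>p. fst p \<in> linear_vars t) \<Gamma>"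
  define \<Gamma>2 where "\<Gamma>2 = filter (\<lambda>p. fst p \<notin> linear_vars t) \<Gamma>"
  have js: "map ((!) \<Gamma>) js = \<Gamma>1" "map ((!) \<Gamma>) js' = \<Gamma>2"
    unfolding js_def js'_def \<Gamma>1_def \<Gamma>2_def by (rule fil)+
  have jl: "\<forall>j\<in>set js. j < length \<Gamma>" "\<forall>j\<in>set js'. j < length \<Gamma>" by (auto simp: js_def js'_def)
  let ?p = "elab \<Theta> \<Gamma>1 t" and ?q = "elab \<Theta> \<Gamma>2 t'"
  note f = f[folded \<Gamma>1_def] and g = g[folded \<Gamma>2_def]
  note df = sound_typedD[OF tsemD(1)[OF f]] and dg = sound_typedD[OF tsemD(1)[OF g]]
  define cut where "cut = Cut 0 ?p (LolliL ?q (Ax B))"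
  define E where "E = Exch G k cut"
  have el: "elab \<Theta> \<Gamma> (App t t') = fold Contr [0..<m] E"
    by (simp only: elab.simps Let_def js_def[symmetric] js'_def[symmetric] m_def[symmetric] js df(3)
        formula.case G_def k_def E_def cut_def)
  have "valid E" using wt valid_fold_Contr unfolding well_typed_def el by blast
  then have k: "distinct k" "set k = {..<length G}" "hyps cut = map ((!) G) k" by (simp_all add: E_def)
  note l = sound_LolliL[OF dg(4), unfolded dg(3), OF df(7)]
  have h: "hyps (LolliL ?q (Ax B)) = [] @ concl ?p # hyps ?q" by (simp add: df(3) dg(3))
  note c = sound_Cut[OF df(4) l(1) h, of 0, folded cut_def]
  have "sound cut" by (rule c(1)) simp
  note e = sound_Exch[OF this k, folded E_def]
  have hE: "hyps E = map OfCourse [] @ concat (map (\<lambda>B. [OfCourse B, OfCourse B]) (map snd \<Theta>)) @ map snd \<Gamma>"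
    by (simp add: E_def G_def o_def)
  have cs: "sound (fold Contr [0..<m] E)"
    and ceval: "xs \<in> BL \<Theta> \<Longrightarrow> ys \<in> env (map snd \<Gamma>) \<Longrightarrow> den M (fold Contr [0..<m] E) (pure (xs @ ys)) =
      psum (\<lambda>ps qs. den M E (pure (interleave ps qs @ ys))) (fam.cops (map snd \<Theta>) xs)" for xs ys
    using sound_contrs[OF e(1) hE] by (auto simp: m_def)
  show "sound (elab \<Theta> \<Gamma> (App t t'))" unfolding el by (rule cs)
  fix \<rho> assume \<rho>: "admissible \<Gamma> \<rho>"
  have \<rho>1: "admissible \<Gamma>1 \<rho>" "admissible \<Gamma>2 \<rho>" unfolding \<Gamma>1_def \<Gamma>2_def by (rule admissible_filter[OF \<rho>])+
  have B: "B \<in> F" by (rule formulas_sub(4)[OF df(7)])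
  have I: "set (map snd \<Theta>) \<subseteq> {A. OfCourse A \<in> F}" using df(5) by (simp add: bangs_def)
  interpret c: coalgebra tscale "BT \<Theta>" "Bcomult \<Theta>" "Bcounit \<Theta>" by (rule coalgebra_BT[OF df(5)])
  have bi: "bilinear_on tscale sc (BT \<Theta>) (sp B) (\<lambda>x y. lapp A B (f x \<rho>) (g y \<rho>))"
    by (rule lapp_bilinear[OF df(7) tsemD(3)[OF f \<rho>1(1)] tsemD(3)[OF g \<rho>1(2)]])
  show "linear_on tscale sc (BT \<Theta>) (sp B) (\<lambda>c. Bsw \<Theta> (\<lambda>x y. lapp A B (f x \<rho>) (g y \<rho>)) c)"
    by (rule c.cs_linear[OF vector_space space[OF B] bi])
  fix xs assume xs: "xs \<in> BL \<Theta>"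
  have "den M (elab \<Theta> \<Gamma> (App t t')) (pure (xs @ vals \<Gamma> \<rho>)) =
      psum (\<lambda>ps qs. den M E (pure (interleave ps qs @ vals \<Gamma> \<rho>))) (fam.cops (map snd \<Theta>) xs)"
    unfolding el by (rule ceval[OF xs vals_in[OF \<rho>]])
  also have "\<dots> = psum (\<lambda>ps qs. lapp A B (f (pure ps) \<rho>) (g (pure qs) \<rho>)) (fam.cops (map snd \<Theta>) xs)"
  proof (rule fam.psum_cops_cong[OF I xs])
    fix ps qs assume ps: "ps \<in> BL \<Theta>" and qs: "qs \<in> BL \<Theta>"
    have lp: "length ps = m" "length qs = m" using listset_length[OF ps] listset_length[OF qs] by (simp_all add: m_def)
    have "interleave ps qs @ vals \<Gamma> \<rho> \<in> env G"
      unfolding G_def using env_append[OF interleave_in[OF ps qs] vals_in[OF \<rho>]] by (simp add: o_def)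
    then have "den M E (pure (interleave ps qs @ vals \<Gamma> \<rho>)) =
        den M cut (pure (map ((!) (interleave ps qs @ vals \<Gamma> \<rho>)) k))"
      by (rule e(2))
    \<comment> \<open>Even positions hold the first legs, for the function, and odd positions the
      second legs, for the argument; the linear values start at position
      \<open>2 * m\<close>.\<close>
    also have "map ((!) (interleave ps qs @ vals \<Gamma> \<rho>)) k = ps @ vals \<Gamma>1 \<rho> @ qs @ vals \<Gamma>2 \<rho>"
    proof -
      note n = interleave_nth[of ps qs, unfolded lp, OF refl]
      have "map (\<lambda>i. (interleave ps qs @ vals \<Gamma> \<rho>) ! (2 * i)) [0..<m] = ps"
        "map (\<lambda>i. (interleave ps qs @ vals \<Gamma> \<rho>) ! Suc (2 * i)) [0..<m] = qs"
        by (intro nth_equalityI; simp add: nth_append n lp)+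
      moreover have "map (\<lambda>j. (interleave ps qs @ vals \<Gamma> \<rho>) ! (2 * m + j)) is = vals (map ((!) \<Gamma>) is) \<rho>"
        if "\<forall>j\<in>set is. j < length \<Gamma>" for "is"
        using that by (auto simp: nth_append n)
      ultimately show ?thesis using jl by (simp add: k_def o_def js[symmetric])
    qed
    also have "den M cut (pure (ps @ vals \<Gamma>1 \<rho> @ qs @ vals \<Gamma>2 \<rho>)) =
        den M (LolliL ?q (Ax B)) (pure (den M ?p (pure (ps @ vals \<Gamma>1 \<rho>)) # qs @ vals \<Gamma>2 \<rho>))"
    proof -
      have "ps @ vals \<Gamma>1 \<rho> \<in> env (hyps ?p)" "qs @ vals \<Gamma>2 \<rho> \<in> env (hyps ?q)"
        unfolding df(2) dg(2) using ps qs by (intro env_append vals_in \<rho>1; simp add: o_def)+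
      from c(2)[OF _ _ this, of "[]"] show ?thesis by simp
    qed
    also have "\<dots> = lapp A B (den M ?p (pure (ps @ vals \<Gamma>1 \<rho>))) (den M ?q (pure (qs @ vals \<Gamma>2 \<rho>)))"
    proof (rule l(2))
      show "den M ?p (pure (ps @ vals \<Gamma>1 \<rho>)) \<in> sp (A \<multimap> B)"
        unfolding tsemD(4)[OF f \<rho>1(1) ps] by (rule tsemD(5)[OF f \<rho>1(1) tpure_in_tspace[OF ps]])
      show "qs @ vals \<Gamma>2 \<rho> \<in> env (hyps ?q)"
        unfolding dg(2) using qs by (intro env_append vals_in \<rho>1) (simp add: o_def)
    qed
    also have "\<dots> = lapp A B (f (pure ps) \<rho>) (g (pure qs) \<rho>)"
      unfolding tsemD(4)[OF f \<rho>1(1) ps] tsemD(4)[OF g \<rho>1(2) qs] ..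
    finally show "den M E (pure (interleave ps qs @ vals \<Gamma> \<rho>)) = lapp A B (f (pure ps) \<rho>) (g (pure qs) \<rho>)" .
  qed
  also have "\<dots> = Bsw \<Theta> (\<lambda>x y. lapp A B (f x \<rho>) (g y \<rho>)) (pure xs)"
    by (rule fam.sw_tcomult[OF I vector_space space[OF B] bi xs, symmetric])
  finally show "den M (elab \<Theta> \<Gamma> (App t t')) (pure (xs @ vals \<Gamma> \<rho>)) = Bsw \<Theta> (\<lambda>x y. lapp A B (f x \<rho>) (g y \<rho>)) (pure xs)" .
qed

text \<open>Terms in which no unrestricted variable occurs depend on the unrestricted variables through the counit only.\<close>

definition csem ::
  "(string \<times> 'a formula) list \<Rightarrow> (string \<times> 'a formula) list \<Rightarrow> 'a tm \<Rightarrow> 'a formula \<Rightarrow> ((string \<Rightarrow> 'v) \<Rightarrow> 'v) \<Rightarrow> bool"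
  where "csem \<Theta> \<Gamma> t B h \<longleftrightarrow> tsem \<Theta> \<Gamma> t B (\<lambda>c \<rho>. sc (Bcounit \<Theta> c) (h \<rho>)) \<and> (\<forall>\<rho>. admissible \<Gamma> \<rho> \<longrightarrow> h \<rho> \<in> sp B)"

lemma csemD:
  assumes "csem \<Theta> \<Gamma> t B h"
  shows "tsem \<Theta> \<Gamma> t B (\<lambda>c \<rho>. sc (Bcounit \<Theta> c) (h \<rho>))" "admissible \<Gamma> \<rho> \<Longrightarrow> h \<rho> \<in> sp B"
  using assms by (auto simp: csem_def)

lemma csem_cong:
  assumes "csem \<Theta> \<Gamma> t B h" "\<And>\<rho>. admissible \<Gamma> \<rho> \<Longrightarrow> h \<rho> = h' \<rho>"
  shows "csem \<Theta> \<Gamma> t B h'"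
  using assms by (auto simp: csem_def elim!: tsem_cong)

lemma csem_Var: "bangs \<Theta> \<Longrightarrow> A \<in> F \<Longrightarrow> csem \<Theta> [(x, A)] (Var x) A (\<lambda>\<rho>. \<rho> x)"
  by (simp add: csem_def tsem_Var) (simp add: admissible_def)

lemma csem_Fst:
  assumes "csem \<Theta> \<Gamma> t (With A B) h"
  shows "csem \<Theta> \<Gamma> (Fst t) A (\<lambda>\<rho>. wfst A B (h \<rho>))" "csem \<Theta> \<Gamma> (Snd t) B (\<lambda>\<rho>. wsnd A B (h \<rho>))"
proof -
  note t = csemD(1)[OF assms] and m = csemD(2)[OF assms]
  note p = with_props[OF sound_typedD(7)[OF tsemD(1)[OF t]]]
  show "csem \<Theta> \<Gamma> (Fst t) A (\<lambda>\<rho>. wfst A B (h \<rho>))"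
    unfolding csem_def by (auto intro!: tsem_cong[OF tsem_Fst(1)[OF t]] linear_on_in[OF p(4)] simp: linear_on_scale[OF p(4)] m)
  show "csem \<Theta> \<Gamma> (Snd t) B (\<lambda>\<rho>. wsnd A B (h \<rho>))"
    unfolding csem_def by (auto intro!: tsem_cong[OF tsem_Fst(2)[OF t]] linear_on_in[OF p(5)] simp: linear_on_scale[OF p(5)] m)
qed

lemma csem_Tup:
  assumes f: "csem \<Theta> \<Gamma> t A f" and g: "csem \<Theta> \<Gamma> t' B g" and AB: "With A B \<in> F"
  shows "csem \<Theta> \<Gamma> (Tup t t') (With A B) (\<lambda>\<rho>. wpair A B (f \<rho>) (g \<rho>))"
proof -
  note p = with_props[OF AB]
  have "wpair A B (sc k x) (sc k y) = sc k (wpair A B x y)" if "x \<in> sp A" "y \<in> sp B" for k x y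
    using linear_on_scale[OF p(6), of "(x, y)" k] that by (simp add: wpair_def prod_scale_def)
  then show ?thesis
    unfolding csem_def
    by (auto intro!: tsem_cong[OF tsem_Tup[OF csemD(1)[OF f] csemD(1)[OF g] AB]] p(1) simp: csemD(2)[OF f] csemD(2)[OF g])
qed

text \<open>A function that sees \<open>c\<close> only through the counit contributes a counit on
  its leg, and the counit law returns the whole of \<open>c\<close> to the argument.\<close>

lemma tsem_App_left:
  assumes f: "csem \<Theta> (filter (\<lambda>p. fst p \<in> linear_vars t) \<Gamma>) t (A \<multimap> B) h"
    and g: "tsem \<Theta> (filter (\<lambda>p. fst p \<notin> linear_vars t) \<Gamma>) t' A g"
  shows "tsem \<Theta> \<Gamma> (App t t') B (\<lambda>c \<rho>. lapp A B (h \<rho>) (g c \<rho>))"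
proof (rule tsem_cong[OF tsem_App[OF csemD(1)[OF f] g]])
  fix c \<rho> assume \<rho>: "admissible \<Gamma> \<rho>" and c: "c \<in> BT \<Theta>"
  note d = sound_typedD[OF tsemD(1)[OF csemD(1)[OF f]]]
  interpret c: coalgebra tscale "BT \<Theta>" "Bcomult \<Theta>" "Bcounit \<Theta>" by (rule coalgebra_BT[OF d(5)])
  have h: "h \<rho> \<in> sp (A \<multimap> B)" by (rule csemD(2)[OF f admissible_filter[OF \<rho>]])
  note g' = tsemD(3)[OF g admissible_filter[OF \<rho>]]
  have "c.cs (\<lambda>x y. lapp A B (sc (Bcounit \<Theta> x) (h \<rho>)) (g y \<rho>)) c = c.cs (\<lambda>x y. sc (Bcounit \<Theta> x) (lapp A B (h \<rho>) (g y \<rho>))) c"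
    by (rule c.cs_cong[OF c]) (rule linear_on_scale[OF lapp_linear(2)[OF d(7) linear_on_in[OF g']] h])
  also have "\<dots> = lapp A B (h \<rho>) (g c \<rho>)"
    by (rule c.counit(1)[OF linear_on_compose[OF g' lapp_linear(1)[OF d(7) h]] c])
  finally show "c.cs (\<lambda>x y. lapp A B (sc (Bcounit \<Theta> x) (h \<rho>)) (g y \<rho>)) c = lapp A B (h \<rho>) (g c \<rho>)" .
qed

lemma tsem_App_right:
  assumes f: "tsem \<Theta> (filter (\<lambda>p. fst p \<in> linear_vars t) \<Gamma>) t (A \<multimap> B) f"
    and g: "csem \<Theta> (filter (\<lambda>p. fst p \<notin> linear_vars t) \<Gamma>) t' A h"
  shows "tsem \<Theta> \<Gamma> (App t t') B (\<lambda>c \<rho>. lapp A B (f c \<rho>) (h \<rho>))"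
proof (rule tsem_cong[OF tsem_App[OF f csemD(1)[OF g]]])
  fix c \<rho> assume \<rho>: "admissible \<Gamma> \<rho>" and c: "c \<in> BT \<Theta>"
  note d = sound_typedD[OF tsemD(1)[OF f]]
  interpret c: coalgebra tscale "BT \<Theta>" "Bcomult \<Theta>" "Bcounit \<Theta>" by (rule coalgebra_BT[OF d(5)])
  have h: "h \<rho> \<in> sp A" by (rule csemD(2)[OF g admissible_filter[OF \<rho>]])
  note f' = tsemD(3)[OF f admissible_filter[OF \<rho>]]
  have "c.cs (\<lambda>x y. lapp A B (f x \<rho>) (sc (Bcounit \<Theta> y) (h \<rho>))) c = c.cs (\<lambda>x y. sc (Bcounit \<Theta> y) (lapp A B (f x \<rho>) (h \<rho>))) c"
    by (rule c.cs_cong[OF c]) (rule linear_on_scale[OF lapp_linear(1)[OF d(7) linear_on_in[OF f']] h])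
  also have "\<dots> = lapp A B (f c \<rho>) (h \<rho>)"
    by (rule c.counit(2)[OF linear_on_compose[OF f' lapp_linear(2)[OF d(7) h]] c])
  finally show "c.cs (\<lambda>x y. lapp A B (f x \<rho>) (sc (Bcounit \<Theta> y) (h \<rho>))) c = lapp A B (f c \<rho>) (h \<rho>)" .
qed

lemma csem_App:
  assumes f: "csem \<Theta> (filter (\<lambda>p. fst p \<in> linear_vars t) \<Gamma>) t (A \<multimap> B) f"
    and g: "csem \<Theta> (filter (\<lambda>p. fst p \<notin> linear_vars t) \<Gamma>) t' A g"
  shows "csem \<Theta> \<Gamma> (App t t') B (\<lambda>\<rho>. lapp A B (f \<rho>) (g \<rho>))"
proof -
  note l = lapp_linear[OF sound_typedD(7)[OF tsemD(1)[OF csemD(1)[OF f]]]]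
  have m: "f \<rho> \<in> sp (A \<multimap> B)" "g \<rho> \<in> sp A" if "admissible \<Gamma> \<rho>" for \<rho>
    using csemD(2)[OF f] csemD(2)[OF g] admissible_filter[OF that] by auto
  show ?thesis
    unfolding csem_def
    by (auto intro!: tsem_cong[OF tsem_App_left[OF f csemD(1)[OF g]]] l(3) m simp: linear_on_scale[OF l(1)] m)
qed

lemma tcounit_Nil: "Bcounit [] (pure []) = 1" "pure [] \<in> BT []"
  using fam.tcounit(2)[of "[]" "[]"] by (auto intro!: tpure_in_tspace)

text \<open>With no unrestricted variable the coalgebra is the ground field, spanned by
  \<open>pure []\<close> with counit 1, so every linear map on it is the counit times its value
  there.\<close>

lemma csem_Nil:
  assumes t: "tsem [] \<Gamma> t B f"
  shows "csem [] \<Gamma> t B (f (pure []))"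
proof -
  have B: "B \<in> F" by (rule sound_typedD(7)[OF tsemD(1)[OF t]])
  interpret c: coalgebra tscale "BT []" "Bcomult []" "Bcounit []" by (rule coalgebra_BT) (simp add: bangs_def)
  have "f c \<rho> = sc (Bcounit [] c) (f (pure []) \<rho>)" if \<rho>: "admissible \<Gamma> \<rho>" and c: "c \<in> BT []" for c \<rho>
  proof (rule linear_on_tspace_eqI[OF tsemD(3)[OF t \<rho>] linear_on_scale_left[OF vector_space space[OF B] c.\<epsilon>] _ c])
    show "f (pure []) \<rho> \<in> sp B" by (rule tsemD(5)[OF t \<rho> tcounit_Nil(2)])
    show "f (pure xs) \<rho> = sc (Bcounit [] (pure xs)) (f (pure []) \<rho>)" if "xs \<in> BL []" for xs
      using that tcounit_Nil(1) by (simp add: vector_space_one[OF vector_space])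
  qed
  then show ?thesis
    unfolding csem_def using tsemD(5)[OF t _ tcounit_Nil(2)] by (auto intro: tsem_cong[OF t])
qed

lemma csem_Nil_den:
  assumes t: "csem [] \<Gamma> t B h" and \<rho>: "admissible \<Gamma> \<rho>"
  shows "den M (elab [] \<Gamma> t) (pure (vals \<Gamma> \<rho>)) = h \<rho>"
  using tsemD(4)[OF csemD(1)[OF t] \<rho>, of "[]"] tcounit_Nil(1) by (simp add: vector_space_one[OF vector_space])

lemma csem_Lam:
  assumes t: "csem [] ((x, A) # \<Gamma>) t B h" and AB: "(A \<multimap> B) \<in> F" and x: "x \<notin> fst ` set \<Gamma>"
  shows "csem [] \<Gamma> (Lam x A t) (A \<multimap> B) (\<lambda>\<rho>. lam A B (\<lambda>a. h (\<rho>(x := a))))"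
    and "admissible \<Gamma> \<rho> \<Longrightarrow> linear_on sc sc (sp A) (sp B) (\<lambda>a. h (\<rho>(x := a)))"
  using csem_Nil[OF tsem_Lam[OF csemD(1)[OF t] AB x]] tsem_linear_var[OF csemD(1)[OF t] x _ tcounit_Nil(2)] tcounit_Nil(1)
  by (simp_all add: vector_space_one[OF vector_space])

subsection \<open>Tuples\<close>

fun tup :: "'a formula \<Rightarrow> 'v list \<Rightarrow> 'v"
  where
    "tup A [v] = v"
  | "tup A (v # v' # vs) = wpair A (pow A (length (v' # vs))) v (tup A (v' # vs))"

text \<open>The meaning of \<open>proj\<close>. The case distinction at 0 reflects that the last
  component of a power is not wrapped in a further pair.\<close>

fun prj :: "'a formula \<Rightarrow> nat \<Rightarrow> nat \<Rightarrow> 'v \<Rightarrow> 'v"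
  where
    "prj A m 0 v = (if m \<le> 1 then v else wfst A (pow A (m - 1)) v)"
  | "prj A m (Suc i) v = prj A (m - 1) i (wsnd A (pow A (m - 1)) v)"

lemma pow_Suc: "m \<ge> 1 \<Longrightarrow> pow A (Suc m) = With A (pow A m)"
  by (cases m) auto

lemma prj_linear: "pow A m \<in> F \<Longrightarrow> i < m \<Longrightarrow> linear_on sc sc (sp (pow A m)) (sp A) (prj A m i)"
proof (induction i arbitrary: m)
  case 0
  then show ?case using pow_Suc[of "m - 1" A] with_props(4)[of A "pow A (m - 1)"]
    by (cases "m \<le> 1") (auto simp: linear_on_id le_Suc_eq)
next
  case (Suc i)
  then have m: "pow A m = With A (pow A (m - 1))" using pow_Suc[of "m - 1" A] by simp
  have "linear_on sc sc (sp (pow A (m - 1))) (sp A) (prj A (m - 1) i)"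
    using Suc formulas_sub(2)[of A "pow A (m - 1)"] m by (intro Suc.IH) auto
  moreover have "linear_on sc sc (sp (pow A m)) (sp (pow A (m - 1))) (wsnd A (pow A (m - 1)))"
    using with_props(5)[of A "pow A (m - 1)"] Suc.prems m by simp
  ultimately show ?case using linear_on_compose by fastforce
qed

lemma tup_in: "vs \<noteq> [] \<Longrightarrow> set vs \<subseteq> sp A \<Longrightarrow> pow A (length vs) \<in> F \<Longrightarrow> tup A vs \<in> sp (pow A (length vs))"
proof (induction vs rule: induct_list012)
  case (3 v v' vs)
  then show ?case using formulas_sub(2)[of A "pow A (length (v' # vs))"] by (auto intro!: with_props(1))
qed auto

lemma prj_tup:
  "set vs \<subseteq> sp A \<Longrightarrow> pow A (length vs) \<in> F \<Longrightarrow> i < length vs \<Longrightarrow> prj A (length vs) i (tup A vs) = vs ! i"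
proof (induction vs arbitrary: i rule: induct_list012)
  case (3 v v' vs)
  have W: "With A (pow A (length (v' # vs))) \<in> F" using 3 by simp
  note p = with_props[OF W]
  have t: "tup A (v' # vs) \<in> sp (pow A (length (v' # vs)))"
    using 3 formulas_sub(2)[OF W] by (intro tup_in) auto
  show ?case
  proof (cases i)
    case 0
    then show ?thesis using p(2) t 3 by simp
  next
    case (Suc j)
    then show ?thesis using p(3) t 3 formulas_sub(2)[OF W] by simp
  qed
qed auto

lemma csem_proj:
  "csem \<Theta> \<Gamma> t (pow A m) h \<Longrightarrow> i < m \<Longrightarrow> csem \<Theta> \<Gamma> (proj m i t) A (\<lambda>\<rho>. prj A m i (h \<rho>))"
proof (induction i arbitrary: m t h)
  case 0
  then show ?case using pow_Suc[of "m - 1" A] csem_Fst(1)[of \<Theta> \<Gamma> t A "pow A (m - 1)" h]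
    by (cases "m \<le> 1") (auto simp: le_Suc_eq)
next
  case (Suc i)
  then have "csem \<Theta> \<Gamma> t (With A (pow A (m - 1))) h" using pow_Suc[of "m - 1" A] by simp
  from Suc.IH[OF csem_Fst(2)[OF this]] Suc.prems show ?case by simp
qed

lemma tsem_proj:
  "tsem \<Theta> \<Gamma> t (pow A m) f \<Longrightarrow> i < m \<Longrightarrow> tsem \<Theta> \<Gamma> (proj m i t) A (\<lambda>c \<rho>. prj A m i (f c \<rho>))"
proof (induction i arbitrary: m t f)
  case 0
  then show ?case using pow_Suc[of "m - 1" A] tsem_Fst(1)[of \<Theta> \<Gamma> t A "pow A (m - 1)" f]
    by (cases "m \<le> 1") (auto simp: le_Suc_eq)
next
  case (Suc i)
  then have "tsem \<Theta> \<Gamma> t (With A (pow A (m - 1))) f" using pow_Suc[of "m - 1" A] by simp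
  from Suc.IH[OF tsem_Fst(2)[OF this]] Suc.prems show ?case by simp
qed

lemma tsem_tuple:
  "list_all2 (\<lambda>t f. tsem \<Theta> \<Gamma> t A f) ts fs \<Longrightarrow> ts \<noteq> [] \<Longrightarrow> pow A (length ts) \<in> F \<Longrightarrow>
    tsem \<Theta> \<Gamma> (tuple ts) (pow A (length ts)) (\<lambda>c \<rho>. tup A (map (\<lambda>f. f c \<rho>) fs))"
proof (induction ts arbitrary: fs rule: induct_list012)
  case (2 t)
  then obtain f where "fs = [f]" by (auto simp: list_all2_Cons1)
  with 2 show ?case by simp
next
  case (3 t t' ts)
  then obtain f f' fs' where fs: "fs = f # f' # fs'" by (auto simp: list_all2_Cons1)
  have W: "With A (pow A (length (t' # ts))) \<in> F" using 3 by simp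
  have l: "length fs' = length ts" using 3 fs by (auto dest: list_all2_lengthD)
  have "tsem \<Theta> \<Gamma> (tuple (t' # ts)) (pow A (length (t' # ts))) (\<lambda>c \<rho>. tup A (map (\<lambda>f. f c \<rho>) (f' # fs')))"
    using 3 fs formulas_sub(2)[OF W] by (intro "3.IH"(2)) auto
  note IH = this
  have "tsem \<Theta> \<Gamma> (Tup t (tuple (t' # ts))) (With A (pow A (length (t' # ts))))
    (\<lambda>c \<rho>. wpair A (pow A (length (t' # ts))) (f c \<rho>) (tup A (map (\<lambda>f. f c \<rho>) (f' # fs'))))"
    using 3 fs by (intro tsem_Tup[OF _ IH W]) auto
  then show ?case by (simp add: fs l)
qed auto

lemma csem_tuple:
  "list_all2 (\<lambda>t f. csem \<Theta> \<Gamma> t A f) ts fs \<Longrightarrow> ts \<noteq> [] \<Longrightarrow> pow A (length ts) \<in> F \<Longrightarrow>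
    csem \<Theta> \<Gamma> (tuple ts) (pow A (length ts)) (\<lambda>\<rho>. tup A (map (\<lambda>f. f \<rho>) fs))"
proof (induction ts arbitrary: fs rule: induct_list012)
  case (2 t)
  then obtain f where "fs = [f]" by (auto simp: list_all2_Cons1)
  with 2 show ?case by simp
next
  case (3 t t' ts)
  then obtain f f' fs' where fs: "fs = f # f' # fs'" by (auto simp: list_all2_Cons1)
  have W: "With A (pow A (length (t' # ts))) \<in> F" using 3 by simp
  have l: "length fs' = length ts" using 3 fs by (auto dest: list_all2_lengthD)
  have "csem \<Theta> \<Gamma> (tuple (t' # ts)) (pow A (length (t' # ts))) (\<lambda>\<rho>. tup A (map (\<lambda>f. f \<rho>) (f' # fs')))"
    using 3 fs formulas_sub(2)[OF W] by (intro "3.IH"(2)) auto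
  note IH = this
  have "csem \<Theta> \<Gamma> (Tup t (tuple (t' # ts))) (With A (pow A (length (t' # ts))))
    (\<lambda>\<rho>. wpair A (pow A (length (t' # ts))) (f \<rho>) (tup A (map (\<lambda>f. f \<rho>) (f' # fs'))))"
    using 3 fs by (intro csem_Tup[OF _ IH W]) auto
  then show ?case by (simp add: fs l)
qed auto

end

section \<open>Binary words\<close>

context sweedler_semantics
begin

abbreviation banged :: "'a formula set"
  where "banged \<equiv> {A. OfCourse A \<in> F}"

text \<open>
  \<open>wsem As B \<phi> h [s\<^sub>l, \<dots>, s\<^sub>1]\<close> is the convolution product of \<open>\<phi> s\<^sub>l, \<dots>, \<phi> s\<^sub>1\<close> and \<open>h\<close> over the
  coalgebra \<open>!A\<^sub>1 \<otimes> \<dots> \<otimes> !A\<^sub>r\<close>, with application as multiplication. The word is read from its end.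
\<close>

primrec wsem ::
  "'a formula list \<Rightarrow> 'a formula \<Rightarrow> (nat \<Rightarrow> ('k, 'v) tensor \<Rightarrow> 'v) \<Rightarrow> (('k, 'v) tensor \<Rightarrow> 'v) \<Rightarrow>
   nat list \<Rightarrow> ('k, 'v) tensor \<Rightarrow> 'v"
  where
    "wsem As B \<phi> h [] c = h c"
  | "wsem As B \<phi> h (s # w) c =
      sw tscale (fam.T As) (\<lambda>x y. lapp B B (\<phi> s x) (wsem As B \<phi> h w y)) (fam.tcomult As c)"

text \<open>The letters at the end of the list act first, so the value on \<open>w'\<close> is the
  starting point for \<open>w\<close>. For \<open>rev (S @ w)\<close> this says that appending a
  word applies further letters to the result of \<open>S\<close>.\<close>

lemma wsem_append: "wsem As B \<phi> h (w @ w') c = wsem As B \<phi> (wsem As B \<phi> h w') w c"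
  by (induction w arbitrary: c) simp_all

lemma wsem_linear:
  assumes As: "set As \<subseteq> banged" and B: "(B \<multimap> B) \<in> F"
    and \<phi>: "\<And>s. linear_on tscale sc (fam.T As) (sp (B \<multimap> B)) (\<phi> s)"
    and h: "linear_on tscale sc (fam.T As) (sp B) h"
  shows "linear_on tscale sc (fam.T As) (sp B) (wsem As B \<phi> h w)"
proof (induction w)
  case Nil
  show ?case using h by simp
next
  case (Cons s w)
  interpret c: coalgebra tscale "fam.T As" "fam.tcomult As" "fam.tcounit As" by (rule fam.coalgebra_tensor[OF As])
  show ?case
    using c.cs_linear[OF vector_space space[OF formulas_sub(4)[OF B]] lapp_bilinear[OF B \<phi> Cons]] by simp
qed

lemma wsem_cong:
  assumes As: "set As \<subseteq> banged" and "\<And>s c. c \<in> fam.T As \<Longrightarrow> \<phi> s c = \<phi>' s c" "\<And>c. c \<in> fam.T As \<Longrightarrow> h c = h' c"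
    and "c \<in> fam.T As"
  shows "wsem As B \<phi> h w c = wsem As B \<phi>' h' w c"
  using assms(4)
proof (induction w arbitrary: c)
  case Nil
  then show ?case by (simp add: assms(3))
next
  case (Cons s w)
  interpret c: coalgebra tscale "fam.T As" "fam.tcomult As" "fam.tcounit As" by (rule fam.coalgebra_tensor[OF As])
  show ?case by (simp only: wsem.simps) (rule c.cs_cong[OF Cons.prems], simp only: Cons.IH assms(2))
qed

text \<open>The context under both binders of a binary word. The binder of \<open>u1\<close> is the
  inner one, and each binder puts its variable in front, so \<open>u1\<close> comes first.\<close>

definition ee :: "'a formula \<Rightarrow> (string \<times> 'a formula) list"
  where "ee B = [(''u1'', B \<multimap> B), (''u0'', B \<multimap> B)]"

abbreviation EE :: "'a formula \<Rightarrow> 'a formula list"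
  where "EE B \<equiv> [B \<multimap> B, B \<multimap> B]"

lemma map_snd_ee: "map snd (ee B) = EE B"
  by (simp add: ee_def)

definition letter :: "'a formula \<Rightarrow> nat \<Rightarrow> ('k, 'v) tensor \<Rightarrow> 'v"
  where "letter B s = den M (elab (ee B) [] (word_var s))"

text \<open>As in \<open>word_var\<close>, every symbol other than 0 is read as 1; this reduces
  arbitrary symbols to two cases.\<close>

lemma letter_if: "letter B s = letter B (if s = 0 then 0 else 1)"
  by (simp add: letter_def word_var_def)

text \<open>In \<open>pure [y, x]\<close> the entry \<open>x\<close> belongs to \<open>u0\<close>
  and \<open>y\<close> to \<open>u1\<close>; a letter derelicts its own factor and takes the counit
  of the other.\<close>

lemma letter_sound:
  assumes B: "OfCourse (B \<multimap> B) \<in> F"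
  shows "sound_typed (ee B) [] (word_var s) (B \<multimap> B)"
    and "linear_on tscale sc (fam.T (EE B)) (sp (B \<multimap> B)) (letter B s)"
    and "x \<in> sp (OfCourse (B \<multimap> B)) \<Longrightarrow> y \<in> sp (OfCourse (B \<multimap> B)) \<Longrightarrow> letter B s (pure [y, x]) =
      (if s = 0 then sc (counit M (B \<multimap> B) y) (derel M (B \<multimap> B) x) else sc (counit M (B \<multimap> B) x) (derel M (B \<multimap> B) y))"
proof -
  have b: "bangs (ee B)" using B by (simp add: bangs_def ee_def)
  have d: "distinct (map fst (ee B))" by (simp add: ee_def)
  have u: "(if s = 0 then ''u0'' else ''u1'', B \<multimap> B) \<in> set (ee B)" by (simp add: ee_def)
  note U = UVar_eval[OF b d u]
  show s: "sound_typed (ee B) [] (word_var s) (B \<multimap> B)" unfolding word_var_def by (rule U(1))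
  show "linear_on tscale sc (fam.T (EE B)) (sp (B \<multimap> B)) (letter B s)"
    using soundD(3)[OF sound_typedD(4)[OF s]] unfolding sound_typedD(2,3)[OF s] letter_def by (simp add: ee_def)
  assume "x \<in> sp (OfCourse (B \<multimap> B))" "y \<in> sp (OfCourse (B \<multimap> B))"
  then have "[y, x] \<in> BL (ee B)" by (simp add: ee_def set_Cons_def)
  from U(2)[OF this] show "letter B s (pure [y, x]) =
      (if s = 0 then sc (counit M (B \<multimap> B) y) (derel M (B \<multimap> B) x) else sc (counit M (B \<multimap> B) x) (derel M (B \<multimap> B) y))"
    unfolding letter_def word_var_def by (cases "s = 0") (simp_all add: ee_def)
qed

text \<open>Each letter is one application, hence one convolution. The letter applied last stands
  outermost, which is why the word is reversed.\<close>

lemma tsem_word: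
  assumes B: "OfCourse (B \<multimap> B) \<in> F" and h: "tsem (ee B) \<Gamma> t B h"
  shows "tsem (ee B) \<Gamma> (apply_word w t) B (\<lambda>c \<rho>. wsem (EE B) B (letter B) (\<lambda>c. h c \<rho>) (rev w) c)"
  unfolding apply_word_def
proof (induction w rule: rev_induct)
  case Nil
  show ?case using h by simp
next
  case (snoc s w)
  have l: "tsem (ee B) [] (word_var s) (B \<multimap> B) (\<lambda>c \<rho>. letter B s c)"
    unfolding letter_def by (rule tsem_closed[OF letter_sound(1)[OF B]])
  have v: "linear_vars (word_var s) = {}" by (simp add: word_var_def)
  show ?case
    using tsem_App[of "ee B" "word_var s" \<Gamma> B B _ "fold (\<lambda>s. App (word_var s)) w t"] l snoc
    by (simp add: v map_snd_ee)
qed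

section \<open>Binary integers and their application\<close>

lemma bint_formulas:
  assumes "bint A \<in> F"
  shows "OfCourse (A \<multimap> A) \<in> F" "(OfCourse (A \<multimap> A) \<multimap> A \<multimap> A) \<in> F" "(A \<multimap> A) \<in> F" "A \<in> F"
  using formulas[OF assms] formulas[of "A \<multimap> A"] by (auto simp: bint_def)

text \<open>An element of \<open>bint A\<close> built from a map on the tensor product of two copies
  of \<open>!E\<close>. The outermost argument \<open>x\<close> is the value of \<open>u0\<close>,
  hence the second factor of \<open>pure [y, x]\<close>.\<close>

definition mkbint :: "'a formula \<Rightarrow> (('k, 'v) tensor \<Rightarrow> 'v \<Rightarrow> 'v) \<Rightarrow> 'v"
  where "mkbint A k = lam (OfCourse (A \<multimap> A)) (OfCourse (A \<multimap> A) \<multimap> A \<multimap> A) (\<lambda>x.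
    lam (OfCourse (A \<multimap> A)) (A \<multimap> A) (\<lambda>y. lam A A (\<lambda>z. k (pure [y, x]) z)))"

definition bapp :: "'a formula \<Rightarrow> 'v \<Rightarrow> 'v \<Rightarrow> 'v \<Rightarrow> 'v \<Rightarrow> 'v"
  where "bapp A b x y z = lapp A A (lapp (OfCourse (A \<multimap> A)) (A \<multimap> A)
    (lapp (OfCourse (A \<multimap> A)) (OfCourse (A \<multimap> A) \<multimap> A \<multimap> A) b x) y) z"

lemma EE_pure: "x \<in> sp (OfCourse (A \<multimap> A)) \<Longrightarrow> y \<in> sp (OfCourse (A \<multimap> A)) \<Longrightarrow> pure [y, x] \<in> fam.T (EE A)"
  by (rule tpure_in_tspace) (simp add: set_Cons_def)

lemma mkbint_cong:
  assumes "\<And>c z. c \<in> fam.T (EE A) \<Longrightarrow> z \<in> sp A \<Longrightarrow> k c z = k' c z"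
  shows "mkbint A k = mkbint A k'"
  unfolding mkbint_def by (intro lam_cong assms EE_pure)

text \<open>The second part undoes the abstractions of the first: applied to three arguments, the
  element gives back the map on the pure tensor. Since \<open>lapp_lam\<close> speaks of linear
  maps, linearity is established at each of the three levels.\<close>

lemma csem_bint:
  assumes t: "tsem [(v, A \<multimap> A), (u, A \<multimap> A)] ((a, A) # \<Gamma>) t A f" and A: "bint A \<in> F" and a: "a \<notin> fst ` set \<Gamma>"
  shows "csem [] \<Gamma> (LamB u (A \<multimap> A) (LamB v (A \<multimap> A) (Lam a A t))) (bint A) (\<lambda>\<rho>. mkbint A (\<lambda>c z. f c (\<rho>(a := z))))"
    and "admissible \<Gamma> \<rho> \<Longrightarrow> x \<in> sp (OfCourse (A \<multimap> A)) \<Longrightarrow> y \<in> sp (OfCourse (A \<multimap> A)) \<Longrightarrow> z \<in> sp A \<Longrightarrow>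
      bapp A (mkbint A (\<lambda>c z. f c (\<rho>(a := z)))) x y z = f (pure [y, x]) (\<rho>(a := z))"
proof -
  note fs = bint_formulas[OF A]
  have A': "(OfCourse (A \<multimap> A) \<multimap> OfCourse (A \<multimap> A) \<multimap> A \<multimap> A) \<in> F" using A by (simp add: bint_def)
  note t2 = tsem_Lam[OF t fs(3) a]
  note t1 = tsem_LamB[OF t2 fs(2)]
  note t0 = tsem_LamB[OF t1 A']
  have b: "bangs [(v, A \<multimap> A), (u, A \<multimap> A)]" "bangs [(u, A \<multimap> A)]" using fs(1) by (simp_all add: bangs_def)
  have c1: "tcons sc [] x (pure []) = pure [x]" if "x \<in> sp (OfCourse (A \<multimap> A))" for x
    using Btcons(2)[OF b(2) that, of "[]"] by simp
  have c2: "tcons sc [sp (OfCourse (A \<multimap> A))] y (pure [x]) = pure [y, x]"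
    if "x \<in> sp (OfCourse (A \<multimap> A))" "y \<in> sp (OfCourse (A \<multimap> A))" for x y
    using Btcons(2)[OF b(1) that(2), of "[x]"] that(1) by (simp add: set_Cons_def)
  show "csem [] \<Gamma> (LamB u (A \<multimap> A) (LamB v (A \<multimap> A) (Lam a A t))) (bint A) (\<lambda>\<rho>. mkbint A (\<lambda>c z. f c (\<rho>(a := z))))"
    unfolding bint_def[of A]
    by (rule csem_cong[OF csem_Nil[OF t0]]) (simp add: mkbint_def c1 c2 cong: lam_cong)
  assume \<rho>: "admissible \<Gamma> \<rho>" and x: "x \<in> sp (OfCourse (A \<multimap> A))" and y: "y \<in> sp (OfCourse (A \<multimap> A))" and z: "z \<in> sp A"
  let ?f2 = "\<lambda>c. lam A A (\<lambda>z. f c (\<rho>(a := z)))"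
  let ?f1 = "\<lambda>x. lam (OfCourse (A \<multimap> A)) (A \<multimap> A) (\<lambda>y. ?f2 (pure [y, x]))"
  have px: "pure [x] \<in> BT [(u, A \<multimap> A)]" using x by (intro tpure_in_tspace) (simp add: set_Cons_def)
  have l1: "linear_on sc sc (sp (OfCourse (A \<multimap> A))) (sp (OfCourse (A \<multimap> A) \<multimap> A \<multimap> A)) ?f1"
    by (rule linear_on_cong[OF vector_space space[OF fs(1)] _ tsem_linear_bang[OF t1 \<rho> tcounit_Nil(2)]])
      (simp add: c1 c2 cong: lam_cong)
  have l2: "linear_on sc sc (sp (OfCourse (A \<multimap> A))) (sp (A \<multimap> A)) (\<lambda>y. ?f2 (pure [y, x]))"
    by (rule linear_on_cong[OF vector_space space[OF fs(1)] _ tsem_linear_bang[OF t2 \<rho> px]])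
      (simp add: c2 x)
  have l3: "linear_on sc sc (sp A) (sp A) (\<lambda>z. f (pure [y, x]) (\<rho>(a := z)))"
    using tsem_linear_var[OF t a \<rho>, of "pure [y, x]"] EE_pure[OF x y] by simp
  show "bapp A (mkbint A (\<lambda>c z. f c (\<rho>(a := z)))) x y z = f (pure [y, x]) (\<rho>(a := z))"
    unfolding bapp_def mkbint_def
    by (simp only: lapp_lam[OF A' l1 x] lapp_lam[OF fs(2) l2 y] lapp_lam[OF fs(3) l3 z])
qed

definition wordmap :: "'a formula \<Rightarrow> nat list \<Rightarrow> 'v"
  where "wordmap A w = mkbint A (\<lambda>c z. wsem (EE A) A (letter A) (\<lambda>c. sc (fam.tcounit (EE A) c) z) (rev w) c)"

lemma bint_val:
  assumes A: "bint A \<in> F"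
  shows "den_closed M (bint_val A w) = wordmap A w" and "wordmap A w \<in> sp (bint A)"
    and "x \<in> sp (OfCourse (A \<multimap> A)) \<Longrightarrow> y \<in> sp (OfCourse (A \<multimap> A)) \<Longrightarrow> z \<in> sp A \<Longrightarrow>
      bapp A (wordmap A w) x y z = wsem (EE A) A (letter A) (\<lambda>c. sc (fam.tcounit (EE A) c) z) (rev w) (pure [y, x])"
proof -
  note fs = bint_formulas[OF A]
  have b: "bangs (ee A)" using fs(1) by (simp add: bangs_def ee_def)
  note t = tsem_word[OF fs(1) tsem_Var[OF b fs(4), of "''a''"], of w, unfolded ee_def[of A] map_snd_ee[unfolded ee_def]]
  note c = csem_bint[OF t A]
  have adm: "admissible [] \<rho>" for \<rho> by (simp add: admissible_def)
  show "den_closed M (bint_val A w) = wordmap A w"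
    using csem_Nil_den[OF c(1) adm] by (simp add: den_closed_def bint_val_def wordmap_def)
  show "wordmap A w \<in> sp (bint A)"
    using csemD(2)[OF c(1) adm] by (simp add: wordmap_def)
  show "x \<in> sp (OfCourse (A \<multimap> A)) \<Longrightarrow> y \<in> sp (OfCourse (A \<multimap> A)) \<Longrightarrow> z \<in> sp A \<Longrightarrow>
      bapp A (wordmap A w) x y z = wsem (EE A) A (letter A) (\<lambda>c. sc (fam.tcounit (EE A) c) z) (rev w) (pure [y, x])"
    using c(2)[OF _ adm, of x y z] by (simp add: wordmap_def)
qed

text \<open>
  Promotions \<open>!P\<close> and \<open>!Q\<close> are coalgebra morphisms, hence so is their pairing into \<open>!E \<otimes> !E\<close>, and
  convolution products are natural in the coalgebra.
\<close>

lemma wordmap_app: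
  assumes B: "bint B \<in> F" and P: "sound_typed \<Theta> [] P (B \<multimap> B)" and Q: "sound_typed \<Theta> [] Q (B \<multimap> B)"
    and z: "z \<in> sp B" and c: "c \<in> BT \<Theta>"
  shows "Bsw \<Theta> (\<lambda>x y. bapp B (wordmap B w) (den M (elab \<Theta> [] (Bang P)) x) (den M (elab \<Theta> [] (Bang Q)) y) z) c =
    wsem (map snd \<Theta>) B (\<lambda>s. den M (elab \<Theta> [] (if s = 0 then P else Q))) (\<lambda>c. sc (Bcounit \<Theta> c) z) (rev w) c"
proof -
  let ?E = "B \<multimap> B"
  let ?P = "den M (elab \<Theta> [] (Bang P))" and ?Q = "den M (elab \<Theta> [] (Bang Q))"
  let ?p = "den M (elab \<Theta> [] P)" and ?q = "den M (elab \<Theta> [] Q)"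
  note fs = bint_formulas[OF B]
  note bP = tsem_Bang[OF tsem_closed[OF P] fs(1)] and bQ = tsem_Bang[OF tsem_closed[OF Q] fs(1)]
  have \<Theta>: "bangs \<Theta>" by (rule sound_typedD(5)[OF P])
  have E: "?E \<in> banged" using fs(1) by simp
  interpret D: coalgebra tscale "BT \<Theta>" "Bcomult \<Theta>" "Bcounit \<Theta>" by (rule coalgebra_BT[OF \<Theta>])
  \<comment> \<open>\<open>Q\<close> precedes \<open>P\<close> in the pairing because
    \<open>u1\<close>, in whose place \<open>Q\<close> is put, is the first factor of the context
    \<open>ee B\<close>.\<close>
  interpret pr: coalgebra_pairing sc banged "\<lambda>A. sp (OfCourse A)" "comult M" "counit M"
    tscale "BT \<Theta>" "Bcomult \<Theta>" "Bcounit \<Theta>" ?E ?E ?Q ?P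
    by (intro coalgebra_pairing.intro coalgebra_pairing_axioms.intro fam.coalgebra_family_axioms D.coalgebra_axioms E bQ(2) bP(2))
  have adm: "admissible [] \<rho>" for \<rho> by (simp add: admissible_def)
  have lp: "linear_on tscale sc (BT \<Theta>) (sp ?E) ?p" "linear_on tscale sc (BT \<Theta>) (sp ?E) ?q"
    using tsemD(3)[OF tsem_closed[OF P] adm] tsemD(3)[OF tsem_closed[OF Q] adm] by auto
  have mem: "?P x \<in> sp (OfCourse ?E)" "?Q x \<in> sp (OfCourse ?E)" if "x \<in> BT \<Theta>" for x
    by (rule linear_on_in[OF pr.g_mor(1) that] linear_on_in[OF pr.f_mor(1) that])+
  let ?h = "\<lambda>c. sc (fam.tcounit (EE B) c) z"
  have hl: "linear_on tscale sc (fam.T (EE B)) (sp B) ?h"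
    by (rule linear_on_scale_left[OF vector_space space[OF fs(4)] pr.P.\<epsilon> z])
  let ?W = "wsem (EE B) B (letter B) ?h"
  have EEb: "set (EE B) \<subseteq> banged" using E by simp
  have Wl: "linear_on tscale sc (fam.T (EE B)) (sp B) (?W w)" for w
    by (rule wsem_linear[OF EEb fs(3) letter_sound(2)[OF fs(1)] hl])
  note V = vector_space_tscale subspace_tspace
  \<comment> \<open>On the pairing a letter derelicts one promotion, which gives back the promoted
    term, and takes the counit of the other, which is the counit of \<Theta>; the counit law removes
    that leg.\<close>
  have ll: "letter B s (pr.pairing c) = (if s = 0 then ?p c else ?q c)" if c: "c \<in> BT \<Theta>" for s c
  proof -
    have "letter B s (pr.pairing c) = D.cs (\<lambda>x y. letter B s (pure [?Q x, ?P y])) c"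
      unfolding pr.pairing_def
      by (rule D.linear_on_apply_cs[OF c V letter_sound(2)[OF fs(1)] bilinear_on_in[OF pr.bilinear_on_fg]])
    also have "\<dots> = D.cs (\<lambda>x y. if s = 0 then sc (Bcounit \<Theta> x) (?p y) else sc (Bcounit \<Theta> y) (?q x)) c"
    proof (rule D.cs_cong[OF c])
      fix x y assume x: "x \<in> BT \<Theta>" and y: "y \<in> BT \<Theta>"
      show "letter B s (pure [?Q x, ?P y]) = (if s = 0 then sc (Bcounit \<Theta> x) (?p y) else sc (Bcounit \<Theta> y) (?q x))"
        unfolding letter_sound(3)[OF fs(1) mem(1)[OF y] mem(2)[OF x]] pr.f_mor(2)[OF x] pr.g_mor(2)[OF y] bP(3)[OF y] bQ(3)[OF x] ..
    qed
    also have "\<dots> = (if s = 0 then ?p c else ?q c)"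
      using D.counit(1)[OF lp(1) c] D.counit(2)[OF lp(2) c] by simp
    finally show ?thesis .
  qed
  \<comment> \<open>Naturality: the pairing respects coproduct and counit, and letters pull back to
    \<open>P\<close> and \<open>Q\<close>, so the convolution product pulls back letter by
    letter.\<close>
  have main: "?W w (pr.pairing c) = wsem (map snd \<Theta>) B (\<lambda>s. den M (elab \<Theta> [] (if s = 0 then P else Q))) (\<lambda>c. sc (Bcounit \<Theta> c) z) w c"
    if "c \<in> BT \<Theta>" for w c
    using that
  proof (induction w arbitrary: c)
    case Nil
    then show ?case by (simp only: wsem.simps pr.tcounit_pairing)
  next
    case (Cons s w)
    have "?W (s # w) (pr.pairing c) = D.cs (\<lambda>x y. lapp B B (letter B s (pr.pairing x)) (?W w (pr.pairing y))) c"
      unfolding wsem.simps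
      by (rule pr.tcomult_pairing[OF vector_space space[OF fs(4)] lapp_bilinear[OF fs(3) letter_sound(2)[OF fs(1)] Wl] Cons.prems])
    also have "\<dots> = D.cs (\<lambda>x y. lapp B B (den M (elab \<Theta> [] (if s = 0 then P else Q)) x)
        (wsem (map snd \<Theta>) B (\<lambda>s. den M (elab \<Theta> [] (if s = 0 then P else Q))) (\<lambda>c. sc (Bcounit \<Theta> c) z) w y)) c"
    proof (rule D.cs_cong[OF Cons.prems])
      fix x y assume x: "x \<in> BT \<Theta>" and y: "y \<in> BT \<Theta>"
      have "letter B s (pr.pairing x) = den M (elab \<Theta> [] (if s = 0 then P else Q)) x"
        using ll[OF x, of s] by (cases "s = 0") simp_all
      then show "lapp B B (letter B s (pr.pairing x)) (?W w (pr.pairing y)) =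
        lapp B B (den M (elab \<Theta> [] (if s = 0 then P else Q)) x)
          (wsem (map snd \<Theta>) B (\<lambda>s. den M (elab \<Theta> [] (if s = 0 then P else Q))) (\<lambda>c. sc (Bcounit \<Theta> c) z) w y)"
        by (simp only: Cons.IH[OF y])
    qed
    finally show ?case by (simp only: wsem.simps)
  qed
  have bi: "bilinear_on tscale sc (BT \<Theta>) (sp B) (\<lambda>x y. ?W (rev w) (pure [?Q x, ?P y]))"
    by (rule bilinear_on_compose[OF pr.bilinear_on_fg Wl])
  have "D.cs (\<lambda>x y. bapp B (wordmap B w) (?P x) (?Q y) z) c = D.cs (\<lambda>x y. ?W (rev w) (pure [?Q y, ?P x])) c"
    by (intro D.cs_cong[OF c] bint_val(3)[OF B] mem z)
  \<comment> \<open>In the term the first leg goes to \<open>P\<close>, in the pairing it goes to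
    \<open>Q\<close>; cocommutativity reconciles the two.\<close>
  also have "\<dots> = D.cs (\<lambda>x y. ?W (rev w) (pure [?Q x, ?P y])) c"
    by (rule D.cocomm[OF vector_space space[OF fs(4)] bi c])
  also have "\<dots> = ?W (rev w) (pr.pairing c)"
    unfolding pr.pairing_def
    by (rule D.linear_on_apply_cs[OF c V Wl bilinear_on_in[OF pr.bilinear_on_fg], symmetric])
  finally show ?thesis by (simp only: main[OF c])
qed

text \<open>Of the three applications only the second has both sides depending on \<Theta> beyond
  the counit, so only there does a coproduct survive. The last application is linear in the function
  and moves inside the sum.\<close>

lemma tsem_bint_app:
  assumes B: "bint B \<in> F" and P: "sound_typed \<Theta> [] P (B \<multimap> B)" and Q: "sound_typed \<Theta> [] Q (B \<multimap> B)"
    and v: "linear_vars P = {}" "linear_vars Q = {}" and b: "filter (\<lambda>p. fst p = b) \<Gamma> = [(b, bint B)]"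
    and T: "csem \<Theta> (filter (\<lambda>p. fst p \<noteq> b) \<Gamma>) T B h"
  shows "tsem \<Theta> \<Gamma> (App (App (App (Var b) (Bang P)) (Bang Q)) T) B
    (\<lambda>c \<rho>. Bsw \<Theta> (\<lambda>x y. bapp B (\<rho> b) (den M (elab \<Theta> [] (Bang P)) x) (den M (elab \<Theta> [] (Bang Q)) y) (h \<rho>)) c)"
proof -
  let ?E = "B \<multimap> B"
  let ?P = "den M (elab \<Theta> [] (Bang P))" and ?Q = "den M (elab \<Theta> [] (Bang Q))"
  note fs = bint_formulas[OF B]
  have B': "(OfCourse ?E \<multimap> OfCourse ?E \<multimap> ?E) \<in> F" using B by (simp add: bint_def)
  have \<Theta>: "bangs \<Theta>" by (rule sound_typedD(5)[OF P])
  interpret D: coalgebra tscale "BT \<Theta>" "Bcomult \<Theta>" "Bcounit \<Theta>" by (rule coalgebra_BT[OF \<Theta>])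
  have adm: "admissible [] \<rho>" for \<rho> by (simp add: admissible_def)
  note tP = tsem_closed[OF tsem_Bang(1)[OF tsem_closed[OF P] fs(1)]]
  note tQ = tsem_closed[OF tsem_Bang(1)[OF tsem_closed[OF Q] fs(1)]]
  note lP = tsemD(3)[OF tP adm] and lQ = tsemD(3)[OF tQ adm]
  have t1: "tsem \<Theta> [(b, bint B)] (App (Var b) (Bang P)) (OfCourse ?E \<multimap> ?E)
      (\<lambda>c \<rho>. lapp (OfCourse ?E) (OfCourse ?E \<multimap> ?E) (\<rho> b) (?P c))"
    using csem_Var[OF \<Theta> B, of b] tP by (intro tsem_App_left) (simp_all add: bint_def)
  have t2: "tsem \<Theta> [(b, bint B)] (App (App (Var b) (Bang P)) (Bang Q)) ?E
      (\<lambda>c \<rho>. Bsw \<Theta> (\<lambda>x y. lapp (OfCourse ?E) ?E (lapp (OfCourse ?E) (OfCourse ?E \<multimap> ?E) (\<rho> b) (?P x)) (?Q y)) c)"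
    using t1 tQ by (intro tsem_App) (simp_all add: v)
  have t3: "tsem \<Theta> \<Gamma> (App (App (App (Var b) (Bang P)) (Bang Q)) T) B
      (\<lambda>c \<rho>. lapp B B (Bsw \<Theta> (\<lambda>x y. lapp (OfCourse ?E) ?E (lapp (OfCourse ?E) (OfCourse ?E \<multimap> ?E) (\<rho> b) (?P x)) (?Q y)) c) (h \<rho>))"
    using t2 T by (intro tsem_App_right) (simp_all add: v b)
  show ?thesis
  proof (rule tsem_cong[OF t3])
    fix c \<rho> assume \<rho>: "admissible \<Gamma> \<rho>" and c: "c \<in> BT \<Theta>"
    have "(b, bint B) \<in> set \<Gamma>" using b by (metis filter_is_subset list.set_intros(1) subsetD)
    then have \<rho>b: "\<rho> b \<in> sp (bint B)" using \<rho> by (auto simp: admissible_def)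
    have h: "h \<rho> \<in> sp B" by (rule csemD(2)[OF T admissible_filter[OF \<rho>]])
    show "lapp B B (Bsw \<Theta> (\<lambda>x y. lapp (OfCourse ?E) ?E (lapp (OfCourse ?E) (OfCourse ?E \<multimap> ?E) (\<rho> b) (?P x)) (?Q y)) c) (h \<rho>) =
      Bsw \<Theta> (\<lambda>x y. bapp B (\<rho> b) (?P x) (?Q y) (h \<rho>)) c"
      unfolding bapp_def
    proof (rule D.linear_on_apply_cs[OF c vector_space space[OF fs(3)] lapp_linear(2)[OF fs(3) h]])
      show "lapp (OfCourse ?E) ?E (lapp (OfCourse ?E) (OfCourse ?E \<multimap> ?E) (\<rho> b) (?P x)) (?Q y) \<in> sp ?E"
        if "x \<in> BT \<Theta>" "y \<in> BT \<Theta>" for x y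
        using \<rho>b linear_on_in[OF lP that(1)] linear_on_in[OF lQ that(2)]
        by (intro lapp_linear(3)[OF fs(2)] lapp_linear(3)[OF B']) (simp_all add: bint_def)
    qed
  qed
qed

end

section \<open>Values of the component proofs\<close>

context sweedler_semantics
begin

lemma nbool_formulas: "nbool n A \<in> F \<Longrightarrow> (pow A n \<multimap> A) \<in> F" "nbool n A \<in> F \<Longrightarrow> pow A n \<in> F" "nbool n A \<in> F \<Longrightarrow> A \<in> F"
  using formulas_sub(3,4)[of "pow A n" A] by (auto simp: nbool_def)

lemma pow_2: "pow A 2 = With A A" and pow_3: "pow A 3 = With A (With A A)"
  by (simp_all add: numeral_eq_Suc)

lemma tsem_triple:
  assumes "tsem \<Theta> \<Gamma> t0 A f0" "tsem \<Theta> \<Gamma> t1 A f1" "tsem \<Theta> \<Gamma> t2 A f2" "pow A 3 \<in> F"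
  shows "tsem \<Theta> \<Gamma> (tuple [t0, t1, t2]) (pow A 3) (\<lambda>c \<rho>. tup A [f0 c \<rho>, f1 c \<rho>, f2 c \<rho>])"
  using tsem_tuple[of \<Theta> \<Gamma> A "[t0, t1, t2]" "[f0, f1, f2]"] assms by (simp add: numeral_3_eq_3)

lemma csem_triple:
  assumes "csem \<Theta> \<Gamma> t0 A f0" "csem \<Theta> \<Gamma> t1 A f1" "csem \<Theta> \<Gamma> t2 A f2" "pow A 3 \<in> F"
  shows "csem \<Theta> \<Gamma> (tuple [t0, t1, t2]) (pow A 3) (\<lambda>\<rho>. tup A [f0 \<rho>, f1 \<rho>, f2 \<rho>])"
  using csem_tuple[of \<Theta> \<Gamma> A "[t0, t1, t2]" "[f0, f1, f2]"] assms by (simp add: numeral_3_eq_3)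

lemma triple:
  assumes "pow A 3 \<in> F" "a \<in> sp A" "b \<in> sp A" "c \<in> sp A"
  shows "tup A [a, b, c] \<in> sp (pow A 3)"
    and "prj A 3 0 (tup A [a, b, c]) = a" "prj A 3 1 (tup A [a, b, c]) = b" "prj A 3 2 (tup A [a, b, c]) = c"
  using assms tup_in[of "[a, b, c]" A] prj_tup[of "[a, b, c]" A 0] prj_tup[of "[a, b, c]" A 1] prj_tup[of "[a, b, c]" A 2]
  by (simp_all add: numeral_3_eq_3 numeral_2_eq_2 del: tup.simps prj.simps)

section \<open>Booleans and transition tables\<close>

definition nb :: "nat \<Rightarrow> 'a formula \<Rightarrow> nat \<Rightarrow> 'v"
  where "nb n A i = lam (pow A n) A (prj A n i)"

lemma nbool_val:
  assumes A: "nbool n A \<in> F" and i: "i < n"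
  shows "den_closed M (nbool_val n A i) = nb n A i" and "nb n A i \<in> sp (nbool n A)"
    and "v \<in> sp (pow A n) \<Longrightarrow> lapp (pow A n) A (nb n A i) v = prj A n i v"
proof -
  note fs = nbool_formulas[OF A]
  have b: "bangs []" by (simp add: bangs_def)
  have nx: "''x'' \<notin> fst ` set ([] :: (string \<times> 'a formula) list)" by simp
  note c = csem_Lam(1)[OF csem_proj[OF csem_Var[OF b fs(2), of "''x''"] i] fs(1) nx]
  have adm: "admissible [] \<rho>" for \<rho> by (simp add: admissible_def)
  show "den_closed M (nbool_val n A i) = nb n A i"
    using csem_Nil_den[OF c adm] by (simp add: den_closed_def nbool_val_def nb_def del: elab.simps)
  show "nb n A i \<in> sp (nbool n A)" unfolding nb_def nbool_def by (rule lam_in[OF fs(1) prj_linear[OF fs(2) i]])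
  show "v \<in> sp (pow A n) \<Longrightarrow> lapp (pow A n) A (nb n A i) v = prj A n i v"
    unfolding nb_def by (rule lapp_lam[OF fs(1) prj_linear[OF fs(2) i]])
qed

lemma nb_pair:
  assumes A: "nbool 2 A \<in> F" and i: "i \<in> {0, 1}" and "a \<in> sp A" "b \<in> sp A"
  shows "lapp (pow A 2) A (nb 2 A i) (wpair A A a b) = (if i = 0 then a else b)"
proof -
  have W: "With A A \<in> F" using nbool_formulas(2)[OF A] by (simp add: pow_2)
  note w = with_props[OF W]
  have "lapp (pow A 2) A (nb 2 A i) (wpair A A a b) = prj A 2 i (wpair A A a b)"
    using i assms(3,4) by (intro nbool_val(3)[OF A]) (auto simp: pow_2 w)
  then show ?thesis using i assms(3,4) by (auto simp: w)
qed

text \<open>The boolean selects the i-th of the diagonal triples, and coordinate 0 of that triple is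
  the i-th component of the argument.\<close>

lemma booltype_value:
  assumes n: "n \<ge> 1" and A: "nbool n (pow A 3) \<in> F" "nbool n A \<in> F"
  shows "sound (booltype n A)" and "i < n \<Longrightarrow> den M (booltype n A) (pure [nb n (pow A 3) i]) = nb n A i"
proof -
  note f1 = nbool_formulas[OF A(1)] and f2 = nbool_formulas[OF A(2)]
  have b: "bangs []" by (simp add: bangs_def)
  let ?x = "\<lambda>i. proj n i (Var ''x'')" and ?G = "[(''x'', pow A n), (''q'', nbool n (pow A 3))]"
  have x: "csem [] [(''x'', pow A n)] (?x i) A (\<lambda>\<rho>. prj A n i (\<rho> ''x''))" if "i < n" for i
    by (rule csem_proj[OF csem_Var[OF b f2(2)] that])
  have tp: "csem [] [(''x'', pow A n)] (tuple (map (\<lambda>i. tuple [?x i, ?x i, ?x i]) [0..<n])) (pow (pow A 3) n)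
      (\<lambda>\<rho>. tup (pow A 3) (map (\<lambda>i. tup A [prj A n i (\<rho> ''x''), prj A n i (\<rho> ''x''), prj A n i (\<rho> ''x'')]) [0..<n]))"
    using csem_tuple[of "[]" "[(''x'', pow A n)]" "pow A 3" "map (\<lambda>i. tuple [?x i, ?x i, ?x i]) [0..<n]"
        "map (\<lambda>i \<rho>. tup A [prj A n i (\<rho> ''x''), prj A n i (\<rho> ''x''), prj A n i (\<rho> ''x'')]) [0..<n]"]
      csem_triple[OF x x x f1(3)] n f1(2)
    by (simp add: list_all2_conv_all_nth o_def del: tuple.simps tup.simps)
  have vt: "linear_vars (tuple (map (\<lambda>i. tuple [?x i, ?x i, ?x i]) [0..<n])) \<subseteq> {''x''}"
    using n by (subst tuple_vars) (auto simp: proj_vars tuple_vars simp del: tuple.simps)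
  have ap: "csem [] ?G (App (Var ''q'') (tuple (map (\<lambda>i. tuple [?x i, ?x i, ?x i]) [0..<n]))) (pow A 3)
      (\<lambda>\<rho>. lapp (pow (pow A 3) n) (pow A 3) (\<rho> ''q'') (tup (pow A 3) (map (\<lambda>i. tup A [prj A n i (\<rho> ''x''), prj A n i (\<rho> ''x''), prj A n i (\<rho> ''x'')]) [0..<n])))"
    using csem_Var[OF b A(1), of "''q''"] tp by (intro csem_App) (simp_all add: nbool_def del: tuple.simps tup.simps)
  have nx: "''x'' \<notin> fst ` set [(''q'', nbool n (pow A 3))]" by simp
  note c = csem_Lam(1)[OF csem_proj[OF ap, of 0] f2(1) nx]
  have el: "booltype n A = elab [] [(''q'', nbool n (pow A 3))] (Lam ''x'' (pow A n) (proj 3 0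
      (App (Var ''q'') (tuple (map (\<lambda>i. tuple [?x i, ?x i, ?x i]) [0..<n])))))"
    unfolding booltype_def Let_def ..
  have three: "(0::nat) < 3" by simp
  show "sound (booltype n A)"
    unfolding el using sound_typedD(4)[OF tsemD(1)[OF csemD(1)[OF c[OF three]]]] .
  assume i: "i < n"
  let ?\<rho> = "\<lambda>_::string. nb n (pow A 3) i"
  have \<rho>: "admissible [(''q'', nbool n (pow A 3))] ?\<rho>" using nbool_val(2)[OF A(1) i] by (simp add: admissible_def)
  have "den M (booltype n A) (pure (vals [(''q'', nbool n (pow A 3))] ?\<rho>)) = nb n A i"
    unfolding el csem_Nil_den[OF c[OF three] \<rho>] nb_def[of n A]
  proof (rule lam_cong)
    fix z assume z: "z \<in> sp (pow A n)"
    let ?l = "map (\<lambda>i. tup A [prj A n i z, prj A n i z, prj A n i z]) [0..<n]"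
    have p: "prj A n j z \<in> sp A" if "j < n" for j by (rule linear_on_in[OF prj_linear[OF f2(2) that] z])
    have l: "set ?l \<subseteq> sp (pow A 3)" using triple(1)[OF f1(3) p p p] by (auto simp del: tup.simps)
    have t: "tup (pow A 3) ?l \<in> sp (pow (pow A 3) n)" using tup_in[OF _ l] n f1(2) by simp
    have "prj (pow A 3) n i (tup (pow A 3) ?l) = tup A [prj A n i z, prj A n i z, prj A n i z]"
      using prj_tup[OF l] f1(2) i by (simp del: tup.simps)
    then show "prj A 3 0 (lapp (pow (pow A 3) n) (pow A 3) ((?\<rho>(''x'' := z)) ''q'') (tup (pow A 3) (map (\<lambda>i. tup A
        [prj A n i ((?\<rho>(''x'' := z)) ''x''), prj A n i ((?\<rho>(''x'' := z)) ''x''), prj A n i ((?\<rho>(''x'' := z)) ''x'')]) [0..<n]))) =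
      prj A n i z"
      using nbool_val(3)[OF A(1) i t] triple(2)[OF f1(3) p[OF i] p[OF i] p[OF i]] by (simp del: tup.simps prj.simps)
  qed
  then show "den M (booltype n A) (pure [nb n (pow A 3) i]) = nb n A i" by simp
qed

text \<open>A table lookup: the symbol chooses the row, the state the entry in it, and the entry is
  the projection with index \<open>delta_comp \<delta> i (s, j)\<close>. That this index is below
  \<open>m\<close> comes from \<open>is_transition\<close>.\<close>

lemma trans_value:
  assumes n: "n \<ge> 1" and \<delta>: "is_transition n \<delta>" and i: "i \<le> 2" and A: "nbool 2 A \<in> F" "nbool n A \<in> F"
  defines "m \<equiv> (if i = 1 then n else 2)"
  shows "sound (trans_proof i n \<delta> A)" and "s \<in> {0, 1} \<Longrightarrow> j < n \<Longrightarrow>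
    den M (trans_proof i n \<delta> A) (pure [nb 2 A s, nb n A j]) = nb m A (delta_comp \<delta> i (s, j))"
proof -
  have d: "delta_comp \<delta> i (s, j) < m" if "s \<in> {0,1}" "j < n" for s j
  proof -
    have "\<delta> (s, j) \<in> {0, 1} \<times> {..<n} \<times> {0, 1}" using \<delta> that unfolding is_transition_def by auto
    then show ?thesis by (auto simp: delta_comp_def m_def split: prod.splits)
  qed
  have Am: "nbool m A \<in> F" using A by (simp add: m_def)
  note f2 = nbool_formulas[OF A(1)] and fn = nbool_formulas[OF A(2)] and fm = nbool_formulas[OF Am]
  have b: "bangs []" by (simp add: bangs_def)
  let ?x = "\<lambda>j. proj m j (Var ''x'')"
  let ?l = "\<lambda>s v. map (\<lambda>j. prj A m (delta_comp \<delta> i (s, j)) v) [0..<n]"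
  let ?row = "\<lambda>s. App (Var ''q'') (tuple (map (\<lambda>j. ?x (delta_comp \<delta> i (s, j))) [0..<n]))"
  let ?G = "[(''b'', nbool 2 A), (''q'', nbool n A)]"
  have x: "csem [] [(''x'', pow A m)] (?x j) A (\<lambda>\<rho>. prj A m j (\<rho> ''x''))" if "j < m" for j
    by (rule csem_proj[OF csem_Var[OF b fm(2)] that])
  have tp: "csem [] [(''x'', pow A m)] (tuple (map (\<lambda>j. ?x (delta_comp \<delta> i (s, j))) [0..<n])) (pow A n) (\<lambda>\<rho>. tup A (?l s (\<rho> ''x'')))"
    if "s \<in> {0, 1}" for s
    using csem_tuple[of "[]" "[(''x'', pow A m)]" A "map (\<lambda>j. ?x (delta_comp \<delta> i (s, j))) [0..<n]"
        "map (\<lambda>j \<rho>. prj A m (delta_comp \<delta> i (s, j)) (\<rho> ''x'')) [0..<n]"] x d[OF that] n fn(2)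
    by (simp add: list_all2_conv_all_nth o_def)
  have row: "csem [] [(''x'', pow A m), (''q'', nbool n A)] (?row s) A (\<lambda>\<rho>. lapp (pow A n) A (\<rho> ''q'') (tup A (?l s (\<rho> ''x''))))"
    if "s \<in> {0, 1}" for s
    using csem_Var[OF b A(2), of "''q''"] tp[OF that] by (intro csem_App) (simp_all add: nbool_def)
  have W: "With A A \<in> F" using f2(2) by (simp add: pow_2)
  have ap: "csem [] ((''x'', pow A m) # ?G) (App (Var ''b'') (tuple [?row 0, ?row 1])) A
      (\<lambda>\<rho>. lapp (pow A 2) A (\<rho> ''b'') (wpair A A (lapp (pow A n) A (\<rho> ''q'') (tup A (?l 0 (\<rho> ''x''))))
        (lapp (pow A n) A (\<rho> ''q'') (tup A (?l 1 (\<rho> ''x''))))))"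
    using csem_Var[OF b A(1), of "''b''"] csem_Tup[OF row[of 0] row[of 1] W]
    by (intro csem_App) (simp_all add: nbool_def pow_2)
  have nx: "''x'' \<notin> fst ` set ?G" by simp
  note c = csem_Lam(1)[OF ap fm(1) nx]
  have el: "trans_proof i n \<delta> A = elab [] ?G (Lam ''x'' (pow A m) (App (Var ''b'') (tuple [?row 0, ?row 1])))"
    unfolding trans_proof_def Let_def m_def ..
  show "sound (trans_proof i n \<delta> A)"
    unfolding el using sound_typedD(4)[OF tsemD(1)[OF csemD(1)[OF c]]] .
  assume s: "s \<in> {0, 1}" and j: "j < n"
  let ?\<rho> = "(\<lambda>_::string. nb n A j)(''b'' := nb 2 A s)"
  have s2: "s < 2" using s by auto
  have \<rho>: "admissible ?G ?\<rho>" using nbool_val(2)[OF A(1) s2] nbool_val(2)[OF A(2) j] by (simp add: admissible_def)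
  have "den M (trans_proof i n \<delta> A) (pure (vals ?G ?\<rho>)) = nb m A (delta_comp \<delta> i (s, j))"
    unfolding el csem_Nil_den[OF c \<rho>] nb_def[of m A]
  proof (rule lam_cong)
    fix z assume z: "z \<in> sp (pow A m)"
    have l: "set (?l s z) \<subseteq> sp A" if "s \<in> {0, 1}" for s
      using linear_on_in[OF prj_linear[OF fm(2) d[OF that]] z] by auto
    have t: "tup A (?l s z) \<in> sp (pow A n)" if "s \<in> {0, 1}" for s
      using tup_in[OF _ l[OF that]] n fn(2) by simp
    have e: "lapp (pow A n) A (nb n A j) (tup A (?l s z)) = prj A m (delta_comp \<delta> i (s, j)) z" if "s \<in> {0, 1}" for s
      using nbool_val(3)[OF A(2) j t[OF that]] prj_tup[OF l[OF that], of j] fn(2) j by simp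
    have p: "prj A m (delta_comp \<delta> i (s, j)) z \<in> sp A" if "s \<in> {0, 1}" for s
      by (rule linear_on_in[OF prj_linear[OF fm(2) d[OF that j]] z])
    show "lapp (pow A 2) A ((?\<rho>(''x'' := z)) ''b'') (wpair A A (lapp (pow A n) A ((?\<rho>(''x'' := z)) ''q'') (tup A (?l 0 ((?\<rho>(''x'' := z)) ''x''))))
        (lapp (pow A n) A ((?\<rho>(''x'' := z)) ''q'') (tup A (?l 1 ((?\<rho>(''x'' := z)) ''x''))))) = prj A m (delta_comp \<delta> i (s, j)) z"
      using nb_pair[OF A(1) s p[of 0] p[of 1]] s by (auto simp: e simp del: prj.simps)
  qed
  then show "den M (trans_proof i n \<delta> A) (pure [nb 2 A s, nb n A j]) = nb m A (delta_comp \<delta> i (s, j))" by simp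
qed

text \<open>The unit \<open>pure []\<close> is group-like, so over the ground field convolution is
  ordinary application.\<close>

lemma wsem_Nil_Cons:
  assumes B: "(B \<multimap> B) \<in> F" and \<phi>: "\<And>s. linear_on tscale sc (fam.T []) (sp (B \<multimap> B)) (\<phi> s)"
    and h: "linear_on tscale sc (fam.T []) (sp B) h"
  shows "wsem [] B \<phi> h (s # w) (pure []) = lapp B B (\<phi> s (pure [])) (wsem [] B \<phi> h w (pure []))"
  using fam.sw_tcomult[OF _ vector_space space[OF formulas_sub(4)[OF B]] lapp_bilinear[OF B \<phi> wsem_linear[OF _ B \<phi> h]], of "[]"]
  by simp

text \<open>The promoted terms are closed, so letters act as the operators \<open>?pl 0\<close> and
  \<open>?pl 1\<close>: they keep coordinates 0 and 1 and copy one of them into coordinate 2. After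
  the last letter \<open>s\<close>, coordinate 2 therefore holds \<open>x0\<close> or
  \<open>x1\<close> according to \<open>s\<close>.\<close>

lemma head_value:
  assumes A: "bint (pow A 3) \<in> F" "nbool 2 A \<in> F"
  shows "sound (head A)" and "s \<in> {0, 1} \<Longrightarrow> den M (head A) (pure [wordmap (pow A 3) (w @ [s])]) = nb 2 A s"
proof -
  note f3 = bint_formulas[OF A(1)] and f2 = nbool_formulas[OF A(2)]
  have b: "bangs []" by (simp add: bangs_def)
  have adm: "admissible [] \<rho>" for \<rho> by (simp add: admissible_def)
  let ?A3 = "pow A 3"
  let ?p = "\<lambda>i. Lam ''t'' ?A3 (tuple [proj 3 0 (Var ''t''), proj 3 1 (Var ''t''), proj 3 i (Var ''t'')])"
  let ?x = "\<lambda>i. proj 2 i (Var ''x'')"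
  let ?G = "[(''x'', pow A 2), (''b'', bint ?A3)]"
  let ?pl = "\<lambda>i z. tup A [prj A 3 0 z, prj A 3 1 z, prj A 3 i z]"
  have tt: "csem [] [(''t'', ?A3)] (proj 3 i (Var ''t'')) A (\<lambda>\<rho>. prj A 3 i (\<rho> ''t''))" if "i < 3" for i
    by (rule csem_proj[OF csem_Var[OF b f3(4)] that])
  have p: "csem [] [(''t'', ?A3)] (tuple [proj 3 0 (Var ''t''), proj 3 1 (Var ''t''), proj 3 i (Var ''t'')]) ?A3 (\<lambda>\<rho>. ?pl i (\<rho> ''t''))"
    if "i < 3" for i
    using that by (intro csem_triple tt f3(4)) auto
  have pp: "csem [] [] (?p i) (?A3 \<multimap> ?A3) (\<lambda>\<rho>. lam ?A3 ?A3 (?pl i))" and pl: "linear_on sc sc (sp ?A3) (sp ?A3) (?pl i)" if "i < 3" for i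
    using csem_Lam[OF p[OF that] f3(3)] adm by (simp_all del: tup.simps prj.simps)
  have ps: "sound_typed [] [] (?p i) (?A3 \<multimap> ?A3)" if "i < 3" for i
    by (rule tsemD(1)[OF csemD(1)[OF pp[OF that]]])
  have pv: "den M (elab [] [] (?p i)) (pure []) = lam ?A3 ?A3 (?pl i)" if "i < 3" for i
    using csem_Nil_den[OF pp[OF that] adm] by simp
  have vp: "linear_vars (?p i) = {}" for i by (auto simp: tuple_vars proj_vars simp del: tuple.simps proj.simps)
  have x: "csem [] [(''x'', pow A 2)] (?x i) A (\<lambda>\<rho>. prj A 2 i (\<rho> ''x''))" if "i < 2" for i
    by (rule csem_proj[OF csem_Var[OF b f2(2)] that])
  have T: "csem [] (filter (\<lambda>p. fst p \<noteq> ''b'') ?G) (tuple [?x 0, ?x 1, ?x 0]) ?A3 (\<lambda>\<rho>. tup A [prj A 2 0 (\<rho> ''x''), prj A 2 1 (\<rho> ''x''), prj A 2 0 (\<rho> ''x'')])"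
    using csem_triple[OF x[of 0] x[of 1] x[of 0] f3(4)] by (simp del: tuple.simps tup.simps proj.simps prj.simps)
  have G: "filter (\<lambda>p. fst p = ''b'') ?G = [(''b'', bint ?A3)]" by simp
  have i3: "(0::nat) < 3" "(1::nat) < 3" "(2::nat) < 3" by simp_all
  note ba = csem_Nil[OF tsem_bint_app[OF A(1) ps[OF i3(1)] ps[OF i3(2)] vp vp G T]]
  have nx: "''x'' \<notin> fst ` set [(''b'', bint ?A3)]" by simp
  have f2': "(pow A 2 \<multimap> A) \<in> F" by (rule f2(1))
  note c = csem_Lam(1)[OF csem_proj[OF ba i3(3)] f2' nx]
  have el: "head A = elab [] [(''b'', bint ?A3)] (Lam ''x'' (pow A 2) (proj 3 2 (App (App (App (Var ''b'') (Bang (?p 0))) (Bang (?p 1))) (tuple [?x 0, ?x 1, ?x 0]))))"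
    unfolding head_def Let_def ..
  show "sound (head A)"
    unfolding el using sound_typedD(4)[OF tsemD(1)[OF csemD(1)[OF c]]] unfolding nbool_def .
  assume s: "s \<in> {0, 1}"
  let ?\<rho> = "\<lambda>_::string. wordmap ?A3 (w @ [s])"
  have \<rho>: "admissible [(''b'', bint ?A3)] ?\<rho>" using bint_val(2)[OF A(1)] by (simp add: admissible_def)
  have "den M (head A) (pure (vals [(''b'', bint ?A3)] ?\<rho>)) = nb 2 A s"
    unfolding el csem_Nil_den[OF c \<rho>] nb_def[of 2 A]
  proof (rule lam_cong)
    fix z assume z: "z \<in> sp (pow A 2)"
    define x0 x1 where "x0 = prj A 2 0 z" and "x1 = prj A 2 1 z"
    have xs: "x0 \<in> sp A" "x1 \<in> sp A" unfolding x0_def x1_def by (rule linear_on_in[OF prj_linear[OF f2(2)] z]; simp)+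
    define t where "t = tup A [x0, x1, x0]"
    have t: "t \<in> sp ?A3" unfolding t_def by (rule triple(1)[OF f3(4) xs xs(1)])
    define \<phi> where "\<phi> s = den M (elab [] [] (if s = 0 then ?p 0 else ?p 1))" for s :: nat
    have \<phi>v: "\<phi> s (pure []) = lam ?A3 ?A3 (?pl (if s = 0 then 0 else 1))" for s
      using pv[OF i3(1)] pv[OF i3(2)] by (simp add: \<phi>_def del: tup.simps prj.simps elab.simps tuple.simps proj.simps)
    have \<phi>l: "linear_on tscale sc (fam.T []) (sp (?A3 \<multimap> ?A3)) (\<phi> s)" for s
      using tsemD(3)[OF tsem_closed[OF ps[OF i3(1)]] adm] tsemD(3)[OF tsem_closed[OF ps[OF i3(2)]] adm]
      by (simp add: \<phi>_def del: elab.simps tuple.simps proj.simps)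
    interpret D: coalgebra tscale "fam.T []" "fam.tcomult []" "fam.tcounit []" by (rule fam.coalgebra_tensor) simp
    let ?h = "\<lambda>c. sc (fam.tcounit [] c) t"
    have hl: "linear_on tscale sc (fam.T []) (sp ?A3) ?h"
      by (rule linear_on_scale_left[OF vector_space space[OF f3(4)] D.\<epsilon> t])
    note step = wsem_Nil_Cons[OF f3(3) \<phi>l hl]
    have act: "lapp ?A3 ?A3 (\<phi> s (pure [])) (tup A [x0, x1, v]) = tup A [x0, x1, if s = 0 then x0 else x1]" if "v \<in> sp A" for s v
      unfolding \<phi>v using lapp_lam[OF f3(3) pl triple(1)[OF f3(4) xs that], of "if s = 0 then 0 else 1"]
        triple(2-4)[OF f3(4) xs that]
      by (auto simp del: tup.simps prj.simps)
    \<comment> \<open>Along the word coordinates 0 and 1 never change. Coordinate 2 is left open,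
      since the next letter overwrites it.\<close>
    have inv: "\<exists>v\<in>sp A. wsem [] ?A3 \<phi> ?h u (pure []) = tup A [x0, x1, v]" for u
    proof (induction u)
      case Nil
      show ?case using xs tcounit_Nil(1) by (auto simp: t_def vector_space_one[OF vector_space] simp del: tup.simps)
    next
      case (Cons s u)
      then obtain v where "v \<in> sp A" "wsem [] ?A3 \<phi> ?h u (pure []) = tup A [x0, x1, v]" by blast
      then show ?case using act[OF \<open>v \<in> sp A\<close>] xs by (auto simp: step simp del: wsem.simps tup.simps)
    qed
    from inv[of "rev w"] obtain v where v: "v \<in> sp A" "wsem [] ?A3 \<phi> ?h (rev w) (pure []) = tup A [x0, x1, v]" by blast
    have "wsem [] ?A3 \<phi> ?h (rev (w @ [s])) (pure []) = tup A [x0, x1, if s = 0 then x0 else x1]"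
      by (simp add: step v(2) act[OF v(1)] del: wsem.simps tup.simps)
    moreover have "Bsw [] (\<lambda>x y. bapp ?A3 (wordmap ?A3 (w @ [s])) (den M (elab [] [] (Bang (?p 0))) x) (den M (elab [] [] (Bang (?p 1))) y) t) (pure []) =
        wsem [] ?A3 \<phi> ?h (rev (w @ [s])) (pure [])"
      using wordmap_app[OF A(1) ps[OF i3(1)] ps[OF i3(2)] t tcounit_Nil(2), of "w @ [s]"] unfolding \<phi>_def list.map .
    ultimately have e: "prj A 3 2 (Bsw [] (\<lambda>x y. bapp ?A3 (wordmap ?A3 (w @ [s])) (den M (elab [] [] (Bang (?p 0))) x) (den M (elab [] [] (Bang (?p 1))) y) t) (pure [])) =
        (if s = 0 then x0 else x1)"
      using triple(4)[OF f3(4) xs, of "if s = 0 then x0 else x1"] xs by (simp only: if_split) auto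
    have "(if s = 0 then x0 else x1) = prj A 2 s z" using s by (auto simp: x0_def x1_def simp del: prj.simps)
    then show "prj A 3 2 (Bsw [] (\<lambda>x y. bapp ?A3 ((?\<rho>(''x'' := z)) ''b'') (den M (elab [] [] (Bang (?p 0))) x) (den M (elab [] [] (Bang (?p 1))) y)
        (tup A [prj A 2 0 ((?\<rho>(''x'' := z)) ''x''), prj A 2 1 ((?\<rho>(''x'' := z)) ''x''), prj A 2 0 ((?\<rho>(''x'' := z)) ''x'')])) (pure [])) = prj A 2 s z"
      using e unfolding t_def x0_def x1_def by (simp del: elab.simps tuple.simps proj.simps tup.simps prj.simps)
  qed
  then show "den M (head A) (pure [wordmap (pow A 3) (w @ [s])]) = nb 2 A s" by simp
qed

text \<open>Coordinate 2 builds up the denotation of the word over \<open>A\<close>, while each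
  letter puts the previous coordinate 2 into coordinates 0 and 1. Reading coordinate 0 thus drops
  exactly the last letter, up to a counit that the counit law absorbs.\<close>

lemma tail_value:
  assumes A: "bint (pow A 3) \<in> F" "bint A \<in> F"
  shows "sound (tail A)" and "den M (tail A) (pure [wordmap (pow A 3) (w @ [s])]) = wordmap A w"
proof -
  note f3 = bint_formulas[OF A(1)] and f1 = bint_formulas[OF A(2)]
  let ?A3 = "pow A 3"
  define \<Theta> where "\<Theta> = [(''v'', A \<multimap> A), (''u'', A \<multimap> A)]"
  have m: "map snd \<Theta> = EE A" by (simp add: \<Theta>_def)
  have b: "bangs \<Theta>" using f1(1) by (simp add: bangs_def \<Theta>_def)
  have adm: "admissible [] \<rho>" for \<rho> by (simp add: admissible_def)
  let ?R = "\<lambda>v. Lam ''t'' ?A3 (tuple [proj 3 2 (Var ''t''), proj 3 2 (Var ''t''), App (UVar v) (proj 3 2 (Var ''t''))])"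
  let ?G = "[(''a'', A), (''b'', bint ?A3)]"
  \<comment> \<open>The action of the promoted terms over the coalgebra: an entry in which the
    unrestricted variable does not occur carries the counit of \<Theta>.\<close>
  define K where "K s c z = tup A [sc (Bcounit \<Theta> c) (prj A 3 2 z), sc (Bcounit \<Theta> c) (prj A 3 2 z), lapp A A (letter A s c) (prj A 3 2 z)]" for s c z
  have two: "(2::nat) < 3" by simp
  have t2: "csem \<Theta> [(''t'', ?A3)] (proj 3 2 (Var ''t'')) A (\<lambda>\<rho>. prj A 3 2 (\<rho> ''t''))"
    by (rule csem_proj[OF csem_Var[OF b f3(4)] two])
  have uv: "sound_typed \<Theta> [] (UVar v) (A \<multimap> A)" "den M (elab \<Theta> [] (UVar v)) = letter A s"
    if "(v, s) \<in> {(''u'', 0), (''v'', 1)}" for v and s :: nat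
  proof -
    show "sound_typed \<Theta> [] (UVar v) (A \<multimap> A)" by (rule UVar_eval(1)[OF b]) (use that in \<open>auto simp: \<Theta>_def\<close>)
    have "elab \<Theta> [] (UVar v) = elab (ee A) [] (word_var s)" using that by (auto simp: \<Theta>_def ee_def word_var_def)
    then show "den M (elab \<Theta> [] (UVar v)) = letter A s" by (simp only: letter_def)
  qed
  have R: "tsem \<Theta> [] (?R v) (?A3 \<multimap> ?A3) (\<lambda>c \<rho>. lam ?A3 ?A3 (K s c))"
    and Kl: "c \<in> BT \<Theta> \<Longrightarrow> linear_on sc sc (sp ?A3) (sp ?A3) (K s c)"
    if vs: "(v, s) \<in> {(''u'', 0), (''v'', 1)}" for v s c
  proof -
    have "tsem \<Theta> [(''t'', ?A3)] (App (UVar v) (proj 3 2 (Var ''t''))) A (\<lambda>c \<rho>. lapp A A (letter A s c) (prj A 3 2 (\<rho> ''t'')))"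
      using tsem_closed[OF uv(1)[OF vs]] t2 unfolding uv(2)[OF vs]
      by (intro tsem_App_right) (simp_all del: elab.simps proj.simps prj.simps)
    from tsem_triple[OF csemD(1)[OF t2] csemD(1)[OF t2] this f3(4)]
    have t: "tsem \<Theta> [(''t'', ?A3)] (tuple [proj 3 2 (Var ''t''), proj 3 2 (Var ''t''), App (UVar v) (proj 3 2 (Var ''t''))]) ?A3 (\<lambda>c \<rho>. K s c (\<rho> ''t''))"
      unfolding K_def .
    have n: "''t'' \<notin> fst ` set ([] :: (string \<times> 'a formula) list)" by simp
    show "tsem \<Theta> [] (?R v) (?A3 \<multimap> ?A3) (\<lambda>c \<rho>. lam ?A3 ?A3 (K s c))" using tsem_Lam[OF t f3(3) n] by simp
    show "c \<in> BT \<Theta> \<Longrightarrow> linear_on sc sc (sp ?A3) (sp ?A3) (K s c)" using tsem_linear_var[OF t n adm] by simp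
  qed
  have uu: "(''u'', 0) \<in> {(''u'', 0::nat), (''v'', 1)}" and vv: "(''v'', 1) \<in> {(''u'', 0::nat), (''v'', 1)}" by auto
  note Rs = tsemD(1)[OF R[OF uu]] tsemD(1)[OF R[OF vv]]
  have vR: "linear_vars (?R v) = {}" for v by (auto simp: tuple_vars proj_vars simp del: tuple.simps proj.simps)
  have a: "csem \<Theta> [(''a'', A)] (Var ''a'') A (\<lambda>\<rho>. \<rho> ''a'')" by (rule csem_Var[OF b f1(4)])
  have T: "csem \<Theta> (filter (\<lambda>p. fst p \<noteq> ''b'') ?G) (tuple [Var ''a'', Var ''a'', Var ''a'']) ?A3 (\<lambda>\<rho>. tup A [\<rho> ''a'', \<rho> ''a'', \<rho> ''a''])"
    using csem_triple[OF a a a f3(4)] by (simp del: tuple.simps tup.simps)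
  have G: "filter (\<lambda>p. fst p = ''b'') ?G = [(''b'', bint ?A3)]" by simp
  have three: "(0::nat) < 3" by simp
  have na: "''a'' \<notin> fst ` set [(''b'', bint ?A3)]" by simp
  note c = csem_bint(1)[OF tsem_proj[OF tsem_bint_app[OF A(1) Rs vR vR G T] three, unfolded \<Theta>_def] A(2) na, folded \<Theta>_def]
  have el: "tail A = elab [] [(''b'', bint ?A3)] (LamB ''u'' (A \<multimap> A) (LamB ''v'' (A \<multimap> A) (Lam ''a'' A
      (proj 3 0 (App (App (App (Var ''b'') (Bang (?R ''u''))) (Bang (?R ''v''))) (tuple [Var ''a'', Var ''a'', Var ''a'']))))))"
    unfolding tail_def Let_def ..
  show "sound (tail A)"
    unfolding el by (rule sound_typedD(4)[OF tsemD(1)[OF csemD(1)[OF c]]])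
  let ?\<rho> = "\<lambda>_::string. wordmap ?A3 (w @ [s])"
  have \<rho>: "admissible [(''b'', bint ?A3)] ?\<rho>" using bint_val(2)[OF A(1)] by (simp add: admissible_def)
  define \<phi> where "\<phi> s = den M (elab \<Theta> [] (if s = 0 then ?R ''u'' else ?R ''v''))" for s :: nat
  have "den M (tail A) (pure (vals [(''b'', bint ?A3)] ?\<rho>)) = wordmap A w"
    unfolding el csem_Nil_den[OF c \<rho>] wordmap_def[of A w]
  proof (rule mkbint_cong)
    fix c z assume c: "c \<in> fam.T (EE A)" and z: "z \<in> sp A"
    define t where "t = tup A [z, z, z]"
    have t: "t \<in> sp ?A3" unfolding t_def by (rule triple(1)[OF f3(4) z z z])
    interpret D: coalgebra tscale "fam.T (EE A)" "fam.tcomult (EE A)" "fam.tcounit (EE A)"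
      using coalgebra_BT[OF b] unfolding m .
    have EEb: "set (EE A) \<subseteq> banged" using f1(1) by simp
    have \<phi>v: "\<phi> s c = lam ?A3 ?A3 (K s c)" if "c \<in> fam.T (EE A)" for s c
    proof -
      have "K s c = K (if s = 0 then 0 else 1) c" unfolding K_def by (subst letter_if) (rule refl)
      then show ?thesis
        using tsem_closed_den[OF R[OF uu], of c] tsem_closed_den[OF R[OF vv], of c] that unfolding m \<phi>_def by auto
    qed
    have Kl': "linear_on sc sc (sp ?A3) (sp ?A3) (K s c)" if "c \<in> fam.T (EE A)" for s c
    proof -
      have "K s c = K (if s = 0 then 0 else 1) c" unfolding K_def by (subst letter_if) (rule refl)
      then show ?thesis using Kl[OF uu, of c] Kl[OF vv, of c] that unfolding m by auto
    qed
    have \<phi>l: "linear_on tscale sc (fam.T (EE A)) (sp (?A3 \<multimap> ?A3)) (\<phi> s)" for s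
      using tsemD(3)[OF tsem_closed[OF Rs(1)] adm] tsemD(3)[OF tsem_closed[OF Rs(2)] adm] unfolding m \<phi>_def by auto
    let ?h = "\<lambda>c. sc (fam.tcounit (EE A) c) t"
    have hl: "linear_on tscale sc (fam.T (EE A)) (sp ?A3) ?h"
      by (rule linear_on_scale_left[OF vector_space space[OF f3(4)] D.\<epsilon> t])
    note W = wsem_linear[OF EEb f3(3) \<phi>l hl]
    note p2 = prj_linear[OF f3(4), of 2, OF two] and p0 = prj_linear[OF f3(4), of 0, OF three]
    have ll: "letter A s c \<in> sp (A \<multimap> A)" if "c \<in> fam.T (EE A)" for s c
      by (rule linear_on_in[OF letter_sound(2)[OF f1(1)] that])
    have act: "prj A 3 2 (lapp ?A3 ?A3 (\<phi> s x) v) = lapp A A (letter A s x) (prj A 3 2 v)"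
      "prj A 3 0 (lapp ?A3 ?A3 (\<phi> s x) v) = sc (fam.tcounit (EE A) x) (prj A 3 2 v)"
      if x: "x \<in> fam.T (EE A)" and v: "v \<in> sp ?A3" for s x v
    proof -
      have v2: "prj A 3 2 v \<in> sp A" by (rule linear_on_in[OF p2 v])
      note tr = triple(2,4)[OF f3(4) subspace_smult[OF vector_space space[OF f1(4)] v2] subspace_smult[OF vector_space space[OF f1(4)] v2]
          lapp_linear(3)[OF f1(3) ll[OF x] v2]]
      show "prj A 3 2 (lapp ?A3 ?A3 (\<phi> s x) v) = lapp A A (letter A s x) (prj A 3 2 v)"
        "prj A 3 0 (lapp ?A3 ?A3 (\<phi> s x) v) = sc (fam.tcounit (EE A) x) (prj A 3 2 v)"
        unfolding \<phi>v[OF x] lapp_lam[OF f3(3) Kl'[OF x] v] unfolding K_def m by (rule tr)+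
    qed
    \<comment> \<open>Coordinate 2 is compatible with convolution: projecting after a letter equals
      letting the letter of \<open>A\<close> act on the projection, so this coordinate follows the
      whole word.\<close>
    have G2: "prj A 3 2 (wsem (EE A) ?A3 \<phi> ?h u c) = wsem (EE A) A (letter A) (\<lambda>c. sc (fam.tcounit (EE A) c) z) u c"
      if "c \<in> fam.T (EE A)" for u c
      using that
    proof (induction u arbitrary: c)
      case Nil
      have "prj A 3 2 (sc k t) = sc k z" for k
        using linear_on_scale[OF p2 t] triple(4)[OF f3(4) z z z] by (simp add: t_def del: tup.simps prj.simps)
      then show ?case by (simp del: prj.simps)
    next
      case (Cons s u)
      have "prj A 3 2 (wsem (EE A) ?A3 \<phi> ?h (s # u) c) = D.cs (\<lambda>x y. prj A 3 2 (lapp ?A3 ?A3 (\<phi> s x) (wsem (EE A) ?A3 \<phi> ?h u y))) c"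
        unfolding wsem.simps
        by (rule D.linear_on_apply_cs[OF Cons.prems vector_space space[OF f3(4)] p2 bilinear_on_in[OF lapp_bilinear[OF f3(3) \<phi>l W]]])
      also have "\<dots> = wsem (EE A) A (letter A) (\<lambda>c. sc (fam.tcounit (EE A) c) z) (s # u) c"
        unfolding wsem.simps
        by (rule D.cs_cong[OF Cons.prems]) (simp only: act(1) linear_on_in[OF W] Cons.IH)
      finally show ?case .
    qed
    have "Bsw \<Theta> (\<lambda>x y. bapp ?A3 (wordmap ?A3 (w @ [s])) (den M (elab \<Theta> [] (Bang (?R ''u''))) x) (den M (elab \<Theta> [] (Bang (?R ''v''))) y) t) c =
        wsem (EE A) ?A3 \<phi> ?h (s # rev w) c"
      using wordmap_app[OF A(1) Rs t, of c "w @ [s]"] c unfolding \<phi>_def m by (simp only: rev_append rev.simps append.simps)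
    then have "prj A 3 0 (Bsw \<Theta> (\<lambda>x y. bapp ?A3 (wordmap ?A3 (w @ [s])) (den M (elab \<Theta> [] (Bang (?R ''u''))) x) (den M (elab \<Theta> [] (Bang (?R ''v''))) y) t) c) =
        prj A 3 0 (wsem (EE A) ?A3 \<phi> ?h (s # rev w) c)" by (rule arg_cong)
    also have "\<dots> = D.cs (\<lambda>x y. prj A 3 0 (lapp ?A3 ?A3 (\<phi> s x) (wsem (EE A) ?A3 \<phi> ?h (rev w) y))) c"
      unfolding wsem.simps
      by (rule D.linear_on_apply_cs[OF c vector_space space[OF f3(4)] p0 bilinear_on_in[OF lapp_bilinear[OF f3(3) \<phi>l W]]])
    \<comment> \<open>The outermost factor is the last letter \<open>s\<close>. In coordinate 0 it
      contributes only a counit, and what is left is coordinate 2 for \<open>w\<close>.\<close>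
    also have "\<dots> = D.cs (\<lambda>x y. sc (fam.tcounit (EE A) x) (prj A 3 2 (wsem (EE A) ?A3 \<phi> ?h (rev w) y))) c"
      by (rule D.cs_cong[OF c]) (simp only: act(2) linear_on_in[OF W])
    also have "\<dots> = prj A 3 2 (wsem (EE A) ?A3 \<phi> ?h (rev w) c)"
      by (rule D.counit(1)[OF linear_on_compose[OF W p2] c])
    also have "\<dots> = wsem (EE A) A (letter A) (\<lambda>c. sc (fam.tcounit (EE A) c) z) (rev w) c" by (rule G2[OF c])
    finally show "prj A 3 0 (Bsw \<Theta> (\<lambda>x y. bapp ?A3 ((?\<rho>(''a'' := z)) ''b'') (den M (elab \<Theta> [] (Bang (?R ''u''))) x) (den M (elab \<Theta> [] (Bang (?R ''v''))) y)
        (tup A [(?\<rho>(''a'' := z)) ''a'', (?\<rho>(''a'' := z)) ''a'', (?\<rho>(''a'' := z)) ''a''])) c) =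
      wsem (EE A) A (letter A) (\<lambda>c. sc (fam.tcounit (EE A) c) z) (rev w) c"
      unfolding t_def by (simp del: elab.simps tuple.simps proj.simps tup.simps prj.simps wsem.simps)
  qed
  then show "den M (tail A) (pure [wordmap (pow A 3) (w @ [s])]) = wordmap A w" by simp
qed

section \<open>Recombination\<close>

abbreviation recomb_hyps :: "'a formula \<Rightarrow> (string \<times> 'a formula) list"
  where "recomb_hyps A \<equiv> [(''S'', bint A), (''tau'', nbool 2 A), (''sigma'', nbool 2 A), (''d'', nbool 2 A)]"

text \<open>The meaning of \<open>after w\<close> for an arbitrary value of \<open>S\<close>; the
  promotions of \<open>u0\<close> and \<open>u1\<close> stay unevaluated until \<open>S\<close> is
  known to be a word.\<close>

definition after_sem :: "'a formula \<Rightarrow> nat list \<Rightarrow> ('k, 'v) tensor \<Rightarrow> (string \<Rightarrow> 'v) \<Rightarrow> 'v"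
  where "after_sem A w c \<rho> = wsem (EE A) A (letter A) (\<lambda>c. Bsw (ee A) (\<lambda>x y. bapp A (\<rho> ''S'')
    (den M (elab (ee A) [] (Bang (word_var 0))) x) (den M (elab (ee A) [] (Bang (word_var 1))) y) (\<rho> ''a'')) c) (rev w) c"

lemma tsem_after:
  assumes A: "bint A \<in> F"
  shows "tsem (ee A) [(''a'', A), (''S'', bint A)] (after w) A (after_sem A w)"
proof -
  note fs = bint_formulas[OF A]
  have b: "bangs (ee A)" using fs(1) by (simp add: bangs_def ee_def)
  have "tsem (ee A) [(''a'', A), (''S'', bint A)] (App (App (App (Var ''S'') (Bang (word_var 0))) (Bang (word_var 1))) (Var ''a'')) A
    (\<lambda>c \<rho>. Bsw (ee A) (\<lambda>x y. bapp A (\<rho> ''S'') (den M (elab (ee A) [] (Bang (word_var 0))) x) (den M (elab (ee A) [] (Bang (word_var 1))) y) (\<rho> ''a'')) c)"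
    using csem_Var[OF b fs(4), of "''a''"]
    by (intro tsem_bint_app[OF A letter_sound(1)[OF fs(1)] letter_sound(1)[OF fs(1)]]) (simp_all add: word_var_def)
  from tsem_word[OF fs(1) this] show ?thesis unfolding after_def after_sem_def .
qed

text \<open>By \<open>wordmap_app\<close>, feeding the promotions of \<open>u0\<close> and
  \<open>u1\<close> to a word replaces its letters by the denotations of \<open>u0\<close> and
  \<open>u1\<close>, which are the letters again. The word \<open>w\<close> then prolongs the
  convolution product, so the result belongs to \<open>S @ w\<close>.\<close>

lemma after_sem_wordmap:
  assumes A: "bint A \<in> F" and S: "\<rho> ''S'' = wordmap A S" and a: "\<rho> ''a'' \<in> sp A" and c: "c \<in> fam.T (EE A)"
  shows "after_sem A w c \<rho> = wsem (EE A) A (letter A) (\<lambda>c. sc (fam.tcounit (EE A) c) (\<rho> ''a'')) (rev (S @ w)) c"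
proof -
  note fs = bint_formulas[OF A]
  have EEb: "set (EE A) \<subseteq> banged" using fs(1) by simp
  have l: "den M (elab (ee A) [] (if s = 0 then word_var 0 else word_var 1)) = letter A s" for s
    using letter_if[of A s] by (simp add: letter_def)
  have "Bsw (ee A) (\<lambda>x y. bapp A (\<rho> ''S'') (den M (elab (ee A) [] (Bang (word_var 0))) x)
      (den M (elab (ee A) [] (Bang (word_var 1))) y) (\<rho> ''a'')) c =
    wsem (EE A) A (letter A) (\<lambda>c. sc (fam.tcounit (EE A) c) (\<rho> ''a'')) (rev S) c" if "c \<in> fam.T (EE A)" for c
    using wordmap_app[OF A letter_sound(1)[OF fs(1), of 0] letter_sound(1)[OF fs(1), of 1] a, of c S] that
    unfolding l S map_snd_ee .
  then show ?thesis
    unfolding after_sem_def rev_append wsem_append by (intro wsem_cong[OF EEb _ _ c]) auto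
qed

definition choice_sem ::
  "'a formula \<Rightarrow> nat list \<Rightarrow> nat list \<Rightarrow> nat list \<Rightarrow> nat list \<Rightarrow> ('k, 'v) tensor \<Rightarrow> (string \<Rightarrow> 'v) \<Rightarrow> 'v"
  where "choice_sem A w w' v v' c \<rho> = lapp (pow A 2) A (\<rho> ''tau'') (wpair A A
    (lapp (pow A 2) A (\<rho> ''sigma'') (wpair A A (after_sem A w c \<rho>) (after_sem A w' c \<rho>)))
    (lapp (pow A 2) A (\<rho> ''sigma'') (wpair A A (after_sem A v c \<rho>) (after_sem A v' c \<rho>))))"

lemma tsem_choice:
  assumes A: "bint A \<in> F" "nbool 2 A \<in> F"
  shows "tsem (ee A) [(''a'', A), (''S'', bint A), (''tau'', nbool 2 A), (''sigma'', nbool 2 A)] (choice w w' v v') A (choice_sem A w w' v v')"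
proof -
  have b: "bangs (ee A)" using bint_formulas(1)[OF A(1)] by (simp add: bangs_def ee_def)
  have W: "With A A \<in> F" using nbool_formulas(2)[OF A(2)] by (simp add: pow_2)
  have inner: "tsem (ee A) [(''a'', A), (''S'', bint A), (''sigma'', nbool 2 A)] (App (Var ''sigma'') (Tup (after w) (after w'))) A
    (\<lambda>c \<rho>. lapp (pow A 2) A (\<rho> ''sigma'') (wpair A A (after_sem A w c \<rho>) (after_sem A w' c \<rho>)))" for w w'
    using csem_Var[OF b A(2), of "''sigma''"] tsem_Tup[OF tsem_after[OF A(1)] tsem_after[OF A(1)] W]
    by (intro tsem_App_left) (simp_all add: nbool_def pow_2)
  show ?thesis
    unfolding choice_def choice_sem_def
    using csem_Var[OF b A(2), of "''tau''"] tsem_Tup[OF inner inner W]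
    by (intro tsem_App_left) (simp_all add: nbool_def pow_2)
qed

text \<open>The nested list is the decision tree of the term: \<open>d\<close> chooses between the
  two halves, \<tau> between the pairs of a half and \<sigma> between the words of a pair. Keeping
  the eight words as parameters covers both recombination proofs.\<close>

lemma recomb_value:
  fixes p0 p1 p2 p3 p4 p5 p6 p7 :: "nat list"
  assumes A: "bint A \<in> F" "nbool 2 A \<in> F"
  defines "r \<equiv> recomb_frame A (choice p0 p1 p2 p3) (choice p4 p5 p6 p7)"
  shows "sound r" and "\<tau> \<in> {0, 1} \<Longrightarrow> \<sigma> \<in> {0, 1} \<Longrightarrow> d \<in> {0, 1} \<Longrightarrow>
    den M r (pure [wordmap A S, nb 2 A \<tau>, nb 2 A \<sigma>, nb 2 A d]) =
    wordmap A (S @ [[[p0, p1], [p2, p3]], [[p4, p5], [p6, p7]]] ! d ! \<tau> ! \<sigma>)"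
proof -
  note f1 = bint_formulas[OF A(1)]
  have b: "bangs (ee A)" using f1(1) by (simp add: bangs_def ee_def)
  have W: "With A A \<in> F" using nbool_formulas(2)[OF A(2)] by (simp add: pow_2)
  have t: "tsem (ee A) ((''a'', A) # recomb_hyps A) (App (Var ''d'') (Tup (choice p0 p1 p2 p3) (choice p4 p5 p6 p7))) A
    (\<lambda>c \<rho>. lapp (pow A 2) A (\<rho> ''d'') (wpair A A (choice_sem A p0 p1 p2 p3 c \<rho>) (choice_sem A p4 p5 p6 p7 c \<rho>)))"
    using csem_Var[OF b A(2), of "''d''"] tsem_Tup[OF tsem_choice[OF A] tsem_choice[OF A] W]
    by (intro tsem_App_left) (simp_all add: nbool_def pow_2)
  have na: "''a'' \<notin> fst ` set (recomb_hyps A)" by simp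
  note c = csem_bint(1)[OF t[unfolded ee_def] A(1) na, folded recomb_frame_def, folded r_def]
  have el: "r = elab [] (recomb_hyps A) (LamB ''u0'' (A \<multimap> A) (LamB ''u1'' (A \<multimap> A) (Lam ''a'' A
      (App (Var ''d'') (Tup (choice p0 p1 p2 p3) (choice p4 p5 p6 p7))))))"
    unfolding r_def recomb_frame_def ..
  show "sound r" unfolding el by (rule sound_typedD(4)[OF tsemD(1)[OF csemD(1)[OF c]]])
  assume \<tau>: "\<tau> \<in> {0, 1}" and \<sigma>: "\<sigma> \<in> {0, 1}" and d: "d \<in> {0, 1}"
  let ?\<rho> = "(\<lambda>_::string. nb 2 A d)(''S'' := wordmap A S, ''tau'' := nb 2 A \<tau>, ''sigma'' := nb 2 A \<sigma>)"
  have "i < 2" if "i \<in> {0, 1}" for i :: nat using that by auto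
  then have \<rho>: "admissible (recomb_hyps A) ?\<rho>"
    using bint_val(2)[OF A(1)] nbool_val(2)[OF A(2)] \<tau> \<sigma> d unfolding admissible_def by simp
  have "den M r (pure (vals (recomb_hyps A) ?\<rho>)) =
    wordmap A (S @ [[[p0, p1], [p2, p3]], [[p4, p5], [p6, p7]]] ! d ! \<tau> ! \<sigma>)"
    unfolding el csem_Nil_den[OF c \<rho>] wordmap_def[of A "S @ [[[p0, p1], [p2, p3]], [[p4, p5], [p6, p7]]] ! d ! \<tau> ! \<sigma>"]
  proof (rule mkbint_cong)
    fix c z assume c: "c \<in> fam.T (EE A)" and z: "z \<in> sp A"
    interpret D: coalgebra tscale "fam.T (EE A)" "fam.tcomult (EE A)" "fam.tcounit (EE A)"
      using coalgebra_BT[OF b] unfolding map_snd_ee .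
    have EEb: "set (EE A) \<subseteq> banged" using f1(1) by simp
    let ?\<rho>z = "?\<rho>(''a'' := z)"
    let ?W = "\<lambda>w. wsem (EE A) A (letter A) (\<lambda>c. sc (fam.tcounit (EE A) c) z) (rev (S @ w)) c"
    have Wm: "?W w \<in> sp A" for w
      by (rule linear_on_in[OF wsem_linear[OF EEb f1(3) letter_sound(2)[OF f1(1)] linear_on_scale_left[OF vector_space space[OF f1(4)] D.\<epsilon> z]] c])
    have af: "after_sem A w c ?\<rho>z = ?W w" for w
      using after_sem_wordmap[OF A(1), of ?\<rho>z S c w] z c by simp
    have ch: "choice_sem A p0 p1 p2 p3 c ?\<rho>z = ?W ([[p0, p1], [p2, p3]] ! \<tau> ! \<sigma>)" for p0 p1 p2 p3
      unfolding choice_sem_def af using \<tau> \<sigma> Wm nb_pair[OF A(2) \<tau>] nb_pair[OF A(2) \<sigma>] by auto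
    show "lapp (pow A 2) A (?\<rho>z ''d'') (wpair A A (choice_sem A p0 p1 p2 p3 c ?\<rho>z) (choice_sem A p4 p5 p6 p7 c ?\<rho>z)) =
      ?W ([[[p0, p1], [p2, p3]], [[p4, p5], [p6, p7]]] ! d ! \<tau> ! \<sigma>)"
      unfolding ch using d Wm nb_pair[OF A(2) d] by auto
  qed
  then show "den M r (pure [wordmap A S, nb 2 A \<tau>, nb 2 A \<sigma>, nb 2 A d]) =
    wordmap A (S @ [[[p0, p1], [p2, p3]], [[p4, p5], [p6, p7]]] ! d ! \<tau> ! \<sigma>)" by simp
qed

end

section \<open>The transition proofs\<close>

lemma linear_on_apply_sum:
  assumes "vector_space s" "module.subspace s V" "linear_on s s' V W f" "\<And>i. i \<in> I \<Longrightarrow> v i \<in> V"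
  shows "f (\<Sum>i\<in>I. s (a i) (v i)) = (\<Sum>i\<in>I. s' (a i) (f (v i)))"
proof -
  have "(\<Sum>i\<in>I. s (a i) (v i)) \<in> V \<and> f (\<Sum>i\<in>I. s (a i) (v i)) = (\<Sum>i\<in>I. s' (a i) (f (v i)))"
    using assms(4)
  proof (induction I rule: infinite_finite_induct)
    case (insert i I)
    then have "s (a i) (v i) \<in> V" by (auto intro: subspace_smult[OF assms(1,2)])
    with insert show ?case
      by (auto simp: linear_on_add[OF assms(3)] linear_on_scale[OF assms(3)] intro: subspace_plus[OF assms(1,2)])
  qed (simp_all add: subspace_zero[OF assms(1,2)] linear_on_zero[OF assms(3)])
  then show ?thesis ..
qed

lemma sum_in:
  assumes "vector_space s" "module.subspace s V" "\<And>i. i \<in> I \<Longrightarrow> v i \<in> V"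
  shows "(\<Sum>i\<in>I. s (a i) (v i)) \<in> V"
  using assms(3)
  by (induction I rule: infinite_finite_induct)
    (auto intro: subspace_zero[OF assms(1,2)] subspace_plus[OF assms(1,2)] subspace_smult[OF assms(1,2)])

context sweedler_semantics
begin

section \<open>Composition by cuts\<close>

lemma env_permute: "set js \<subseteq> {..<length \<Gamma>} \<Longrightarrow> xs \<in> env \<Gamma> \<Longrightarrow> map ((!) xs) js \<in> env (map ((!) \<Gamma>) js)"
  by (auto simp: listset_nth subset_iff)

text \<open>Both moves have the same shape, an exchange after four cuts, and differ only in the
  permutation and in \<open>r\<close>. The values \<open>y0\<close> to \<open>y5\<close> are the
  arguments in the order in which the cuts consume them.\<close>

lemma sound_chain:
  assumes v: "proves p [B] C1" "proves p' [B] C2" "proves q [B, Q] C3" "proves q' [B, Q] C4" "proves r [C1, C2, C3, C4] C"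
    and s: "sound p" "sound p'" "sound q" "sound q'" "sound r"
    and js: "distinct js" "set js = {..<6}" "map ((!) [B, B, B, B, Q, Q]) js = [B, B, B, Q, B, Q]"
    and xs: "xs \<in> env [B, B, B, B, Q, Q]" "map ((!) xs) js = [y0, y1, y2, y3, y4, y5]"
  defines "e \<equiv> Exch [B, B, B, B, Q, Q] js (Cut 0 p (Cut 1 p' (Cut 2 q (Cut 3 q' r))))"
  shows "den M e (pure xs) = den M r (pure [den M p (pure [y0]), den M p' (pure [y1]), den M q (pure [y2, y3]), den M q' (pure [y4, y5])])"
    and "den M e (pure xs) \<in> sp C"
proof -
  note v = v[unfolded proves_def]
  have y: "y0 \<in> sp B" "y1 \<in> sp B" "y2 \<in> sp B" "y3 \<in> sp Q" "y4 \<in> sp B" "y5 \<in> sp Q"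
  proof -
    have "map ((!) xs) js \<in> env (map ((!) [B, B, B, B, Q, Q]) js)"
      by (rule env_permute[OF _ xs(1)]) (simp add: js(2))
    then have "[y0, y1, y2, y3, y4, y5] \<in> env [B, B, B, Q, B, Q]" unfolding xs(2) js(3) .
    then show "y0 \<in> sp B" "y1 \<in> sp B" "y2 \<in> sp B" "y3 \<in> sp Q" "y4 \<in> sp B" "y5 \<in> sp Q" by (simp_all add: set_Cons_def)
  qed
  have d: "den M p (pure [y0]) \<in> sp C1" "den M p' (pure [y1]) \<in> sp C2" "den M q (pure [y2, y3]) \<in> sp C3" "den M q' (pure [y4, y5]) \<in> sp C4"
    using y v multilinear_on_in[OF soundD(4)[OF s(1)], of "[y0]"] multilinear_on_in[OF soundD(4)[OF s(2)], of "[y1]"]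
      multilinear_on_in[OF soundD(4)[OF s(3)], of "[y2, y3]"] multilinear_on_in[OF soundD(4)[OF s(4)], of "[y4, y5]"]
    by (auto simp: set_Cons_def)
  define r3 where "r3 = Cut 3 q' r"
  define r2 where "r2 = Cut 2 q r3"
  define r1 where "r1 = Cut 1 p' r2"
  define r0 where "r0 = Cut 0 p r1"
  have h: "hyps r3 = [C1, C2, C3, B, Q]" "hyps r2 = [C1, C2, B, Q, B, Q]" "hyps r1 = [C1, B, B, Q, B, Q]" "hyps r0 = [B, B, B, Q, B, Q]"
    "concl r3 = C" "concl r2 = C" "concl r1 = C" "concl r0 = C"
    using v by (simp_all add: r3_def r2_def r1_def r0_def)
  note c3 = sound_Cut[OF s(4,5), of "[C1, C2, C3]" "[]" 3, folded r3_def]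
  have s3: "sound r3" using v by (intro c3) simp_all
  note c2 = sound_Cut[OF s(3) s3, of "[C1, C2]" "[B, Q]" 2, folded r2_def]
  have s2: "sound r2" using v h by (intro c2) simp_all
  note c1 = sound_Cut[OF s(2) s2, of "[C1]" "[B, Q, B, Q]" 1, folded r1_def]
  have s1: "sound r1" using v h by (intro c1) simp_all
  note c0 = sound_Cut[OF s(1) s1, of "[]" "[B, B, Q, B, Q]" 0, folded r0_def]
  have s0: "sound r0" using v h by (intro c0) simp_all
  have k: "set js = {..<length [B, B, B, B, Q, Q]}" "hyps r0 = map ((!) [B, B, B, B, Q, Q]) js" using js h by simp_all
  note ex = sound_Exch[OF s0 js(1) k]
  have e: "e = Exch [B, B, B, B, Q, Q] js r0" by (simp add: e_def r0_def r1_def r2_def r3_def)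
  let ?a = "den M p (pure [y0])" and ?b = "den M p' (pure [y1])" and ?c = "den M q (pure [y2, y3])" and ?d = "den M q' (pure [y4, y5])"
  have "den M e (pure xs) = den M r0 (pure ([] @ [y0] @ [y1, y2, y3, y4, y5]))"
    unfolding e ex(2)[OF xs(1)] xs(2) by simp
  also have "\<dots> = den M r1 (pure ([] @ ?a # [y1, y2, y3, y4, y5]))"
    by (rule c0(2)) (use v h y in \<open>simp_all add: set_Cons_def\<close>)
  also have "\<dots> = den M r1 (pure ([?a] @ [y1] @ [y2, y3, y4, y5]))" by simp
  also have "\<dots> = den M r2 (pure ([?a] @ ?b # [y2, y3, y4, y5]))"
    by (rule c1(2)) (use v h y d in \<open>simp_all add: set_Cons_def\<close>)
  also have "\<dots> = den M r2 (pure ([?a, ?b] @ [y2, y3] @ [y4, y5]))" by simp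
  also have "\<dots> = den M r3 (pure ([?a, ?b] @ ?c # [y4, y5]))"
    by (rule c2(2)) (use v h y d in \<open>simp_all add: set_Cons_def\<close>)
  also have "\<dots> = den M r3 (pure ([?a, ?b, ?c] @ [y4, y5] @ []))" by simp
  also have "\<dots> = den M r (pure ([?a, ?b, ?c] @ ?d # []))"
    by (rule c3(2)) (use v y d in \<open>simp_all add: set_Cons_def\<close>)
  finally show "den M e (pure xs) = den M r (pure [?a, ?b, ?c, ?d])" by simp
  show "den M e (pure xs) \<in> sp C"
    using multilinear_on_in[OF soundD(4)[OF ex(1)], of xs] xs(1) h(8) by (simp add: e)
qed

lemma step_value:
  assumes n: "n \<ge> 1" and \<delta>: "is_transition n \<delta>" and i: "i \<le> 2"
    and A: "bint (pow A 3) \<in> F" "nbool n (pow A 3) \<in> F" "nbool n A \<in> F" "nbool 2 A \<in> F"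
  shows "sound (step_proof i n \<delta> A)"
    and "s \<in> {0, 1} \<Longrightarrow> j < n \<Longrightarrow> den M (step_proof i n \<delta> A) (pure [wordmap (pow A 3) (w @ [s]), nb n (pow A 3) j]) =
      nb (if i = 1 then n else 2) A (delta_comp \<delta> i (s, j))"
proof -
  have t: "hyps (trans_proof i n \<delta> A) = [nbool 2 A] @ concl (booltype n A) # []"
    using trans_valid[OF n \<delta> i, of A] booltype_valid[OF n, of A] by simp
  define c where "c = Cut 1 (booltype n A) (trans_proof i n \<delta> A)"
  note bt = booltype_value[OF n A(2,3)] and tr = trans_value[OF n \<delta> i A(4,3)] and hd = head_value[OF A(1,4)]
  note c1 = sound_Cut[OF bt(1) tr(1) t, of 1, folded c_def]
  have s1: "sound c" by (rule c1(1)) simp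
  have h: "hyps c = [] @ concl (head A) # [nbool n (pow A 3)]"
    using t booltype_valid[OF n, of A] head_valid[of A] by (simp add: c_def)
  note c0 = sound_Cut[OF hd(1) s1 h, of 0, folded step_proof_def[unfolded c_def[symmetric]] c_def]
  show "sound (step_proof i n \<delta> A)" unfolding step_proof_def c_def[symmetric] by (rule c0(1)) simp
  assume s: "s \<in> {0, 1}" and j: "j < n"
  let ?x = "wordmap (pow A 3) (w @ [s])" and ?y = "nb n (pow A 3) j"
  have s2: "s < 2" using s by auto
  have m: "?x \<in> sp (bint (pow A 3))" "?y \<in> sp (nbool n (pow A 3))" "nb 2 A s \<in> sp (nbool 2 A)"
    by (rule bint_val(2)[OF A(1)] nbool_val(2)[OF A(2) j] nbool_val(2)[OF A(4) s2])+
  have hb: "hyps (booltype n A) = [nbool n (pow A 3)]" "hyps (head A) = [bint (pow A 3)]"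
    using booltype_valid[OF n, of A] head_valid[of A] by simp_all
  have "den M (step_proof i n \<delta> A) (pure ([] @ [?x] @ [?y])) = den M c (pure ([] @ den M (head A) (pure [?x]) # [?y]))"
    unfolding step_proof_def c_def[symmetric] by (rule c0(2)) (simp_all add: hb m set_Cons_def)
  also have "\<dots> = den M c (pure ([nb 2 A s] @ [?y] @ []))" by (simp add: hd(2)[OF s])
  also have "\<dots> = den M (trans_proof i n \<delta> A) (pure ([nb 2 A s] @ den M (booltype n A) (pure [?y]) # []))"
    by (rule c1(2)) (simp_all add: hb m set_Cons_def)
  also have "\<dots> = nb (if i = 1 then n else 2) A (delta_comp \<delta> i (s, j))"
    by (simp add: bt(2)[OF j] tr(2)[OF s j])
  finally show "den M (step_proof i n \<delta> A) (pure [?x, ?y]) = nb (if i = 1 then n else 2) A (delta_comp \<delta> i (s, j))" by simp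
qed

section \<open>Expansion of linear combinations\<close>

lemma multilinear_on_apply_sums:
  assumes f: "multilinear_on sc sc [V, U] W f" and VU: "module.subspace sc V" "module.subspace sc U"
    and v: "\<And>i. i \<in> I \<Longrightarrow> v i \<in> V" and u: "\<And>j. j \<in> J \<Longrightarrow> u j \<in> U"
  shows "f [\<Sum>i\<in>I. sc (a i) (v i), \<Sum>j\<in>J. sc (c j) (u j)] = (\<Sum>i\<in>I. \<Sum>j\<in>J. sc (a i * c j) (f [v i, u j]))"
proof -
  interpret vector_space sc by (rule vector_space)
  have "f [\<Sum>i\<in>I. sc (a i) (v i), \<Sum>j\<in>J. sc (c j) (u j)] = (\<Sum>i\<in>I. sc (a i) (f [v i, \<Sum>j\<in>J. sc (c j) (u j)]))"
  proof (rule linear_on_apply_sum[OF vector_space VU(1) _ v, of sc W "\<lambda>x. f [x, _]"])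
    have "(\<Sum>j\<in>J. sc (c j) (u j)) \<in> U" by (rule sum_in[OF vector_space VU(2) u])
    then show "linear_on sc sc V W (\<lambda>x. f [x, \<Sum>j\<in>J. sc (c j) (u j)])"
      using f by (simp add: set_Cons_def)
  qed
  also have "\<dots> = (\<Sum>i\<in>I. sc (a i) (\<Sum>j\<in>J. sc (c j) (f [v i, u j])))"
    using f v by (intro sum.cong refl arg_cong[of _ _ "sc _"] linear_on_apply_sum[OF vector_space VU(2) _ u, of sc W "\<lambda>x. f [_, x]"]) auto
  finally show ?thesis by (simp add: scale_sum_right)
qed

text \<open>Here \<open>e\<close> is the direction in which the word is kept, and
  \<open>1 - e\<close>, the other bit, the one in which \<open>g \<tau> \<sigma>\<close> is
  appended. The direction slot is expanded over \<open>J\<close> and \<open>L\<close> on its own; it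
  supplies only the two scalars that depend on \<delta>.\<close>

lemma recomb_sum:
  assumes r: "multilinear_on sc sc [sp (bint A), sp (nbool 2 A), sp (nbool 2 A), sp (nbool 2 A)] W f"
    and A: "bint A \<in> F" "nbool 2 A \<in> F" and e: "e \<in> {0, 1}"
    and keep: "\<And>U \<tau> \<sigma>. \<tau> \<in> {0, 1} \<Longrightarrow> \<sigma> \<in> {0, 1} \<Longrightarrow> f [wordmap A U, nb 2 A \<tau>, nb 2 A \<sigma>, nb 2 A e] = wordmap A U"
    and add: "\<And>U \<tau> \<sigma>. \<tau> \<in> {0, 1} \<Longrightarrow> \<sigma> \<in> {0, 1} \<Longrightarrow> f [wordmap A U, nb 2 A \<tau>, nb 2 A \<sigma>, nb 2 A (1 - e)] = wordmap A (U @ g \<tau> \<sigma>)"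
    and \<tau>: "\<And>k. k \<in> K \<Longrightarrow> \<tau> k \<in> {0, 1}"
    and \<sigma>: "\<And>j l. j \<in> J \<Longrightarrow> l \<in> L \<Longrightarrow> \<sigma> j l \<in> {0, 1}" and d: "\<And>j l. j \<in> J \<Longrightarrow> l \<in> L \<Longrightarrow> d j l \<in> {0, 1}"
  shows "f [\<Sum>i\<in>I. sc (x i) (wordmap A (U i)), \<Sum>k\<in>K. sc (b k) (nb 2 A (\<tau> k)),
      \<Sum>j\<in>J. \<Sum>l\<in>L. sc (a j * c l) (nb 2 A (\<sigma> j l)), \<Sum>j\<in>J. \<Sum>l\<in>L. sc (a j * c l) (nb 2 A (d j l))] =
    sc ((\<Sum>j\<in>J. \<Sum>l\<in>L. a j * c l * of_bool (d j l = e)) * (\<Sum>j\<in>J. a j) * (\<Sum>k\<in>K. b k) * (\<Sum>l\<in>L. c l))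
      (\<Sum>i\<in>I. sc (x i) (wordmap A (U i))) +
    sc (\<Sum>j\<in>J. \<Sum>l\<in>L. a j * c l * of_bool (d j l = 1 - e))
      (\<Sum>i\<in>I. \<Sum>j\<in>J. \<Sum>k\<in>K. \<Sum>l\<in>L. sc (x i * a j * b k * c l) (wordmap A (U i @ g (\<tau> k) (\<sigma> j l))))"
proof -
  interpret vector_space sc by (rule vector_space)
  note VB = space[OF A(1)] and VN = space[OF A(2)]
  have nbm: "nb 2 A i \<in> sp (nbool 2 A)" if "i \<in> {0, 1}" for i using that by (intro nbool_val(2)[OF A(2)]) auto
  note wm = bint_val(2)[OF A(1)]
  define X where "X = (\<Sum>i\<in>I. sc (x i) (wordmap A (U i)))"
  define Y where "Y = (\<Sum>k\<in>K. sc (b k) (nb 2 A (\<tau> k)))"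
  define Z where "Z = (\<Sum>j\<in>J. \<Sum>l\<in>L. sc (a j * c l) (nb 2 A (\<sigma> j l)))"
  have Xm: "X \<in> sp (bint A)" unfolding X_def by (rule sum_in[OF vector_space VB]) (rule wm)
  have Ym: "Y \<in> sp (nbool 2 A)" unfolding Y_def by (rule sum_in[OF vector_space VN]) (intro nbm \<tau>)
  have Zeq: "Z = (\<Sum>j\<in>J. sc (a j) (\<Sum>l\<in>L. sc (c l) (nb 2 A (\<sigma> j l))))" by (simp add: Z_def scale_sum_right)
  have Zj: "(\<Sum>l\<in>L. sc (c l) (nb 2 A (\<sigma> j l))) \<in> sp (nbool 2 A)" if "j \<in> J" for j
    using that by (intro sum_in[OF vector_space VN] nbm \<sigma>)
  have Zm: "Z \<in> sp (nbool 2 A)" unfolding Zeq by (rule sum_in[OF vector_space VN Zj])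
  have l1: "linear_on sc sc (sp (bint A)) W (\<lambda>v. f [v, y, z, w])"
    and l2: "v \<in> sp (bint A) \<Longrightarrow> linear_on sc sc (sp (nbool 2 A)) W (\<lambda>y. f [v, y, z, w])"
    and l3: "v \<in> sp (bint A) \<Longrightarrow> linear_on sc sc (sp (nbool 2 A)) W (\<lambda>z. f [v, y, z, w])"
    and l4: "v \<in> sp (bint A) \<Longrightarrow> linear_on sc sc (sp (nbool 2 A)) W (\<lambda>w. f [v, y, z, w])"
    if "y \<in> sp (nbool 2 A)" "z \<in> sp (nbool 2 A)" "w \<in> sp (nbool 2 A)" for v y z w
    using r that by (simp_all add: set_Cons_def)
  \<comment> \<open>The words are expanded over \<open>i\<close>, \<open>j\<close>,
    \<open>k\<close>, \<open>l\<close> in the order of the final formula. As \<sigma> depends on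
    both \<open>j\<close> and \<open>l\<close>, its sum over \<open>j\<close> is opened before the
    one over \<open>k\<close>, and its sum over \<open>l\<close> afterwards.\<close>
  have expand: "f [X, Y, Z, w] = (\<Sum>i\<in>I. \<Sum>j\<in>J. \<Sum>k\<in>K. \<Sum>l\<in>L. sc (x i * a j * b k * c l) (f [wordmap A (U i), nb 2 A (\<tau> k), nb 2 A (\<sigma> j l), w]))"
    if w: "w \<in> sp (nbool 2 A)" for w
  proof -
    have "f [X, Y, Z, w] = (\<Sum>i\<in>I. sc (x i) (f [wordmap A (U i), Y, Z, w]))"
      unfolding X_def by (rule linear_on_apply_sum[OF vector_space VB l1[OF Ym Zm w] wm])
    also have "\<dots> = (\<Sum>i\<in>I. sc (x i) (\<Sum>j\<in>J. sc (a j) (f [wordmap A (U i), Y, \<Sum>l\<in>L. sc (c l) (nb 2 A (\<sigma> j l)), w])))"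
      unfolding Zeq
      by (intro sum.cong refl arg_cong[of _ _ "sc _"] linear_on_apply_sum[OF vector_space VN l3[OF Ym Ym w wm] Zj])
    also have "\<dots> = (\<Sum>i\<in>I. sc (x i) (\<Sum>j\<in>J. sc (a j) (\<Sum>k\<in>K. sc (b k) (f [wordmap A (U i), nb 2 A (\<tau> k), \<Sum>l\<in>L. sc (c l) (nb 2 A (\<sigma> j l)), w]))))"
      unfolding Y_def
      by (intro sum.cong refl arg_cong[of _ _ "sc _"] linear_on_apply_sum[OF vector_space VN l2[OF Ym Zj w wm]] nbm \<tau>)
    also have "\<dots> = (\<Sum>i\<in>I. sc (x i) (\<Sum>j\<in>J. sc (a j) (\<Sum>k\<in>K. sc (b k) (\<Sum>l\<in>L. sc (c l) (f [wordmap A (U i), nb 2 A (\<tau> k), nb 2 A (\<sigma> j l), w])))))"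
      by (intro sum.cong refl arg_cong[of _ _ "sc _"] linear_on_apply_sum[OF vector_space VN l3[OF nbm Ym w wm]] nbm \<tau> \<sigma>)
    finally show ?thesis by (simp add: scale_sum_right mult.assoc)
  qed
  define Pe where "Pe = (\<Sum>j\<in>J. \<Sum>l\<in>L. a j * c l * of_bool (d j l = e))"
  define Pf where "Pf = (\<Sum>j\<in>J. \<Sum>l\<in>L. a j * c l * of_bool (d j l = 1 - e))"
  \<comment> \<open>A direction bit is either \<open>e\<close> or \<open>1 - e\<close>, so the whole
    direction slot collapses to a combination of two booleans.\<close>
  have "nb 2 A (d j l) = sc (of_bool (d j l = e)) (nb 2 A e) + sc (of_bool (d j l = 1 - e)) (nb 2 A (1 - e))"
    if "j \<in> J" "l \<in> L" for j l
    using d[OF that] e by auto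
  then have "(\<Sum>j\<in>J. \<Sum>l\<in>L. sc (a j * c l) (nb 2 A (d j l))) = (\<Sum>j\<in>J. \<Sum>l\<in>L. sc (a j * c l)
      (sc (of_bool (d j l = e)) (nb 2 A e) + sc (of_bool (d j l = 1 - e)) (nb 2 A (1 - e))))"
    by (intro sum.cong refl arg_cong[of _ _ "sc _"])
  also have "\<dots> = sc Pe (nb 2 A e) + sc Pf (nb 2 A (1 - e))"
    by (simp add: Pe_def Pf_def scale_right_distrib sum.distrib scale_sum_left)
  finally have D: "(\<Sum>j\<in>J. \<Sum>l\<in>L. sc (a j * c l) (nb 2 A (d j l))) = sc Pe (nb 2 A e) + sc Pf (nb 2 A (1 - e))" .
  have em: "nb 2 A e \<in> sp (nbool 2 A)" "nb 2 A (1 - e) \<in> sp (nbool 2 A)" using e by (auto intro: nbm)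
  have "f [X, Y, Z, sc Pe (nb 2 A e) + sc Pf (nb 2 A (1 - e))] = sc Pe (f [X, Y, Z, nb 2 A e]) + sc Pf (f [X, Y, Z, nb 2 A (1 - e)])"
    using linear_on_add[OF l4[OF Ym Zm em(1) Xm] subspace_smult[OF vector_space VN em(1)] subspace_smult[OF vector_space VN em(2)]]
      linear_on_scale[OF l4[OF Ym Zm em(1) Xm] em(1)] linear_on_scale[OF l4[OF Ym Zm em(1) Xm] em(2)] by simp
  moreover have "f [X, Y, Z, nb 2 A e] = sc ((\<Sum>j\<in>J. a j) * (\<Sum>k\<in>K. b k) * (\<Sum>l\<in>L. c l)) X"
  proof -
    \<comment> \<open>At \<open>e\<close> the value depends on \<open>i\<close> alone, so the sums
      over \<open>j\<close>, \<open>k\<close> and \<open>l\<close> run over coefficients only and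
      factor into three totals.\<close>
    have "f [X, Y, Z, nb 2 A e] = (\<Sum>i\<in>I. \<Sum>j\<in>J. \<Sum>k\<in>K. \<Sum>l\<in>L. sc (x i * a j * b k * c l) (wordmap A (U i)))"
      unfolding expand[OF em(1)] by (intro sum.cong refl arg_cong[of _ _ "sc _"] keep \<tau> \<sigma>)
    also have "\<dots> = (\<Sum>i\<in>I. sc (\<Sum>j\<in>J. \<Sum>k\<in>K. \<Sum>l\<in>L. x i * a j * b k * c l) (wordmap A (U i)))"
      by (simp add: scale_sum_left)
    also have "\<dots> = (\<Sum>i\<in>I. sc ((\<Sum>j\<in>J. a j) * (\<Sum>k\<in>K. b k) * (\<Sum>l\<in>L. c l)) (sc (x i) (wordmap A (U i))))"
      by (simp add: sum_distrib_left sum_distrib_right mult_ac)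
    finally show ?thesis by (simp only: X_def scale_sum_right)
  qed
  moreover have "f [X, Y, Z, nb 2 A (1 - e)] =
      (\<Sum>i\<in>I. \<Sum>j\<in>J. \<Sum>k\<in>K. \<Sum>l\<in>L. sc (x i * a j * b k * c l) (wordmap A (U i @ g (\<tau> k) (\<sigma> j l))))"
    unfolding expand[OF em(2)] by (intro sum.cong refl arg_cong[of _ _ "sc _"] add \<tau> \<sigma>)
  ultimately show ?thesis
    unfolding D X_def[symmetric] Y_def[symmetric] Z_def[symmetric] Pe_def[symmetric] Pf_def[symmetric]
    by (simp add: mult.assoc)
qed

lemma step_sum:
  assumes n: "n \<ge> 1" and \<delta>: "is_transition n \<delta>" and i: "i \<le> 2"
    and A: "bint (pow A 3) \<in> F" "nbool n (pow A 3) \<in> F" "nbool n A \<in> F" "nbool 2 A \<in> F"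
    and \<sigma>: "\<And>j. j \<in> J \<Longrightarrow> \<sigma> j \<in> {0, 1}" and q: "\<And>l. l \<in> L \<Longrightarrow> q l < n"
  shows "den M (step_proof i n \<delta> A) (pure [\<Sum>j\<in>J. sc (a j) (wordmap (pow A 3) (S j @ [\<sigma> j])), \<Sum>l\<in>L. sc (c l) (nb n (pow A 3) (q l))]) =
    (\<Sum>j\<in>J. \<Sum>l\<in>L. sc (a j * c l) (nb (if i = 1 then n else 2) A (delta_comp \<delta> i (\<sigma> j, q l))))"
proof -
  note v = step_value[OF n \<delta> i A]
  have p: "hyps (step_proof i n \<delta> A) = [bint (pow A 3), nbool n (pow A 3)]"
    using step_valid[OF n \<delta> i, of A] by (simp add: proves_def)
  have m: "multilinear_on sc sc [sp (bint (pow A 3)), sp (nbool n (pow A 3))] (sp (concl (step_proof i n \<delta> A)))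
      (\<lambda>xs. den M (step_proof i n \<delta> A) (pure xs))"
    using soundD(4)[OF v(1)] unfolding p by simp
  have nm: "l \<in> L \<Longrightarrow> nb n (pow A 3) (q l) \<in> sp (nbool n (pow A 3))" for l
    by (rule nbool_val(2)[OF A(2) q])
  show ?thesis
    by (rule trans[OF multilinear_on_apply_sums[OF m space[OF A(1)] space[OF A(2)] bint_val(2)[OF A(1)] nm]])
      (simp_all only: v(2) \<sigma> q cong: sum.cong)
qed

lemma delta_comp_range:
  assumes "is_transition n \<delta>" "s \<in> {0, 1}" "j < n"
  shows "delta_comp \<delta> 0 (s, j) \<in> {0, 1}" "delta_comp \<delta> 1 (s, j) < n" "delta_comp \<delta> 2 (s, j) \<in> {0, 1}"
proof -
  have "\<delta> (s, j) \<in> {0, 1} \<times> {..<n} \<times> {0, 1}" using assms unfolding is_transition_def by auto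
  then show "delta_comp \<delta> 0 (s, j) \<in> {0, 1}" "delta_comp \<delta> 1 (s, j) < n" "delta_comp \<delta> 2 (s, j) \<in> {0, 1}"
    by (auto simp: delta_comp_def split: prod.splits)
qed

text \<open>Common evaluation of the left and the right move. \<open>X\<close> is the combination
  whose words lose their last symbol, \<alpha> for the left and \<beta> for the right move; \<alpha>
  and \<gamma> occur twice after it, for the new symbol and for the direction.\<close>

lemma move_value:
  fixes p0 p1 p2 p3 p4 p5 p6 p7 :: "nat list"
  assumes n: "n \<ge> 1" and \<delta>: "is_transition n \<delta>"
    and A: "bint (pow A 3) \<in> F" "nbool n (pow A 3) \<in> F" "bint A \<in> F" "nbool n A \<in> F" "nbool 2 A \<in> F"
    and \<sigma>: "\<And>j. j \<in> J \<Longrightarrow> \<sigma> j \<in> {0, 1}" and \<tau>: "\<And>k. k \<in> K \<Longrightarrow> \<tau> k \<in> {0, 1}" and q: "\<And>l. l \<in> L \<Longrightarrow> q l < n"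
    and \<alpha>: "\<alpha> = (\<Sum>j\<in>J. sc (a j) (wordmap (pow A 3) (S j @ [\<sigma> j])))"
    and \<beta>: "\<beta> = (\<Sum>k\<in>K. sc (b k) (wordmap (pow A 3) (T k @ [\<tau> k])))"
    and \<gamma>: "\<gamma> = (\<Sum>l\<in>L. sc (c l) (nb n (pow A 3) (q l)))"
    and X: "X = (\<Sum>i\<in>I. sc (x i) (wordmap (pow A 3) (U i @ [u i])))"
    and js: "distinct js" "set js = {..<6}" "map ((!) [B, B, B, B, Q, Q]) js = [B, B, B, Q, B, Q]"
    and xs: "xs \<in> env [B, B, B, B, Q, Q]" "map ((!) xs) js = [X, \<beta>, \<alpha>, \<gamma>, \<alpha>, \<gamma>]"
    and BQ: "B = bint (pow A 3)" "Q = nbool n (pow A 3)"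
    and e: "e \<in> {0, 1}"
    and table: "\<And>\<tau> \<sigma>. \<tau> \<in> {0, 1} \<Longrightarrow> \<sigma> \<in> {0, 1} \<Longrightarrow> [[[p0, p1], [p2, p3]], [[p4, p5], [p6, p7]]] ! e ! \<tau> ! \<sigma> = []"
      "\<And>\<tau> \<sigma>. \<tau> \<in> {0, 1} \<Longrightarrow> \<sigma> \<in> {0, 1} \<Longrightarrow> [[[p0, p1], [p2, p3]], [[p4, p5], [p6, p7]]] ! (1 - e) ! \<tau> ! \<sigma> = g \<tau> \<sigma>"
    and r: "r = recomb_frame A (choice p0 p1 p2 p3) (choice p4 p5 p6 p7)" "proves r [bint A, nbool 2 A, nbool 2 A, nbool 2 A] (bint A)"
  defines "m \<equiv> Exch [B, B, B, B, Q, Q] js (Cut 0 (tail A) (Cut 1 (head A) (Cut 2 (step_proof 0 n \<delta> A) (Cut 3 (step_proof 2 n \<delta> A) r))))"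
  shows "den M m (pure xs) \<in> sp (bint A)"
    and "den M m (pure xs) =
      sc ((\<Sum>j\<in>J. \<Sum>l\<in>L. a j * c l * of_bool (delta_comp \<delta> 2 (\<sigma> j, q l) = e)) * (\<Sum>j\<in>J. a j) * (\<Sum>k\<in>K. b k) * (\<Sum>l\<in>L. c l))
        (\<Sum>i\<in>I. sc (x i) (wordmap A (U i))) +
      sc (\<Sum>j\<in>J. \<Sum>l\<in>L. a j * c l * of_bool (delta_comp \<delta> 2 (\<sigma> j, q l) = 1 - e))
        (\<Sum>i\<in>I. \<Sum>j\<in>J. \<Sum>k\<in>K. \<Sum>l\<in>L. sc (x i * a j * b k * c l) (wordmap A (U i @ g (\<tau> k) (delta_comp \<delta> 0 (\<sigma> j, q l)))))"
proof -
  have i: "(0::nat) \<le> 2" "(2::nat) \<le> 2" by simp_all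
  note tl = tail_value[OF A(1,3)] and hd = head_value[OF A(1,5)] and rv = recomb_value[OF A(3,5), where ?p0.0 = p0 and ?p1.0 = p1 and ?p2.0 = p2 and ?p3.0 = p3
        and ?p4.0 = p4 and ?p5.0 = p5 and ?p6.0 = p6 and ?p7.0 = p7, folded r(1)]
  note s0 = step_value(1)[OF n \<delta> i(1) A(1,2,4,5)] and s2 = step_value(1)[OF n \<delta> i(2) A(1,2,4,5)]
  have pv: "proves (tail A) [B] (bint A)" "proves (head A) [B] (nbool 2 A)"
    "proves (step_proof 0 n \<delta> A) [B, Q] (nbool 2 A)" "proves (step_proof 2 n \<delta> A) [B, Q] (nbool 2 A)"
    unfolding BQ proves_def using tail_valid[of A] head_valid[of A] step_valid[OF n \<delta> i(1), of A] step_valid[OF n \<delta> i(2), of A]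
    by (simp_all add: proves_def)
  note ch = sound_chain[OF pv r(2) tl(1) hd(1) s0 s2 rv(1) js xs, folded m_def]
  show "den M m (pure xs) \<in> sp (bint A)" by (rule ch(2))
  have lt: "linear_on sc sc (sp B) (sp (bint A)) (\<lambda>x. den M (tail A) (pure [x]))"
    using soundD(4)[OF tl(1)] tail_valid[of A] by (simp add: BQ)
  have lh: "linear_on sc sc (sp B) (sp (nbool 2 A)) (\<lambda>x. den M (head A) (pure [x]))"
    using soundD(4)[OF hd(1)] head_valid[of A] by (simp add: BQ)
  note wm = bint_val(2)[OF A(1)]
  have X': "den M (tail A) (pure [X]) = (\<Sum>i\<in>I. sc (x i) (wordmap A (U i)))"
    unfolding X by (rule trans[OF linear_on_apply_sum[OF vector_space space[OF A(1)] lt[unfolded BQ] wm]]) (simp add: tl(2))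
  have \<beta>': "den M (head A) (pure [\<beta>]) = (\<Sum>k\<in>K. sc (b k) (nb 2 A (\<tau> k)))"
    unfolding \<beta> by (rule trans[OF linear_on_apply_sum[OF vector_space space[OF A(1)] lh[unfolded BQ] wm]]) (simp only: hd(2) \<tau> cong: sum.cong)
  have s0': "den M (step_proof 0 n \<delta> A) (pure [\<alpha>, \<gamma>]) = (\<Sum>j\<in>J. \<Sum>l\<in>L. sc (a j * c l) (nb 2 A (delta_comp \<delta> 0 (\<sigma> j, q l))))"
    unfolding \<alpha> \<gamma> by (subst step_sum[OF n \<delta> i(1) A(1,2,4,5) \<sigma> q]) simp_all
  have s2': "den M (step_proof 2 n \<delta> A) (pure [\<alpha>, \<gamma>]) = (\<Sum>j\<in>J. \<Sum>l\<in>L. sc (a j * c l) (nb 2 A (delta_comp \<delta> 2 (\<sigma> j, q l))))"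
    unfolding \<alpha> \<gamma> by (subst step_sum[OF n \<delta> i(2) A(1,2,4,5) \<sigma> q]) simp_all
  have mr: "multilinear_on sc sc [sp (bint A), sp (nbool 2 A), sp (nbool 2 A), sp (nbool 2 A)] (sp (bint A)) (\<lambda>xs. den M r (pure xs))"
    using soundD(4)[OF rv(1)] r(2) unfolding proves_def by auto
  have e': "1 - e \<in> {0, 1}" using e by auto
  show "den M m (pure xs) =
      sc ((\<Sum>j\<in>J. \<Sum>l\<in>L. a j * c l * of_bool (delta_comp \<delta> 2 (\<sigma> j, q l) = e)) * (\<Sum>j\<in>J. a j) * (\<Sum>k\<in>K. b k) * (\<Sum>l\<in>L. c l))
        (\<Sum>i\<in>I. sc (x i) (wordmap A (U i))) +
      sc (\<Sum>j\<in>J. \<Sum>l\<in>L. a j * c l * of_bool (delta_comp \<delta> 2 (\<sigma> j, q l) = 1 - e))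
        (\<Sum>i\<in>I. \<Sum>j\<in>J. \<Sum>k\<in>K. \<Sum>l\<in>L. sc (x i * a j * b k * c l) (wordmap A (U i @ g (\<tau> k) (delta_comp \<delta> 0 (\<sigma> j, q l)))))"
    unfolding ch(1) X' \<beta>' s0' s2'
  proof (rule recomb_sum[OF mr A(3,5) e])
    show "den M r (pure [wordmap A U, nb 2 A \<tau>, nb 2 A \<sigma>, nb 2 A e]) = wordmap A U" if "\<tau> \<in> {0, 1}" "\<sigma> \<in> {0, 1}" for U \<tau> \<sigma>
      unfolding rv(2)[OF that e] table(1)[OF that] by simp
    show "den M r (pure [wordmap A U, nb 2 A \<tau>, nb 2 A \<sigma>, nb 2 A (1 - e)]) = wordmap A (U @ g \<tau> \<sigma>)" if "\<tau> \<in> {0, 1}" "\<sigma> \<in> {0, 1}" for U \<tau> \<sigma>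
      unfolding rv(2)[OF that e'] table(2)[OF that] ..
  qed (rule \<tau> delta_comp_range(1)[OF \<delta> \<sigma> q] delta_comp_range(3)[OF \<delta> \<sigma> q]; assumption)+
qed

end

theorem lemma4p19:
  fixes M :: "('a, 'k::alg_closed_field, 'v::ab_group_add) semantics"
    and A :: "'a formula" and n s t r :: nat and \<delta> :: transition
    and S T :: "nat \<Rightarrow> nat list" and \<sigma> \<tau> q :: "nat \<Rightarrow> nat" and a b c :: "nat \<Rightarrow> 'k"
    and \<alpha> \<beta> \<gamma> :: 'v
  assumes "sweedler_semantics M"
    and "{bint (pow A 3), nbool n (pow A 3), bint A, nbool n A, nbool 2 A} \<subseteq> formulas M"
    and "n \<ge> 1" and "is_transition n \<delta>"
    and "\<And>i. i \<in> {1..s} \<Longrightarrow> set (S i) \<subseteq> {0, 1} \<and> \<sigma> i \<in> {0, 1}"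
    and "\<And>i. i \<in> {1..t} \<Longrightarrow> set (T i) \<subseteq> {0, 1} \<and> \<tau> i \<in> {0, 1}"
    and "\<And>i. i \<in> {1..r} \<Longrightarrow> q i < n"
    and "\<alpha> = (\<Sum>i=1..s. scale M (a i) (den_closed M (bint_val (pow A 3) (S i @ [\<sigma> i]))))"
    and "\<beta> = (\<Sum>i=1..t. scale M (b i) (den_closed M (bint_val (pow A 3) (T i @ [\<tau> i]))))"
    and "\<gamma> = (\<Sum>i=1..r. scale M (c i) (den_closed M (nbool_val n (pow A 3) (q i))))"
  shows
    "den M (left_proof n \<delta> A) (tpure (scale M) [\<alpha>, \<alpha>, \<alpha>, \<beta>, \<gamma>, \<gamma>]) \<in> space M (bint A) \<and>
     den M (left_proof n \<delta> A) (tpure (scale M) [\<alpha>, \<alpha>, \<alpha>, \<beta>, \<gamma>, \<gamma>]) =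
       scale M ((\<Sum>i=1..s. \<Sum>j=1..r. a i * c j * of_bool (delta_comp \<delta> 2 (\<sigma> i, q j) = 0)) *
                (\<Sum>i=1..s. a i) * (\<Sum>i=1..t. b i) * (\<Sum>i=1..r. c i))
         (\<Sum>i=1..s. scale M (a i) (den_closed M (bint_val A (S i)))) +
       scale M (\<Sum>i=1..s. \<Sum>j=1..r. a i * c j * of_bool (delta_comp \<delta> 2 (\<sigma> i, q j) = 1))
         (\<Sum>i=1..s. \<Sum>j=1..s. \<Sum>k=1..t. \<Sum>l=1..r. scale M (a i * a j * b k * c l)
            (den_closed M (bint_val A (S i @ [delta_comp \<delta> 0 (\<sigma> j, q l), \<tau> k]))))
   \<and>
     den M (right_proof n \<delta> A) (tpure (scale M) [\<alpha>, \<alpha>, \<beta>, \<beta>, \<gamma>, \<gamma>]) \<in> space M (bint A) \<and>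
     den M (right_proof n \<delta> A) (tpure (scale M) [\<alpha>, \<alpha>, \<beta>, \<beta>, \<gamma>, \<gamma>]) =
       scale M ((\<Sum>i=1..s. \<Sum>j=1..r. a i * c j * of_bool (delta_comp \<delta> 2 (\<sigma> i, q j) = 1)) *
                (\<Sum>i=1..s. a i) * (\<Sum>i=1..t. b i) * (\<Sum>i=1..r. c i))
         (\<Sum>i=1..t. scale M (b i) (den_closed M (bint_val A (T i)))) +
       scale M (\<Sum>i=1..s. \<Sum>j=1..r. a i * c j * of_bool (delta_comp \<delta> 2 (\<sigma> i, q j) = 0))
         (\<Sum>i=1..t. \<Sum>j=1..s. \<Sum>k=1..t. \<Sum>l=1..r. scale M (b i * a j * b k * c l)
            (den_closed M (bint_val A (T i @ [\<tau> k, delta_comp \<delta> 0 (\<sigma> j, q l)]))))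
   \<and>
     den M (state_proof n \<delta> A) (tpure (scale M) [\<alpha>, \<gamma>]) \<in> space M (nbool n A) \<and>
     den M (state_proof n \<delta> A) (tpure (scale M) [\<alpha>, \<gamma>]) =
       (\<Sum>i=1..s. \<Sum>j=1..r. scale M (a i * c j) (den_closed M (nbool_val n A (delta_comp \<delta> 1 (\<sigma> i, q j)))))"
proof -
  interpret sweedler_semantics M by fact
  interpret V: vector_space "scale M" by (rule vector_space)
  have F: "bint (pow A 3) \<in> formulas M" "nbool n (pow A 3) \<in> formulas M" "bint A \<in> formulas M"
    "nbool n A \<in> formulas M" "nbool 2 A \<in> formulas M" using assms(2) by auto
  note \<delta> = delta_comp_range[OF assms(4)]
  have \<sigma>: "\<sigma> i \<in> {0, 1}" if "i \<in> {1..s}" for i using assms(5)[OF that] by simp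
  have \<tau>: "\<tau> i \<in> {0, 1}" if "i \<in> {1..t}" for i using assms(6)[OF that] by simp
  note q = assms(7)
  have \<alpha>: "\<alpha> = (\<Sum>i=1..s. scale M (a i) (wordmap (pow A 3) (S i @ [\<sigma> i])))"
    and \<beta>: "\<beta> = (\<Sum>i=1..t. scale M (b i) (wordmap (pow A 3) (T i @ [\<tau> i])))"
    unfolding assms(8,9) bint_val(1)[OF F(1)] by simp_all
  have \<gamma>: "\<gamma> = (\<Sum>i=1..r. scale M (c i) (nb n (pow A 3) (q i)))"
    unfolding assms(10) by (rule sum.cong) (simp_all add: nbool_val(1)[OF F(2) q])
  have mem: "\<alpha> \<in> space M (bint (pow A 3))" "\<beta> \<in> space M (bint (pow A 3))" "\<gamma> \<in> space M (nbool n (pow A 3))"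
    unfolding \<alpha> \<beta> \<gamma>
    by (intro sum_in[OF vector_space] space F bint_val(2) nbool_val(2) q; simp)+
  have d: "distinct [0, 3, 1, 4, 2, 5::nat]" "distinct [3, 2, 0, 4, 1, 5::nat]"
    and s: "set [0, 3, 1, 4, 2, 5] = {..<6::nat}" "set [3, 2, 0, 4, 1, 5] = {..<6::nat}" by auto
  have m: "map ((!) [B, B, B, B, Q, Q]) [0, 3, 1, 4, 2, 5] = [B, B, B, Q, B, Q]"
    "map ((!) [B, B, B, B, Q, Q]) [3, 2, 0, 4, 1, 5] = [B, B, B, Q, B, Q]" for B Q :: "'a formula"
    by (simp_all add: numeral_eq_Suc)
  \<comment> \<open>The permuted arguments start with the words to be shortened, \<alpha> for the
    left and \<beta> for the right move.\<close>
  have xs: "map ((!) [\<alpha>, \<alpha>, \<alpha>, \<beta>, \<gamma>, \<gamma>]) [0, 3, 1, 4, 2, 5] = [\<alpha>, \<beta>, \<alpha>, \<gamma>, \<alpha>, \<gamma>]"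
    "map ((!) [\<alpha>, \<alpha>, \<beta>, \<beta>, \<gamma>, \<gamma>]) [3, 2, 0, 4, 1, 5] = [\<beta>, \<beta>, \<alpha>, \<gamma>, \<alpha>, \<gamma>]"
    by (simp_all add: numeral_eq_Suc)
  have env: "[\<alpha>, \<alpha>, \<alpha>, \<beta>, \<gamma>, \<gamma>] \<in> env [bint (pow A 3), bint (pow A 3), bint (pow A 3), bint (pow A 3), nbool n (pow A 3), nbool n (pow A 3)]"
    "[\<alpha>, \<alpha>, \<beta>, \<beta>, \<gamma>, \<gamma>] \<in> env [bint (pow A 3), bint (pow A 3), bint (pow A 3), bint (pow A 3), nbool n (pow A 3), nbool n (pow A 3)]"
    using mem by (simp_all add: set_Cons_def)
  have w: "well_typed [(''u1'', A \<multimap> A), (''u0'', A \<multimap> A)] [(''a'', A), (''S'', bint A), (''tau'', nbool 2 A), (''sigma'', nbool 2 A)] (choice w w' v v') A"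
    if "\<Union>(set ` {w, w', v, v'}) \<subseteq> {0, 1}" for w w' v v' by (rule well_typed_choice[OF that])
  have pr: "proves (recomb0 A) [bint A, nbool 2 A, nbool 2 A, nbool 2 A] (bint A)"
    "proves (recomb1 A) [bint A, nbool 2 A, nbool 2 A, nbool 2 A] (bint A)"
    unfolding proves_def recomb0_def recomb1_def by (rule recomb_valid; rule w; simp)+
  have e: "(0::nat) \<in> {0, 1}" "(1::nat) \<in> {0, 1}" by simp_all
  \<comment> \<open>Rows are indexed by \<tau> and columns by \<sigma>. On the left part the new
    symbol \<sigma> is appended before the symbol \<tau> of the other part, on the right part after
    it.\<close>
  have tl: "[[[[], []], [[], []]], [[[0, 0], [1, 0]], [[0, 1], [1, 1]]]] ! 0 ! \<tau> ! \<sigma> = ([] :: nat list)"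
    "[[[[], []], [[], []]], [[[0, 0], [1, 0]], [[0, 1], [1, 1]]]] ! (1 - 0) ! \<tau> ! \<sigma> = [\<sigma>, \<tau>]"
    and tr: "[[[[0, 0], [0, 1]], [[1, 0], [1, 1]]], [[[], []], [[], []]]] ! 1 ! \<tau> ! \<sigma> = ([] :: nat list)"
    "[[[[0, 0], [0, 1]], [[1, 0], [1, 1]]], [[[], []], [[], []]]] ! (1 - 1) ! \<tau> ! \<sigma> = [\<tau>, \<sigma>]"
    if "\<tau> \<in> {0, 1}" "\<sigma> \<in> {0, 1}" for \<tau> \<sigma> :: nat
    using that by auto
  \<comment> \<open>The left part keeps its shortened words when the direction is 0, so
    \<open>e\<close> is 0 here; for the right part it is 1.\<close>
  note left = move_value[OF assms(3,4) F \<sigma> \<tau> q \<alpha> \<beta> \<gamma> \<alpha> d(1) s(1) m(1) env(1) xs(1) refl refl e(1) tl recomb0_def pr(1),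
      folded left_proof_def[unfolded Let_def]]
  note right = move_value[OF assms(3,4) F \<sigma> \<tau> q \<alpha> \<beta> \<gamma> \<beta> d(2) s(2) m(2) env(2) xs(2) refl refl e(2) tr recomb1_def pr(2),
      folded right_proof_def[unfolded Let_def]]
  have one: "(1::nat) \<le> 2" by simp
  have state: "den M (state_proof n \<delta> A) (tpure (scale M) [\<alpha>, \<gamma>]) =
      (\<Sum>i=1..s. \<Sum>j=1..r. scale M (a i * c j) (nb n A (delta_comp \<delta> 1 (\<sigma> i, q j))))"
    unfolding state_proof_def \<alpha> \<gamma> by (subst step_sum[OF assms(3,4) one F(1,2,4,5) \<sigma> q]) simp_all
  have sm: "den M (state_proof n \<delta> A) (tpure (scale M) [\<alpha>, \<gamma>]) \<in> space M (nbool n A)"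
    unfolding state
    by (intro V.subspace_sum space[OF F(4)] V.subspace_scale nbool_val(2)[OF F(4)] \<delta>(2) \<sigma> q)
  have state': "(\<Sum>i=1..s. \<Sum>j=1..r. scale M (a i * c j) (nb n A (delta_comp \<delta> 1 (\<sigma> i, q j)))) =
      (\<Sum>i=1..s. \<Sum>j=1..r. scale M (a i * c j) (den_closed M (nbool_val n A (delta_comp \<delta> 1 (\<sigma> i, q j)))))"
    by (intro sum.cong refl arg_cong[of _ _ "scale M _"] nbool_val(1)[symmetric] F \<delta>(2) \<sigma> q)
  show ?thesis
    unfolding bint_val(1)[OF F(3)]
    using left(1) left(2)[unfolded diff_zero] right(1) right(2)[unfolded diff_self_eq_0] state[unfolded state'] sm
    by (intro conjI)
qed

end
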